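(* Let $\alpha\in(0,1)$ and let $L,N\to\infty$ with $N\sim\alpha L$. For each such $L,N$ let $(X(t))_{t\ge0}$ be the linearly interpolated MESSEP on $\mathcal W_{\mathbb Z,L,N}$ (see context) and let $$\upsilon_{L,N}(t,dx)=\frac1N\sum_{k=1}^N\delta_{2\pi X_k(L^2t)/L}(dx)$$ be the empirical measure on $\mathbb R/2\pi\mathbb Z$. Assume that $\upsilon_{L,N}(0,dx)$ converges in probability to a (possibly random) probability measure with density profile $f_0(x)$. Then $(\upsilon_{L,N}(t,dx))_{t\ge0}$ converges in probability (for each $t\ge 0$) to a family of (random) probability measures with densities $(f(t,x))_{t\ge0}$, with $f(0,\cdot)=f_0$, which satisfies, in a weak sense, the nonlinear and nonlocal PDE $$\frac{\partial f}{\partial t}+\frac{1}{\alpha\sin(\pi\alpha)}\frac{\partial\,\mathcal J_\alpha f}{\partial x}=0,\qquad \mathcal J_\alpha f=\sin\left(2\pi^2\alpha f\right)\sinh\left(2\pi^2\alpha\,\mathcal Hf\right).$$ Equivalently (this is the meaning of the weak sense), almost surely, the associated moment generating function $g(t,z)=\sum_{n\ge1}\mathfrak m_n(t)z^n$ is the unique analytic solution on $[0,\infty)\times\mathbb D$, with initial condition $g(0,\cdot)=g_0$ the moment generating function of $f_0$, of the nonlinear transport equation $$\frac{\partial g(t,z)}{\partial t}+z\,\mathcal V_\alpha(g(t,z))\frac{\partial g(t,z)}{\partial z}=0,\qquad \mathcal V_\alpha(z)=2\pi^2\,\frac{\sin(\pi\alpha(1+2z))}{\sin(\pi\alpha)}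.$$
   Context: MESSEP. Let $1\le N\le L-1$. Let $\mathcal C_{L,N}$ be the set of subsets of $\mathbb Z/L\mathbb Z$ of cardinality $N$, made into an undirected graph by joining two configurations when one is obtained from the other by moving exactly one particle to a nearest-neighbour ($\pm1$ mod $L$) empty site. Let $\rho$ be the spectral radius of its adjacency matrix and $\psi>0$ a corresponding positive eigenvector. Let $\mathcal W_{\mathbb Z,L,N}=\{x\in\mathbb Z^N: x_1<\cdots<x_N<x_1+L\}$, with $x\sim y$ if $y$ is obtained from $x$ by adding $\pm1$ to exactly one coordinate, and $\psi_1(x)=\psi(\{x_1\bmod L,\dots,x_N\bmod L\})$. The MESSEP on $\mathcal W_{\mathbb Z,L,N}$ is the Markov chain $(X(n))_{n\ge0}$ with $\mathbb P(X(n+1)=y\mid X(n)=x)=\psi_1(y)/(\rho\psi_1(x))$ if $x\sim y$ and $0$ otherwise; $(X(t))_{t\ge0}$ is its continuous piecewise linear interpolation. The initial configuration may be random. Convergence in probability. All processes are defined on one probability space. The random measures $\upsilon_{L,N}(t,dx)$ converge in probability to a (possibly random) probability measure $\upsilon(t,dx)$ if for every continuous $\varphi$ on $\mathbb R/2\pi\mathbb Z$ and every $\varepsilon>0$, $\mathbb P(|\int\varphi\,d\upsilon_{L,N}(t,\cdot)-\int\varphi\,d\upsilon(t,\cdot)|>\varepsilon)\to0$ as $L,N\to\infty$. Any such limit has a density with values in $[0,1/(2\pi\alpha)]$. Notation. $\mathbb D$ is the open unit disk. For a density $f(t,\cdot)$ on $\mathbb R/2\pi\mathbb Z$ (with respect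 to $dx$), $\mathfrak m_n(t)=\int_0^{2\pi}e^{inx}f(t,x)\,dx$ for $n\ge1$. $\mathcal H$ is the spatial Hilbert transform on the circle: if $f(t,x)=\sum_{n\in\mathbb Z}c_n(t)e^{inx}$, then $\mathcal Hf(t,x)=-i\sum_{n\in\mathbb Z}\mathrm{sgn}(n)c_n(t)e^{inx}$, with $\mathrm{sgn}(0)=0$. *)

theory Defs
  imports
    "HOL-Probability.Probability"
    "HOL-Library.Landau_Symbols"
    "HOL-Library.Real_Mod"
    "Jordan_Normal_Form.Spectral_Radius"
begin

section \<open>The configuration graph and its Perron data\<close>

text \<open>The ring of integers modulo L is represented by the residues 0, ..., L - 1.\<close>

definition configs :: "nat \<Rightarrow> nat \<Rightarrow> int set set" where
  "configs L N = {A. A \<subseteq> {0..<int L} \<and> card A = N}"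

definition config_adj :: "nat \<Rightarrow> int set \<Rightarrow> int set \<Rightarrow> bool" where
  "config_adj L A B \<longleftrightarrow>
     (\<exists>i\<in>A. \<exists>j\<in>{(i + 1) mod int L, (i - 1) mod int L} - A. B = insert j (A - {i}))"

text \<open>An explicit duplicate-free enumeration of the configurations, needed because the matrices
  of the library are indexed by natural numbers; the lemmas below justify it.\<close>

definition config_list :: "nat \<Rightarrow> nat \<Rightarrow> int set list" where
  "config_list L N = filter (\<lambda>A. card A = N) (map set (List.subseqs [0..int L - 1]))"

lemma set_config_list: "set (config_list L N) = configs L N"
proof -
  have "set (map set (List.subseqs [0..int L - 1])) = Pow {0..<int L}"
    using subseqs_powset[of "[0..int L - 1]"] by auto
  then show ?thesis
    unfolding config_list_def configs_def set_filter by blast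
qed

lemma distinct_config_list: "distinct (config_list L N)"
  unfolding config_list_def by (intro distinct_filter distinct_set_subseqs) simp

definition adj_matrix :: "nat \<Rightarrow> nat \<Rightarrow> complex mat" where
  "adj_matrix L N =
     (let cs = config_list L N; n = length cs
      in mat n n (\<lambda>(i, j). if config_adj L (cs ! i) (cs ! j) then 1 else 0))"

definition messep_rho :: "nat \<Rightarrow> nat \<Rightarrow> real" where
  "messep_rho L N = spectral_radius (adj_matrix L N)"

text \<open>The positive eigenvector is only determined up to a positive factor; all notions below
  depend on ratios of its entries only.\<close>

definition perron_eigenvector :: "nat \<Rightarrow> nat \<Rightarrow> (int set \<Rightarrow> real) \<Rightarrow> bool" where
  "perron_eigenvector L N \<psi> \<longleftrightarrow>
     (\<forall>A\<in>configs L N. 0 < \<psi> A) \<and>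
     eigenvector (adj_matrix L N)
       (vec (length (config_list L N)) (\<lambda>i. complex_of_real (\<psi> (config_list L N ! i))))
       (complex_of_real (messep_rho L N))"

section \<open>The MESSEP\<close>

text \<open>Elements of $\mathbb{Z}^N$ are integer lists of length N, so the coordinates
  $x_1, \dots, x_N$ are \<open>x ! 0\<close>, ..., \<open>x ! (N - 1)\<close>.\<close>

definition weyl_walks :: "nat \<Rightarrow> nat \<Rightarrow> int list set" where
  "weyl_walks L N = {x. length x = N \<and> sorted_wrt (<) x \<and> last x < hd x + int L}"

definition walk_adj :: "int list \<Rightarrow> int list \<Rightarrow> bool" where
  "walk_adj x y \<longleftrightarrow> (\<exists>k<length x. y = x[k := x ! k + 1] \<or> y = x[k := x ! k - 1])"

definition psi1 :: "nat \<Rightarrow> (int set \<Rightarrow> real) \<Rightarrow> int list \<Rightarrow> real" where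
  "psi1 L \<psi> x = \<psi> ((\<lambda>i. i mod int L) ` set x)"

definition messep_kernel ::
    "nat \<Rightarrow> nat \<Rightarrow> (int set \<Rightarrow> real) \<Rightarrow> int list \<Rightarrow> int list \<Rightarrow> real" where
  "messep_kernel L N \<psi> x y =
     (if y \<in> weyl_walks L N \<and> walk_adj x y
      then psi1 L \<psi> y / (messep_rho L N * psi1 L \<psi> x) else 0)"

text \<open>A Markov chain with this transition kernel, started from an arbitrary (random) initial
  configuration: the conditional law of the next state given any possible history
  \<open>h 0, ..., h n\<close> is the kernel evaluated at \<open>h n\<close>.\<close>

definition messep ::
    "'a measure \<Rightarrow> nat \<Rightarrow> nat \<Rightarrow> (int set \<Rightarrow> real) \<Rightarrow> (nat \<Rightarrow> 'a \<Rightarrow> int list) \<Rightarrow> bool" where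
  "messep M L N \<psi> X \<longleftrightarrow>
     (\<forall>n. X n \<in> measurable M (count_space UNIV)) \<and>
     (\<forall>n. \<forall>\<omega>\<in>space M. X n \<omega> \<in> weyl_walks L N) \<and>
     (\<forall>n h y. \<P>(\<omega> in M. \<forall>i\<le>n. X i \<omega> = h i) \<noteq> 0 \<longrightarrow>
        \<P>(\<omega> in M. X (Suc n) \<omega> = y \<bar> \<forall>i\<le>n. X i \<omega> = h i) = messep_kernel L N \<psi> (h n) y)"

definition interpolate :: "(nat \<Rightarrow> 'a \<Rightarrow> int list) \<Rightarrow> real \<Rightarrow> 'a \<Rightarrow> nat \<Rightarrow> real" where
  "interpolate X t \<omega> k =
     (let n = nat \<lfloor>t\<rfloor>
      in (1 - frac t) * real_of_int (X n \<omega> ! k) + frac t * real_of_int (X (Suc n) \<omega> ! k))"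

section \<open>Random measures on the circle\<close>

text \<open>The circle $\mathbb{R}/2\pi\mathbb{Z}$ is represented by the fundamental domain
  $[0, 2\pi)$: measures on the circle are Borel measures on the real line carried by
  $[0, 2\pi)$, continuous functions on the circle are continuous $2\pi$-periodic functions, and
  only the values of a density on $[0, 2\pi)$ matter.\<close>

definition empirical_measure ::
    "nat \<Rightarrow> nat \<Rightarrow> (nat \<Rightarrow> 'a \<Rightarrow> int list) \<Rightarrow> real \<Rightarrow> 'a \<Rightarrow> real measure" where
  "empirical_measure L N X t \<omega> =
     distr (uniform_count_measure {..<N}) borel
       (\<lambda>k. (2 * pi * interpolate X ((real L)\<^sup>2 * t) \<omega> k / real L) rmod (2 * pi))"

definition circle_measure :: "(real \<Rightarrow> real) \<Rightarrow> real measure" where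
  "circle_measure f = density lborel (\<lambda>x. indicator {0..<2 * pi} x * ennreal (f x))"

definition random_density :: "'a measure \<Rightarrow> ('a \<Rightarrow> real \<Rightarrow> real) \<Rightarrow> bool" where
  "random_density M f \<longleftrightarrow>
     (\<forall>\<omega>\<in>space M. f \<omega> \<in> borel_measurable borel \<and> (\<forall>x. 0 \<le> f \<omega> x)) \<and>
     (\<lambda>\<omega>. circle_measure (f \<omega>)) \<in> measurable M (prob_algebra borel)"

definition converges_in_probability ::
    "'a measure \<Rightarrow> (nat \<Rightarrow> 'a \<Rightarrow> real measure) \<Rightarrow> ('a \<Rightarrow> real measure) \<Rightarrow> bool" where
  "converges_in_probability M \<mu> \<nu> \<longleftrightarrow>
     (\<forall>\<phi>::real \<Rightarrow> real. continuous_on UNIV \<phi> \<and> (\<forall>x. \<phi> (x + 2 * pi) = \<phi> x) \<longrightarrow>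
        (\<forall>\<epsilon>>0. (\<lambda>n. \<P>(\<omega> in M. \<bar>(LINT x|\<mu> n \<omega>. \<phi> x) - (LINT x|\<nu> \<omega>. \<phi> x)\<bar> > \<epsilon>))
                  \<longlonglongrightarrow> 0))"

section \<open>The partial differential equation\<close>

definition fourier_coeff :: "(real \<Rightarrow> real) \<Rightarrow> int \<Rightarrow> complex" where
  "fourier_coeff u n =
     (LBINT x:{0..2 * pi}. cis (- (of_int n * x)) * complex_of_real (u x)) / (2 * pi)"

text \<open>The series in the next two definitions are real for real u; \<open>Re\<close> only adjusts the type.\<close>

definition hilbert_transform :: "(real \<Rightarrow> real) \<Rightarrow> real \<Rightarrow> real" where
  "hilbert_transform u x =
     Re (- \<i> * (\<Sum>\<^sub>\<infinity>n::int. of_int (sgn n) * fourier_coeff u n * cis (of_int n * x)))"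

definition poisson_mean :: "real \<Rightarrow> (real \<Rightarrow> real) \<Rightarrow> real \<Rightarrow> real" where
  "poisson_mean r u x =
     Re (\<Sum>\<^sub>\<infinity>n::int. complex_of_real (r ^ nat \<bar>n\<bar>) * fourier_coeff u n * cis (of_int n * x))"

definition flux :: "real \<Rightarrow> (real \<Rightarrow> real) \<Rightarrow> real \<Rightarrow> real" where
  "flux \<alpha> u x =
     sin (2 * pi\<^sup>2 * \<alpha> * u x) * sinh (2 * pi\<^sup>2 * \<alpha> * hilbert_transform u x)"

text \<open>The limiting densities are in general too irregular for the equation
  $\partial_t f + (\alpha \sin(\pi\alpha))^{-1} \partial_x \mathcal{J}_\alpha f = 0$ to hold pointwise.
  It is imposed on the Poisson regularisations $f_r$ of $f$, for every $r < 1$. With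
  $w = g(t, r e^{-ix})$ one has $f_r = (1 + 2 \, \mathrm{Re} \, w) / 2\pi$,
  $\mathcal{H} f_r = - \mathrm{Im} \, w / \pi$ and
  $\mathrm{Im} \cos(\pi\alpha(1 + 2w)) = \mathcal{J}_\alpha f_r$, so that this is precisely
  the real part, on the circle of radius r, of the transport equation for g below.\<close>

definition weak_solution :: "real \<Rightarrow> (real \<Rightarrow> real \<Rightarrow> real) \<Rightarrow> bool" where
  "weak_solution \<alpha> f \<longleftrightarrow>
     (\<forall>r\<in>{0<..<1}. \<forall>t\<ge>0. \<forall>x. \<exists>D.
        (flux \<alpha> (poisson_mean r (f t)) has_real_derivative D) (at x) \<and>
        ((\<lambda>s. poisson_mean r (f s) x) has_real_derivative - (1 / (\<alpha> * sin (pi * \<alpha>)) * D))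
          (at t within {0..}))"

definition moment :: "(real \<Rightarrow> real) \<Rightarrow> nat \<Rightarrow> complex" where
  "moment f n = (LBINT x:{0..2 * pi}. cis (real n * x) * complex_of_real (f x))"

definition moment_gf :: "(real \<Rightarrow> real) \<Rightarrow> complex \<Rightarrow> complex" where
  "moment_gf f z = (\<Sum>n. moment f (Suc n) * z ^ Suc n)"

definition velocity :: "real \<Rightarrow> complex \<Rightarrow> complex" where
  "velocity \<alpha> z =
     complex_of_real (2 * pi\<^sup>2) *
       (sin (complex_of_real (pi * \<alpha>) * (1 + 2 * z)) / complex_of_real (sin (pi * \<alpha>)))"

text \<open>Joint analyticity in the real variable t and the complex variable z: local expansion into a
  double power series (relative to T and U, so that one-sided neighbourhoods are used at boundary
  points of T).\<close>

definition jointly_analytic_on ::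
    "real set \<Rightarrow> complex set \<Rightarrow> (real \<Rightarrow> complex \<Rightarrow> complex) \<Rightarrow> bool" where
  "jointly_analytic_on T U g \<longleftrightarrow>
     (\<forall>t\<^sub>0\<in>T. \<forall>z\<^sub>0\<in>U. \<exists>a :: nat \<Rightarrow> nat \<Rightarrow> complex. \<exists>e>0.
        \<forall>t\<in>T. \<forall>z\<in>U. dist t t\<^sub>0 < e \<and> dist z z\<^sub>0 < e \<longrightarrow>
          ((\<lambda>(m, n). a m n * complex_of_real (t - t\<^sub>0) ^ m * (z - z\<^sub>0) ^ n) has_sum g t z) UNIV)"

definition analytic_transport_solution ::
    "real \<Rightarrow> (complex \<Rightarrow> complex) \<Rightarrow> (real \<Rightarrow> complex \<Rightarrow> complex) \<Rightarrow> bool" where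
  "analytic_transport_solution \<alpha> g\<^sub>0 g \<longleftrightarrow>
     jointly_analytic_on {0..} (ball 0 1) g \<and>
     (\<forall>z\<in>ball 0 1. g 0 z = g\<^sub>0 z) \<and>
     (\<forall>t\<ge>0. \<forall>z\<in>ball 0 1. \<exists>g\<^sub>t g\<^sub>z.
        ((\<lambda>s. g s z) has_vector_derivative g\<^sub>t) (at t within {0..}) \<and>
        (g t has_field_derivative g\<^sub>z) (at z) \<and>
        g\<^sub>t + z * velocity \<alpha> (g t z) * g\<^sub>z = 0)"

end

theory Submission
  imports Defs "HOL-Complex_Analysis.Complex_Analysis"
begin

text \<open>
Let $p_n = \frac1N \sum_k e^{2\pi i n x_k/L}$ be the n-th moment of a configuration. Convergence of measures
on the circle is convergence of all moments, so the theorem follows from a law of large numbers for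
each $p_n$. Three facts make this possible.

\<^item> The drift of the moments is explicit and closed. The positive eigenvector is, up to a constant
  along edges, the product of $|\sin(\pi(i-j)/L)|$ over all pairs of particles
  (\<open>sine_vandermonde_eigenfunction\<close>, \<open>perron_eigenvector_ratio\<close>), so the jump rates are products of ratios of
  sines. These are the residues of the rational function $\prod_j (q - \xi_j w)/(1 - \xi_j w)$ with
  $q = e^{\pm 2\pi i/L}$ and $\xi_j = e^{2 \pi i x_j/L}$. Its power series is the exponential of a series that is
  linear in the power sums, whence the expected change of $p_n$ in one step is an exact function of
  $p_1, \dots, p_n$ (\<open>residue_sum\<close>, \<open>kernel_drift\<close>). No local equilibrium has to be established.

\<^item> The drift, multiplied by $L^2$, converges uniformly to the n-th coefficient of
  $-z \mathcal V_\alpha(g) \partial_z g$ with $g = \sum p_n z^n$ (\<open>walk_drift_limit\<close>). The limit equation is a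
  triangular system: the n-th coefficient enters its own equation linearly and all others have lower
  order. It therefore has unique global solutions that are bounded on compact time intervals
  uniformly in the initial data. A single jump changes $p_n$ by $O(1/(LN))$, so that the martingale part
  over $L^2 t$ steps is $O(1/N)$ in $L^2$ (\<open>noise_sum_L1\<close>), and Gronwall's inequality gives convergence of the
  moments in $L^1$ (\<open>walk_flow_distance\<close>).

\<^item> There is at most one particle per site. Hence the Fejer means of the empirical measures lie
  between 0 and $L/N$ (\<open>fejer_mean_walk_bounds\<close>). For each order this is a condition on finitely many
  moments, so the limiting moments satisfy it with $1/\alpha$ in place of $L/N$, almost surely for all times
  simultaneously. Bounded Fejer means characterise the moments of bounded densities
  (\<open>density_with_moments\<close>), which yields $f(t, \cdot)$, and in particular all limiting moments have
  modulus at most 1.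

The last bound makes g(t, z) analytic in the disc. For the analyticity in t, the k-th time derivative
of a solution is $D^{k-1}(s(g)^k D g)$ with $D = z\,\partial_z$ and $s = -\mathcal V_\alpha$; since $D^{k-1}$ multiplies
the n-th coefficient by $n^{k-1}$ only, the derivatives grow like $C^k k!$ on smaller discs
(\<open>iter_rate_bound\<close>, \<open>flow_jointly_analytic\<close>). The coefficients of any other analytic solution solve the same
triangular system, which gives uniqueness. The weak form of the equation for f is the real part of the
transport equation on the circles of radius r (\<open>weak_solution_of_transport\<close>).
\<close>

section \<open>The exponential of a formal power series\<close>

definition euler :: "complex fps \<Rightarrow> complex fps" where
  "euler f = fps_X * fps_deriv f"

lemma euler_nth [simp]: "fps_nth (euler f) n = of_nat n * fps_nth f n"
  by (cases n) (simp_all add: euler_def)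

lemma euler_add: "euler (f + g) = euler f + euler g"
  and euler_mult: "euler (f * g) = euler f * g + f * euler g"
  and euler_const_mult: "euler (fps_const c * f) = fps_const c * euler f"
  by (simp_all add: euler_def algebra_simps)

lemma euler_power: "euler (f ^ Suc k) = of_nat (Suc k) * f ^ k * euler f"
  by (induction k) (simp_all add: euler_mult algebra_simps)

text \<open>The exponential of a series without constant term. Composition with a series that has a constant
term is not the formal exponential, hence the recurring hypothesis that the coefficient of order 0
vanishes.\<close>
definition fexp :: "complex fps \<Rightarrow> complex fps" where
  "fexp g = fps_compose (fps_exp 1) g"

lemma fexp_nth_0 [simp]: "fps_nth (fexp g) 0 = 1"
  by (simp add: fexp_def)

lemma fps_deriv_fexp: "fps_nth g 0 = 0 \<Longrightarrow> fps_deriv (fexp g) = fexp g * fps_deriv g"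
  by (simp add: fexp_def fps_compose_deriv)

lemma euler_fexp: "fps_nth g 0 = 0 \<Longrightarrow> euler (fexp g) = euler g * fexp g"
  by (simp add: euler_def fps_deriv_fexp algebra_simps)

lemma euler_ode_nth:
  assumes "fps_nth g 0 = 0" "euler F = euler g * F"
  shows "of_nat n * fps_nth F n = (\<Sum>k=1..n. of_nat k * fps_nth g k * fps_nth F (n - k))"
proof -
  have "of_nat n * fps_nth F n = fps_nth (euler g * F) n"
    using assms(2) by (metis euler_nth)
  also have "\<dots> = (\<Sum>k=0..n. of_nat k * fps_nth g k * fps_nth F (n - k))"
    by (simp add: fps_mult_nth)
  also have "\<dots> = (\<Sum>k=1..n. of_nat k * fps_nth g k * fps_nth F (n - k))"
    by (simp add: sum.atLeast_Suc_atMost)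
  finally show ?thesis .
qed

text \<open>The exponential is characterised by the equation $D F = (D g) F$, $D = z\,d/dz$, because this
equation determines the coefficients recursively. All identities for the exponential below are
proved by checking this equation, including the one for a product of linear factors that yields
the drift of the moments.\<close>
lemma fexp_unique:
  assumes g: "fps_nth g 0 = 0" and F: "fps_nth F 0 = 1" "euler F = euler g * F"
  shows "F = fexp g"
proof (rule fps_ext)
  fix n show "fps_nth F n = fps_nth (fexp g) n"
  proof (induction n rule: less_induct)
    case (less n)
    show ?case
    proof (cases n)
      case 0 then show ?thesis using F by simp
    next
      case (Suc m)
      have "of_nat n * fps_nth F n = of_nat n * fps_nth (fexp g) n"
        unfolding euler_ode_nth[OF g F(2)] euler_ode_nth[OF g euler_fexp[OF g]]
        using Suc by (intro sum.cong) (auto simp: less)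
      then show ?thesis using Suc by (simp del: of_nat_Suc)
    qed
  qed
qed

lemma fexp_add:
  assumes "fps_nth g 0 = 0" "fps_nth h 0 = 0"
  shows "fexp (g + h) = fexp g * fexp h"
  by (rule sym, rule fexp_unique)
     (use assms in \<open>simp_all add: euler_mult euler_fexp euler_add algebra_simps\<close>)

text \<open>The n-th coefficient of the exponential is $g_n$ plus a function of $g_1, \dots, g_{n-1}$. This is
what makes the transport equation a triangular system for the coefficients.\<close>
lemma fexp_nth_diff_cong:
  assumes "fps_nth g 0 = 0" "fps_nth h 0 = 0" "\<And>k. k < n \<Longrightarrow> fps_nth g k = fps_nth h k" "n > 0"
  shows "fps_nth (fexp g) n - fps_nth g n = fps_nth (fexp h) n - fps_nth h n"
proof -
  have *: "m < n \<Longrightarrow> fps_nth (fexp g) m = fps_nth (fexp h) m" for m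
  proof (induction m rule: less_induct)
    case (less m)
    show ?case
    proof (cases "m = 0")
      case False
      have "of_nat m * fps_nth (fexp g) m = of_nat m * fps_nth (fexp h) m"
        unfolding euler_ode_nth[OF assms(1) euler_fexp[OF assms(1)]]
          euler_ode_nth[OF assms(2) euler_fexp[OF assms(2)]]
        using less False assms(3) by (intro sum.cong) auto
      then show ?thesis using False by simp
    qed simp
  qed
  have "of_nat n * (fps_nth (fexp g) n - fps_nth g n) = (\<Sum>k=1..<n. of_nat k * fps_nth g k * fps_nth (fexp g) (n - k))"
    if "fps_nth g 0 = 0" for g
  proof -
    have "{1..n} = insert n {1..<n}" using \<open>n>0\<close> by auto
    then show ?thesis using euler_ode_nth[OF that euler_fexp[OF that], of n]
      by (simp add: algebra_simps)
  qed
  from this[of g] this[of h] have "of_nat n * (fps_nth (fexp g) n - fps_nth g n) = of_nat n * (fps_nth (fexp h) n - fps_nth h n)"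
    using assms * by (auto intro!: sum.cong)
  then show ?thesis using \<open>n > 0\<close> by simp
qed

text \<open>The norm of the truncated series on the disc of radius R. Like the Wiener norm it is
submultiplicative, so estimates for scalars carry over to the exponential of a series; it involves
only the coefficients up to n, on which alone the n-th coefficient of the drift depends.\<close>
definition pnorm :: "real \<Rightarrow> nat \<Rightarrow> complex fps \<Rightarrow> real" where
  "pnorm R n f = (\<Sum>i\<le>n. norm (fps_nth f i) * R ^ i)"

lemma pnorm_nonneg: "0 \<le> R \<Longrightarrow> 0 \<le> pnorm R n f"
  by (simp add: pnorm_def sum_nonneg)

lemma norm_nth_le_pnorm: "0 \<le> R \<Longrightarrow> i \<le> n \<Longrightarrow> norm (fps_nth f i) * R ^ i \<le> pnorm R n f"
  unfolding pnorm_def by (rule member_le_sum) auto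

lemma pnorm_add: "0 \<le> R \<Longrightarrow> pnorm R n (f + g) \<le> pnorm R n f + pnorm R n g"
  unfolding pnorm_def sum.distrib[symmetric]
  by (rule sum_mono) (metis distrib_right fps_add_nth mult_right_mono norm_triangle_ineq zero_le_power)

lemma pnorm_const_mult: "pnorm R n (fps_const c * f) = norm c * pnorm R n f"
  by (simp add: pnorm_def norm_mult sum_distrib_left mult_ac)

lemma pnorm_uminus: "pnorm R n (- f) = pnorm R n f"
  by (simp add: pnorm_def)

lemma pnorm_1 [simp]: "pnorm R n 1 = 1"
proof -
  have "pnorm R n 1 = (\<Sum>i\<le>n. if i = 0 then 1 else 0)"
    unfolding pnorm_def by (rule sum.cong) auto
  then show ?thesis by simp
qed

lemma pnorm_mult:
  assumes R: "0 \<le> R"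
  shows "pnorm R n (f * g) \<le> pnorm R n f * pnorm R n g"
proof -
  let ?F = "\<lambda>i. norm (fps_nth f i) * R ^ i" and ?G = "\<lambda>i. norm (fps_nth g i) * R ^ i"
  have "pnorm R n (f * g) \<le> (\<Sum>m\<le>n. \<Sum>i\<le>m. ?F i * ?G (m - i))"
    unfolding pnorm_def
  proof (rule sum_mono)
    fix m
    have "norm (fps_nth (f * g) m) \<le> (\<Sum>i\<le>m. norm (fps_nth f i) * norm (fps_nth g (m - i)))"
      unfolding fps_mult_nth atLeast0AtMost
      by (rule order_trans[OF norm_sum]) (simp add: norm_mult)
    then have "norm (fps_nth (f * g) m) * R ^ m \<le> (\<Sum>i\<le>m. norm (fps_nth f i) * norm (fps_nth g (m - i))) * R ^ m"
      using R by (intro mult_right_mono) auto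
    also have "\<dots> = (\<Sum>i\<le>m. ?F i * ?G (m - i))"
      unfolding sum_distrib_right
      by (rule sum.cong) (auto simp: mult_ac simp flip: power_add)
    finally show "norm (fps_nth (f * g) m) * R ^ m \<le> (\<Sum>i\<le>m. ?F i * ?G (m - i))" .
  qed
  also have "\<dots> = (\<Sum>(i,j)\<in>{(i,j). i + j \<le> n}. ?F i * ?G j)"
    by (subst sum.triangle_reindex_eq) simp
  also have "\<dots> \<le> (\<Sum>(i,j)\<in>{..n} \<times> {..n}. ?F i * ?G j)"
    using R by (intro sum_mono2) auto
  also have "\<dots> = pnorm R n f * pnorm R n g"
    by (simp add: pnorm_def sum_product sum.cartesian_product)
  finally show ?thesis .
qed

lemma pnorm_power: "0 \<le> R \<Longrightarrow> pnorm R n (f ^ k) \<le> pnorm R n f ^ k"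
proof (induction k)
  case (Suc k)
  have "pnorm R n (f ^ Suc k) \<le> pnorm R n f * pnorm R n (f ^ k)"
    using pnorm_mult[OF Suc.prems] by simp
  also have "\<dots> \<le> pnorm R n f * pnorm R n f ^ k"
    using Suc by (intro mult_left_mono pnorm_nonneg) auto
  finally show ?case by simp
qed simp

lemma fps_power_nth_eq_0:
  fixes g :: "complex fps"
  assumes "fps_nth g 0 = 0" "i < k"
  shows "fps_nth (g ^ k) i = 0"
  using assms startsby_zero_power_prefix by blast

lemma pnorm_fexp_minus_1:
  assumes R: "0 \<le> R" and g: "fps_nth g 0 = 0"
  shows "pnorm R n (fexp g - 1) \<le> exp (pnorm R n g) - 1"
proof -
  have nth: "fps_nth (fexp g - 1) i = (\<Sum>k=1..n. fps_nth (g ^ k) i / fact k)" if "i \<le> n" for i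
  proof -
    have "fps_nth (fexp g) i = (\<Sum>k=0..i. fps_nth (g ^ k) i / fact k)"
      by (simp add: fexp_def fps_compose_nth field_simps)
    also have "\<dots> = (\<Sum>k=0..n. fps_nth (g ^ k) i / fact k)"
      using that by (intro sum.mono_neutral_left) (auto simp: fps_power_nth_eq_0[OF g])
    also have "\<dots> = fps_nth 1 i + (\<Sum>k=1..n. fps_nth (g ^ k) i / fact k)"
      by (simp add: sum.atLeast_Suc_atMost)
    finally show ?thesis by simp
  qed
  have "pnorm R n (fexp g - 1) \<le> (\<Sum>i\<le>n. \<Sum>k=1..n. norm (fps_nth (g ^ k) i) * R ^ i / fact k)"
    unfolding pnorm_def
  proof (rule sum_mono)
    fix i assume "i \<in> {..n}"
    then have "norm (fps_nth (fexp g - 1) i) \<le> (\<Sum>k=1..n. norm (fps_nth (g ^ k) i) / fact k)"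
      unfolding nth[of i, simplified atMost_iff[symmetric]] 
      by (subst nth) (auto intro!: order_trans[OF norm_sum] simp: norm_divide)
    then have "norm (fps_nth (fexp g - 1) i) * R ^ i \<le> (\<Sum>k=1..n. norm (fps_nth (g ^ k) i) / fact k) * R ^ i"
      using R by (intro mult_right_mono) auto
    then show "norm (fps_nth (fexp g - 1) i) * R ^ i \<le> (\<Sum>k=1..n. norm (fps_nth (g ^ k) i) * R ^ i / fact k)"
      by (simp add: sum_distrib_right)
  qed
  also have "\<dots> = (\<Sum>k=1..n. pnorm R n (g ^ k) / fact k)"
    by (subst sum.swap) (simp add: pnorm_def sum_divide_distrib)
  also have "\<dots> \<le> (\<Sum>k=1..n. pnorm R n g ^ k / fact k)"
    using pnorm_power[OF R] by (intro sum_mono divide_right_mono) auto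
  also have "\<dots> = (\<Sum>k<Suc n. pnorm R n g ^ k /\<^sub>R fact k) - 1"
    by (simp add: lessThan_Suc_atMost atMost_atLeast0 sum.atLeast_Suc_atMost field_simps)
  also have "\<dots> \<le> exp (pnorm R n g) - 1"
    using sum_le_suminf[OF summable_exp_generic[of "pnorm R n g"], of "{..<Suc n}"] pnorm_nonneg[OF R, of n g]
    by (simp add: exp_def)
  finally show ?thesis .
qed

lemma pnorm_fexp:
  assumes R: "0 \<le> R" and g: "fps_nth g 0 = 0"
  shows "pnorm R n (fexp g) \<le> exp (pnorm R n g)"
  using pnorm_add[OF R, of n "fexp g - 1" 1] pnorm_fexp_minus_1[OF assms, of n] by simp

text \<open>Local Lipschitz continuity of the exponential, from
$e^g - e^h = e^h (e^{g-h} - 1)$.\<close>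
lemma pnorm_fexp_diff:
  assumes R: "0 \<le> R" and g: "fps_nth g 0 = 0" "fps_nth h 0 = 0"
    and B: "pnorm R n g \<le> B" "pnorm R n h \<le> B"
  shows "pnorm R n (fexp g - fexp h) \<le> exp (3 * B) * pnorm R n (g - h)"
proof -
  let ?x = "pnorm R n (g - h)"
  have x0: "0 \<le> ?x" by (rule pnorm_nonneg[OF R])
  have "pnorm R n (g - h) \<le> pnorm R n g + pnorm R n h"
    using pnorm_add[OF R, of n g "- h"] by (simp add: pnorm_uminus)
  then have x: "?x \<le> 2 * B" using B by simp
  have "fexp g = fexp (g - h) * fexp h"
    using fexp_add[of "g - h" h] g by simp
  then have "fexp g - fexp h = fexp h * (fexp (g - h) - 1)"
    by (simp add: algebra_simps)
  then have "pnorm R n (fexp g - fexp h) \<le> pnorm R n (fexp h) * pnorm R n (fexp (g - h) - 1)"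
    using pnorm_mult[OF R] by simp
  also have "\<dots> \<le> exp B * (exp ?x - 1)"
  proof (intro mult_mono)
    show "pnorm R n (fexp h) \<le> exp B"
      using pnorm_fexp[OF R g(2), of n] B(2) by (meson exp_le_cancel_iff order_trans)
    show "pnorm R n (fexp (g - h) - 1) \<le> exp ?x - 1"
      using pnorm_fexp_minus_1[OF R, of "g - h" n] g by simp
  qed (use pnorm_nonneg[OF R] in auto)
  also have "exp ?x - 1 \<le> ?x * exp ?x"
    \<comment> \<open>the inequality \<open>1 - x \<le> exp (- x)\<close>, multiplied by \<open>exp x\<close>\<close>
  proof -
    have "(1 - ?x) * exp ?x \<le> exp (- ?x) * exp ?x"
      using exp_ge_add_one_self[of "- ?x"] by (intro mult_right_mono) auto
    then show ?thesis by (simp add: exp_minus field_simps)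
  qed
  also have "\<dots> \<le> ?x * exp (2 * B)"
    using x x0 by (intro mult_left_mono) auto
  finally have "pnorm R n (fexp g - fexp h) \<le> exp B * (?x * exp (2 * B))" by simp
  also have "\<dots> = exp (3 * B) * ?x"
    by (simp add: mult_ac flip: exp_add)
  finally show ?thesis .
qed

section \<open>The transport equation as a triangular system\<close>

lemma continuous_fps_mult:
  assumes "\<And>n. continuous_on S (\<lambda>t. fps_nth (f t) n)" "\<And>n. continuous_on S (\<lambda>t. fps_nth (g t) n)"
  shows "continuous_on S (\<lambda>t. fps_nth (f t * g t) n :: complex)"
  unfolding fps_mult_nth by (intro continuous_intros assms)

lemma continuous_fps_power:
  assumes "\<And>n. continuous_on S (\<lambda>t. fps_nth (f t) n :: complex)"
  shows "continuous_on S (\<lambda>t. fps_nth (f t ^ k) n)"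
proof (induction k arbitrary: n)
  case (Suc k) then show ?case using continuous_fps_mult[OF assms] by simp
qed (auto intro: continuous_intros)

lemma continuous_fexp:
  assumes "\<And>n. continuous_on S (\<lambda>t. fps_nth (f t) n)"
  shows "continuous_on S (\<lambda>t. fps_nth (fexp (f t)) n)"
  unfolding fexp_def fps_compose_nth
  by (intro continuous_intros continuous_fps_power assms)

lemma measurable_fps_mult:
  assumes "\<And>n. (\<lambda>t. fps_nth (f t) n) \<in> borel_measurable M" "\<And>n. (\<lambda>t. fps_nth (g t) n) \<in> borel_measurable M"
  shows "(\<lambda>t. fps_nth (f t * g t) n :: complex) \<in> borel_measurable M"
  unfolding fps_mult_nth by (intro borel_measurable_sum borel_measurable_times assms)

lemma measurable_fps_power:
  assumes "\<And>n. (\<lambda>t. fps_nth (f t) n :: complex) \<in> borel_measurable M"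
  shows "(\<lambda>t. fps_nth (f t ^ k) n) \<in> borel_measurable M"
proof (induction k arbitrary: n)
  case (Suc k) then show ?case using measurable_fps_mult[OF assms] by simp
qed auto

lemma measurable_fexp:
  assumes "\<And>n. (\<lambda>t. fps_nth (f t) n) \<in> borel_measurable M"
  shows "(\<lambda>t. fps_nth (fexp (f t)) n) \<in> borel_measurable M"
  unfolding fexp_def fps_compose_nth
  by (intro borel_measurable_sum borel_measurable_times borel_measurable_const measurable_fps_power assms)

text \<open>The transport equation $\partial_t g = s(g)\, z \partial_z g$ with
$s(w) = \beta a e^{\beta w} - \beta b e^{-\beta w}$, read coefficientwise for
$g(t) = \sum_{n \ge 1} g_n(t) z^n$. The two exponentials are the contributions of jumps to the right
and to the left.\<close>
locale transport_equation =
  fixes a b \<beta> :: complex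
begin

definition speed :: "complex fps \<Rightarrow> complex fps" where
  "speed g = fps_const (\<beta> * a) * fexp (fps_const \<beta> * g) - fps_const (\<beta> * b) * fexp (fps_const (- \<beta>) * g)"

definition rate :: "complex fps \<Rightarrow> complex fps" where
  "rate g = speed g * euler g"

text \<open>The equation is a conservation law for $D = z\,\partial_z$: its right hand side is D of this
series. This is the form in which it arises as a limit of the drifts.\<close>
definition potential :: "complex fps \<Rightarrow> complex fps" where
  "potential g = fps_const a * fexp (fps_const \<beta> * g) + fps_const b * fexp (fps_const (- \<beta>) * g)"

lemma euler_fexp_const_mult:
  "fps_nth g 0 = 0 \<Longrightarrow> euler (fexp (fps_const c * g)) = fps_const c * euler g * fexp (fps_const c * g)"
  by (simp add: euler_fexp euler_const_mult)

lemma rate_eq_euler: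
  assumes "fps_nth g 0 = 0"
  shows "rate g = euler (potential g)"
proof -
  have neg: "fps_const (- \<beta>) * h = - (fps_const \<beta> * h)" for h by (simp flip: fps_const_neg)
  show ?thesis
    unfolding rate_def speed_def potential_def euler_add euler_const_mult
      euler_fexp_const_mult[OF assms] fps_const_mult[symmetric]
    by (simp only: neg algebra_simps minus_mult_left[symmetric] minus_mult_right[symmetric] minus_minus
        add.right_inverse add_0_right add_0_left)
qed

text \<open>The part of the n-th component of the vector field that depends on lower coefficients only: the
n-th coefficient itself enters linearly, with factor $\beta (a - b) n$.\<close>
definition lower_rate :: "nat \<Rightarrow> complex fps \<Rightarrow> complex" where
  "lower_rate n g = fps_nth (rate g) n - \<beta> * (a - b) * of_nat n * fps_nth g n"

lemma lower_rate_eq: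
  assumes "fps_nth g 0 = 0"
  shows "lower_rate n g = of_nat n *
    (a * (fps_nth (fexp (fps_const \<beta> * g)) n - fps_nth (fps_const \<beta> * g) n)
     + b * (fps_nth (fexp (fps_const (- \<beta>) * g)) n - fps_nth (fps_const (- \<beta>) * g) n))"
  unfolding lower_rate_def rate_eq_euler[OF assms] potential_def
  by (simp add: algebra_simps)

lemma lower_rate_cong:
  assumes "fps_nth g 0 = 0" "fps_nth h 0 = 0" "\<And>k. k < n \<Longrightarrow> fps_nth g k = fps_nth h k"
  shows "lower_rate n g = lower_rate n h"
proof (cases "n = 0")
  case False
  have "fps_nth (fexp (fps_const c * g)) n - fps_nth (fps_const c * g) n =
      fps_nth (fexp (fps_const c * h)) n - fps_nth (fps_const c * h) n" for c
    by (rule fexp_nth_diff_cong) (use assms False in auto)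
  then show ?thesis using assms by (simp only: lower_rate_eq)
qed (use assms in \<open>simp add: lower_rate_eq\<close>)

lemma pnorm_1_le:
  assumes "\<And>k. k \<le> n \<Longrightarrow> norm (fps_nth g k) \<le> B"
  shows "pnorm 1 n g \<le> real (Suc n) * B"
  unfolding pnorm_def using assms sum_bounded_above[of "{..n}" "\<lambda>i. norm (fps_nth g i) * 1 ^ i" B] by simp

lemma lower_rate_bound:
  assumes "B \<ge> 0"
  shows "\<exists>K. \<forall>g. fps_nth g 0 = 0 \<longrightarrow> (\<forall>k<n. norm (fps_nth g k) \<le> B) \<longrightarrow> norm (lower_rate n g) \<le> K"
proof (intro exI allI impI)
  fix g :: "complex fps"
  assume g: "fps_nth g 0 = 0" "\<forall>k<n. norm (fps_nth g k) \<le> B"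
  let ?h = "fps_cutoff n g" and ?b = "norm \<beta> * (real (Suc n) * B)"
  have h0: "fps_nth ?h 0 = 0" using g by simp
  have eq: "lower_rate n g = lower_rate n ?h"
    by (rule lower_rate_cong) (use g in auto)
  have p: "pnorm 1 n (fps_const c * ?h) \<le> ?b" if "norm c = norm \<beta>" for c
  proof -
    have "pnorm 1 n ?h \<le> real (Suc n) * B"
      using g assms by (intro pnorm_1_le) auto
    then show ?thesis unfolding pnorm_const_mult that by (intro mult_left_mono) auto
  qed
  have e: "norm (fps_nth (fexp (fps_const c * ?h)) n) \<le> exp ?b" if "norm c = norm \<beta>" for c
  proof -
    have "norm (fps_nth (fexp (fps_const c * ?h)) n) \<le> pnorm 1 n (fexp (fps_const c * ?h))"
      using norm_nth_le_pnorm[of 1 n n "fexp (fps_const c * ?h)"] by simp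
    also have "\<dots> \<le> exp (pnorm 1 n (fps_const c * ?h))" by (rule pnorm_fexp) (use h0 in auto)
    also have "\<dots> \<le> exp ?b" using p[OF that] by simp
    finally show ?thesis .
  qed
  have "lower_rate n ?h = of_nat n * (a * fps_nth (fexp (fps_const \<beta> * ?h)) n
     + b * fps_nth (fexp (fps_const (- \<beta>) * ?h)) n)"
    unfolding lower_rate_eq[OF h0] by simp
  also have "norm \<dots> \<le> real n * (norm a * exp ?b + norm b * exp ?b)"
    unfolding norm_mult norm_of_nat
    by (intro mult_left_mono order_trans[OF norm_triangle_ineq] add_mono)
       (auto simp: norm_mult simp del: fps_cutoff_nth of_nat_Suc intro!: mult_left_mono e)
  finally show "norm (lower_rate n g) \<le> real n * (norm a * exp ?b + norm b * exp ?b)"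
    by (simp only: eq)
qed

lemma continuous_lower_rate:
  assumes "\<And>t. t \<in> S \<Longrightarrow> fps_nth (g t) 0 = 0" "\<And>n. continuous_on S (\<lambda>t. fps_nth (g t) n)"
  shows "continuous_on S (\<lambda>t. lower_rate n (g t))"
proof -
  have "continuous_on S (\<lambda>t. fps_nth (fexp (fps_const c * g t)) n)" for c
    by (rule continuous_fexp) (auto intro!: continuous_intros assms)
  then have "continuous_on S (\<lambda>t. of_nat n *
    (a * (fps_nth (fexp (fps_const \<beta> * g t)) n - fps_nth (fps_const \<beta> * g t) n)
     + b * (fps_nth (fexp (fps_const (- \<beta>) * g t)) n - fps_nth (fps_const (- \<beta>) * g t) n)))"
    by (auto intro!: continuous_intros assms(2))
  then show ?thesis
    by (rule continuous_on_eq) (auto simp: lower_rate_eq assms(1))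
qed

definition transport_flow :: "(real \<Rightarrow> complex fps) \<Rightarrow> bool" where
  "transport_flow g \<longleftrightarrow> (\<forall>t\<ge>0. fps_nth (g t) 0 = 0 \<and>
     (\<forall>n. ((\<lambda>s. fps_nth (g s) n) has_vector_derivative fps_nth (rate (g t)) n) (at t within {0..})))"

text \<open>Since $g_n$ enters its own equation linearly, an integrating factor turns that equation into a plain
integral of lower coefficients. Uniqueness, a priori bounds and existence all follow by induction
on n.\<close>
lemma transport_flow_integrating_factor:
  fixes n :: nat
  assumes "transport_flow g" "t \<ge> 0"
  defines "c \<equiv> - (\<beta> * (a - b) * of_nat n)"
  shows "((\<lambda>s. exp (of_real s * c) * fps_nth (g s) n) has_vector_derivative exp (of_real t * c) * lower_rate n (g t))
    (at t within {0..})"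
proof -
  have d: "((\<lambda>s. fps_nth (g s) n) has_vector_derivative fps_nth (rate (g t)) n) (at t within {0..})"
    using assms by (auto simp: transport_flow_def)
  have "((\<lambda>z. exp (z * c)) has_field_derivative exp (of_real t * c) * c) (at (of_real t))"
    by (auto intro!: derivative_eq_intros)
  then have e: "((\<lambda>s. exp (of_real s * c)) has_vector_derivative exp (of_real t * c) * c) (at t within {0..})"
    by (rule has_vector_derivative_real_field)
  have "exp (of_real t * c) * fps_nth (rate (g t)) n + exp (of_real t * c) * c * fps_nth (g t) n = 
      exp (of_real t * c) * lower_rate n (g t)"
    by (simp add: c_def lower_rate_def algebra_simps)
  then show ?thesis
    using has_vector_derivative_mult[OF e d] by simp
qed

lemma transport_flow_unique:
  assumes g: "transport_flow g" and h: "transport_flow h" and 0: "g 0 = h 0" and "t \<ge> 0"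
  shows "g t = h t"
proof (rule fps_ext)
  fix n
  from \<open>t \<ge> 0\<close> show "fps_nth (g t) n = fps_nth (h t) n"
  proof (induction n arbitrary: t rule: less_induct)
    case (less n)
    define c where "c = - (\<beta> * (a - b) * of_nat n)"
    let ?d = "\<lambda>s. exp (of_real s * c) * fps_nth (g s) n - exp (of_real s * c) * fps_nth (h s) n"
    have d0: "(?d has_vector_derivative 0) (at s within {0..})" if "s \<in> {0..}" for s
    proof -
      have "lower_rate n (g s) = lower_rate n (h s)"
        using g h that less.IH by (intro lower_rate_cong) (auto simp: transport_flow_def)
      then show ?thesis
        using has_vector_derivative_diff[OF transport_flow_integrating_factor[OF g, of s n]
            transport_flow_integrating_factor[OF h, of s n]] that by (simp add: c_def)
    qed
    then obtain k where k: "\<And>s. s \<in> {0..} \<Longrightarrow> ?d s = k"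
      using has_vector_derivative_zero_constant[OF convex_real_interval(1) d0] by blast
    have "?d t = ?d 0" by (rule trans[OF k k[symmetric]]) (use less.prems in auto)
    then have "exp (of_real t * c) * (fps_nth (g t) n - fps_nth (h t) n) = 0" using 0 by (simp add: algebra_simps)
    then show ?case by simp
  qed
qed

text \<open>The bound does not depend on the solution, only on the bound 1 for the initial coefficients; this
uniformity makes the comparison with the random chain possible for random initial data.\<close>
lemma transport_flow_bounded:
  fixes T :: real
  assumes T: "T \<ge> 0"
  shows "\<exists>B\<ge>0. \<forall>g. transport_flow g \<longrightarrow> (\<forall>k. norm (fps_nth (g 0) k) \<le> 1) \<longrightarrow>
    (\<forall>t\<in>{0..T}. \<forall>k\<le>n. norm (fps_nth (g t) k) \<le> B)"
proof (induction n)
  case 0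
  show ?case by (rule exI[of _ 0]) (auto simp: transport_flow_def)
next
  case (Suc n)
  then obtain B where B: "B \<ge> 0" "\<And>g t k. transport_flow g \<Longrightarrow> (\<forall>k. norm (fps_nth (g 0) k) \<le> 1) \<Longrightarrow>
      t \<in> {0..T} \<Longrightarrow> k \<le> n \<Longrightarrow> norm (fps_nth (g t) k) \<le> B" by blast
  obtain K where K: "\<And>g. fps_nth g 0 = 0 \<Longrightarrow> (\<forall>k<Suc n. norm (fps_nth g k) \<le> B) \<Longrightarrow> norm (lower_rate (Suc n) g) \<le> K"
    using lower_rate_bound[OF B(1), of "Suc n"] by blast
  define c where "c = - (\<beta> * (a - b) * of_nat (Suc n))"
  let ?e = "exp (T * norm c)"
  have ce: "norm (exp (of_real t * c)) \<le> ?e" "1 \<le> ?e * norm (exp (of_real t * c))" if "t \<in> {0..T}" for t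
  proof -
    have "\<bar>t * Re c\<bar> \<le> T * norm c" using that abs_Re_le_cmod[of c] by (auto simp: abs_mult intro!: mult_mono)
    then have "t * Re c \<le> T * norm c" "0 \<le> T * norm c + t * Re c" by linarith+
    then show "norm (exp (of_real t * c)) \<le> ?e" "1 \<le> ?e * norm (exp (of_real t * c))"
      by (auto simp flip: exp_add)
  qed
  let ?B = "max B (?e * (1 + T * (?e * \<bar>K\<bar>)))"
  show ?case
  proof (intro exI conjI allI impI ballI)
    show "0 \<le> ?B" using B by simp
    fix g t k
    assume g: "transport_flow g" "\<forall>k. norm (fps_nth (g 0) k) \<le> 1" and t: "t \<in> {0..T}" and k: "k \<le> Suc n"
    show "norm (fps_nth (g t) k) \<le> ?B"
    proof (cases "k \<le> n")
      case True then show ?thesis using B(2)[OF g t True] by simp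
    next
      case False
      with k have kn: "k = Suc n" by simp
      let ?y = "\<lambda>s. exp (of_real s * c) * fps_nth (g s) (Suc n)"
      have "norm (?y t - ?y 0) \<le> ?e * \<bar>K\<bar> * norm (t - 0)"
      proof (rule differentiable_bound[where S = "{0..T}"])
        fix s assume s: "s \<in> {0..T}"
        have "norm (lower_rate (Suc n) (g s)) \<le> \<bar>K\<bar>"
          using K[of "g s"] B(2)[OF g s] g(1) s by (fastforce simp: transport_flow_def)
        then have "norm (exp (of_real s * c) * lower_rate (Suc n) (g s)) \<le> ?e * \<bar>K\<bar>"
          unfolding norm_mult using ce(1)[OF s] by (intro mult_mono) auto
        then show "onorm (\<lambda>x. x *\<^sub>R (exp (of_real s * c) * lower_rate (Suc n) (g s))) \<le> ?e * \<bar>K\<bar>"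
          by (intro onorm_le) (simp only: norm_scaleR real_norm_def mult.commute[of _ "\<bar>_\<bar>"] mult_left_mono abs_ge_zero)
        show "(?y has_derivative (\<lambda>x. x *\<^sub>R (exp (of_real s * c) * lower_rate (Suc n) (g s)))) (at s within {0..T})"
          using transport_flow_integrating_factor[OF g(1), of s "Suc n"] s
          unfolding has_vector_derivative_def c_def by (auto intro: has_derivative_subset)
      qed (use t T in auto)
      also have "\<dots> \<le> ?e * \<bar>K\<bar> * T" using t by (intro mult_left_mono) auto
      finally have "norm (?y t) \<le> 1 + T * (?e * \<bar>K\<bar>)"
        using g(2)[rule_format, of "Suc n"] norm_triangle_sub[of "?y t" "?y 0"] by (simp add: mult_ac)
      then have "?e * norm (?y t) \<le> ?e * (1 + T * (?e * \<bar>K\<bar>))" by (intro mult_left_mono) auto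
      moreover have "norm (fps_nth (g t) (Suc n)) \<le> ?e * norm (?y t)"
        using mult_right_mono[OF ce(2)[OF t], of "norm (fps_nth (g t) (Suc n))"] by (simp add: norm_mult mult_ac)
      ultimately show ?thesis unfolding kn by (intro max.coboundedI2) linarith
    qed
  qed
qed

text \<open>The solution up to order n: the coefficient of order n is obtained by variation of constants from
the stage before.\<close>
primrec flow_stage :: "complex fps \<Rightarrow> nat \<Rightarrow> real \<Rightarrow> complex fps" where
  "flow_stage f 0 t = 0"
| "flow_stage f (Suc n) t = flow_stage f n t + fps_const (exp (of_real t * (\<beta> * (a - b) * of_nat n)) *
     (fps_nth f n + integral {0..t} (\<lambda>s. exp (- of_real s * (\<beta> * (a - b) * of_nat n)) * lower_rate n (flow_stage f n s)))) * fps_X ^ n"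

definition flow :: "complex fps \<Rightarrow> real \<Rightarrow> complex fps" where
  "flow f t = Abs_fps (\<lambda>n. fps_nth (flow_stage f (Suc n) t) n)"

lemma flow_stage_nth: "fps_nth (flow_stage f n t) k = (if k < n then fps_nth (flow f t) k else 0)"
  by (induction n) (auto simp: flow_def less_Suc_eq fps_X_power_nth)

lemma flow_nth: "fps_nth (flow f t) n = exp (of_real t * (\<beta> * (a - b) * of_nat n)) *
     (fps_nth f n + integral {0..t} (\<lambda>s. exp (- of_real s * (\<beta> * (a - b) * of_nat n)) * lower_rate n (flow_stage f n s)))"
  by (simp add: flow_def flow_stage_nth fps_X_power_nth)

lemma flow_0 [simp]: "flow f 0 = f"
  by (rule fps_ext) (simp add: flow_nth)

lemma integral_has_vector_derivative_half_line:
  fixes f :: "real \<Rightarrow> complex"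
  assumes "continuous_on {0..} f" "t \<ge> 0"
  shows "((\<lambda>u. integral {0..u} f) has_vector_derivative f t) (at t within {0..})"
proof -
  have "((\<lambda>u. integral {0..u} f) has_vector_derivative f t) (at t within {0..t+1})"
    by (rule integral_has_vector_derivative) (use assms in \<open>auto intro: continuous_on_subset\<close>)
  moreover have "at t within {0..t+1} = at t within {0..}"
    by (rule at_within_nhd[of _ "{..<t+1}"]) auto
  ultimately show ?thesis by simp
qed

theorem transport_flow_flow:
  assumes f: "fps_nth f 0 = 0"
  shows "transport_flow (flow f)"
proof -
  have lr0: "lower_rate 0 g = 0" for g by (simp add: lower_rate_def rate_def)
  have z: "fps_nth (flow f t) 0 = 0" for t
    using f by (simp add: flow_nth lr0)
  have zs: "fps_nth (flow_stage f n t) 0 = 0" for n t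
    by (simp add: flow_stage_nth z)
  have d: "((\<lambda>s. fps_nth (flow f s) n) has_vector_derivative fps_nth (rate (flow f t)) n) (at t within {0..})"
    if "t \<ge> 0" for t n
    using that
  proof (induction n arbitrary: t rule: less_induct)
    case (less n)
    define c where "c = \<beta> * (a - b) * of_nat n"
    have "continuous_on {0..} (\<lambda>s. fps_nth (flow f s) k)" if "k < n" for k
      using less.IH[OF that] 
      by (auto simp: continuous_on_eq_continuous_within intro: has_vector_derivative_continuous)
    then have "continuous_on {0..} (\<lambda>s. fps_nth (flow_stage f n s) k)" for k
      by (cases "k < n") (simp_all add: flow_stage_nth)
    then have "continuous_on {0..} (\<lambda>s. lower_rate n (flow_stage f n s))"
      by (intro continuous_lower_rate zs)
    then have "continuous_on {0..} (\<lambda>s. exp (- of_real s * c) * lower_rate n (flow_stage f n s))"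
      by (intro continuous_intros)
    from integral_has_vector_derivative_half_line[OF this less.prems]
    have i: "((\<lambda>s. fps_nth f n + integral {0..s} (\<lambda>s. exp (- of_real s * c) * lower_rate n (flow_stage f n s)))
       has_vector_derivative exp (- of_real t * c) * lower_rate n (flow_stage f n t)) (at t within {0..})" (is "(?I has_vector_derivative _) _")
      using has_vector_derivative_add[OF has_vector_derivative_const[of "fps_nth f n"]] by fastforce
    have "((\<lambda>z. exp (z * c)) has_field_derivative exp (of_real t * c) * c) (at (of_real t))"
      by (auto intro!: derivative_eq_intros)
    then have e: "((\<lambda>s. exp (of_real s * c)) has_vector_derivative exp (of_real t * c) * c) (at t within {0..})"
      by (rule has_vector_derivative_real_field)
    have inv: "exp (of_real t * c) * exp (- of_real t * c) = 1"
      by (simp flip: exp_add)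
    have lr: "lower_rate n (flow_stage f n t) = lower_rate n (flow f t)"
      by (rule lower_rate_cong) (auto simp: zs z flow_stage_nth)
    have "exp (of_real t * c) * (exp (- of_real t * c) * lower_rate n (flow_stage f n t)) + exp (of_real t * c) * c * ?I t
       = lower_rate n (flow f t) + c * fps_nth (flow f t) n"
      unfolding lr flow_nth[of f t n] c_def[symmetric] mult.assoc[symmetric] inv by (simp add: mult_ac)
    also have "\<dots> = fps_nth (rate (flow f t)) n"
      by (simp add: lower_rate_def c_def)
    finally show ?case
      using has_vector_derivative_mult[OF e i] unfolding flow_nth[abs_def] c_def by simp
  qed
  show ?thesis unfolding transport_flow_def using z d by blast
qed

end

section \<open>Taylor expansion of the solutions in time\<close>

lemma at_within_half_line_neq_bot: "t \<ge> 0 \<Longrightarrow> at t within {0::real..} \<noteq> bot"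
proof
  assume "t \<ge> 0" and bot: "at t within {0::real..} = bot"
  have "at_right t \<le> at t within {0..}" by (rule at_le) (use \<open>t \<ge> 0\<close> in auto)
  then show False using bot by (metis bot_unique trivial_limit_at_right_real)
qed

definition has_coeff_deriv :: "(real \<Rightarrow> complex fps) \<Rightarrow> complex fps \<Rightarrow> real \<Rightarrow> bool" where
  "has_coeff_deriv F F' t \<longleftrightarrow>
     (\<forall>n. ((\<lambda>s. fps_nth (F s) n) has_vector_derivative fps_nth F' n) (at t within {0..}))"

lemma has_coeff_deriv_diff:
  "has_coeff_deriv F F' t \<Longrightarrow> has_coeff_deriv G G' t \<Longrightarrow> has_coeff_deriv (\<lambda>s. F s - G s) (F' - G') t"
  by (auto simp: has_coeff_deriv_def intro!: derivative_intros)

lemma has_coeff_deriv_const_mult: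
  "has_coeff_deriv F F' t \<Longrightarrow> has_coeff_deriv (\<lambda>s. fps_const c * F s) (fps_const c * F') t"
  by (auto simp: has_coeff_deriv_def intro!: derivative_intros has_vector_derivative_mult_right)

lemma has_coeff_deriv_euler:
  "has_coeff_deriv F F' t \<Longrightarrow> has_coeff_deriv (\<lambda>s. euler (F s)) (euler F') t"
  by (auto simp: has_coeff_deriv_def intro!: derivative_intros has_vector_derivative_mult_right)

lemma has_coeff_deriv_funpow_euler:
  "has_coeff_deriv F F' t \<Longrightarrow> has_coeff_deriv (\<lambda>s. (euler ^^ m) (F s)) ((euler ^^ m) F') t"
  by (induction m) (auto intro: has_coeff_deriv_euler)

lemma has_coeff_deriv_mult:
  assumes "has_coeff_deriv F F' t" "has_coeff_deriv G G' t"
  shows "has_coeff_deriv (\<lambda>s. F s * G s) (F' * G t + F t * G') t"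
  unfolding has_coeff_deriv_def
proof
  fix n
  have "((\<lambda>s. \<Sum>i=0..n. fps_nth (F s) i * fps_nth (G s) (n - i)) has_vector_derivative
      (\<Sum>i=0..n. fps_nth (F t) i * fps_nth G' (n - i) + fps_nth F' i * fps_nth (G t) (n - i))) (at t within {0..})"
    using assms by (intro has_vector_derivative_sum has_vector_derivative_mult) (auto simp: has_coeff_deriv_def)
  then show "((\<lambda>s. fps_nth (F s * G s) n) has_vector_derivative fps_nth (F' * G t + F t * G') n) (at t within {0..})"
    by (simp add: fps_mult_nth sum.distrib add.commute)
qed

lemma has_coeff_deriv_power:
  assumes "has_coeff_deriv F F' t"
  shows "has_coeff_deriv (\<lambda>s. F s ^ Suc k) (of_nat (Suc k) * F t ^ k * F') t"
proof (induction k)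
  case (Suc k)
  have "F' * F t ^ Suc k + F t * (of_nat (Suc k) * F t ^ k * F') = of_nat (Suc (Suc k)) * F t ^ Suc k * F'"
    by (simp add: algebra_simps)
  then show ?case using has_coeff_deriv_mult[OF assms Suc] by simp
qed (use assms in simp)

lemma has_coeff_deriv_fexp:
  assumes g: "has_coeff_deriv g g' t" and 0: "\<And>s. s \<ge> 0 \<Longrightarrow> fps_nth (g s) 0 = 0" and t: "t \<ge> 0"
  shows "has_coeff_deriv (\<lambda>s. fexp (g s)) (fexp (g t) * g') t"
  unfolding has_coeff_deriv_def
proof
  fix n
  show "((\<lambda>s. fps_nth (fexp (g s)) n) has_vector_derivative fps_nth (fexp (g t) * g') n) (at t within {0..})"
  proof (induction n rule: less_induct)
    case (less n)
    let ?E' = "fexp (g t) * g'"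
    have g'0: "fps_nth g' 0 = 0"
    proof -
      have "((\<lambda>s. fps_nth (g s) 0) has_vector_derivative fps_nth g' 0) (at t within {0..})"
        using g by (simp add: has_coeff_deriv_def)
      then have "((\<lambda>s. 0) has_vector_derivative fps_nth g' 0) (at t within {0..})"
        by (rule has_vector_derivative_transform[rotated 2]) (use t 0 in auto)
      then show ?thesis
        using vector_derivative_unique_within[OF at_within_half_line_neq_bot[OF t] has_vector_derivative_const] by metis
    qed
    show ?case
    proof (cases "n = 0")
      case True
      then show ?thesis using g'0 by simp
    next
      case False
      have "((\<lambda>s. (\<Sum>k=1..n. of_nat k * fps_nth (g s) k * fps_nth (fexp (g s)) (n - k))) has_vector_derivative
         (\<Sum>k=1..n. of_nat k * fps_nth (g t) k * fps_nth ?E' (n - k) + of_nat k * fps_nth g' k * fps_nth (fexp (g t)) (n - k)))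
         (at t within {0..})"
        using g False
        by (intro has_vector_derivative_sum has_vector_derivative_mult has_vector_derivative_mult_right less)
           (auto simp: has_coeff_deriv_def)
      moreover have "(\<Sum>k=1..n. of_nat k * fps_nth (g t) k * fps_nth ?E' (n - k) + of_nat k * fps_nth g' k * fps_nth (fexp (g t)) (n - k))
         = (\<Sum>k=0..n. of_nat k * fps_nth (g t) k * fps_nth ?E' (n - k)) + (\<Sum>k=0..n. of_nat k * fps_nth g' k * fps_nth (fexp (g t)) (n - k))"
        by (simp add: sum.atLeast_Suc_atMost sum.distrib)
      also have "\<dots> = fps_nth (euler (g t) * ?E' + euler g' * fexp (g t)) n"
        by (simp add: fps_mult_nth)
      also have "euler (g t) * ?E' + euler g' * fexp (g t) = euler ?E'"
        using 0[OF t] by (simp add: euler_mult euler_fexp algebra_simps)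
      finally have "((\<lambda>s. (\<Sum>k=1..n. of_nat k * fps_nth (g s) k * fps_nth (fexp (g s)) (n - k))) has_vector_derivative
         of_nat n * fps_nth ?E' n) (at t within {0..})" by simp
      then have "((\<lambda>s. of_nat n * fps_nth (fexp (g s)) n) has_vector_derivative of_nat n * fps_nth ?E' n) (at t within {0..})"
        by (rule has_vector_derivative_transform[rotated 2])
           (use t 0 in \<open>simp_all add: euler_ode_nth[OF 0 euler_fexp[OF 0]]\<close>)
      from has_vector_derivative_mult_right[OF this, of "inverse (of_nat n)"]
      show ?thesis using False by (simp flip: mult.assoc)
    qed
  qed
qed

lemma power_div_fact_le_exp:
  fixes x :: real
  assumes "x \<ge> 0"
  shows "x ^ j / fact j \<le> exp x"
  using sum_le_suminf[OF summable_exp_generic[of x], of "{j}"] assms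
  by (simp add: exp_def divide_inverse mult.commute)

text \<open>A function whose derivatives grow at most like $B^k k!$ is the sum of its Taylor series at distance
less than $1/B$: the remainder is at most $(B |z - w|)^{k}$ up to a constant. The set S is a half-line
in the application, so that expansions at the initial time are included.\<close>
lemma taylor_sums:
  fixes f :: "nat \<Rightarrow> real \<Rightarrow> complex"
  assumes S: "convex S"
    and f: "\<And>k x. x \<in> S \<Longrightarrow> (f k has_vector_derivative f (Suc k) x) (at x within S)"
    and bd: "\<And>k x. x \<in> S \<Longrightarrow> norm (f k x) \<le> M * B ^ k * fact k"
    and w: "w \<in> S" and z: "z \<in> S" and small: "B * \<bar>z - w\<bar> < 1" and B: "B \<ge> 0"
  shows "(\<lambda>k. f k w / fact k * of_real (z - w) ^ k) sums f 0 z"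
proof -
  have real: "(\<lambda>k. (z - w) ^ k / fact k * h (f k w)) sums h (f 0 z)"
    if h: "bounded_linear h" "\<And>x. \<bar>h x\<bar> \<le> norm x" for h :: "complex \<Rightarrow> real"
  proof -
    let ?q = "B * \<bar>z - w\<bar>"
    have le: "norm (h (f 0 z) - (\<Sum>k\<le>n. h (f k w) * (z - w) ^ k / fact k)) \<le> M * (real (Suc n) * ?q ^ Suc n)" for n
    proof -
      have "norm (h (f 0 z) - (\<Sum>k\<le>n. h (f k w) * (z - w) ^ k / fact k)) \<le>
          (M * B ^ Suc n * fact (Suc n)) * norm (z - w) ^ Suc n / fact n"
      proof (rule field_Taylor[OF S, where f = "\<lambda>k x. h (f k x)"])
        fix i x assume "x \<in> S"
        then show "((\<lambda>x. h (f i x)) has_field_derivative h (f (Suc i) x)) (at x within S)"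
          using bounded_linear.has_vector_derivative[OF h(1) f]
          by (simp add: has_real_derivative_iff_has_vector_derivative)
      next
        fix x assume "x \<in> S"
        then show "norm (h (f (Suc n) x)) \<le> M * B ^ Suc n * fact (Suc n)"
          using bd[of x "Suc n"] h(2)[of "f (Suc n) x"] by simp
      qed (use w z in auto)
      also have "\<dots> = M * (real (Suc n) * ?q ^ Suc n)"
        by (simp add: power_mult_distrib field_simps)
      finally show ?thesis .
    qed
    have "(\<lambda>n. M * (real (Suc n) * ?q ^ Suc n)) \<longlonglongrightarrow> M * 0"
      by (intro tendsto_mult tendsto_const LIMSEQ_Suc powser_times_n_limit_0) (use small B in auto)
    then have lim: "(\<lambda>n. M * (real (Suc n) * ?q ^ Suc n)) \<longlonglongrightarrow> 0" by (simp only: mult_zero_right)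
    have "(\<lambda>n. h (f 0 z) - (\<Sum>k\<le>n. h (f k w) * (z - w) ^ k / fact k)) \<longlonglongrightarrow> 0"
      by (rule Lim_null_comparison[OF _ lim]) (rule always_eventually, rule allI, rule le)
    from tendsto_diff[OF tendsto_const[of "h (f 0 z)"] this]
    show ?thesis unfolding sums_def_le by (simp add: mult.commute)
  qed
  have eq: "f k w / fact k * of_real (z - w) ^ k = of_real ((z - w) ^ k / fact k) * f k w" for k
    by simp
  show ?thesis
    unfolding sums_complex_iff eq
    using real[OF bounded_linear_Re abs_Re_le_cmod] real[OF bounded_linear_Im abs_Im_le_cmod]
    by (simp del: of_real_divide of_real_power)
qed

context transport_equation begin

text \<open>The k-th time derivative of a solution, as a function of the present state:
$\partial_t^k g = D^{k-1}(s(g)^k D g)$. In this closed form, which resembles the inversion formula of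
Lagrange, the operator $D^{k-1}$ costs only a factor $n^{k-1}$ in the n-th coefficient, so that
derivatives of all orders can be estimated without any combinatorics.\<close>
definition iter_rate :: "nat \<Rightarrow> complex fps \<Rightarrow> complex fps" where
  "iter_rate k g = (if k = 0 then g else (euler ^^ (k - 1)) (speed g ^ k * euler g))"

lemma funpow_euler_nth: "fps_nth ((euler ^^ m) f) n = of_nat n ^ m * fps_nth f n"
  by (induction m) auto

lemma iter_rate_nth:
  "fps_nth (iter_rate k g) n =
     (if k = 0 then fps_nth g n else of_nat n ^ (k - 1) * fps_nth (speed g ^ k * euler g) n)"
  by (simp add: iter_rate_def funpow_euler_nth)

text \<open>The derivative of the speed with respect to g.\<close>
definition accel :: "complex fps \<Rightarrow> complex fps" where
  "accel g = fps_const (\<beta> * \<beta> * a) * fexp (fps_const \<beta> * g) + fps_const (\<beta> * \<beta> * b) * fexp (fps_const (- \<beta>) * g)"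

lemma accel_def': "accel g = fps_const \<beta> * fps_const (\<beta> * a) * fexp (fps_const \<beta> * g)
    - fps_const (- \<beta>) * fps_const (\<beta> * b) * fexp (fps_const (- \<beta>) * g)"
  by (simp add: accel_def mult.assoc flip: fps_const_neg)

lemma euler_speed:
  assumes "fps_nth g 0 = 0"
  shows "euler (speed g) = accel g * euler g"
proof -
  have d: "euler (x - y) = euler x - euler y" for x y by (simp add: euler_def algebra_simps)
  show ?thesis
    unfolding speed_def accel_def' d euler_const_mult euler_fexp_const_mult[OF assms]
    by (simp add: algebra_simps del: fps_const_mult)
qed

lemma has_coeff_deriv_speed:
  assumes g: "has_coeff_deriv g g' t" and 0: "\<And>s. s \<ge> 0 \<Longrightarrow> fps_nth (g s) 0 = 0" and t: "t \<ge> 0"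
  shows "has_coeff_deriv (\<lambda>s. speed (g s)) (accel (g t) * g') t"
proof -
  have e: "has_coeff_deriv (\<lambda>s. fps_const d * fexp (fps_const c * g s)) (fps_const d * (fexp (fps_const c * g t) * (fps_const c * g'))) t" for c d
    by (intro has_coeff_deriv_const_mult has_coeff_deriv_fexp) (use g 0 t in auto)
  from has_coeff_deriv_diff[OF e[of "\<beta> * a" \<beta>] e[of "\<beta> * b" "- \<beta>"]]
  show ?thesis
    unfolding speed_def accel_def'
    by (simp add: algebra_simps del: fps_const_mult)
qed

lemma transport_flow_nth_0: "transport_flow g \<Longrightarrow> t \<ge> 0 \<Longrightarrow> fps_nth (g t) 0 = 0"
  by (simp add: transport_flow_def)

text \<open>The closed form is preserved under differentiation because $\partial_t s(g) = s'(g)\, s(g) D g$ and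
$D\,s(g) = s'(g) D g$: both terms of $\partial_t (s^k D g)$ combine to $D (s^{k+1} D g)$.\<close>
lemma has_coeff_deriv_iter_rate:
  assumes flow: "transport_flow g" and t: "t \<ge> 0"
  shows "has_coeff_deriv (\<lambda>s. iter_rate k (g s)) (iter_rate (Suc k) (g t)) t"
proof (cases k)
  case 0
  then show ?thesis using assms by (simp add: iter_rate_def has_coeff_deriv_def transport_flow_def rate_def)
next
  case (Suc m)
  have z: "\<And>s. s \<ge> 0 \<Longrightarrow> fps_nth (g s) 0 = 0" using flow by (simp add: transport_flow_def)
  let ?c = "speed (g t)" and ?c' = "accel (g t)" and ?e = "euler (g t)"
  have g: "has_coeff_deriv g (?c * ?e) t"
    using flow t by (simp add: has_coeff_deriv_def transport_flow_def rate_def)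
  have "has_coeff_deriv (\<lambda>s. speed (g s) ^ Suc m * euler (g s))
     ((of_nat (Suc m) * ?c ^ m * (?c' * (?c * ?e))) * ?e + ?c ^ Suc m * euler (?c * ?e)) t"
    by (intro has_coeff_deriv_mult has_coeff_deriv_power has_coeff_deriv_speed has_coeff_deriv_euler g z t)
  also have "(of_nat (Suc m) * ?c ^ m * (?c' * (?c * ?e))) * ?e + ?c ^ Suc m * euler (?c * ?e) =
      euler (?c ^ Suc (Suc m) * ?e)"
    unfolding euler_mult[of ?c ?e] euler_mult[of "?c ^ Suc (Suc m)" ?e] euler_power euler_speed[OF z[OF t]]
    by (simp add: algebra_simps)
  finally have "has_coeff_deriv (\<lambda>s. (euler ^^ m) (speed (g s) ^ Suc m * euler (g s)))
     ((euler ^^ m) (euler (?c ^ Suc (Suc m) * ?e))) t"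
    by (rule has_coeff_deriv_funpow_euler)
  then show ?thesis
    by (simp add: iter_rate_def Suc funpow_swap1 del: power_Suc)
qed

lemma pnorm_speed:
  assumes "R \<ge> 0" "fps_nth g 0 = 0"
  shows "pnorm R n (speed g) \<le> norm \<beta> * (norm a + norm b) * exp (norm \<beta> * pnorm R n g)"
proof -
  have e: "pnorm R n (fps_const d * fexp (fps_const c * g)) \<le> norm d * exp (norm \<beta> * pnorm R n g)" if "norm c = norm \<beta>" for c d
    unfolding pnorm_const_mult using pnorm_fexp[OF assms(1), of "fps_const c * g" n] assms(2) that
    by (intro mult_left_mono) (auto simp: pnorm_const_mult)
  have "pnorm R n (speed g) \<le> pnorm R n (fps_const (\<beta> * a) * fexp (fps_const \<beta> * g)) + pnorm R n (fps_const (\<beta> * b) * fexp (fps_const (- \<beta>) * g))"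
    unfolding speed_def using pnorm_add[OF assms(1), of n _ "- _"] by (simp add: pnorm_uminus)
  also have "\<dots> \<le> norm (\<beta> * a) * exp (norm \<beta> * pnorm R n g) + norm (\<beta> * b) * exp (norm \<beta> * pnorm R n g)"
    by (intro add_mono e) auto
  finally show ?thesis by (simp add: norm_mult algebra_simps)
qed

lemma iter_rate_bound_pnorm:
  assumes R: "R \<ge> 0" and k: "k > 0"
  shows "norm (fps_nth (iter_rate k g) n) * R ^ n \<le> real n ^ (k - 1) * (pnorm R n (speed g) ^ k * pnorm R n (euler g))"
proof -
  have "norm (fps_nth (speed g ^ k * euler g) n) * R ^ n \<le> pnorm R n (speed g ^ k * euler g)"
    by (rule norm_nth_le_pnorm[OF R]) simp
  also have "\<dots> \<le> pnorm R n (speed g ^ k) * pnorm R n (euler g)" by (rule pnorm_mult[OF R])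
  also have "\<dots> \<le> pnorm R n (speed g) ^ k * pnorm R n (euler g)"
    by (intro mult_right_mono pnorm_power pnorm_nonneg R)
  finally have "real n ^ (k - 1) * (norm (fps_nth (speed g ^ k * euler g) n) * R ^ n) \<le> 
     real n ^ (k - 1) * (pnorm R n (speed g) ^ k * pnorm R n (euler g))"
    by (intro mult_left_mono) auto
  then show ?thesis using k by (simp add: iter_rate_nth norm_mult norm_power mult_ac)
qed

text \<open>For coefficients bounded by 1 the polynomial factor $n^{k-1}$ is at most $k!\,\delta^{-k} e^{\delta n}$,
and the exponential is absorbed by a slightly larger radius. This gives the growth $B^k k!$ of an
analytic function of time, uniformly in n after weighting with $r^n$.\<close>
lemma iter_rate_bound:
  assumes r: "0 < r" "r < 1"
  obtains C B where "C > 0" "B > 0"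
    "\<And>g k n. fps_nth g 0 = 0 \<Longrightarrow> (\<And>k. norm (fps_nth g k) \<le> 1) \<Longrightarrow>
       norm (fps_nth (iter_rate k g) n) * r ^ n \<le> C * B ^ k * fact k"
proof -
  define R where "R = (r + 1) / 2"
  have R: "r < R" "R < 1" "0 < R" using r by (auto simp: R_def)
  \<comment> \<open>Passing from the radius R to r gains the factor $(r/R)^n = e^{-\delta n}$, which absorbs $n^{k-1}$.\<close>
  define \<delta> where "\<delta> = ln (R / r)"
  have \<delta>: "\<delta> > 0" using R r by (simp add: \<delta>_def)
  define S where "S = norm \<beta> * (norm a + norm b) * exp (norm \<beta> * (1 / (1 - R))) + 1"
  have S: "S > 0" by (simp add: S_def add_nonneg_pos)
  define Q where "Q = 1 / (1 - R)\<^sup>2"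
  have Q: "Q > 0" using R by (simp add: Q_def)
  show ?thesis
  proof (rule that[of "max 1 (Q * \<delta>)" "S / \<delta>"])
    show "max 1 (Q * \<delta>) > 0" "S / \<delta> > 0" using Q \<delta> S by auto
    fix g :: "complex fps" and k n
    assume g: "fps_nth g 0 = 0" "\<And>k. norm (fps_nth g k) \<le> 1"
    have "pnorm R n g \<le> (\<Sum>i\<le>n. R ^ i)"
      unfolding pnorm_def using g(2) R by (intro sum_mono) (simp add: mult_left_le_one_le)
    also have "\<dots> \<le> 1 / (1 - R)"
      using sum_le_suminf[OF summable_geometric[of R], of "{..n}"] R by (simp add: suminf_geometric)
    finally have p: "pnorm R n g \<le> 1 / (1 - R)" .
    have "pnorm R n (speed g) \<le> norm \<beta> * (norm a + norm b) * exp (norm \<beta> * pnorm R n g)"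
      by (rule pnorm_speed) (use R g in auto)
    also have "\<dots> \<le> norm \<beta> * (norm a + norm b) * exp (norm \<beta> * (1 / (1 - R)))"
      by (intro mult_left_mono iffD2[OF exp_le_cancel_iff] p) auto
    finally have sp: "pnorm R n (speed g) \<le> S" by (simp add: S_def)
    have "pnorm R n (euler g) \<le> (\<Sum>i\<le>n. of_nat (Suc i) * R ^ i)"
      unfolding pnorm_def
    proof (rule sum_mono)
      fix i
      have "real i * norm (fps_nth g i) \<le> real (Suc i) * 1"
        using g(2)[of i] by (intro mult_mono) auto
      then show "norm (fps_nth (euler g) i) * R ^ i \<le> real (Suc i) * R ^ i"
        using R by (intro mult_right_mono) (auto simp: norm_mult)
    qed
    also have "\<dots> \<le> Q"
    proof -
      have s: "(\<lambda>n. of_nat (Suc n) * R ^ n) sums Q"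
        unfolding Q_def by (rule geometric_deriv_sums) (use R in auto)
      show ?thesis using sum_le_suminf[OF sums_summable[OF s], of "{..n}"] sums_unique[OF s] R by simp
    qed
    finally have eu: "pnorm R n (euler g) \<le> Q" .
    show "norm (fps_nth (iter_rate k g) n) * r ^ n \<le> max 1 (Q * \<delta>) * (S / \<delta>) ^ k * fact k"
    proof (cases k)
      case 0
      have "norm (fps_nth g n) * r ^ n \<le> 1 * 1"
        using g(2) r by (intro mult_mono) (auto simp: power_le_one)
      then show ?thesis using 0 by (simp add: iter_rate_nth)
    next
      case (Suc m)
      have rR: "(r / R) ^ n = exp (- (\<delta> * real n))"
      proof -
        have "exp (- \<delta>) = r / R" using R r by (simp add: \<delta>_def exp_minus field_simps)
        then show ?thesis by (metis exp_of_nat_mult mult.commute mult_minus_left)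
      qed
      have "norm (fps_nth (iter_rate k g) n) * r ^ n = norm (fps_nth (iter_rate k g) n) * R ^ n * (r / R) ^ n"
        using R by (simp add: power_divide)
      also have "\<dots> \<le> (real n ^ m * (S ^ k * Q)) * (r / R) ^ n"
      proof (intro mult_right_mono)
        have "norm (fps_nth (iter_rate k g) n) * R ^ n \<le> real n ^ (k - 1) * (pnorm R n (speed g) ^ k * pnorm R n (euler g))"
          by (rule iter_rate_bound_pnorm) (use R Suc in auto)
        also have "\<dots> \<le> real n ^ (k - 1) * (S ^ k * Q)"
          using sp eu R S by (intro mult_left_mono mult_mono power_mono pnorm_nonneg) auto
        finally show "norm (fps_nth (iter_rate k g) n) * R ^ n \<le> real n ^ m * (S ^ k * Q)" using Suc by simp
      qed (use R r in auto)
      also have "\<dots> = (\<delta> * real n) ^ m * exp (- (\<delta> * real n)) * (S ^ k * Q / \<delta> ^ m)"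
        unfolding rR using \<delta> by (simp add: power_mult_distrib)
      also have "\<dots> \<le> fact m * (S ^ k * Q / \<delta> ^ m)"
      proof (intro mult_right_mono)
        show "(\<delta> * real n) ^ m * exp (- (\<delta> * real n)) \<le> fact m"
          using power_div_fact_le_exp[of "\<delta> * real n" m] \<delta> by (simp add: exp_minus field_simps)
      qed (use S Q \<delta> in auto)
      also have "\<dots> = (Q * \<delta>) * (S / \<delta>) ^ k * fact m"
        using \<delta> Suc by (simp add: power_divide)
      also have "\<dots> \<le> max 1 (Q * \<delta>) * (S / \<delta>) ^ k * fact k"
        using S \<delta> Suc Q by (intro mult_mono fact_mono) auto
      finally show ?thesis .
    qed
  qed
qed

text \<open>The solution depends measurably on its initial value: for a fixed n the derivatives on a
compact time interval are bounded by powers $c^k$, so the Taylor series at time 0, whose terms are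
polynomials in the initial coefficients, represents $g_n(t)$ for all t.\<close>
lemma flow_taylor_measurable:
  assumes f: "\<And>n. (\<lambda>\<omega>. fps_nth (f \<omega>) n) \<in> borel_measurable M"
    and f0: "\<And>\<omega>. \<omega> \<in> space M \<Longrightarrow> fps_nth (f \<omega>) 0 = 0"
    and f1: "\<And>\<omega> k. \<omega> \<in> space M \<Longrightarrow> norm (fps_nth (f \<omega>) k) \<le> 1" and t: "t \<ge> 0"
  shows "(\<lambda>\<omega>. fps_nth (flow (f \<omega>) t) n) \<in> borel_measurable M"
proof (rule borel_measurable_LIMSEQ_metric)
  let ?u = "\<lambda>m \<omega>. \<Sum>k<m. fps_nth (iter_rate k (f \<omega>)) n / fact k * of_real t ^ k"
  have e: "(\<lambda>\<omega>. fps_nth (fexp (fps_const c * f \<omega>)) m) \<in> borel_measurable M" for c m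
    by (rule measurable_fexp) (auto intro!: borel_measurable_times f)
  have "(\<lambda>\<omega>. fps_nth (speed (f \<omega>)) m) \<in> borel_measurable M" for m
    unfolding speed_def by (auto intro!: borel_measurable_diff borel_measurable_times e)
  then have "(\<lambda>\<omega>. fps_nth (speed (f \<omega>) ^ k * euler (f \<omega>)) m) \<in> borel_measurable M" for k m
    by (intro measurable_fps_mult measurable_fps_power) (auto intro!: borel_measurable_times f)
  then have "(\<lambda>\<omega>. fps_nth (iter_rate k (f \<omega>)) n) \<in> borel_measurable M" for k
    unfolding iter_rate_nth using f by (cases "k = 0") auto
  then show "?u m \<in> borel_measurable M" for m
    by (intro borel_measurable_sum borel_measurable_times borel_measurable_divide borel_measurable_const)
  fix \<omega> assume \<omega>: "\<omega> \<in> space M"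
  note flow = transport_flow_flow[OF f0[OF \<omega>]]
  obtain B0 where B0: "B0 \<ge> 0" "\<And>s k. s \<in> {0..t} \<Longrightarrow> k \<le> n \<Longrightarrow> norm (fps_nth (flow (f \<omega>) s) k) \<le> B0"
    using transport_flow_bounded[OF t, of n] flow f1[OF \<omega>] by (metis flow_0)
  let ?P = "real (Suc n) * B0"
  define S where "S = norm \<beta> * (norm a + norm b) * exp (norm \<beta> * ?P)"
  \<comment> \<open>Powers $c^k$ are dominated by $B^k k!$ for every positive B; with this choice the Taylor series at 0 reaches time t.\<close>
  define B where "B = 1 / (t + 1)"
  define c where "c = (real n + 1) * S"
  have c0: "c \<ge> 0" "S \<ge> 0" "B > 0" using t by (auto simp: c_def S_def B_def)
  let ?M = "real n * ?P * exp (c / B) + B0"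
  have "(\<lambda>k. fps_nth (iter_rate k (flow (f \<omega>) 0)) n / fact k * of_real (t - 0) ^ k) sums fps_nth (iter_rate 0 (flow (f \<omega>) t)) n"
  proof (rule taylor_sums[where S = "{0..t}" and B = B and M = ?M])
    fix k s assume s: "s \<in> {0..t}"
    show "((\<lambda>s. fps_nth (iter_rate k (flow (f \<omega>) s)) n) has_vector_derivative fps_nth (iter_rate (Suc k) (flow (f \<omega>) s)) n) (at s within {0..t})"
      using has_coeff_deriv_iter_rate[OF flow, of s k] s unfolding has_coeff_deriv_def
      by (auto intro: has_vector_derivative_within_subset)
    have g0: "fps_nth (flow (f \<omega>) s) 0 = 0" by (rule transport_flow_nth_0[OF flow]) (use s in auto)
    have p: "pnorm 1 n (flow (f \<omega>) s) \<le> ?P" by (rule pnorm_1_le) (use B0(2)[OF s] in auto)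
    have sp: "pnorm 1 n (speed (flow (f \<omega>) s)) \<le> S"
    proof -
      have "pnorm 1 n (speed (flow (f \<omega>) s)) \<le> norm \<beta> * (norm a + norm b) * exp (norm \<beta> * pnorm 1 n (flow (f \<omega>) s))"
        by (rule pnorm_speed) (use g0 in auto)
      also have "\<dots> \<le> S" unfolding S_def using p by (intro mult_left_mono) (auto intro!: mult_left_mono)
      finally show ?thesis .
    qed
    have eu: "pnorm 1 n (euler (flow (f \<omega>) s)) \<le> real n * ?P"
    proof -
      have "pnorm 1 n (euler (flow (f \<omega>) s)) \<le> real n * pnorm 1 n (flow (f \<omega>) s)"
        unfolding pnorm_def sum_distrib_left by (intro sum_mono) (auto simp: norm_mult intro!: mult_right_mono)
      also have "\<dots> \<le> real n * ?P" by (intro mult_left_mono p) auto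
      finally show ?thesis .
    qed
    show "norm (fps_nth (iter_rate k (flow (f \<omega>) s)) n) \<le> ?M * B ^ k * fact k"
    proof (cases "k = 0")
      case True
      then show ?thesis using B0(2)[OF s, of n] B0(1) c0 by (simp add: iter_rate_nth add_increasing)
    next
      case False
      have "norm (fps_nth (iter_rate k (flow (f \<omega>) s)) n) \<le> real n ^ (k - 1) * (S ^ k * (real n * ?P))"
        using iter_rate_bound_pnorm[of 1 k "flow (f \<omega>) s" n] False
          mult_left_mono[OF mult_mono[OF power_mono[OF sp, of k] eu], of "real n ^ (k - 1)"] c0
        by (simp add: pnorm_nonneg)
      also have "\<dots> \<le> (real n + 1) ^ k * (S ^ k * (real n * ?P))"
      proof (intro mult_right_mono)
        have "real n ^ (k - 1) \<le> (real n + 1) ^ (k - 1)" by (intro power_mono) auto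
        also have "\<dots> \<le> (real n + 1) ^ k" by (intro power_increasing) auto
        finally show "real n ^ (k - 1) \<le> (real n + 1) ^ k" .
      qed (use c0 B0 in auto)
      also have "\<dots> = (real n * ?P) * (c ^ k)" by (simp add: c_def power_mult_distrib)
      also have "\<dots> \<le> (real n * ?P) * (exp (c / B) * (B ^ k * fact k))"
      proof (intro mult_left_mono)
        show "c ^ k \<le> exp (c / B) * (B ^ k * fact k)"
          using power_div_fact_le_exp[of "c / B" k] c0 by (simp add: power_divide field_simps)
      qed (use B0 in auto)
      also have "\<dots> \<le> ?M * B ^ k * fact k"
        using B0 c0 by (simp add: algebra_simps)
      finally show ?thesis .
    qed
  next
    show "B * \<bar>t - 0\<bar> < 1" using t by (simp add: B_def)
  qed (use t c0 in auto)
  then show "(\<lambda>m. ?u m \<omega>) \<longlonglongrightarrow> fps_nth (flow (f \<omega>) t) n"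
    by (simp add: sums_def iter_rate_nth)
qed

end

section \<open>Analytic solutions of the transport equation\<close>

text \<open>Rearrangement of a double series dominated by geometric series; it is used to pass between the
expansions in time of the coefficients and that of the function.\<close>
lemma double_series_geometric:
  fixes u :: "nat \<Rightarrow> nat \<Rightarrow> complex"
  assumes bd: "\<And>k n. norm (u k n) \<le> C * p ^ k * q ^ n" and C: "C \<ge> 0"
    and p: "0 \<le> p" "p < 1" and q: "0 \<le> q" "q < 1"
  obtains S where "((\<lambda>(k, n). u k n) has_sum S) UNIV"
    and "\<And>R. (\<And>k. u k sums R k) \<Longrightarrow> R sums S"
    and "\<And>R. (\<And>n. (\<lambda>k. u k n) sums R n) \<Longrightarrow> R sums S"
proof -
  have geo: "(\<lambda>n. D * x ^ n) summable_on UNIV" if "0 \<le> x" "x < 1" "D \<ge> 0" for x D :: real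
    using that by (intro norm_summable_imp_summable_on) (auto intro!: summable_mult summable_geometric simp: norm_mult norm_power)
  have rows: "summable (\<lambda>n. norm (u k n))" for k
    by (rule summable_comparison_test'[of "\<lambda>n. (C * p ^ k) * q ^ n" 0])
       (use bd q in \<open>auto intro!: summable_mult summable_geometric\<close>)
  have cols: "summable (\<lambda>k. norm (u k n))" for n
  proof (rule summable_comparison_test'[of "\<lambda>k. (C * q ^ n) * p ^ k" 0])
    show "summable (\<lambda>k. (C * q ^ n) * p ^ k)" using p by (intro summable_mult summable_geometric) auto
    show "norm (norm (u k n)) \<le> (C * q ^ n) * p ^ k" for k using bd[of k n] by (simp add: mult_ac)
  qed
  have "(\<lambda>(k, n). C * p ^ k * q ^ n) summable_on UNIV \<times> UNIV"
  proof (rule summable_on_SigmaI)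
    fix k
    have "(\<lambda>n. (C * p ^ k) * q ^ n) sums ((C * p ^ k) * (1 / (1 - q)))"
      by (intro sums_mult geometric_sums) (use q in auto)
    then show "((\<lambda>n. case (k, n) of (k, n) \<Rightarrow> C * p ^ k * q ^ n) has_sum (C * (1 / (1 - q))) * p ^ k) UNIV"
      using C p q by (intro sums_nonneg_imp_has_sum) (auto simp: mult_ac)
  qed (use geo[OF p, of "C * (1 / (1 - q))"] C p q in auto)
  then have "(\<lambda>x. norm (case x of (k, n) \<Rightarrow> u k n)) summable_on UNIV \<times> UNIV"
    by (rule Infinite_Sum.abs_summable_on_comparison_test') (use bd in auto)
  then have "(\<lambda>(k, n). u k n) summable_on UNIV \<times> UNIV"
    by (rule Infinite_Sum.abs_summable_summable)
  then obtain S where S: "((\<lambda>(k, n). u k n) has_sum S) (UNIV \<times> UNIV)"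
    by (auto simp: summable_on_def)
  then have S': "((\<lambda>(n, k). u k n) has_sum S) (UNIV \<times> UNIV)"
    by (subst has_sum_swap) (simp add: case_prod_unfold)
  show ?thesis
  proof (rule that)
    show "((\<lambda>(k, n). u k n) has_sum S) UNIV" using S by simp
    show "R sums S" if "\<And>k. u k sums R k" for R
      by (rule has_sum_imp_sums, rule has_sum_SigmaD[OF S])
         (use norm_summable_imp_has_sum[OF rows that] in simp)
    show "R sums S" if "\<And>n. (\<lambda>k. u k n) sums R n" for R
      by (rule has_sum_imp_sums, rule has_sum_SigmaD[OF S'])
         (use norm_summable_imp_has_sum[OF cols that] in simp)
  qed
qed

lemma ereal_norm_less: "norm z < r \<Longrightarrow> ereal r \<le> R \<Longrightarrow> ereal (norm z) < R"
  by (rule less_le_trans[of _ "ereal r"]) auto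

lemma ereal_norm_less_1: "norm z < 1 \<Longrightarrow> 1 \<le> R \<Longrightarrow> ereal (norm z) < R"
  using ereal_norm_less[of z 1 R] by (simp add: one_ereal_def)

lemma fps_conv_radius_ge_bounded:
  fixes f :: "complex fps"
  assumes bd: "\<And>n. norm (fps_nth f n) * r ^ n \<le> C" and r: "r > 0"
  shows "fps_conv_radius f \<ge> ereal r"
  unfolding fps_conv_radius_def
proof (rule conv_radius_geI_ex')
  fix s :: real assume s: "0 < s" "ereal s < ereal r"
  have "summable (\<lambda>n. norm (fps_nth f n * of_real s ^ n))"
  proof (rule summable_comparison_test'[of "\<lambda>n. C * (s / r) ^ n" 0])
    show "summable (\<lambda>n. C * (s / r) ^ n)" using s r by (intro summable_mult summable_geometric) auto
    fix n
    have "norm (fps_nth f n) * s ^ n = (norm (fps_nth f n) * r ^ n) * (s / r) ^ n"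
      using r by (simp add: power_divide)
    also have "\<dots> \<le> C * (s / r) ^ n" using bd s r by (intro mult_right_mono) auto
    finally show "norm (norm (fps_nth f n * of_real s ^ n)) \<le> C * (s / r) ^ n"
      using s by (simp add: norm_mult norm_power)
  qed
  then show "summable (\<lambda>n. fps_nth f n * of_real s ^ n)" by (rule summable_norm_cancel)
qed

lemma powser_has_vector_derivative:
  fixes h :: "real \<Rightarrow> complex"
  assumes "\<And>t. t \<ge> 0 \<Longrightarrow> \<bar>t - t0\<bar> < e \<Longrightarrow> (\<lambda>k. c k * of_real (t - t0) ^ k) sums h t"
    and e: "e > 0" and t0: "t0 \<ge> 0"
  shows "(h has_vector_derivative c 1) (at t0 within {0..})"
proof -
  let ?F = "Abs_fps c"
  have "summable (\<lambda>k. c k * of_real (e / 2) ^ k)"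
    using assms(1)[of "t0 + e / 2"] e t0 by (simp add: sums_summable)
  then have "fps_conv_radius ?F \<ge> ereal (e / 2)"
    unfolding fps_conv_radius_def using conv_radius_geI[of c "of_real (e / 2)"] e by simp
  then have rad: "fps_conv_radius ?F > 0"
    using e by (auto simp: less_le_trans[of 0 "ereal (e / 2)"])
  have "(eval_fps ?F has_field_derivative eval_fps (fps_deriv ?F) 0) (at (of_real 0))"
    using has_field_derivative_eval_fps[of 0 ?F] rad by (simp add: zero_ereal_def)
  then have d: "((\<lambda>s. eval_fps ?F (of_real s)) has_vector_derivative c 1) (at 0)"
    using has_vector_derivative_real_field[of "eval_fps ?F" _ 0 UNIV] by (simp add: eval_fps_at_0)
  have "((\<lambda>t. t - t0) has_vector_derivative 1) (at t0 within {0..})"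
    by (auto intro!: derivative_eq_intros)
  from vector_diff_chain_within[OF this, of "\<lambda>s. eval_fps ?F (of_real s)" "c 1"]
  have "((\<lambda>t. eval_fps ?F (of_real (t - t0))) has_vector_derivative c 1) (at t0 within {0..})"
    using d by (auto simp: o_def intro: has_vector_derivative_at_within)
  then show ?thesis
  proof (rule has_vector_derivative_transform_within[OF _ e])
    fix t assume t: "t \<in> {0..}" "dist t t0 < e"
    then have "(\<lambda>k. c k * of_real (t - t0) ^ k) sums h t" using assms(1) by (auto simp: dist_real_def)
    then show "eval_fps ?F (of_real (t - t0)) = h t" by (simp add: eval_fps_def sums_iff)
  qed (use t0 in auto)
qed

lemma has_fps_expansion_fexp:
  assumes "f has_fps_expansion F" "fps_nth F 0 = 0"
  shows "(\<lambda>z. exp (f z)) has_fps_expansion fexp F"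
proof -
  have "exp has_fps_expansion fps_exp (1::complex)" by (rule has_fps_expansion_exp1)
  from has_fps_expansion_compose[OF this assms]
  show ?thesis by (simp add: fexp_def o_def)
qed

context transport_equation begin

definition speed_fun :: "complex \<Rightarrow> complex" where
  "speed_fun w = \<beta> * a * exp (\<beta> * w) - \<beta> * b * exp (- \<beta> * w)"

text \<open>Formal operations on coefficients correspond to operations on functions, so that the coefficientwise
equation and the partial differential equation are equivalent.\<close>
lemma has_fps_expansion_rate:
  assumes f: "f has_fps_expansion F" and 0: "fps_nth F 0 = 0"
  shows "(\<lambda>z. speed_fun (f z) * (z * deriv f z)) has_fps_expansion rate F"
  unfolding speed_fun_def rate_def speed_def euler_def
  by (intro fps_expansion_intros has_fps_expansion_fexp f) (use 0 in auto)

lemma eval_fps_rate: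
  assumes rad: "fps_conv_radius F \<ge> 1" and 0: "fps_nth F 0 = 0" and z: "norm z < 1"
  shows "eval_fps (rate F) z = speed_fun (eval_fps F z) * (z * eval_fps (fps_deriv F) z)"
proof -
  let ?f = "eval_fps F"
  let ?h = "\<lambda>z. speed_fun (?f z) * (z * deriv ?f z)"
  have zr: "norm z < fps_conv_radius F"
    by (rule ereal_norm_less_1[OF z rad])
  have hf: "?f holomorphic_on eball 0 1"
    using rad by (intro holomorphic_on_eval_fps) (auto simp: in_eball_iff one_ereal_def intro!: ereal_norm_less_1)
  then have hol: "?h holomorphic_on eball 0 1"
    unfolding speed_fun_def
    by (intro holomorphic_on_mult holomorphic_on_diff holomorphic_on_const holomorphic_on_exp'
        holomorphic_on_id[unfolded id_def] holomorphic_deriv) auto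
  have "?f has_fps_expansion F"
    using ereal_norm_less_1[of "0 :: complex", OF _ rad] by (intro eval_fps_has_fps_expansion) (simp add: zero_ereal_def)
  from fps_expansion_eqI[OF has_fps_expansion_rate[OF this 0]]
  have "fps_expansion ?h 0 = rate F" .
  with eval_fps_expansion'[OF hol, of z] z
  have "eval_fps (rate F) z = ?h z" by (simp add: one_ereal_def)
  then show ?thesis using eval_fps_deriv[OF zr] by simp
qed

context
  fixes g :: "real \<Rightarrow> complex fps"
  assumes flow: "transport_flow g" and bounded: "\<And>t n. t \<ge> 0 \<Longrightarrow> norm (fps_nth (g t) n) \<le> 1"
begin

lemma flow_conv_radius: "t \<ge> 0 \<Longrightarrow> fps_conv_radius (g t) \<ge> 1"
  using fps_conv_radius_ge_bounded[of "g t" 1 1] bounded by (simp add: one_ereal_def)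

lemma flow_taylor_bound:
  assumes r: "0 < r" "r < 1"
  obtains C B where "C > 0" "B > 0"
    "\<And>(t::real) k n. t \<ge> 0 \<Longrightarrow> norm (fps_nth (iter_rate k (g t)) n) * r ^ n \<le> C * B ^ k * fact k"
    "\<And>(t::real) s n. t \<ge> 0 \<Longrightarrow> s \<ge> 0 \<Longrightarrow> B * \<bar>s - t\<bar> < 1 \<Longrightarrow>
       (\<lambda>k. fps_nth (iter_rate k (g t)) n / fact k * of_real (s - t) ^ k) sums fps_nth (g s) n"
proof -
  obtain C B where CB: "C > 0" "B > 0"
    "\<And>g k n. fps_nth g 0 = 0 \<Longrightarrow> (\<And>k. norm (fps_nth g k) \<le> 1) \<Longrightarrow>
       norm (fps_nth (iter_rate k g) n) * r ^ n \<le> C * B ^ k * fact k"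
    by (rule iter_rate_bound[OF r]) blast
  have bd: "norm (fps_nth (iter_rate k (g t)) n) * r ^ n \<le> C * B ^ k * fact k" if "t \<ge> 0" for t k n
    by (rule CB(3)) (use that bounded transport_flow_nth_0[OF flow] in auto)
  have "(\<lambda>k. fps_nth (iter_rate k (g t)) n / fact k * of_real (s - t) ^ k) sums fps_nth (iter_rate 0 (g s)) n"
    if "t \<ge> 0" "s \<ge> 0" "B * \<bar>s - t\<bar> < 1" for t s n
  proof (rule taylor_sums[where S = "{0..}" and M = "C / r ^ n" and B = B])
    fix k x assume x: "x \<in> {0::real..}"
    then show "((\<lambda>x. fps_nth (iter_rate k (g x)) n) has_vector_derivative fps_nth (iter_rate (Suc k) (g x)) n) (at x within {0..})"
      using has_coeff_deriv_iter_rate[OF flow, of x k] unfolding has_coeff_deriv_def by auto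
    show "norm (fps_nth (iter_rate k (g x)) n) \<le> C / r ^ n * B ^ k * fact k"
      using bd[of x k n] x r by (simp add: field_simps)
  qed (use that CB in auto)
  then show ?thesis
    using that[of C B] CB(1,2) bd by (simp add: iter_rate_nth)
qed

text \<open>The time expansions of all coefficients have a common radius of convergence, so that they can be
summed over n to an expansion in time of the analytic function itself.\<close>
lemma flow_time_expansion:
  assumes r: "0 < r" "r < 1"
  obtains C B where "C > 0" "B > 0"
    "\<And>(t::real) k z. t \<ge> 0 \<Longrightarrow> norm z < r \<Longrightarrow>
       norm (eval_fps (iter_rate k (g t)) z / fact k) \<le> C * B ^ k * (1 / (1 - norm z / r))"
    "\<And>(t::real) s z. t \<ge> 0 \<Longrightarrow> s \<ge> 0 \<Longrightarrow> B * \<bar>s - t\<bar> < 1 \<Longrightarrow> norm z < r \<Longrightarrow>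
       (\<lambda>k. eval_fps (iter_rate k (g t)) z / fact k * of_real (s - t) ^ k) sums eval_fps (g s) z"
    "\<And>(t::real) k. t \<ge> 0 \<Longrightarrow> fps_conv_radius (iter_rate k (g t)) \<ge> ereal r"
proof -
  obtain C B where CB: "C > 0" "B > 0"
    and bd: "\<And>(t::real) k n. t \<ge> 0 \<Longrightarrow> norm (fps_nth (iter_rate k (g t)) n) * r ^ n \<le> C * B ^ k * fact k"
    and ty: "\<And>(t::real) s n. t \<ge> 0 \<Longrightarrow> s \<ge> 0 \<Longrightarrow> B * \<bar>s - t\<bar> < 1 \<Longrightarrow>
       (\<lambda>k. fps_nth (iter_rate k (g t)) n / fact k * of_real (s - t) ^ k) sums fps_nth (g s) n"
    by (rule flow_taylor_bound[OF r]) blast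
  have rad: "fps_conv_radius (iter_rate k (g t)) \<ge> ereal r" if "t \<ge> 0" for t :: real and k
    by (rule fps_conv_radius_ge_bounded[OF bd r(1)]) (use that in auto)
  have ev: "(\<lambda>n. fps_nth (iter_rate k (g t)) n * z ^ n) sums eval_fps (iter_rate k (g t)) z"
    if "t \<ge> 0" "norm z < r" for t :: real and k z
    by (rule sums_eval_fps, rule ereal_norm_less[OF that(2) rad[OF that(1)]])
  have nb: "norm (fps_nth (iter_rate k (g t)) n * z ^ n / fact k) \<le> C * B ^ k * (norm z / r) ^ n"
    if "t \<ge> 0" for t :: real and k n and z :: complex
  proof -
    have "norm (fps_nth (iter_rate k (g t)) n) \<le> C * B ^ k * fact k / r ^ n"
      using bd[OF that, of k n] r by (simp add: field_simps)
    then have "norm (fps_nth (iter_rate k (g t)) n) * (norm z ^ n / fact k) \<le> (C * B ^ k * fact k / r ^ n) * (norm z ^ n / fact k)"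
      by (intro mult_right_mono) auto
    then show ?thesis by (simp add: norm_mult norm_power norm_divide power_divide mult_ac)
  qed
  show ?thesis
  proof (rule that[OF CB])
    fix t :: real and k and z :: complex assume t: "t \<ge> 0" and z: "norm z < r"
    let ?q = "norm z / r"
    have q: "0 \<le> ?q" "?q < 1" using z r by auto
    have s: "(\<lambda>n. C * B ^ k * ?q ^ n) sums (C * B ^ k * (1 / (1 - ?q)))"
      using q by (intro sums_mult geometric_sums) auto
    have s2: "(\<lambda>n. fps_nth (iter_rate k (g t)) n * z ^ n / fact k) sums (eval_fps (iter_rate k (g t)) z / fact k)"
      by (intro sums_divide ev t z)
    have "norm (\<Sum>n. fps_nth (iter_rate k (g t)) n * z ^ n / fact k) \<le> (\<Sum>n. C * B ^ k * ?q ^ n)"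
      by (rule norm_suminf_le[OF nb[OF t] sums_summable[OF s]])
    then show "norm (eval_fps (iter_rate k (g t)) z / fact k) \<le> C * B ^ k * (1 / (1 - norm z / r))"
      using s s2 by (simp add: sums_iff)
  next
    fix t s :: real and z :: complex assume t: "t \<ge> 0" and s: "s \<ge> 0" and small: "B * \<bar>s - t\<bar> < 1" and z: "norm z < r"
    let ?u = "\<lambda>k n. fps_nth (iter_rate k (g t)) n * z ^ n / fact k * of_real (s - t) ^ k"
    have "norm (?u k n) \<le> C * (B * \<bar>s - t\<bar>) ^ k * (norm z / r) ^ n" for k n
    proof -
      have "norm (?u k n) = norm (fps_nth (iter_rate k (g t)) n * z ^ n / fact k) * \<bar>s - t\<bar> ^ k"
        by (simp only: norm_mult[of "_ / _"] norm_power norm_of_real)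
      also have "\<dots> \<le> (C * B ^ k * (norm z / r) ^ n) * \<bar>s - t\<bar> ^ k"
        by (intro mult_right_mono nb t) auto
      finally show ?thesis by (simp add: power_mult_distrib mult_ac)
    qed
    then obtain S where rows: "\<And>R. (\<And>k. ?u k sums R k) \<Longrightarrow> R sums S"
      and cols: "\<And>R. (\<And>n. (\<lambda>k. ?u k n) sums R n) \<Longrightarrow> R sums S"
      by (rule double_series_geometric) (use CB small z r in auto)
    have "(\<lambda>k. eval_fps (iter_rate k (g t)) z / fact k * of_real (s - t) ^ k) sums S"
      by (intro rows sums_mult2 sums_divide ev t z)
    moreover have "(\<lambda>n. fps_nth (g s) n * z ^ n) sums S"
    proof (rule cols)
      fix n show "(\<lambda>k. ?u k n) sums (fps_nth (g s) n * z ^ n)"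
        using sums_mult2[OF ty[OF t s small, of n], of "z ^ n"] by (simp add: mult_ac)
    qed
    then have "S = eval_fps (g s) z" by (simp add: eval_fps_def sums_iff)
    ultimately show "(\<lambda>k. eval_fps (iter_rate k (g t)) z / fact k * of_real (s - t) ^ k) sums eval_fps (g s) z" by simp
  qed (rule rad)
qed

text \<open>The expansion in time about $t_0$ has holomorphic coefficients with geometric bounds. Cauchy's inequality
on a small circle about $z_0$ turns these into geometric bounds for the double series.\<close>
theorem flow_jointly_analytic: "jointly_analytic_on {0..} (ball 0 1) (\<lambda>t. eval_fps (g t))"
  unfolding jointly_analytic_on_def
proof (intro ballI)
  fix t0 :: real and z0 :: complex assume t0: "t0 \<in> {0..}" and z0: "z0 \<in> ball 0 1"
  define r where "r = (1 + norm z0) / 2"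
  \<comment> \<open>The closed disc of radius d about z0 stays inside the disc of radius r.\<close>
  define d where "d = (r - norm z0) / 2"
  have r: "0 < r" "r < 1" "norm z0 < r" using z0 by (auto simp: r_def add_pos_nonneg)
  have d: "d > 0" "norm z0 + d < r" using r unfolding d_def by (auto simp: field_simps)
  obtain C B where CB: "C > 0" "B > 0"
    and bd: "\<And>(t::real) k z. t \<ge> 0 \<Longrightarrow> norm z < r \<Longrightarrow>
       norm (eval_fps (iter_rate k (g t)) z / fact k) \<le> C * B ^ k * (1 / (1 - norm z / r))"
    and ty: "\<And>(t::real) s z. t \<ge> 0 \<Longrightarrow> s \<ge> 0 \<Longrightarrow> B * \<bar>s - t\<bar> < 1 \<Longrightarrow> norm z < r \<Longrightarrow>
       (\<lambda>k. eval_fps (iter_rate k (g t)) z / fact k * of_real (s - t) ^ k) sums eval_fps (g s) z"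
    and rad: "\<And>(t::real) k. t \<ge> 0 \<Longrightarrow> fps_conv_radius (iter_rate k (g t)) \<ge> ereal r"
    by (rule flow_time_expansion[OF r(1,2)]) blast
  let ?G = "\<lambda>k z. eval_fps (iter_rate k (g t0)) z / fact k"
  let ?K = "C * (1 / (1 - (norm z0 + d) / r))"
  have K: "?K \<ge> 0" using CB d r by (auto simp: field_simps)
  let ?a = "\<lambda>k j. (deriv ^^ j) (?G k) z0 / fact j"
  have inr: "norm z < r" if "z \<in> cball z0 d" for z
    using that norm_triangle_sub[of z z0] d by (simp add: dist_norm norm_minus_commute)
  have hol: "?G k holomorphic_on cball z0 d" for k
  proof -
    have "cball z0 d \<subseteq> eball 0 (fps_conv_radius (iter_rate k (g t0)))"
    proof
      fix z assume "z \<in> cball z0 d"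
      from ereal_norm_less[OF inr[OF this] rad] t0
      show "z \<in> eball 0 (fps_conv_radius (iter_rate k (g t0)))" by (simp add: in_eball_iff)
    qed
    then show ?thesis by (intro holomorphic_intros) auto
  qed
  have cauchy: "norm (?a k j) \<le> ?K * B ^ k * (1 / d) ^ j" for k j
  proof -
    have "norm ((deriv ^^ j) (?G k) z0) \<le> fact j * (?K * B ^ k) / d ^ j"
    proof (rule Cauchy_inequality)
      show "?G k holomorphic_on ball z0 d" using hol holomorphic_on_subset ball_subset_cball by blast
      show "continuous_on (cball z0 d) (?G k)" by (rule holomorphic_on_imp_continuous_on[OF hol])
      fix z assume "norm (z0 - z) = d"
      then have z: "z \<in> cball z0 d" by (simp add: dist_norm)
      have nz: "norm z \<le> norm z0 + d" using z norm_triangle_sub[of z z0] by (simp add: dist_norm norm_minus_commute)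
      have "norm (?G k z) \<le> C * B ^ k * (1 / (1 - norm z / r))"
        using bd[of t0 z k] t0 inr[OF z] by auto
      also have "\<dots> \<le> C * B ^ k * (1 / (1 - (norm z0 + d) / r))"
      proof (intro mult_left_mono divide_left_mono)
        show "1 - (norm z0 + d) / r \<le> 1 - norm z / r" using nz r by (simp add: divide_right_mono)
        show "0 < (1 - norm z / r) * (1 - (norm z0 + d) / r)" using inr[OF z] d r by (intro mult_pos_pos) auto
      qed (use CB in auto)
      finally show "norm (?G k z) \<le> ?K * B ^ k" by (simp add: mult_ac)
    qed (use d in auto)
    then show ?thesis by (simp add: norm_divide power_divide field_simps)
  qed
  show "\<exists>a :: nat \<Rightarrow> nat \<Rightarrow> complex. \<exists>e>0. \<forall>t\<in>{0..}. \<forall>z\<in>ball 0 1. dist t t0 < e \<and> dist z z0 < e \<longrightarrow>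
      ((\<lambda>(m, n). a m n * of_real (t - t0) ^ m * (z - z0) ^ n) has_sum eval_fps (g t) z) UNIV"
  proof (intro exI[of _ ?a] exI[of _ "min d (1 / B)"] conjI ballI impI)
    show "0 < min d (1 / B)" using d CB by simp
    fix t z assume t: "t \<in> {0::real..}" and "z \<in> ball 0 (1::real)" and "dist t t0 < min d (1 / B) \<and> dist z z0 < min d (1 / B)"
    then have small: "B * \<bar>t - t0\<bar> < 1" and z: "norm (z - z0) < d" using CB by (auto simp: dist_real_def dist_norm field_simps)
    let ?u = "\<lambda>k j. ?a k j * of_real (t - t0) ^ k * (z - z0) ^ j"
    have "norm (?u k j) \<le> ?K * (B * \<bar>t - t0\<bar>) ^ k * (norm (z - z0) / d) ^ j" for k j
    proof -
      have "norm (?u k j) = norm (?a k j) * (\<bar>t - t0\<bar> ^ k * norm (z - z0) ^ j)"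
        by (simp only: norm_mult norm_power norm_of_real mult.assoc)
      also have "\<dots> \<le> (?K * B ^ k * (1 / d) ^ j) * (\<bar>t - t0\<bar> ^ k * norm (z - z0) ^ j)"
        by (intro mult_right_mono cauchy) auto
      finally show ?thesis by (simp add: power_mult_distrib power_divide mult_ac)
    qed
    then obtain S where S: "((\<lambda>(k, n). ?u k n) has_sum S) UNIV" and rows: "\<And>R. (\<And>k. ?u k sums R k) \<Longrightarrow> R sums S"
      by (rule double_series_geometric[OF _ K]) (use CB small z d in auto)
    have zb: "z \<in> ball z0 d" "z \<in> cball z0 d" using z by (auto simp: dist_norm norm_minus_commute)
    have "(\<lambda>k. ?G k z * of_real (t - t0) ^ k) sums S"
    proof (rule rows)
      fix k
      have "(\<lambda>j. ?a k j * (z - z0) ^ j) sums ?G k z"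
        by (rule holomorphic_power_series[OF _ zb(1)]) (use hol holomorphic_on_subset ball_subset_cball in blast)
      from sums_mult2[OF this, of "of_real (t - t0) ^ k"]
      show "?u k sums (?G k z * of_real (t - t0) ^ k)" by (simp add: mult_ac)
    qed
    moreover have "(\<lambda>k. ?G k z * of_real (t - t0) ^ k) sums eval_fps (g t) z"
      by (rule ty) (use t t0 small inr[OF zb(2)] in auto)
    ultimately have "S = eval_fps (g t) z" by (rule sums_unique2)
    with S show "((\<lambda>(m, n). ?u m n) has_sum eval_fps (g t) z) UNIV" by simp
  qed
qed

lemma flow_pde:
  assumes t: "t \<ge> 0" and z: "norm z < 1"
  shows "((\<lambda>s. eval_fps (g s) z) has_vector_derivative
            speed_fun (eval_fps (g t) z) * (z * eval_fps (fps_deriv (g t)) z)) (at t within {0..})"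
    and "(eval_fps (g t) has_field_derivative eval_fps (fps_deriv (g t)) z) (at z)"
proof -
  define r where "r = (1 + norm z) / 2"
  have r: "0 < r" "r < 1" "norm z < r" using z by (auto simp: r_def add_pos_nonneg)
  obtain C B where CB: "C > 0" "B > 0"
    and "\<And>(t::real) k z. t \<ge> 0 \<Longrightarrow> norm z < r \<Longrightarrow>
       norm (eval_fps (iter_rate k (g t)) z / fact k) \<le> C * B ^ k * (1 / (1 - norm z / r))"
    and ty: "\<And>(t::real) s z. t \<ge> 0 \<Longrightarrow> s \<ge> 0 \<Longrightarrow> B * \<bar>s - t\<bar> < 1 \<Longrightarrow> norm z < r \<Longrightarrow>
       (\<lambda>k. eval_fps (iter_rate k (g t)) z / fact k * of_real (s - t) ^ k) sums eval_fps (g s) z"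
    and "\<And>(t::real) k. t \<ge> 0 \<Longrightarrow> fps_conv_radius (iter_rate k (g t)) \<ge> ereal r"
    by (rule flow_time_expansion[OF r(1,2)]) blast
  have "((\<lambda>s. eval_fps (g s) z) has_vector_derivative eval_fps (iter_rate 1 (g t)) z / fact 1) (at t within {0..})"
    by (rule powser_has_vector_derivative[where e = "1 / B"])
       (use ty[OF t] CB r t in \<open>auto simp: field_simps\<close>)
  moreover have "iter_rate 1 (g t) = rate (g t)" by (simp add: iter_rate_def rate_def)
  ultimately show "((\<lambda>s. eval_fps (g s) z) has_vector_derivative
            speed_fun (eval_fps (g t) z) * (z * eval_fps (fps_deriv (g t)) z)) (at t within {0..})"
    using eval_fps_rate[OF flow_conv_radius[OF t] transport_flow_nth_0[OF flow t] z] by simp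
  show "(eval_fps (g t) has_field_derivative eval_fps (fps_deriv (g t)) z) (at z)"
    using flow_conv_radius[OF t] z
    by (intro has_field_derivative_eval_fps ereal_norm_less_1)
qed

end

end

context transport_equation begin

text \<open>The coefficients at 0 of any analytic solution solve the triangular system. The double series
expansion at the point 0 gives differentiability in time of each coefficient, the value of the
derivative is read off from the equation.\<close>
lemma analytic_solution_coefficients:
  fixes h :: "real \<Rightarrow> complex \<Rightarrow> complex"
  assumes ja: "jointly_analytic_on {0..} (ball 0 1) h"
    and pde: "\<And>t z. t \<ge> 0 \<Longrightarrow> norm z < 1 \<Longrightarrow> \<exists>h\<^sub>t h\<^sub>z.
        ((\<lambda>s. h s z) has_vector_derivative h\<^sub>t) (at t within {0..}) \<and>
        (h t has_field_derivative h\<^sub>z) (at z) \<and> h\<^sub>t = speed_fun (h t z) * (z * h\<^sub>z)"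
    and h00: "h 0 0 = 0"
  shows "transport_flow (\<lambda>t. fps_expansion (h t) 0)"
    and "t \<ge> 0 \<Longrightarrow> norm z < 1 \<Longrightarrow> eval_fps (fps_expansion (h t) 0) z = h t z"
proof -
  let ?H = "\<lambda>t. fps_expansion (h t) 0"
  have holb: "h t holomorphic_on ball 0 1" if "t \<ge> 0" for t
    unfolding holomorphic_on_open[OF open_ball] using pde[OF that] by fastforce
  have hol: "h t holomorphic_on eball 0 1" if "t \<ge> 0" for t
    using holb[OF that] by (simp add: one_ereal_def)
  show ev: "eval_fps (?H t) z = h t z" if "t \<ge> 0" "norm z < 1" for t z
    using eval_fps_expansion'[OF hol[OF that(1)], of z] that by (simp add: one_ereal_def)
  have exp: "h t has_fps_expansion ?H t" if "t \<ge> 0" for t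
    by (rule has_fps_expansion_fps_expansion[OF open_ball _ holb[OF that]]) simp
  have h0: "h t 0 = 0" if "t \<ge> 0" for t
  proof -
    have d: "((\<lambda>s. h s 0) has_vector_derivative 0) (at s within {0..})" if "s \<in> {0..}" for s
      using pde[of s 0] that by auto
    obtain k where "\<And>s. s \<in> {0..} \<Longrightarrow> h s 0 = k"
      using has_vector_derivative_zero_constant[OF convex_real_interval(1) d] by blast
    from this[of t] this[of 0] that h00 show ?thesis by simp
  qed
  have H0: "fps_nth (?H t) 0 = 0" if "t \<ge> 0" for t
    using h0[OF that] by (simp add: fps_expansion_def)
  show "transport_flow ?H"
    unfolding transport_flow_def
  proof (intro allI impI conjI)
    fix t0 :: real assume t0: "t0 \<ge> 0"
    show "fps_nth (?H t0) 0 = 0" by (rule H0[OF t0])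
    fix n
    have "t0 \<in> {0..}" "(0 :: complex) \<in> ball 0 1" using t0 by auto
    from ja[unfolded jointly_analytic_on_def, THEN bspec, THEN bspec, OF this]
    obtain c e where e: "e > 0" and c: "\<forall>t\<in>{0..}. \<forall>z\<in>ball 0 1. dist t t0 < e \<and> dist z 0 < e \<longrightarrow>
        ((\<lambda>(m, n). c m n * of_real (t - t0) ^ m * (z - 0) ^ n) has_sum h t z) UNIV"
      by blast
    define d where "d = min e 1"
    have d: "d > 0" "d \<le> e" "d \<le> 1" using e by (auto simp: d_def)
    have hs: "((\<lambda>(m, n). c m n * of_real (t - t0) ^ m * z ^ n) has_sum h t z) (UNIV \<times> UNIV)"
      if "t \<ge> 0" "\<bar>t - t0\<bar> < d" "norm z < d" for t z
      using c[THEN bspec, THEN bspec, of t z] that d by (simp add: dist_real_def)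
    have rowsum: "(\<lambda>m. \<Sum>\<^sub>\<infinity>n. c m n * of_real (t - t0) ^ m * z ^ n) sums h t z"
      and row: "(\<lambda>n. c m n * of_real (t - t0) ^ m * z ^ n) summable_on UNIV"
      and colsum: "(\<lambda>n. \<Sum>\<^sub>\<infinity>m. c m n * of_real (t - t0) ^ m * z ^ n) sums h t z"
      and col: "(\<lambda>m. c m n * of_real (t - t0) ^ m * z ^ n) summable_on UNIV"
      if "t \<ge> 0" "\<bar>t - t0\<bar> < d" "norm z < d" for t z m n
    proof -
      note S = hs[OF that]
      then have S': "((\<lambda>(n, m). c m n * of_real (t - t0) ^ m * z ^ n) has_sum h t z) (UNIV \<times> UNIV)"
        by (subst has_sum_swap) (simp add: case_prod_unfold)
      show row: "(\<lambda>n. c m n * of_real (t - t0) ^ m * z ^ n) summable_on UNIV" for m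
        using summable_on_SigmaD1[of "\<lambda>m n. c m n * of_real (t - t0) ^ m * z ^ n" UNIV "\<lambda>_. UNIV" m] S by (auto simp: summable_on_def)
      show col: "(\<lambda>m. c m n * of_real (t - t0) ^ m * z ^ n) summable_on UNIV" for n
        using summable_on_SigmaD1[of "\<lambda>n m. c m n * of_real (t - t0) ^ m * z ^ n" UNIV "\<lambda>_. UNIV" n] S' by (auto simp: summable_on_def)
      show "(\<lambda>m. \<Sum>\<^sub>\<infinity>n. c m n * of_real (t - t0) ^ m * z ^ n) sums h t z"
        by (rule has_sum_imp_sums, rule has_sum_SigmaD[OF S]) (use row in simp)
      show "(\<lambda>n. \<Sum>\<^sub>\<infinity>m. c m n * of_real (t - t0) ^ m * z ^ n) sums h t z"
        by (rule has_sum_imp_sums, rule has_sum_SigmaD[OF S']) (use col in simp)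
    qed
    have coeff: "(\<lambda>m. c m n * of_real (t - t0) ^ m) sums fps_nth (?H t) n" if t: "t \<ge> 0" "\<bar>t - t0\<bar> < d" for t n
    proof -
      let ?z = "of_real (d / 2) :: complex"
      have z: "norm ?z < d" "?z \<noteq> 0" using d by (auto simp: norm_divide)
      have sm: "(\<lambda>m. c m n * of_real (t - t0) ^ m) summable_on UNIV" for n
        using summable_on_cmult_left[OF col[OF t z(1), of n], of "inverse (?z ^ n)"] z(2) by (simp add: mult.assoc)
      define A where "A = Abs_fps (\<lambda>n. \<Sum>\<^sub>\<infinity>m. c m n * of_real (t - t0) ^ m)"
      have A: "(\<lambda>n. fps_nth A n * z ^ n) sums h t z" if "norm z < d" for z
        using colsum[OF t that] by (simp add: A_def infsum_cmult_left')
      have rad: "fps_conv_radius A \<ge> ereal (d / 2)"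
        unfolding fps_conv_radius_def using conv_radius_geI[OF sums_summable[OF A[OF z(1)]]] d by (simp add: norm_divide)
      have "h t has_fps_expansion A"
        unfolding has_fps_expansion_def
      proof
        show "0 < fps_conv_radius A" by (rule less_le_trans[OF _ rad]) (use d in simp)
        show "eventually (\<lambda>z. eval_fps A z = h t z) (nhds 0)"
          using eventually_nhds_in_open[of "ball 0 d" "0 :: complex"] d
          by (auto elim!: eventually_mono simp: eval_fps_def sums_unique[OF A, symmetric])
      qed
      then have "A = ?H t" using exp[OF t(1)] by (rule fps_expansion_unique_complex)
      then have "fps_nth (?H t) n = (\<Sum>\<^sub>\<infinity>m. c m n * of_real (t - t0) ^ m)" by (metis A_def fps_nth_Abs_fps)
      moreover have "(\<lambda>m. c m n * of_real (t - t0) ^ m) sums (\<Sum>\<^sub>\<infinity>m. c m n * of_real (t - t0) ^ m)"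
        by (rule has_sum_imp_sums) (use sm in auto)
      ultimately show ?thesis by simp
    qed
    have dn: "((\<lambda>s. fps_nth (?H s) n) has_vector_derivative c 1 n) (at t0 within {0..})" for n
      by (rule powser_has_vector_derivative[OF coeff d(1) t0])
    let ?R = "\<lambda>z. speed_fun (h t0 z) * (z * deriv (h t0) z)"
    have "(\<lambda>n. c 1 n * z ^ n) sums ?R z" if z: "norm z < d" for z
    proof -
      let ?b = "\<lambda>m. \<Sum>\<^sub>\<infinity>n. c m n * z ^ n"
      have sm: "(\<lambda>n. c m n * z ^ n) summable_on UNIV" for m
      proof -
        let ?t = "t0 + d / 2"
        have "(\<lambda>n. c m n * of_real (?t - t0) ^ m * z ^ n) summable_on UNIV"
          by (rule row) (use d t0 z in auto)
        from summable_on_cmult_right[OF this, of "inverse (of_real (d / 2) ^ m)"] d show ?thesis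
          by (simp add: mult.assoc mult.left_commute[of "c _ _"] divide_simps flip: of_real_power)
      qed
      have "((\<lambda>s. h s z) has_vector_derivative ?b 1) (at t0 within {0..})"
      proof (rule powser_has_vector_derivative[OF _ d(1) t0])
        fix t assume t: "t \<ge> 0" "\<bar>t - t0\<bar> < d"
        have "(\<Sum>\<^sub>\<infinity>n. c m n * of_real (t - t0) ^ m * z ^ n) = ?b m * of_real (t - t0) ^ m" for m
        proof -
          have "(\<Sum>\<^sub>\<infinity>n. c m n * of_real (t - t0) ^ m * z ^ n) = (\<Sum>\<^sub>\<infinity>n. (c m n * z ^ n) * of_real (t - t0) ^ m)"
            by (simp add: mult_ac)
          then show ?thesis by (simp add: infsum_cmult_left')
        qed
        then show "(\<lambda>m. ?b m * of_real (t - t0) ^ m) sums h t z" using rowsum[OF t z] by simp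
      qed
      moreover obtain h\<^sub>t h\<^sub>z where p: "((\<lambda>s. h s z) has_vector_derivative h\<^sub>t) (at t0 within {0..})"
        "(h t0 has_field_derivative h\<^sub>z) (at z)" "h\<^sub>t = speed_fun (h t0 z) * (z * h\<^sub>z)"
        using pde[OF t0, of z] z d by auto
      ultimately have "?b 1 = h\<^sub>t"
        using vector_derivative_unique_within[OF at_within_half_line_neq_bot[OF t0]] by blast
      also have "h\<^sub>t = ?R z" using p DERIV_imp_deriv by metis
      finally have "?b 1 = ?R z" .
      moreover have "(\<lambda>n. c 1 n * z ^ n) sums ?b 1"
        by (rule has_sum_imp_sums) (use sm in auto)
      ultimately show ?thesis by simp
    qed
    note R = this
    have "?R has_fps_expansion Abs_fps (c 1)"
      unfolding has_fps_expansion_def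
    proof
      have "summable (\<lambda>n. c 1 n * of_real (d / 2) ^ n)" by (rule sums_summable[OF R]) (use d in \<open>auto simp: norm_divide\<close>)
      then have "fps_conv_radius (Abs_fps (c 1)) \<ge> ereal (d / 2)"
        unfolding fps_conv_radius_def using conv_radius_geI[of "c 1" "of_real (d / 2)"] d by (simp add: norm_divide)
      then show "0 < fps_conv_radius (Abs_fps (c 1))" by (rule less_le_trans[rotated]) (use d in simp)
      show "eventually (\<lambda>z. eval_fps (Abs_fps (c 1)) z = ?R z) (nhds 0)"
        using eventually_nhds_in_open[of "ball 0 d" "0 :: complex"] d
        by (auto elim!: eventually_mono simp: eval_fps_def sums_unique[OF R, symmetric] simp del: One_nat_def)
    qed
    then have "Abs_fps (c 1) = rate (?H t0)"
      using has_fps_expansion_rate[OF exp[OF t0] H0[OF t0]] by (rule fps_expansion_unique_complex)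
    then have "c 1 n = fps_nth (rate (?H t0)) n" by (metis fps_nth_Abs_fps)
    then show "((\<lambda>s. fps_nth (?H s) n) has_vector_derivative fps_nth (rate (?H t0)) n) (at t0 within {0..})"
      using dn[of n] by simp
  qed
qed

theorem analytic_transport_solution_flow:
  assumes flow: "transport_flow g" and bounded: "\<And>t n. t \<ge> 0 \<Longrightarrow> norm (fps_nth (g t) n) \<le> 1"
    and velocity: "\<And>w. velocity \<alpha> w = - speed_fun w"
  shows "analytic_transport_solution \<alpha> (eval_fps (g 0)) (\<lambda>t. eval_fps (g t))"
  unfolding analytic_transport_solution_def
proof (intro conjI allI impI ballI)
  show "jointly_analytic_on {0..} (ball 0 1) (\<lambda>t. eval_fps (g t))"
    by (rule flow_jointly_analytic[OF flow bounded])
  fix t :: real and z :: complex assume t: "t \<ge> 0" and z: "z \<in> ball 0 1"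
  then have z: "norm z < 1" by simp
  show "\<exists>g\<^sub>t g\<^sub>z. ((\<lambda>s. eval_fps (g s) z) has_vector_derivative g\<^sub>t) (at t within {0..}) \<and>
        (eval_fps (g t) has_field_derivative g\<^sub>z) (at z) \<and>
        g\<^sub>t + z * velocity \<alpha> (eval_fps (g t) z) * g\<^sub>z = 0"
    by (rule exI, rule exI, rule conjI[OF flow_pde(1)[OF flow bounded t z] conjI[OF flow_pde(2)[OF flow bounded t z]]])
       (simp_all add: velocity)
qed auto

text \<open>Uniqueness for the triangular system of the coefficients gives uniqueness of the analytic solution.\<close>
theorem analytic_transport_solution_unique:
  assumes flow: "transport_flow g" and bounded: "\<And>t n. t \<ge> 0 \<Longrightarrow> norm (fps_nth (g t) n) \<le> 1"
    and velocity: "\<And>w. velocity \<alpha> w = - speed_fun w"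
    and h: "analytic_transport_solution \<alpha> g\<^sub>0 h"
    and g0: "\<And>z. z \<in> ball 0 1 \<Longrightarrow> g\<^sub>0 z = eval_fps (g 0) z"
    and t: "t \<ge> 0" and z: "z \<in> ball 0 1"
  shows "h t z = eval_fps (g t) z"
proof -
  let ?H = "\<lambda>t. fps_expansion (h t) 0"
  have ja: "jointly_analytic_on {0..} (ball 0 1) h" and i: "\<And>z. z \<in> ball 0 1 \<Longrightarrow> h 0 z = eval_fps (g 0) z"
    using h g0 by (auto simp: analytic_transport_solution_def)
  have pde: "\<exists>h\<^sub>t h\<^sub>z. ((\<lambda>s. h s z) has_vector_derivative h\<^sub>t) (at t within {0..}) \<and>
        (h t has_field_derivative h\<^sub>z) (at z) \<and> h\<^sub>t = speed_fun (h t z) * (z * h\<^sub>z)" if tz: "t \<ge> 0" "norm z < 1" for t z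
  proof -
    obtain h\<^sub>t h\<^sub>z where "((\<lambda>s. h s z) has_vector_derivative h\<^sub>t) (at t within {0..})"
        "(h t has_field_derivative h\<^sub>z) (at z)" and e: "h\<^sub>t + z * velocity \<alpha> (h t z) * h\<^sub>z = 0"
      using h tz unfolding analytic_transport_solution_def by (metis mem_ball_0)
    moreover have "h\<^sub>t = speed_fun (h t z) * (z * h\<^sub>z)" using e by (simp add: velocity algebra_simps)
    ultimately show ?thesis by blast
  qed
  have h00: "h 0 0 = 0"
    using i[of 0] transport_flow_nth_0[OF flow, of 0] by (simp add: eval_fps_at_0)
  have H: "transport_flow ?H" by (rule analytic_solution_coefficients(1)[OF ja _ h00]) (rule pde)
  have ev: "eval_fps (?H t) z = h t z"
    by (rule analytic_solution_coefficients(2)[OF ja _ h00 t]) (use pde z in auto)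
  have "?H 0 = fps_expansion (eval_fps (g 0)) 0"
    by (rule fps_expansion_cong)
       (use eventually_nhds_in_open[of "ball 0 1" "0 :: complex"] i in \<open>auto elim!: eventually_mono\<close>)
  also have "\<dots> = g 0"
    using flow_conv_radius[OF flow bounded, of 0]
    by (intro fps_expansion_eqI eval_fps_has_fps_expansion) (auto intro: less_le_trans[of 0 1])
  finally have "?H t = g t"
    by (intro transport_flow_unique[OF H flow _ t]) 
  then show ?thesis using ev by simp
qed

end

section \<open>A residue identity\<close>

text \<open>Partial fraction decomposition of $\prod_j (q - \xi_j w)/(1 - \xi_j w)$, with denominators cleared:
both sides are polynomials of degree at most the number of points with the same leading coefficient,
and they agree at all $1/\xi_k$.\<close>
lemma partial_fractions_poly:
  fixes \<xi> :: "'i \<Rightarrow> complex"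
  assumes A: "finite A" and inj: "inj_on \<xi> A" and nz: "\<And>k. k \<in> A \<Longrightarrow> \<xi> k \<noteq> 0"
  shows "(\<Prod>j\<in>A. [:q, - \<xi> j:]) = (\<Prod>j\<in>A. [:1, - \<xi> j:]) +
     (\<Sum>k\<in>A. Polynomial.smult ((q - 1) * (\<Prod>j\<in>A - {k}. (q * \<xi> k - \<xi> j) / (\<xi> k - \<xi> j))) (\<Prod>j\<in>A - {k}. [:1, - \<xi> j:]))"
    (is "?P = ?R + ?S")
proof (rule poly_eqI_degree_lead_coeff)
  let ?n = "card A"
  have deg: "Polynomial.degree (\<Prod>j\<in>B. [:c, - \<xi> j:]) \<le> card B" if "finite B" for c B
    using that by (intro order_trans[OF degree_prod_sum_le]) (auto intro!: order_trans[OF sum_bounded_above[where K = 1]])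
  have lc: "Polynomial.coeff (\<Prod>j\<in>B. [:c, - \<xi> j:]) (card B) = (\<Prod>j\<in>B. - \<xi> j)" if "finite B" for c B
    using that
  proof (induction B)
    case (insert b B)
    have "Polynomial.coeff ([:c, - \<xi> b:] * (\<Prod>j\<in>B. [:c, - \<xi> j:])) (Suc (card B)) =
        c * Polynomial.coeff (\<Prod>j\<in>B. [:c, - \<xi> j:]) (Suc (card B)) - \<xi> b * Polynomial.coeff (\<Prod>j\<in>B. [:c, - \<xi> j:]) (card B)"
      by simp
    also have "Polynomial.coeff (\<Prod>j\<in>B. [:c, - \<xi> j:]) (Suc (card B)) = 0"
      using deg[OF insert.hyps(1), of c] by (intro coeff_eq_0) auto
    finally show ?case using insert by simp
  qed simp
  have degS: "Polynomial.degree ?S \<le> ?n - 1"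
  proof (rule degree_sum_le[OF A])
    fix k assume "k \<in> A"
    then have "Polynomial.degree (\<Prod>j\<in>A - {k}. [:1, - \<xi> j:]) \<le> ?n - 1" using deg[of "A - {k}" 1] A by simp
    then show "Polynomial.degree (Polynomial.smult ((q - 1) * (\<Prod>j\<in>A - {k}. (q * \<xi> k - \<xi> j) / (\<xi> k - \<xi> j))) (\<Prod>j\<in>A - {k}. [:1, - \<xi> j:])) \<le> ?n - 1"
      using degree_smult_le order_trans by blast
  qed
  show "Polynomial.degree ?P \<le> ?n" by (rule deg[OF A])
  show "Polynomial.degree (?R + ?S) \<le> ?n" using deg[OF A, of 1] degS by (intro degree_add_le) auto
  have "Polynomial.coeff ?S ?n = 0"
  proof (cases "A = {}")
    case False
    then have "card A > 0" using A by (simp add: card_gt_0_iff)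
    then show ?thesis using degS by (intro coeff_eq_0) auto
  qed simp
  then show "Polynomial.coeff ?P ?n = Polynomial.coeff (?R + ?S) ?n" using lc[OF A] by simp
  show "card ((\<lambda>k. 1 / \<xi> k) ` A) \<ge> ?n"
    using inj by (subst card_image) (auto simp: inj_on_def divide_simps)
  fix x assume "x \<in> (\<lambda>k. 1 / \<xi> k) ` A"
  then obtain k where k: "k \<in> A" and x: "x = 1 / \<xi> k" by blast
  have z: "(\<Prod>j\<in>B. poly [:1, - \<xi> j:] x) = 0" if "k \<in> B" "finite B" for B
    using that nz[OF k] by (intro prod_zero bexI[of _ k]) (auto simp: x)
  have ne: "\<xi> k \<noteq> \<xi> j" if "j \<in> A - {k}" for j using inj k that by (auto simp: inj_on_def)
  have "poly (?R + ?S) x = (\<Sum>i\<in>A. (q - 1) * (\<Prod>j\<in>A - {i}. (q * \<xi> i - \<xi> j) / (\<xi> i - \<xi> j)) * (\<Prod>j\<in>A - {i}. poly [:1, - \<xi> j:] x))"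
    using z[OF k A] by (simp add: poly_sum poly_prod)
  also have "\<dots> = (\<Sum>i\<in>{k}. (q - 1) * (\<Prod>j\<in>A - {i}. (q * \<xi> i - \<xi> j) / (\<xi> i - \<xi> j)) * (\<Prod>j\<in>A - {i}. poly [:1, - \<xi> j:] x))"
    using A k z by (intro sum.mono_neutral_right) auto
  also have "\<dots> = (q - 1) * (\<Prod>j\<in>A - {k}. (q * \<xi> k - \<xi> j) / (\<xi> k - \<xi> j)) * (\<Prod>j\<in>A - {k}. 1 - \<xi> j / \<xi> k)"
    by (simp add: x)
  also have "\<dots> = (q - 1) * (\<Prod>j\<in>A - {k}. ((q * \<xi> k - \<xi> j) / (\<xi> k - \<xi> j)) * (1 - \<xi> j / \<xi> k))"
    by (simp only: prod.distrib mult.assoc)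
  also have "\<dots> = (q - 1) * (\<Prod>j\<in>A - {k}. q - \<xi> j / \<xi> k)"
    using ne nz[OF k] by (intro arg_cong[where f = "(*) (q - 1)"] prod.cong refl) (auto simp: field_simps)
  also have "\<dots> = (\<Prod>j\<in>A. q - \<xi> j / \<xi> k)"
    using A k nz[OF k] by (simp add: prod.remove)
  also have "\<dots> = poly ?P x" by (simp add: x poly_prod)
  finally show "poly ?P x = poly (?R + ?S) x" by simp
qed

definition geom_fps :: "complex \<Rightarrow> complex fps" where
  "geom_fps a = Abs_fps (\<lambda>n. a ^ n)"

lemma geom_fps_inverse: "(1 - fps_const a * fps_X) * geom_fps a = 1"
proof (rule fps_ext)
  fix n show "fps_nth ((1 - fps_const a * fps_X) * geom_fps a) n = fps_nth 1 n"
    by (cases n) (simp_all add: geom_fps_def left_diff_distrib mult.assoc)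
qed

lemma euler_geom_fps: "euler (geom_fps a) = (geom_fps a - 1) * geom_fps a"
proof -
  let ?G = "geom_fps a" and ?l = "1 - fps_const a * fps_X"
  have e: "euler ?l = ?l - 1" by (rule fps_ext) (simp add: fps_X_def fps_one_nth)
  have "0 = euler (?l * ?G)" by (simp add: geom_fps_inverse euler_def)
  also have "\<dots> = (?l - 1) * ?G + ?l * euler ?G" by (simp add: euler_mult e)
  finally have "?l * euler ?G = ?G - ?l * ?G" by (simp add: algebra_simps)
  then have "?G * (?l * euler ?G) = ?G * (?G - 1)" by (simp add: geom_fps_inverse)
  moreover have "?G * (?l * euler ?G) = (?l * ?G) * euler ?G" by (simp only: mult_ac)
  ultimately show ?thesis by (metis geom_fps_inverse mult_1 mult.commute)
qed

lemma euler_prod: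
  assumes "finite A" "\<And>j. j \<in> A \<Longrightarrow> euler (f j) = h j * f j"
  shows "euler (\<Prod>j\<in>A. f j) = (\<Sum>j\<in>A. h j) * (\<Prod>j\<in>A. f j)"
  using assms
proof (induction A)
  case empty
  then show ?case by (simp add: euler_def)
next
  case (insert a A)
  then show ?case by (simp add: euler_mult algebra_simps)
qed

text \<open>The sum on the left collects the coefficients of $w^n$ in the partial fractions of
$\prod_j (q - \xi_j w)/(1 - \xi_j w)$. On the other hand this product is $q^{|A|}$ times the exponential
of a series that is linear in the power sums of the $\xi_j$, since
$\log (1 - c w) = -\sum_n c^n w^n/n$. With q a root of unity the products on the left will be the
jump rates of the particles, and this identity expresses their moments through power sums.\<close>
lemma residue_sum:
  fixes \<xi> :: "'i \<Rightarrow> complex"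
  assumes A: "finite A" and inj: "inj_on \<xi> A" and nz: "\<And>k. k \<in> A \<Longrightarrow> \<xi> k \<noteq> 0" and q: "q \<noteq> 0"
  defines "g \<equiv> Abs_fps (\<lambda>n. (1 - 1 / q ^ n) * (\<Sum>k\<in>A. \<xi> k ^ n) / of_nat n)"
  shows "(q - 1) * (\<Sum>k\<in>A. (\<Prod>j\<in>A - {k}. (q * \<xi> k - \<xi> j) / (\<xi> k - \<xi> j)) * \<xi> k ^ n) =
    q ^ card A * fps_nth (fexp g) n - (if n = 0 then 1 else 0)"
proof -
  let ?c = "\<lambda>k. (q - 1) * (\<Prod>j\<in>A - {k}. (q * \<xi> k - \<xi> j) / (\<xi> k - \<xi> j))"
  let ?G = "\<lambda>k. geom_fps (\<xi> k)" and ?l = "\<lambda>a. 1 - fps_const a * fps_X :: complex fps"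
  have pc: "fps_of_poly [:c, - d:] = fps_const c - fps_const d * fps_X" for c d :: complex
    by (simp add: fps_of_poly_pCons fps_const_neg[symmetric] del: fps_const_neg)
  have pk: "(\<Prod>j\<in>B. ?l (\<xi> j)) * (\<Prod>j\<in>B. ?G j) = 1" for B
    by (simp add: geom_fps_inverse flip: prod.distrib)
  have "fps_of_poly (\<Prod>j\<in>A. [:q, - \<xi> j:]) =
      (\<Prod>j\<in>A. ?l (\<xi> j)) + (\<Sum>k\<in>A. fps_const (?c k) * (\<Prod>j\<in>A - {k}. ?l (\<xi> j)))"
    using arg_cong[OF partial_fractions_poly[OF A inj nz, of q], of fps_of_poly]
    by (simp add: fps_of_poly_add fps_of_poly_sum fps_of_poly_prod fps_of_poly_smult pc)
  then have "fps_of_poly (\<Prod>j\<in>A. [:q, - \<xi> j:]) * (\<Prod>j\<in>A. ?G j) =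
      ((\<Prod>j\<in>A. ?l (\<xi> j)) + (\<Sum>k\<in>A. fps_const (?c k) * (\<Prod>j\<in>A - {k}. ?l (\<xi> j)))) * (\<Prod>j\<in>A. ?G j)"
    by (simp only:)
  also have "\<dots> = 1 + (\<Sum>k\<in>A. fps_const (?c k) * ?G k)"
  proof -
    have "fps_const (?c k) * (\<Prod>j\<in>A - {k}. ?l (\<xi> j)) * (\<Prod>j\<in>A. ?G j) = fps_const (?c k) * ?G k" if "k \<in> A" for k
    proof -
      have "(\<Prod>j\<in>A. ?G j) = ?G k * (\<Prod>j\<in>A - {k}. ?G j)" using A that by (simp add: prod.remove)
      then have "fps_const (?c k) * (\<Prod>j\<in>A - {k}. ?l (\<xi> j)) * (\<Prod>j\<in>A. ?G j) =
          fps_const (?c k) * ?G k * ((\<Prod>j\<in>A - {k}. ?l (\<xi> j)) * (\<Prod>j\<in>A - {k}. ?G j))" by (simp only: mult_ac)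
      then show ?thesis by (simp only: pk mult_1_right)
    qed
    then show ?thesis unfolding distrib_right pk sum_distrib_right
      by (intro arg_cong2[where f = "(+)"] sum.cong refl)
  qed
  finally have 1: "fps_of_poly (\<Prod>j\<in>A. [:q, - \<xi> j:]) * (\<Prod>j\<in>A. ?G j) = 1 + (\<Sum>k\<in>A. fps_const (?c k) * ?G k)" .
  let ?T = "\<Prod>j\<in>A. ?l (\<xi> j / q) * ?G j"
  have "fps_of_poly (\<Prod>j\<in>A. [:q, - \<xi> j:]) * (\<Prod>j\<in>A. ?G j) = (\<Prod>j\<in>A. fps_const q * (?l (\<xi> j / q) * ?G j))"
  proof -
    have "fps_const q - fps_const d * fps_X = fps_const q * ?l (d / q)" for d
      using q by (simp add: right_diff_distrib mult.assoc[symmetric] fps_const_mult)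
    then show ?thesis by (simp only: fps_of_poly_prod pc mult.assoc prod.distrib[symmetric])
  qed
  also have "\<dots> = fps_const (q ^ card A) * ?T"
    by (simp add: prod.distrib fps_const_power)
  finally have 2: "fps_of_poly (\<Prod>j\<in>A. [:q, - \<xi> j:]) * (\<Prod>j\<in>A. ?G j) = fps_const (q ^ card A) * ?T" .
  have eT: "euler ?T = (\<Sum>j\<in>A. ?G j - geom_fps (\<xi> j / q)) * ?T"
  proof (rule euler_prod[OF A])
    fix j
    let ?g = "geom_fps (\<xi> j / q)" and ?m = "?l (\<xi> j / q)"
    have "0 = euler (?m * ?g)" by (simp add: geom_fps_inverse euler_def)
    also have "\<dots> = euler ?m * ?g + ?m * ?g * (?g - 1)" by (simp add: euler_mult euler_geom_fps mult_ac)
    finally have "euler ?m * ?g + (?g - 1) = 0" by (simp add: geom_fps_inverse)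
    then have "euler ?m * ?g = 1 - ?g" by (metis eq_neg_iff_add_eq_0 minus_diff_eq)
    then have "?m * (euler ?m * ?g) = ?m * (1 - ?g)" by simp
    moreover have "?m * (euler ?m * ?g) = (?m * ?g) * euler ?m" by (simp only: mult_ac)
    ultimately have em: "euler ?m = (1 - ?g) * ?m" by (metis geom_fps_inverse mult.commute mult_1)
    have "euler (?m * ?G j) = ((1 - ?g) * ?m) * ?G j + ?m * ((?G j - 1) * ?G j)"
      by (simp only: euler_mult euler_geom_fps em)
    also have "\<dots> = (?G j - ?g) * (?m * ?G j)" by (simp add: algebra_simps)
    finally show "euler (?m * ?G j) = (?G j - ?g) * (?m * ?G j)" .
  qed
  have "?T = fexp g"
  proof (rule fexp_unique)
    show "fps_nth g 0 = 0" by (simp add: g_def)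
    show "fps_nth ?T 0 = 1"
      using A by (induction A) (auto simp: geom_fps_def)
    have "euler g = (\<Sum>j\<in>A. ?G j - geom_fps (\<xi> j / q))"
    proof (rule fps_ext)
      fix n show "fps_nth (euler g) n = fps_nth (\<Sum>j\<in>A. ?G j - geom_fps (\<xi> j / q)) n"
        by (cases "n = 0")
           (auto simp: g_def geom_fps_def fps_sum_nth sum_subtractf power_divide left_diff_distrib sum_divide_distrib)
    qed
    with eT show "euler ?T = euler g * ?T" by simp
  qed
  with 1 2 have "fps_const (q ^ card A) * fexp g = 1 + (\<Sum>k\<in>A. fps_const (?c k) * ?G k)" by simp
  then have "q ^ card A * fps_nth (fexp g) n = (if n = 0 then 1 else 0) + (\<Sum>k\<in>A. ?c k * \<xi> k ^ n)"
    by (simp add: fps_eq_iff fps_sum_nth geom_fps_def fps_one_nth)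
  then show ?thesis by (simp add: sum_distrib_left mult_ac)
qed

section \<open>The Perron eigenvector and the jump rates\<close>

text \<open>Symmetry of E gives equality of the eigenvalues, by pairing the two eigenfunctions. With
$u = \psi/\phi$ the eigenvalue equations then make the Dirichlet form
$\sum_{E(x,y)} \phi(x) \phi(y) (u(x) - u(y))^2$ vanish. Hence u is constant along edges, so the
two eigenfunctions define the same transition probabilities.\<close>
lemma positive_eigenfunctions_proportional:
  fixes \<phi> \<psi> :: "'a \<Rightarrow> real"
  assumes S: "finite S" "S \<noteq> {}" and sym: "\<And>x y. E x y \<longleftrightarrow> E y x"
    and \<phi>: "\<And>x. x \<in> S \<Longrightarrow> 0 < \<phi> x" "\<And>x. x \<in> S \<Longrightarrow> (\<Sum>y | y \<in> S \<and> E x y. \<phi> y) = \<mu> * \<phi> x"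
    and \<psi>: "\<And>x. x \<in> S \<Longrightarrow> 0 < \<psi> x" "\<And>x. x \<in> S \<Longrightarrow> (\<Sum>y | y \<in> S \<and> E x y. \<psi> y) = \<rho> * \<psi> x"
  shows "\<rho> = \<mu>" and "\<And>x y. x \<in> S \<Longrightarrow> y \<in> S \<Longrightarrow> E x y \<Longrightarrow> \<psi> y / \<psi> x = \<phi> y / \<phi> x"
proof -
  define e where "e x y = (if E x y then 1 else 0 :: real)" for x y
  have es: "e x y = e y x" for x y using sym by (simp add: e_def)
  have ev: "(\<Sum>y\<in>S. e x y * f y) = (\<Sum>y | y \<in> S \<and> E x y. f y)" for x and f :: "'a \<Rightarrow> real"
  proof -
    have "(\<Sum>y | y \<in> S \<and> E x y. f y) = (\<Sum>y\<in>S. if E x y then f y else 0)"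
      using S(1) by (simp add: sum.inter_filter)
    also have "\<dots> = (\<Sum>y\<in>S. e x y * f y)" by (intro sum.cong refl) (simp add: e_def)
    finally show ?thesis by simp
  qed
  have e\<phi>: "(\<Sum>y\<in>S. e x y * \<phi> y) = \<mu> * \<phi> x" if "x \<in> S" for x using \<phi>(2)[OF that] ev by simp
  have e\<psi>: "(\<Sum>y\<in>S. e x y * \<psi> y) = \<rho> * \<psi> x" if "x \<in> S" for x using \<psi>(2)[OF that] ev by simp
  have "(\<Sum>x\<in>S. \<phi> x * (\<Sum>y\<in>S. e x y * \<psi> y)) = (\<Sum>y\<in>S. \<psi> y * (\<Sum>x\<in>S. e y x * \<phi> x))"
    unfolding sum_distrib_left by (subst sum.swap) (simp add: es mult_ac)
  then have "(\<Sum>x\<in>S. \<phi> x * (\<rho> * \<psi> x)) = (\<Sum>y\<in>S. \<psi> y * (\<mu> * \<phi> y))"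
    using e\<phi> e\<psi> by simp
  then have "\<rho> * (\<Sum>x\<in>S. \<phi> x * \<psi> x) = \<mu> * (\<Sum>x\<in>S. \<phi> x * \<psi> x)"
    by (simp add: sum_distrib_left mult_ac)
  moreover have "(\<Sum>x\<in>S. \<phi> x * \<psi> x) > 0" using S \<phi>(1) \<psi>(1) by (intro sum_pos) auto
  ultimately show \<rho>: "\<rho> = \<mu>" by simp
  fix x y assume xy: "x \<in> S" "y \<in> S" "E x y"
  let ?u = "\<lambda>x. \<psi> x / \<phi> x"
  let ?d = "\<lambda>x y. e x y * \<phi> x * \<phi> y * (?u x - ?u y)\<^sup>2"
  have d0: "?d x y \<ge> 0" if "x \<in> S" "y \<in> S" for x y using \<phi>(1)[OF that(1)] \<phi>(1)[OF that(2)] by (simp add: e_def)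
  have d: "?d x y = e x y * \<phi> y * (\<phi> x * (?u x)\<^sup>2) + e y x * \<phi> x * (\<phi> y * (?u y)\<^sup>2) - 2 * (\<psi> x * (e x y * \<psi> y))"
    if "x \<in> S" "y \<in> S" for x y
    using \<phi>(1)[OF that(1)] \<phi>(1)[OF that(2)] by (simp add: es[of y x] power2_eq_square field_simps)
  have "(\<Sum>x\<in>S. \<Sum>y\<in>S. ?d x y) = (\<Sum>x\<in>S. \<Sum>y\<in>S. e x y * \<phi> y * (\<phi> x * (?u x)\<^sup>2)) +
     (\<Sum>x\<in>S. \<Sum>y\<in>S. e y x * \<phi> x * (\<phi> y * (?u y)\<^sup>2)) - 2 * (\<Sum>x\<in>S. \<psi> x * (\<Sum>y\<in>S. e x y * \<psi> y))"
    using d by (simp add: sum.distrib sum_subtractf sum_distrib_left)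
  also have "(\<Sum>x\<in>S. \<Sum>y\<in>S. e y x * \<phi> x * (\<phi> y * (?u y)\<^sup>2)) = (\<Sum>x\<in>S. \<Sum>y\<in>S. e x y * \<phi> y * (\<phi> x * (?u x)\<^sup>2))"
    by (rule sum.swap)
  also have "\<dots> = (\<Sum>x\<in>S. (\<mu> * \<phi> x) * (\<phi> x * (?u x)\<^sup>2))"
    using e\<phi> by (simp flip: sum_distrib_right)
  also have "\<dots> = (\<Sum>x\<in>S. \<psi> x * (\<mu> * \<psi> x))"
  proof (intro sum.cong refl)
    fix x assume "x \<in> S"
    then show "(\<mu> * \<phi> x) * (\<phi> x * (?u x)\<^sup>2) = \<psi> x * (\<mu> * \<psi> x)"
      using \<phi>(1)[of x] by (simp add: power2_eq_square field_simps)
  qed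
  also have "(\<Sum>x\<in>S. \<psi> x * (\<Sum>y\<in>S. e x y * \<psi> y)) = (\<Sum>x\<in>S. \<psi> x * (\<mu> * \<psi> x))"
    using e\<psi> by (simp add: \<rho>)
  finally have "(\<Sum>x\<in>S. \<Sum>y\<in>S. ?d x y) = 0" by simp
  then have "\<forall>x\<in>S. (\<Sum>y\<in>S. ?d x y) = 0"
    by (subst (asm) sum_nonneg_eq_0_iff[OF S(1)]) (auto intro!: sum_nonneg d0)
  then have "(\<Sum>y\<in>S. ?d x y) = 0" using xy by blast
  then have "?d x y = 0"
    using xy by (subst (asm) sum_nonneg_eq_0_iff[OF S(1)]) (auto intro!: d0)
  then have "?u x = ?u y"
    using xy \<phi>(1)[OF xy(1)] \<phi>(1)[OF xy(2)] by (simp add: e_def)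
  then show "\<psi> y / \<psi> x = \<phi> y / \<phi> x"
    using \<phi>(1)[OF xy(1)] \<phi>(1)[OF xy(2)] \<psi>(1)[OF xy(1)] by (simp add: field_simps)
qed

lemma sin_add_int_pi: "sin (x + of_int k * pi) = (-1) powi k * sin x" "cos (x + of_int k * pi) = (-1) powi k * cos x"
proof -
  have nat: "sin (x + real n * pi) = (-1) ^ n * sin x" "cos (x + real n * pi) = (-1) ^ n * cos x" for n x
    by (simp_all add: sin_add cos_add)
  have "sin (x + of_int k * pi) = (-1) powi k * sin x \<and> cos (x + of_int k * pi) = (-1) powi k * cos x"
  proof (cases "k \<ge> 0")
    case True
    then show ?thesis using nat[of x "nat k"] by (simp add: power_int_def)
  next
    case False
    then show ?thesis using nat[of "x + of_int k * pi" "nat (- k)"]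
      by (simp add: power_int_def)
  qed
  then show "sin (x + of_int k * pi) = (-1) powi k * sin x" "cos (x + of_int k * pi) = (-1) powi k * cos x" by auto
qed

lemma cis_diff: "cis a - cis b = 2 * \<i> * of_real (sin ((a - b) / 2)) * cis ((a + b) / 2)"
proof -
  have "cis a = cis ((a + b) / 2) * cis ((a - b) / 2)" "cis b = cis ((a + b) / 2) * cis (- ((a - b) / 2))"
    by (simp_all add: cis_mult field_simps)
  then have "cis a - cis b = cis ((a + b) / 2) * (cis ((a - b) / 2) - cis (- ((a - b) / 2)))"
    by (simp add: algebra_simps)
  also have "cis x - cis (- x) = 2 * \<i> * of_real (sin x)" for x by (simp add: complex_eq_iff)
  finally show ?thesis by (simp add: mult_ac)
qed

context
  fixes L :: nat
  assumes L: "L \<ge> 3"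
begin

definition sinL :: "int \<Rightarrow> real" where
  "sinL k = sin (pi * of_int k / real L)"

lemma sinL_add_mult: "sinL (k + c * int L) = (-1) powi c * sinL k"
  using sin_add_int_pi(1)[of "pi * of_int k / real L" c] L
  by (simp add: sinL_def add_divide_distrib distrib_left mult_ac)

lemma abs_sinL_add_mult: "\<bar>sinL (k + c * int L)\<bar> = \<bar>sinL k\<bar>"
  by (simp add: sinL_add_mult abs_mult power_int_abs)

lemma sinL_pos: "0 < k \<Longrightarrow> k < int L \<Longrightarrow> 0 < sinL k"
  unfolding sinL_def using L by (intro sin_gt_zero) (auto simp: field_simps)

lemma sinL_nonneg: "0 \<le> k \<Longrightarrow> k \<le> int L \<Longrightarrow> 0 \<le> sinL k"
  unfolding sinL_def using L by (intro sin_ge_zero) (auto simp: field_simps)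

lemma sinL_0 [simp]: "sinL 0 = 0" and sinL_L [simp]: "sinL (int L) = 0" and sinL_uminus [simp]: "sinL (- k) = - sinL k"
  using L by (auto simp: sinL_def)

lemma sinL_eq_0: "sinL k = 0 \<Longrightarrow> k mod int L = 0"
proof (rule ccontr)
  assume 0: "sinL k = 0" and "k mod int L \<noteq> 0"
  moreover have "0 < int L" using L by simp
  ultimately have "0 < k mod int L" "k mod int L < int L"
    using pos_mod_sign[of "int L" k] pos_mod_bound[of "int L" k] by linarith+
  then have "0 < sinL (k mod int L)" by (rule sinL_pos)
  moreover have "\<bar>sinL k\<bar> = \<bar>sinL (k mod int L)\<bar>"
    using abs_sinL_add_mult[of "k mod int L" "k div int L"] by simp
  ultimately show False using 0 by simp
qed

text \<open>Every unordered pair occurs twice in the double product below, which the square root compensates;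
the value 1 at 0 removes the diagonal.\<close>
definition pair_weight :: "int \<Rightarrow> real" where
  "pair_weight k = (if k = 0 then 1 else sqrt \<bar>sinL k\<bar>)"

text \<open>The positive eigenfunction: up to a constant it is the modulus of the Vandermonde determinant of
the points $e^{2 \pi i k/L}$, the wave function of free fermions on the circle.\<close>
definition sine_vandermonde :: "int set \<Rightarrow> real" where
  "sine_vandermonde A = (\<Prod>i\<in>A. \<Prod>j\<in>A. pair_weight (i - j))"

lemma sine_vandermonde_insert:
  assumes "finite S" "a \<notin> S"
  shows "sine_vandermonde (insert a S) = sine_vandermonde S * (\<Prod>s\<in>S. \<bar>sinL (a - s)\<bar>)"
proof -
  have "pair_weight (a - s) * pair_weight (s - a) = \<bar>sinL (a - s)\<bar>" if "s \<in> S" for s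
  proof -
    have "sinL (s - a) = - sinL (a - s)" using sinL_uminus[of "a - s"] by simp
    then show ?thesis using that assms by (auto simp: pair_weight_def)
  qed
  then have "(\<Prod>s\<in>S. pair_weight (a - s)) * (\<Prod>s\<in>S. pair_weight (s - a)) = (\<Prod>s\<in>S. \<bar>sinL (a - s)\<bar>)"
    by (simp flip: prod.distrib)
  then show ?thesis
    using assms by (simp add: sine_vandermonde_def prod.distrib pair_weight_def[of 0] mult_ac)
qed

lemma sine_vandermonde_pos:
  assumes "A \<subseteq> {0..<int L}"
  shows "sine_vandermonde A > 0"
  unfolding sine_vandermonde_def
proof (intro prod_pos)
  fix i j assume "i \<in> A" "j \<in> A"
  then have "i \<noteq> j \<Longrightarrow> (i - j) mod int L \<noteq> 0"
    using assms by (metis atLeastLessThan_iff mod_eq_dvd_iff mod_pos_pos_trivial subsetD dvd_eq_mod_eq_0)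
  then show "0 < pair_weight (i - j)" using sinL_eq_0[of "i - j"] by (auto simp: pair_weight_def)
qed

text \<open>The ratio of the eigenfunction after and before the particle at i has moved by \<open>\<sigma>\<close>. A move to an
occupied site gives the value 0, so that the exclusion rule need not be imposed separately.\<close>
definition hop :: "int set \<Rightarrow> int \<Rightarrow> int \<Rightarrow> real" where
  "hop A i \<sigma> = (\<Prod>s\<in>A - {i}. sinL (i + \<sigma> - s) / sinL (i - s))"

lemma hop_cases:
  assumes A: "A \<subseteq> {0..<int L}" and i: "i \<in> A" and \<sigma>: "\<sigma> = 1 \<or> \<sigma> = -1"
  defines "j \<equiv> (i + \<sigma>) mod int L"
  shows "j \<in> A \<Longrightarrow> hop A i \<sigma> = 0"
    and "j \<notin> A \<Longrightarrow> hop A i \<sigma> = sine_vandermonde (insert j (A - {i})) / sine_vandermonde A"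
    and "hop A i \<sigma> \<ge> 0"
proof -
  have fin: "finite A" using A finite_subset by blast
  have factor: "sinL (i + \<sigma> - s) / sinL (i - s) = \<bar>sinL (j - s)\<bar> / \<bar>sinL (i - s)\<bar>" if s: "s \<in> A - {i}" for s
  proof -
    have ib: "0 \<le> i" "i < int L" and sb: "0 \<le> s" "s < int L" using i s A by auto
    have "i + \<sigma> = j + ((i + \<sigma>) div int L) * int L" by (simp add: j_def)
    then have "\<bar>sinL (i + \<sigma> - s)\<bar> = \<bar>sinL (j - s)\<bar>"
      using abs_sinL_add_mult[of "j - s" "(i + \<sigma>) div int L"] by (simp add: algebra_simps)
    moreover have "sinL (i + \<sigma> - s) / sinL (i - s) \<ge> 0"
    proof (cases "i > s")
      case True
      then have "0 \<le> i + \<sigma> - s" "i + \<sigma> - s \<le> int L" "0 \<le> i - s" "i - s \<le> int L"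
        using ib sb \<sigma> \<open>i > s\<close> by auto
      then show ?thesis by (intro divide_nonneg_nonneg sinL_nonneg)
    next
      case False
      then have "0 \<le> - (i + \<sigma> - s)" "- (i + \<sigma> - s) \<le> int L" "0 \<le> - (i - s)" "- (i - s) \<le> int L"
        using ib sb \<sigma> False s by auto
      then have "0 \<le> sinL (- (i + \<sigma> - s)) / sinL (- (i - s))" by (intro divide_nonneg_nonneg sinL_nonneg)
      then show ?thesis by (simp only: sinL_uminus)
    qed
    ultimately show ?thesis by (metis abs_divide abs_of_nonneg)
  qed
  have hop: "hop A i \<sigma> = (\<Prod>s\<in>A - {i}. \<bar>sinL (j - s)\<bar>) / (\<Prod>s\<in>A - {i}. \<bar>sinL (i - s)\<bar>)"
    unfolding hop_def prod_dividef[symmetric] by (rule prod.cong[OF refl factor])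
  then show "hop A i \<sigma> \<ge> 0" by (simp add: prod_nonneg)
  have "j \<noteq> i"
  proof
    assume "j = i"
    then have "(i + \<sigma>) mod int L = i mod int L" using i A by (auto simp: j_def)
    then have "int L dvd \<sigma>" by (simp add: mod_eq_dvd_iff)
    then show False using \<sigma> L by (auto dest: zdvd_imp_le)
  qed
  then show "hop A i \<sigma> = 0" if "j \<in> A"
    using that fin unfolding hop by (auto intro!: prod_zero bexI[of _ j])
  show "hop A i \<sigma> = sine_vandermonde (insert j (A - {i})) / sine_vandermonde A" if "j \<notin> A"
  proof -
    have "sine_vandermonde A = sine_vandermonde (A - {i}) * (\<Prod>s\<in>A - {i}. \<bar>sinL (i - s)\<bar>)"
      using sine_vandermonde_insert[of "A - {i}" i] fin i by (simp add: insert_absorb)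
    moreover have "sine_vandermonde (insert j (A - {i})) = sine_vandermonde (A - {i}) * (\<Prod>s\<in>A - {i}. \<bar>sinL (j - s)\<bar>)"
      using sine_vandermonde_insert[of "A - {i}" j] fin that by simp
    moreover have "sine_vandermonde (A - {i}) > 0" by (rule sine_vandermonde_pos) (use A in auto)
    ultimately show ?thesis unfolding hop by simp
  qed
qed

definition power_sum :: "int set \<Rightarrow> nat \<Rightarrow> complex" where
  "power_sum A n = (\<Sum>i\<in>A. cis (2 * pi * real n * of_int i / real L))"

text \<open>The logarithm of the product in the residue identity, for $q = e^{2 \pi i \sigma/L}$.\<close>
definition twisted_sums :: "int \<Rightarrow> int set \<Rightarrow> complex fps" where
  "twisted_sums \<sigma> A = Abs_fps (\<lambda>n. (1 - cis (- (2 * pi * of_int \<sigma> * real n / real L))) * power_sum A n / of_nat n)"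

text \<open>The residue identity at the points $e^{2 \pi i k/L}$: the ratios of sines in the jump rates are, up to
phases that cancel in the product, the factors $(q \xi_k - \xi_j)/(\xi_k - \xi_j)$.\<close>
lemma hop_power_sum:
  assumes A: "A \<subseteq> {0..<int L}" and \<sigma>: "\<sigma> = 1 \<or> \<sigma> = -1"
  shows "2 * \<i> * of_real (sin (pi * of_int \<sigma> / real L)) * (\<Sum>i\<in>A. of_real (hop A i \<sigma>) * cis (2 * pi * real n * of_int i / real L)) =
    cis (pi * of_int \<sigma> * real (card A) / real L) * fps_nth (fexp (twisted_sums \<sigma> A)) n
     - (if n = 0 then cis (- (pi * of_int \<sigma> * real (card A) / real L)) else 0)"
proof -
  let ?\<xi> = "\<lambda>i :: int. cis (2 * pi * of_int i / real L)" and ?q = "cis (2 * pi * of_int \<sigma> / real L)"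
  let ?N = "real (card A)"
  have fin: "finite A" using A finite_subset by blast
  have inj: "inj_on ?\<xi> A"
  proof
    fix i j assume ij: "i \<in> A" "j \<in> A" and "?\<xi> i = ?\<xi> j"
    then have "?\<xi> i - ?\<xi> j = 0" by simp
    then have "2 * \<i> * of_real (sin ((2 * pi * of_int i / real L - 2 * pi * of_int j / real L) / 2)) * cis ((2 * pi * of_int i / real L + 2 * pi * of_int j / real L) / 2) = 0"
      by (simp only: cis_diff)
    moreover have "(2 * pi * of_int i / real L - 2 * pi * of_int j / real L) / 2 = pi * of_int (i - j) / real L"
      by (simp add: diff_divide_distrib right_diff_distrib)
    ultimately have "sinL (i - j) = 0" by (simp add: sinL_def)
    then have "(i - j) mod int L = 0" by (rule sinL_eq_0)
    then have "i mod int L = j mod int L" by (simp add: mod_eq_dvd_iff dvd_eq_mod_eq_0)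
    then show "i = j" using ij A by (metis atLeastLessThan_iff mod_pos_pos_trivial subsetD)
  qed
  have pow: "?\<xi> i ^ n = cis (2 * pi * real n * of_int i / real L)" for i n
    by (simp add: Complex.DeMoivre mult_ac)
  have g: "Abs_fps (\<lambda>n. (1 - 1 / ?q ^ n) * (\<Sum>k\<in>A. ?\<xi> k ^ n) / of_nat n) = twisted_sums \<sigma> A"
  proof -
    have "1 / ?q ^ n = cis (- (2 * pi * of_int \<sigma> * real n / real L))" for n
      unfolding Complex.DeMoivre by (simp add: cis_inverse[symmetric] inverse_eq_divide mult_ac)
    then show ?thesis by (simp only: twisted_sums_def power_sum_def pow)
  qed
  have ratio: "(\<Prod>j\<in>A - {k}. (?q * ?\<xi> k - ?\<xi> j) / (?\<xi> k - ?\<xi> j)) = cis (pi * of_int \<sigma> * (?N - 1) / real L) * of_real (hop A k \<sigma>)"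
    if k: "k \<in> A" for k
  proof -
    have f: "(?q * ?\<xi> k - ?\<xi> j) / (?\<xi> k - ?\<xi> j) = cis (pi * of_int \<sigma> / real L) * of_real (sinL (k + \<sigma> - j) / sinL (k - j))" for j
    proof -
      have h1: "(2 * pi * of_int a / real L - 2 * pi * of_int b / real L) / 2 = pi * of_int (a - b) / real L"
        and h2: "(2 * pi * of_int a / real L + 2 * pi * of_int b / real L) / 2 = pi * of_int (a + b) / real L" for a b :: int
        by (simp_all add: diff_divide_distrib right_diff_distrib add_divide_distrib distrib_left)
      have "?q * ?\<xi> k = cis (2 * pi * of_int (k + \<sigma>) / real L)"
        unfolding cis_mult by (rule arg_cong[where f = cis]) (simp add: add_divide_distrib distrib_left)
      then have n: "?q * ?\<xi> k - ?\<xi> j = 2 * \<i> * of_real (sinL (k + \<sigma> - j)) * cis (pi * of_int (k + \<sigma> + j) / real L)"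
        by (simp only: cis_diff h1 h2 sinL_def)
      have d: "?\<xi> k - ?\<xi> j = 2 * \<i> * of_real (sinL (k - j)) * cis (pi * of_int (k + j) / real L)"
        by (simp only: cis_diff h1 h2 sinL_def)
      have e: "cis (pi * of_int (k + \<sigma> + j) / real L) = cis (pi * of_int \<sigma> / real L) * cis (pi * of_int (k + j) / real L)"
        unfolding cis_mult by (rule arg_cong[where f = cis]) (simp add: add_divide_distrib distrib_left)
      show ?thesis unfolding n d e by simp
    qed
    have "card A > 0" using k fin by (auto simp: card_gt_0_iff)
    have "(\<Prod>j\<in>A - {k}. (?q * ?\<xi> k - ?\<xi> j) / (?\<xi> k - ?\<xi> j)) = cis (pi * of_int \<sigma> / real L) ^ card (A - {k}) * of_real (hop A k \<sigma>)"
      unfolding f prod.distrib hop_def of_real_prod by simp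
    also have "cis (pi * of_int \<sigma> / real L) ^ card (A - {k}) = cis (pi * of_int \<sigma> * (?N - 1) / real L)"
      unfolding Complex.DeMoivre using fin k \<open>card A > 0\<close> by (simp add: of_nat_diff mult_ac)
    finally show ?thesis .
  qed
  let ?S = "\<Sum>i\<in>A. of_real (hop A i \<sigma>) * cis (2 * pi * real n * of_int i / real L)"
  let ?e = "cis (- (pi * of_int \<sigma> * ?N / real L))"
  have q1: "?q - 1 = 2 * \<i> * of_real (sin (pi * of_int \<sigma> / real L)) * cis (pi * of_int \<sigma> / real L)"
    using cis_diff[of "2 * pi * of_int \<sigma> / real L" 0] by simp
  have "(\<Sum>k\<in>A. (\<Prod>j\<in>A - {k}. (?q * ?\<xi> k - ?\<xi> j) / (?\<xi> k - ?\<xi> j)) * ?\<xi> k ^ n) =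
      cis (pi * of_int \<sigma> * (?N - 1) / real L) * ?S"
    unfolding sum_distrib_left by (rule sum.cong[OF refl], subst ratio, assumption, subst pow, rule mult.assoc)
  then have "(?q - 1) * (\<Sum>k\<in>A. (\<Prod>j\<in>A - {k}. (?q * ?\<xi> k - ?\<xi> j) / (?\<xi> k - ?\<xi> j)) * ?\<xi> k ^ n) =
      (?q - 1) * cis (pi * of_int \<sigma> * (?N - 1) / real L) * ?S"
    by (rule arg_cong[where f = "(*) (?q - 1)", THEN trans, OF _ mult.assoc[symmetric]])
  also have "(?q - 1) * cis (pi * of_int \<sigma> * (?N - 1) / real L) =
      2 * \<i> * of_real (sin (pi * of_int \<sigma> / real L)) * (cis (pi * of_int \<sigma> / real L) * cis (pi * of_int \<sigma> * (?N - 1) / real L))"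
    unfolding q1 by simp
  also have "cis (pi * of_int \<sigma> / real L) * cis (pi * of_int \<sigma> * (?N - 1) / real L) = cis (pi * of_int \<sigma> * ?N / real L)"
    unfolding cis_mult using L by (intro arg_cong[where f = cis]) (simp add: field_simps)
  finally have "2 * \<i> * of_real (sin (pi * of_int \<sigma> / real L)) * cis (pi * of_int \<sigma> * ?N / real L) * ?S =
      ?q ^ card A * fps_nth (fexp (twisted_sums \<sigma> A)) n - (if n = 0 then 1 else 0)"
    using residue_sum[OF fin inj, of ?q n] unfolding g by simp
  then have "?e * (2 * \<i> * of_real (sin (pi * of_int \<sigma> / real L)) * cis (pi * of_int \<sigma> * ?N / real L) * ?S) =
      ?e * (?q ^ card A * fps_nth (fexp (twisted_sums \<sigma> A)) n - (if n = 0 then 1 else 0))" by simp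
  moreover have "?e * (2 * \<i> * of_real (sin (pi * of_int \<sigma> / real L)) * cis (pi * of_int \<sigma> * ?N / real L) * ?S) =
      (?e * cis (pi * of_int \<sigma> * ?N / real L)) * (2 * \<i> * of_real (sin (pi * of_int \<sigma> / real L)) * ?S)"
    by (simp only: mult_ac)
  moreover have "?e * cis (pi * of_int \<sigma> * ?N / real L) = 1" by (simp add: cis_mult)
  moreover have "?e * ?q ^ card A = cis (pi * of_int \<sigma> * ?N / real L)"
    unfolding Complex.DeMoivre cis_mult using L by (intro arg_cong[where f = cis]) (simp add: field_simps)
  ultimately have fin: "cis (pi * of_int \<sigma> * ?N / real L) * fps_nth (fexp (twisted_sums \<sigma> A)) n - ?e * (if n = 0 then 1 else 0) =
      2 * \<i> * of_real (sin (pi * of_int \<sigma> / real L)) * ?S"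
    by (simp add: right_diff_distrib mult.assoc[symmetric])
  have "?e * (if n = 0 then 1 else 0) = (if n = 0 then ?e else 0)" by simp
  with fin show ?thesis by (simp only:)
qed

end

text \<open>For $L \ge 3$ a neighbouring configuration determines the particle and the direction of the jump; for
L = 2 the two directions would lead to the same site.\<close>
lemma config_neighbours:
  assumes L: "L \<ge> 3" and A: "A \<in> configs L N"
  defines "h \<equiv> \<lambda>(i, \<sigma>). insert ((i + \<sigma>) mod int L) (A - {i})"
  shows "bij_betw h {(i, \<sigma>) \<in> A \<times> {1, -1}. (i + \<sigma>) mod int L \<notin> A} {B \<in> configs L N. config_adj L A B}"
    (is "bij_betw h ?I ?S")
  unfolding bij_betw_def
proof
  have fin: "finite A" using A finite_subset by (auto simp: configs_def)
  show "inj_on h ?I"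
  proof (rule inj_onI)
    fix p q assume p: "p \<in> ?I" and q: "q \<in> ?I" and eq: "h p = h q"
    obtain i \<sigma> j \<tau> where pq: "p = (i, \<sigma>)" "q = (j, \<tau>)" by (metis surj_pair)
    have "A - h p = {i}" "h p - A = {(i + \<sigma>) mod int L}" "A - h q = {j}" "h q - A = {(j + \<tau>) mod int L}"
      using p q unfolding pq h_def by auto
    then have ij: "i = j" and "(i + \<sigma>) mod int L = (j + \<tau>) mod int L" using eq by auto
    then have "int L dvd \<sigma> - \<tau>" by (simp add: mod_eq_dvd_iff)
    then have "\<sigma> = \<tau>" using p q L dvd_imp_le_int[of "\<sigma> - \<tau>" "int L"] unfolding pq by auto
    with ij pq show "p = q" by simp
  qed
  show "h ` ?I = ?S"
  proof (intro equalityI subsetI)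
    fix B assume "B \<in> h ` ?I"
    then obtain i \<sigma> where i: "i \<in> A" "\<sigma> \<in> {1, -1}" "(i + \<sigma>) mod int L \<notin> A" and B: "B = insert ((i + \<sigma>) mod int L) (A - {i})"
      by (auto simp: h_def)
    have "card B = card A" using i fin card_gt_0_iff[of A] unfolding B by (subst card_insert_disjoint) auto
    then have "B \<in> configs L N" using A L i unfolding B configs_def by auto
    moreover have "config_adj L A B" unfolding config_adj_def B using i by (intro bexI[of _ i] bexI[of _ "(i + \<sigma>) mod int L"]) auto
    ultimately show "B \<in> ?S" by simp
  next
    fix B assume "B \<in> ?S"
    then obtain i j where ij: "i \<in> A" "j \<in> {(i + 1) mod int L, (i - 1) mod int L} - A" "B = insert j (A - {i})"
      by (auto simp: config_adj_def)
    then have "(i, 1) \<in> ?I \<and> B = h (i, 1) \<or> (i, -1) \<in> ?I \<and> B = h (i, -1)" by (auto simp: h_def)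
    then show "B \<in> h ` ?I" by (elim disjE conjE) (rule image_eqI; assumption)+
  qed
qed

text \<open>The moment of order 0 of the jump rates is the same for all configurations, which is why the
Vandermonde product is an eigenfunction.\<close>
lemma hop_total:
  assumes L: "L \<ge> 3" and A: "A \<in> configs L N" and \<sigma>: "\<sigma> = 1 \<or> \<sigma> = -1"
  shows "(\<Sum>i\<in>A. hop L A i \<sigma>) = sin (pi * real N / real L) / sin (pi / real L)"
proof -
  have s: "sin (pi / real L) > 0" using L by (intro sin_gt_zero) (auto simp: field_simps)
  have AL: "A \<subseteq> {0..<int L}" and N: "card A = N" using A by (auto simp: configs_def)
  have "fps_nth (fexp (twisted_sums L \<sigma> A)) 0 = 1" by simp
  with hop_power_sum[OF L AL \<sigma>, of 0]
  have "2 * \<i> * of_real (sin (pi * of_int \<sigma> / real L)) * of_real (\<Sum>i\<in>A. hop L A i \<sigma>) =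
     cis (pi * of_int \<sigma> * real N / real L) - cis (- (pi * of_int \<sigma> * real N / real L))"
    by (simp add: N)
  also have "\<dots> = 2 * \<i> * of_real (sin (pi * of_int \<sigma> * real N / real L))" by (simp add: complex_eq_iff)
  finally have "complex_of_real (sin (pi * of_int \<sigma> / real L) * (\<Sum>i\<in>A. hop L A i \<sigma>)) = complex_of_real (sin (pi * of_int \<sigma> * real N / real L))"
    by simp
  then have "sin (pi * of_int \<sigma> / real L) * (\<Sum>i\<in>A. hop L A i \<sigma>) = sin (pi * of_int \<sigma> * real N / real L)"
    by (simp only: of_real_eq_iff)
  then show ?thesis using \<sigma> s by (auto simp: field_simps)
qed

lemma sine_vandermonde_eigenfunction:
  assumes L: "L \<ge> 3" and A: "A \<in> configs L N"
  shows "(\<Sum>B | B \<in> configs L N \<and> config_adj L A B. sine_vandermonde L B) =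
    2 * sin (pi * real N / real L) / sin (pi / real L) * sine_vandermonde L A"
proof -
  let ?h = "\<lambda>(i, \<sigma>). insert ((i + \<sigma>) mod int L) (A - {i})"
  let ?I = "{(i, \<sigma>) \<in> A \<times> {1, -1}. (i + \<sigma>) mod int L \<notin> A}"
  have AL: "A \<subseteq> {0..<int L}" using A by (auto simp: configs_def)
  have fin: "finite A" using AL finite_subset by blast
  note pos = sine_vandermonde_pos[OF L AL]
  have "(\<Sum>B | B \<in> configs L N \<and> config_adj L A B. sine_vandermonde L B) = (\<Sum>p\<in>?I. sine_vandermonde L (?h p))"
    by (rule sum.reindex_bij_betw[OF config_neighbours[OF L A], symmetric])
  also have "\<dots> = (\<Sum>(i, \<sigma>)\<in>?I. hop L A i \<sigma> * sine_vandermonde L A)"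
    using hop_cases(2)[OF L AL] pos by (intro sum.cong refl) auto
  also have "\<dots> = (\<Sum>(i, \<sigma>)\<in>A \<times> {1, -1}. hop L A i \<sigma> * sine_vandermonde L A)"
    using hop_cases(1)[OF L AL] fin by (intro sum.mono_neutral_left) auto
  also have "\<dots> = (\<Sum>\<sigma>\<in>{1, -1}. (\<Sum>i\<in>A. hop L A i \<sigma>) * sine_vandermonde L A)"
    by (subst sum.cartesian_product[symmetric], subst sum.swap) (simp add: sum_distrib_right)
  also have "\<dots> = 2 * sin (pi * real N / real L) / sin (pi / real L) * sine_vandermonde L A"
    using hop_total[OF L A, of 1] hop_total[OF L A, of "-1"] by simp
  finally show ?thesis .
qed

lemma config_adj_sym:
  assumes L: "L \<ge> 3" and A: "A \<subseteq> {0..<int L}" and adj: "config_adj L A B"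
  shows "config_adj L B A"
proof -
  obtain i j where ij: "i \<in> A" "j = (i + 1) mod int L \<or> j = (i - 1) mod int L" "j \<notin> A" "B = insert j (A - {i})"
    using adj unfolding config_adj_def by blast
  have i: "i mod int L = i" using ij A by auto
  have "i = (j + 1) mod int L \<or> i = (j - 1) mod int L"
    using ij(2) i by (auto simp: mod_simps)
  moreover have "i \<notin> B" using ij(1,3,4) by auto
  moreover have "A = insert i (B - {j})" using ij(1,3,4) by auto
  moreover have "j \<in> B" using ij(4) by auto
  ultimately show ?thesis unfolding config_adj_def by blast
qed

lemma perron_eigenvector_sum:
  assumes \<psi>: "perron_eigenvector L N \<psi>" and A: "A \<in> configs L N"
  shows "(\<Sum>B | B \<in> configs L N \<and> config_adj L A B. \<psi> B) = messep_rho L N * \<psi> A"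
proof -
  let ?cs = "config_list L N" and ?M = "adj_matrix L N"
  let ?n = "length ?cs"
  let ?v = "vec ?n (\<lambda>i. complex_of_real (\<psi> (?cs ! i)))"
  have dim: "dim_row ?M = ?n" "dim_col ?M = ?n" by (simp_all add: adj_matrix_def Let_def)
  have ev: "?M *\<^sub>v ?v = complex_of_real (messep_rho L N) \<cdot>\<^sub>v ?v"
    using \<psi> unfolding perron_eigenvector_def eigenvector_def by blast
  obtain i where i: "i < ?n" "A = ?cs ! i" using A by (metis in_set_conv_nth set_config_list)
  have bij: "bij_betw ((!) ?cs) {0..<?n} (configs L N)"
    using bij_betw_nth[OF distinct_config_list refl refl, of L N] by (simp add: set_config_list lessThan_atLeast0)
  have fin: "finite (configs L N)" by (metis List.finite_set set_config_list)
  have "complex_of_real (messep_rho L N * \<psi> A) = vec_index (?M *\<^sub>v ?v) i"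
    unfolding ev using i by simp
  also have "\<dots> = (\<Sum>j\<in>{0..<?n}. (if config_adj L A (?cs ! j) then 1 else 0) * complex_of_real (\<psi> (?cs ! j)))"
    using i dim by (simp add: scalar_prod_def adj_matrix_def Let_def)
  also have "\<dots> = (\<Sum>B\<in>configs L N. (if config_adj L A B then 1 else 0) * complex_of_real (\<psi> B))"
    by (rule sum.reindex_bij_betw[OF bij])
  also have "\<dots> = (\<Sum>B\<in>configs L N. if config_adj L A B then complex_of_real (\<psi> B) else 0)"
    by (intro sum.cong refl) simp
  also have "\<dots> = complex_of_real (\<Sum>B | B \<in> configs L N \<and> config_adj L A B. \<psi> B)"
    using fin by (simp add: sum.inter_filter, intro sum.cong refl, simp)
  finally show ?thesis by (simp only: of_real_eq_iff)
qed

lemma perron_eigenvector_ratio: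
  assumes L: "L \<ge> 3" and N: "N \<le> L" and \<psi>: "perron_eigenvector L N \<psi>"
  shows "messep_rho L N = 2 * sin (pi * real N / real L) / sin (pi / real L)"
    and "\<And>A B. A \<in> configs L N \<Longrightarrow> B \<in> configs L N \<Longrightarrow> config_adj L A B \<Longrightarrow>
      \<psi> B / \<psi> A = sine_vandermonde L B / sine_vandermonde L A"
proof -
  let ?E = "\<lambda>A B. A \<in> configs L N \<and> B \<in> configs L N \<and> config_adj L A B"
  have fin: "finite (configs L N)" by (metis List.finite_set set_config_list)
  have "{0..<int N} \<in> configs L N" using N by (auto simp: configs_def)
  then have ne: "configs L N \<noteq> {}" by blast
  have sub: "A \<subseteq> {0..<int L}" if "A \<in> configs L N" for A using that by (simp add: configs_def)
  have sym: "?E A B \<longleftrightarrow> ?E B A" for A B using config_adj_sym[OF L] sub by blast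
  have eq: "{B. B \<in> configs L N \<and> ?E A B} = {B. B \<in> configs L N \<and> config_adj L A B}" if "A \<in> configs L N" for A
    using that by auto
  have pos: "A \<in> configs L N \<Longrightarrow> 0 < \<psi> A" for A using \<psi> by (simp add: perron_eigenvector_def)
  let ?m = "2 * sin (pi * real N / real L) / sin (pi / real L)"
  note hyps = sine_vandermonde_pos[OF L sub] pos sine_vandermonde_eigenfunction[OF L] perron_eigenvector_sum[OF \<psi>]
  show "messep_rho L N = ?m"
    by (rule positive_eigenfunctions_proportional(1)[of "configs L N" ?E "sine_vandermonde L" ?m \<psi>, OF fin ne sym])
       (simp_all add: eq hyps)
  show "\<psi> B / \<psi> A = sine_vandermonde L B / sine_vandermonde L A" if "A \<in> configs L N" "B \<in> configs L N" "config_adj L A B" for A B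
    by (rule positive_eigenfunctions_proportional(2)[of "configs L N" ?E "sine_vandermonde L" ?m \<psi> "messep_rho L N", OF fin ne sym])
       (use that in \<open>simp_all add: eq hyps\<close>)
qed

lemma weyl_walks_iff:
  assumes "N \<ge> 1"
  shows "x \<in> weyl_walks L N \<longleftrightarrow> length x = N \<and> (\<forall>i j. i < j \<and> j < N \<longrightarrow> x ! i < x ! j \<and> x ! j < x ! i + int L) \<and> (N = 1 \<longrightarrow> L > 0)"
proof (cases "length x = N")
  case True
  then have ne: "x \<noteq> []" using assms by auto
  have hl: "hd x = x ! 0" "last x = x ! (N - 1)" using ne True by (simp_all add: hd_conv_nth last_conv_nth)
  show ?thesis
  proof
    assume x: "x \<in> weyl_walks L N"
    then have s: "x ! i < x ! j" if "i < j" "j < N" for i j using that True by (auto simp: weyl_walks_def sorted_wrt_iff_nth_less)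
    have le: "x ! i \<le> x ! j" if "i \<le> j" "j < N" for i j using s[of i j] that by (cases "i = j") auto
    have lh: "x ! (N - 1) < x ! 0 + int L" using x hl by (simp add: weyl_walks_def)
    have "x ! j < x ! i + int L" if "i < j" "j < N" for i j
      using le[of j "N - 1"] le[of 0 i] lh that by linarith
    moreover have "L > 0" using lh le[of 0 "N - 1"] assms by linarith
    ultimately show "length x = N \<and> (\<forall>i j. i < j \<and> j < N \<longrightarrow> x ! i < x ! j \<and> x ! j < x ! i + int L) \<and> (N = 1 \<longrightarrow> L > 0)"
      using s True by blast
  next
    assume *: "length x = N \<and> (\<forall>i j. i < j \<and> j < N \<longrightarrow> x ! i < x ! j \<and> x ! j < x ! i + int L) \<and> (N = 1 \<longrightarrow> L > 0)"
    have "x ! (N - 1) < x ! 0 + int L"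
    proof (cases "N = 1")
      case False
      then show ?thesis using * assms by auto
    qed (use * in simp)
    then show "x \<in> weyl_walks L N" using * hl by (simp add: weyl_walks_def sorted_wrt_iff_nth_less)
  qed
qed (auto simp: weyl_walks_def)

definition residues_of :: "nat \<Rightarrow> int list \<Rightarrow> int set" where
  "residues_of L x = (\<lambda>i. i mod int L) ` set x"

context
  fixes L N :: nat and x :: "int list"
  assumes L: "L \<ge> 3" and N: "N \<ge> 1" and x: "x \<in> weyl_walks L N"
begin

lemma walk_length: "length x = N"
  using x by (simp add: weyl_walks_def)

lemma walk_residues_inj: "inj_on (\<lambda>k. x ! k mod int L) {..<N}"
proof (rule linorder_inj_onI)
  fix i j assume ij: "i < j" "i \<in> {..<N}" "j \<in> {..<N}"
  then have d: "0 < x ! j - x ! i" "x ! j - x ! i < int L"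
    using x weyl_walks_iff[OF N, of x L] by (auto simp: algebra_simps)
  show "x ! i mod int L \<noteq> x ! j mod int L"
  proof
    assume "x ! i mod int L = x ! j mod int L"
    then have "int L dvd x ! j - x ! i" by (metis mod_eq_dvd_iff)
    then show False using d by (auto dest: zdvd_imp_le)
  qed
qed auto

lemma residues_of_eq: "residues_of L x = (\<lambda>k. x ! k mod int L) ` {..<N}"
  unfolding residues_of_def set_conv_nth walk_length by auto

lemma residues_of_configs: "residues_of L x \<in> configs L N"
  using walk_residues_inj L unfolding configs_def residues_of_eq by (auto simp: card_image)

lemma walk_step:
  assumes k: "k < N" and \<sigma>: "\<sigma> = 1 \<or> \<sigma> = -1"
  defines "y \<equiv> x[k := x ! k + \<sigma>]"
  shows "y \<in> weyl_walks L N \<longleftrightarrow> (x ! k + \<sigma>) mod int L \<notin> residues_of L x"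
    and "residues_of L y = insert ((x ! k + \<sigma>) mod int L) (residues_of L x - {x ! k mod int L})"
proof -
  let ?r = "\<lambda>k. x ! k mod int L"
  have yn: "y ! i = (if i = k then x ! k + \<sigma> else x ! i)" if "i < N" for i
    using that by (auto simp: y_def walk_length)
  have ly: "length y = N" by (simp add: y_def walk_length)
  have xs: "x ! i < x ! j" "x ! j < x ! i + int L" if "i < j" "j < N" for i j
    using x weyl_walks_iff[OF N, of x L] that by auto
  have self: "(x ! k + \<sigma>) mod int L \<noteq> ?r k"
  proof
    assume "(x ! k + \<sigma>) mod int L = ?r k"
    then have "int L dvd \<sigma>" by (simp add: mod_eq_dvd_iff)
    then show False using \<sigma> L by (auto dest: zdvd_imp_le)
  qed
  show "residues_of L y = insert ((x ! k + \<sigma>) mod int L) (residues_of L x - {?r k})"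
  proof -
    have "residues_of L y = (\<lambda>i. y ! i mod int L) ` {..<N}"
      unfolding residues_of_def set_conv_nth ly by auto
    also have "{..<N} = insert k ({..<N} - {k})" using k by auto
    also have "(\<lambda>i. y ! i mod int L) ` \<dots> = insert ((x ! k + \<sigma>) mod int L) (?r ` ({..<N} - {k}))"
      using yn k by auto
    also have "?r ` ({..<N} - {k}) = residues_of L x - {?r k}"
      unfolding residues_of_eq using walk_residues_inj k by (subst inj_on_image_set_diff[of ?r "{..<N}"]) auto
    finally show ?thesis .
  qed
  show "y \<in> weyl_walks L N \<longleftrightarrow> (x ! k + \<sigma>) mod int L \<notin> residues_of L x"
  proof
    assume y: "y \<in> weyl_walks L N"
    show "(x ! k + \<sigma>) mod int L \<notin> residues_of L x"
    proof
      assume "(x ! k + \<sigma>) mod int L \<in> residues_of L x"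
      then obtain i where i: "i < N" "(x ! k + \<sigma>) mod int L = ?r i" unfolding residues_of_eq by auto
      then have ne: "i \<noteq> k" using self by auto
      have "int L dvd y ! k - y ! i" using i ne yn k by (simp add: mod_eq_dvd_iff)
      moreover have "0 < \<bar>y ! k - y ! i\<bar>" "\<bar>y ! k - y ! i\<bar> < int L"
      proof -
        have ys: "y ! p < y ! q \<and> y ! q < y ! p + int L" if "p < q" "q < N" for p q
          using y weyl_walks_iff[OF N, of y L] that by blast
        have "0 < \<bar>y ! k - y ! i\<bar> \<and> \<bar>y ! k - y ! i\<bar> < int L"
        proof (cases "i < k")
          case True
          then show ?thesis using ys[of i k] k by auto
        next
          case False
          then show ?thesis using ys[of k i] ne i(1) by auto
        qed
        then show "0 < \<bar>y ! k - y ! i\<bar>" "\<bar>y ! k - y ! i\<bar> < int L" by auto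
      qed
      ultimately show False using dvd_imp_le_int[of "y ! k - y ! i" "int L"] by auto
    qed
  next
    assume out: "(x ! k + \<sigma>) mod int L \<notin> residues_of L x"
    have ne: "x ! k + \<sigma> \<noteq> x ! i + c * int L" if "i < N" for i c
    proof
      assume "x ! k + \<sigma> = x ! i + c * int L"
      then have "(x ! k + \<sigma>) mod int L = ?r i" by simp
      then show False using out that unfolding residues_of_eq by auto
    qed
    have "y ! i < y ! j \<and> y ! j < y ! i + int L" if ij: "i < j" "j < N" for i j
    proof -
      consider "i = k" | "j = k" | "i \<noteq> k" "j \<noteq> k" by blast
      then show ?thesis
      proof cases
        case 1
        then show ?thesis using ij yn[of i] yn[of j] xs[OF ij] ne[of j 0] ne[of j "-1"] \<sigma> by auto
      next
        case 2
        then show ?thesis using ij yn[of i] yn[of j] xs[OF ij] ne[of i 0] ne[of i 1] \<sigma> by auto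
      next
        case 3
        then show ?thesis using ij yn[of i] yn[of j] xs[OF ij] by auto
      qed
    qed
    then show "y \<in> weyl_walks L N" using weyl_walks_iff[OF N, of y L] ly L by auto
  qed
qed

text \<open>The transition probabilities on the walks, rewritten as a sum over all particles and both directions.
Forbidden moves may be included since their rate is 0.\<close>
lemma kernel_sum:
  fixes G :: "int list \<Rightarrow> complex"
  assumes NL: "N \<le> L - 1" and \<psi>: "perron_eigenvector L N \<psi>"
  shows "finite {y. y \<in> weyl_walks L N \<and> walk_adj x y}"
    and "\<And>y. messep_kernel L N \<psi> x y \<ge> 0"
    and "(\<Sum>y | y \<in> weyl_walks L N \<and> walk_adj x y. of_real (messep_kernel L N \<psi> x y) * G y) =
      (\<Sum>\<sigma>\<in>{1, -1}. \<Sum>k<N. of_real (hop L (residues_of L x) (x ! k mod int L) \<sigma>) * G (x[k := x ! k + \<sigma>])) / of_real (messep_rho L N)"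
proof -
  let ?A = "residues_of L x" and ?S = "{y. y \<in> weyl_walks L N \<and> walk_adj x y}"
  let ?h = "\<lambda>(\<sigma>, k). x[k := x ! k + \<sigma>]"
  let ?I = "{(\<sigma>, k) \<in> {1, -1} \<times> {..<N}. (x ! k + \<sigma>) mod int L \<notin> ?A}"
  have A: "?A \<in> configs L N" by (rule residues_of_configs)
  then have AL: "?A \<subseteq> {0..<int L}" by (simp add: configs_def)
  have sg: "\<sigma> = 1 \<or> \<sigma> = -1" if "\<sigma> \<in> {1, -1 :: int}" for \<sigma> using that by auto
  have inj: "inj_on ?h ?I"
  proof (rule inj_onI)
    fix p q assume p: "p \<in> ?I" and q: "q \<in> ?I" and eq: "?h p = ?h q"
    obtain \<sigma> k \<tau> l where pq: "p = (\<sigma>, k)" "q = (\<tau>, l)" by (metis surj_pair)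
    have kl: "k < N" "l < N" and st: "\<sigma> \<noteq> 0" "\<tau> \<noteq> 0" using p q unfolding pq by auto
    have e: "x[k := x ! k + \<sigma>] = x[l := x ! l + \<tau>]" using eq pq by simp
    have "k = l"
    proof (rule ccontr)
      assume "k \<noteq> l"
      then have "x ! k + \<sigma> = x ! k" using arg_cong[OF e, of "\<lambda>z. z ! k"] kl by (simp add: walk_length)
      then show False using st by simp
    qed
    moreover have "\<sigma> = \<tau>" using arg_cong[OF e, of "\<lambda>z. z ! k"] kl \<open>k = l\<close> by (simp add: walk_length)
    ultimately show "p = q" using pq by simp
  qed
  have img: "?h ` ?I = ?S"
  proof (intro equalityI subsetI)
    fix y assume "y \<in> ?h ` ?I"
    then show "y \<in> ?S" using walk_step(1) sg by (auto simp: walk_adj_def walk_length)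
  next
    fix y assume y: "y \<in> ?S"
    then obtain k where k: "k < N" "y = x[k := x ! k + 1] \<or> y = x[k := x ! k - 1]"
      by (auto simp: walk_adj_def walk_length)
    then obtain \<sigma> where \<sigma>: "\<sigma> \<in> {1, -1}" "y = x[k := x ! k + \<sigma>]" by fastforce
    then have "(\<sigma>, k) \<in> ?I" using walk_step(1)[OF k(1) sg[OF \<sigma>(1)]] y k by auto
    then show "y \<in> ?h ` ?I" using \<sigma> by force
  qed
  show fin: "finite ?S" unfolding img[symmetric] by (intro finite_imageI) (auto intro: finite_subset[of _ "{1, -1} \<times> {..<N}"])
  have rho: "messep_rho L N > 0"
  proof -
    have "sin (pi / real L) > 0" "sin (pi * real N / real L) > 0"
      using L N NL by (auto intro!: sin_gt_zero simp: field_simps)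
    then show ?thesis using perron_eigenvector_ratio(1)[OF L _ \<psi>] NL by auto
  qed
  have kern: "messep_kernel L N \<psi> x (x[k := x ! k + \<sigma>]) = hop L ?A (x ! k mod int L) \<sigma> / messep_rho L N"
    if \<sigma>: "\<sigma> \<in> {1, -1}" and k: "k < N" and out: "(x ! k + \<sigma>) mod int L \<notin> ?A" for \<sigma> k
  proof -
    let ?y = "x[k := x ! k + \<sigma>]" and ?i = "x ! k mod int L"
    have iA: "?i \<in> ?A" using k unfolding residues_of_eq by auto
    have y: "?y \<in> weyl_walks L N" using walk_step(1)[OF k sg[OF \<sigma>]] out by simp
    have adj: "walk_adj x ?y" using k \<sigma> by (auto simp: walk_adj_def walk_length)
    have By: "residues_of L ?y = insert ((?i + \<sigma>) mod int L) (?A - {?i})" using walk_step(2)[OF k sg[OF \<sigma>]] by (simp add: mod_simps)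
    have out': "(?i + \<sigma>) mod int L \<notin> ?A" using out by (simp add: mod_simps)
    have Bc: "residues_of L ?y \<in> configs L N" and cadj: "config_adj L ?A (residues_of L ?y)"
    proof -
      have "(?i, \<sigma>) \<in> {(i, \<sigma>) \<in> ?A \<times> {1, -1}. (i + \<sigma>) mod int L \<notin> ?A}" using iA \<sigma> out' by simp
      from bspec[OF bij_betwE[OF config_neighbours[OF L A]] this]
      have "residues_of L ?y \<in> {B \<in> configs L N. config_adj L ?A B}" by (simp add: By)
      then show "residues_of L ?y \<in> configs L N" "config_adj L ?A (residues_of L ?y)" by auto
    qed
    have "psi1 L \<psi> ?y / psi1 L \<psi> x = sine_vandermonde L (residues_of L ?y) / sine_vandermonde L ?A"
      using perron_eigenvector_ratio(2)[OF L _ \<psi> A Bc cadj] NL by (simp add: psi1_def residues_of_def)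
    also have "\<dots> = hop L ?A ?i \<sigma>"
      using hop_cases(2)[OF L AL iA sg[OF \<sigma>] out'] By by simp
    finally have "psi1 L \<psi> ?y / psi1 L \<psi> x = hop L ?A ?i \<sigma>" .
    moreover have "psi1 L \<psi> ?y / (messep_rho L N * psi1 L \<psi> x) = (psi1 L \<psi> ?y / psi1 L \<psi> x) / messep_rho L N"
      by (simp add: mult.commute)
    ultimately show ?thesis using y adj by (simp only: messep_kernel_def if_True simp_thms)
  qed
  show "messep_kernel L N \<psi> x y \<ge> 0" for y
  proof (cases "y \<in> ?S")
    case True
    then obtain \<sigma> k where *: "\<sigma> \<in> {1, -1}" "k < N" "(x ! k + \<sigma>) mod int L \<notin> ?A" "y = x[k := x ! k + \<sigma>]"
      unfolding img[symmetric] by auto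
    have iA: "x ! k mod int L \<in> ?A" using * unfolding residues_of_eq by auto
    show ?thesis unfolding *(4) kern[OF *(1-3)] using hop_cases(3)[OF L AL iA sg[OF *(1)]] rho by simp
  qed (auto simp: messep_kernel_def)
  have "(\<Sum>y\<in>?S. of_real (messep_kernel L N \<psi> x y) * G y) = (\<Sum>p\<in>?I. of_real (messep_kernel L N \<psi> x (?h p)) * G (?h p))"
    unfolding img[symmetric] by (subst sum.reindex[OF inj]) simp
  also have "\<dots> = (\<Sum>(\<sigma>, k)\<in>?I. of_real (hop L ?A (x ! k mod int L) \<sigma>) * G (x[k := x ! k + \<sigma>]) / of_real (messep_rho L N))"
  proof (intro sum.cong refl)
    fix p assume p: "p \<in> ?I"
    obtain \<sigma> k where pk: "p = (\<sigma>, k)" by (metis surj_pair)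
    then have *: "\<sigma> \<in> {1, -1}" "k < N" "(x ! k + \<sigma>) mod int L \<notin> ?A" using p by auto
    show "of_real (messep_kernel L N \<psi> x (?h p)) * G (?h p) =
        (case p of (\<sigma>, k) \<Rightarrow> of_real (hop L ?A (x ! k mod int L) \<sigma>) * G (x[k := x ! k + \<sigma>]) / of_real (messep_rho L N))"
      unfolding pk prod.case kern[OF *] by simp
  qed
  also have "\<dots> = (\<Sum>(\<sigma>, k)\<in>{1, -1} \<times> {..<N}. of_real (hop L ?A (x ! k mod int L) \<sigma>) * G (x[k := x ! k + \<sigma>]) / of_real (messep_rho L N))"
  proof (intro sum.mono_neutral_left ballI)
    fix p assume p: "p \<in> {1, -1} \<times> {..<N} - ?I"
    obtain \<sigma> k where pk: "p = (\<sigma>, k)" by (metis surj_pair)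
    then have *: "\<sigma> \<in> {1, -1}" "k < N" "(x ! k + \<sigma>) mod int L \<in> ?A" using p by auto
    have iA: "x ! k mod int L \<in> ?A" using * unfolding residues_of_eq by auto
    have "hop L ?A (x ! k mod int L) \<sigma> = 0"
      by (rule hop_cases(1)[OF L AL iA sg[OF *(1)]]) (use *(3) in \<open>simp add: mod_simps\<close>)
    then show "(case p of (\<sigma>, k) \<Rightarrow> of_real (hop L ?A (x ! k mod int L) \<sigma>) * G (x[k := x ! k + \<sigma>]) / of_real (messep_rho L N)) = 0"
      by (simp add: pk)
  qed auto
  also have "\<dots> = (\<Sum>\<sigma>\<in>{1, -1}. \<Sum>k<N. of_real (hop L ?A (x ! k mod int L) \<sigma>) * G (x[k := x ! k + \<sigma>]) / of_real (messep_rho L N))"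
    by (rule sum.cartesian_product[symmetric])
  finally show "(\<Sum>y\<in>?S. of_real (messep_kernel L N \<psi> x y) * G y) =
      (\<Sum>\<sigma>\<in>{1, -1}. \<Sum>k<N. of_real (hop L ?A (x ! k mod int L) \<sigma>) * G (x[k := x ! k + \<sigma>])) / of_real (messep_rho L N)"
    by (simp only: sum_divide_distrib)
qed

end

section \<open>Drift and noise of the empirical moments\<close>

text \<open>The generating series of the moments of the empirical measure. The moment of order 0 is replaced by 0,
to match the series g of the transport equation.\<close>
definition walk_moments :: "nat \<Rightarrow> int list \<Rightarrow> complex fps" where
  "walk_moments L x = Abs_fps (\<lambda>n. if n = 0 then 0 else
     (\<Sum>k<length x. cis (2 * pi * real n * of_int (x ! k) / real L)) / of_nat (length x))"

definition twist :: "nat \<Rightarrow> nat \<Rightarrow> int \<Rightarrow> complex fps \<Rightarrow> complex fps" where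
  "twist L N \<sigma> z = Abs_fps (\<lambda>n. (1 - cis (- (2 * pi * of_int \<sigma> * real n / real L))) * of_nat N * fps_nth z n / of_nat n)"

text \<open>The conditional expectation of the increment of the n-th moment, as a function of the present
moments. It is an exact expression for finite L and depends on the moments up to order n only.\<close>
definition walk_drift :: "nat \<Rightarrow> nat \<Rightarrow> complex fps \<Rightarrow> nat \<Rightarrow> complex" where
  "walk_drift L N z n = of_real (sin (pi * real n / real L) / (2 * sin (pi * real N / real L))) *
     (\<Sum>\<sigma>\<in>{1, -1}. cis (pi * of_int \<sigma> * real (N + n) / real L) * fps_nth (fexp (twist L N \<sigma> z)) n) / of_nat N"

lemma norm_cis_diff_le: "norm (cis a - cis b) \<le> \<bar>a - b\<bar>"
  unfolding cis_diff using abs_sin_x_le_abs_x[of "(a - b) / 2"] by (simp add: norm_mult)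

lemma walk_moments_norm: "norm (fps_nth (walk_moments L x) n) \<le> 1"
proof (cases "n = 0 \<or> length x = 0")
  case False
  have "norm (\<Sum>k<length x. cis (2 * pi * real n * of_int (x ! k) / real L)) \<le> real (length x)"
    by (rule order_trans[OF norm_sum]) simp
  then show ?thesis using False by (simp add: walk_moments_def norm_divide divide_simps)
qed (auto simp: walk_moments_def)

context
  fixes L N :: nat and x :: "int list" and \<psi> :: "int set \<Rightarrow> real"
  assumes L: "L \<ge> 3" and N: "N \<ge> 1" and NL: "N \<le> L - 1" and x: "x \<in> weyl_walks L N"
    and \<psi>: "perron_eigenvector L N \<psi>"
begin

lemma sin_circle_pos: "sin (pi / real L) > 0" "sin (pi * real N / real L) > 0"
  using L N NL by (auto intro!: sin_gt_zero simp: field_simps)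

lemma sum_over_positions:
  fixes G :: "int \<Rightarrow> complex"
  shows "(\<Sum>k<N. G (x ! k mod int L)) = (\<Sum>i\<in>residues_of L x. G i)"
  unfolding residues_of_eq[OF L N x] by (subst sum.reindex[OF walk_residues_inj[OF L N x]]) simp

lemma cis_residue: "cis (2 * pi * real n * of_int (i mod int L) / real L) = cis (2 * pi * real n * of_int i / real L)"
proof -
  have "real_of_int i = of_int (i mod int L) + of_int (i div int L) * real L"
    by (metis mod_mult_div_eq add.commute mult.commute of_int_add of_int_mult of_int_of_nat_eq)
  then have "2 * pi * real n * of_int i / real L = 2 * pi * real n * of_int (i mod int L) / real L + 2 * pi * of_int (int n * (i div int L))"
    using L by (simp add: field_simps)
  then have "cis (2 * pi * real n * of_int i / real L) = cis (2 * pi * real n * of_int (i mod int L) / real L) * cis (2 * pi * of_int (int n * (i div int L)))"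
    by (simp only: cis_mult)
  also have "cis (2 * pi * of_int (int n * (i div int L))) = 1"
    by (rule cis_multiple_2pi) simp
  finally show ?thesis by simp
qed

lemma twisted_sums_eq: "twisted_sums L \<sigma> (residues_of L x) = twist L N \<sigma> (walk_moments L x)"
proof (rule fps_ext)
  fix n
  have "power_sum L (residues_of L x) n = (\<Sum>k<N. cis (2 * pi * real n * of_int (x ! k) / real L))"
    unfolding power_sum_def[OF L] using sum_over_positions[of "\<lambda>i. cis (2 * pi * real n * of_int i / real L)"]
    by (simp only: cis_residue)
  then show "fps_nth (twisted_sums L \<sigma> (residues_of L x)) n = fps_nth (twist L N \<sigma> (walk_moments L x)) n"
    using N by (simp add: twisted_sums_def[OF L] twist_def walk_moments_def walk_length[OF L N x])
qed

lemma kernel_total: "(\<Sum>y | y \<in> weyl_walks L N \<and> walk_adj x y. messep_kernel L N \<psi> x y) = 1"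
proof -
  let ?A = "residues_of L x"
  have A: "?A \<in> configs L N" by (rule residues_of_configs[OF L N x])
  have rho: "messep_rho L N = 2 * sin (pi * real N / real L) / sin (pi / real L)"
    by (rule perron_eigenvector_ratio(1)[OF L _ \<psi>]) (use NL in simp)
  have h: "(\<Sum>k<N. complex_of_real (hop L ?A (x ! k mod int L) \<sigma>)) = of_real (sin (pi * real N / real L) / sin (pi / real L))"
    if "\<sigma> = 1 \<or> \<sigma> = -1" for \<sigma>
    using sum_over_positions[of "\<lambda>i. of_real (hop L ?A i \<sigma>)"] hop_total[OF L A that] by (simp flip: of_real_sum)
  have "complex_of_real (\<Sum>y | y \<in> weyl_walks L N \<and> walk_adj x y. messep_kernel L N \<psi> x y) =
      (\<Sum>\<sigma>\<in>{1, -1}. \<Sum>k<N. of_real (hop L ?A (x ! k mod int L) \<sigma>) * 1) / of_real (messep_rho L N)"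
    using kernel_sum(3)[OF L N x NL \<psi>, of "\<lambda>_. 1"] by simp
  also have "\<dots> = 1" using h[of 1] h[of "-1"] sin_circle_pos by (simp add: rho flip: of_real_divide of_real_add of_real_mult)
  finally show ?thesis by (simp only: of_real_eq_1_iff)
qed

lemma walk_moments_step:
  assumes k: "k < N" and n: "n > 0"
  shows "fps_nth (walk_moments L (x[k := x ! k + \<sigma>])) n - fps_nth (walk_moments L x) n =
    (cis (2 * pi * real n * of_int (x ! k + \<sigma>) / real L) - cis (2 * pi * real n * of_int (x ! k) / real L)) / of_nat N"
proof -
  let ?c = "\<lambda>i. cis (2 * pi * real n * of_int i / real L)"
  have "(\<Sum>j<N. ?c (x[k := x ! k + \<sigma>] ! j)) - (\<Sum>j<N. ?c (x ! j)) = (\<Sum>j<N. if j = k then ?c (x ! k + \<sigma>) - ?c (x ! k) else 0)"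
    unfolding sum_subtractf[symmetric] using k walk_length[OF L N x] by (intro sum.cong) auto
  also have "\<dots> = ?c (x ! k + \<sigma>) - ?c (x ! k)" using k by simp
  finally show ?thesis using n by (simp add: walk_moments_def walk_length[OF L N x] flip: diff_divide_distrib)
qed

text \<open>One particle moves by one site, so a moment changes by at most $2 \pi n/(L N)$.\<close>
lemma walk_moments_increment:
  assumes y: "y \<in> weyl_walks L N" "walk_adj x y"
  shows "norm (fps_nth (walk_moments L y) n - fps_nth (walk_moments L x) n) \<le> 2 * pi * real n / (real L * real N)"
proof (cases "n = 0")
  case False
  obtain k where k: "k < N" "y = x[k := x ! k + 1] \<or> y = x[k := x ! k - 1]"
    using y(2) walk_length[OF L N x] by (auto simp: walk_adj_def)
  then obtain \<sigma> :: int where \<sigma>: "\<bar>\<sigma>\<bar> = 1" "y = x[k := x ! k + \<sigma>]"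
    by (metis abs_1 abs_minus_cancel uminus_add_conv_diff add.commute)
  have "norm (fps_nth (walk_moments L y) n - fps_nth (walk_moments L x) n) =
      norm (cis (2 * pi * real n * of_int (x ! k + \<sigma>) / real L) - cis (2 * pi * real n * of_int (x ! k) / real L)) / real N"
    unfolding \<sigma>(2) walk_moments_step[OF k(1), of n] using False walk_moments_step[OF k(1), of n \<sigma>] by (simp add: norm_divide)
  also have "\<dots> \<le> \<bar>2 * pi * real n * of_int (x ! k + \<sigma>) / real L - 2 * pi * real n * of_int (x ! k) / real L\<bar> / real N"
    by (intro divide_right_mono norm_cis_diff_le) simp
  also have "2 * pi * real n * of_int (x ! k + \<sigma>) / real L - 2 * pi * real n * of_int (x ! k) / real L = 2 * pi * real n * of_int \<sigma> / real L"
    by (simp add: algebra_simps add_divide_distrib)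
  also have "\<bar>2 * pi * real n * of_int \<sigma> / real L\<bar> / real N = 2 * pi * real n / (real L * real N)"
  proof -
    have "\<bar>real_of_int \<sigma>\<bar> = 1" using \<sigma>(1) by linarith
    then show ?thesis by (simp add: abs_mult)
  qed
  finally show ?thesis .
qed (simp add: walk_moments_def)

text \<open>The increment of the n-th moment when the particle at i jumps is a phase times $\xi_i^n$; summing
against the jump rates is the moment identity for the rates.\<close>
lemma kernel_drift:
  assumes n: "n > 0"
  shows "(\<Sum>y | y \<in> weyl_walks L N \<and> walk_adj x y. of_real (messep_kernel L N \<psi> x y) *
      (fps_nth (walk_moments L y) n - fps_nth (walk_moments L x) n)) = walk_drift L N (walk_moments L x) n"
proof -
  let ?A = "residues_of L x" and ?c = "\<lambda>i. cis (2 * pi * real n * of_int i / real L)"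
  have A: "?A \<in> configs L N" by (rule residues_of_configs[OF L N x])
  then have AL: "?A \<subseteq> {0..<int L}" and cA: "card ?A = N" by (auto simp: configs_def)
  have rho: "messep_rho L N = 2 * sin (pi * real N / real L) / sin (pi / real L)"
    by (rule perron_eigenvector_ratio(1)[OF L _ \<psi>]) (use NL in simp)
  let ?F = "\<lambda>\<sigma>. fps_nth (fexp (twist L N \<sigma> (walk_moments L x))) n"
  have inner: "(\<Sum>k<N. of_real (hop L ?A (x ! k mod int L) \<sigma>) *
      (fps_nth (walk_moments L (x[k := x ! k + \<sigma>])) n - fps_nth (walk_moments L x) n)) =
      of_real (sin (pi * real n / real L) / sin (pi / real L)) * cis (pi * of_int \<sigma> * real (N + n) / real L) * ?F \<sigma> / of_nat N"
    (is "?lhs = ?rhs") if \<sigma>: "\<sigma> = 1 \<or> \<sigma> = -1" for \<sigma>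
  proof -
    let ?S = "\<Sum>i\<in>?A. of_real (hop L ?A i \<sigma>) * ?c i"
    let ?s = "sin (pi * of_int \<sigma> / real L)" and ?q = "cis (2 * pi * real n * of_int \<sigma> / real L)"
    have s0: "?s \<noteq> 0" using \<sigma> sin_circle_pos by auto
    have "?lhs = (\<Sum>k<N. of_real (hop L ?A (x ! k mod int L) \<sigma>) * ?c (x ! k mod int L)) * (?q - 1) / of_nat N"
      unfolding sum_distrib_right sum_divide_distrib
    proof (intro sum.cong refl)
      fix k assume "k \<in> {..<N}"
      then have k: "k < N" by simp
      have "?c (x ! k + \<sigma>) = ?c (x ! k) * ?q"
        unfolding cis_mult by (rule arg_cong[where f = cis]) (simp add: algebra_simps add_divide_distrib)
      then show "of_real (hop L ?A (x ! k mod int L) \<sigma>) * (fps_nth (walk_moments L (x[k := x ! k + \<sigma>])) n - fps_nth (walk_moments L x) n)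
          = of_real (hop L ?A (x ! k mod int L) \<sigma>) * ?c (x ! k mod int L) * (?q - 1) / of_nat N"
        unfolding walk_moments_step[OF k n] cis_residue by (simp add: right_diff_distrib diff_divide_distrib mult.assoc)
    qed
    also have "\<dots> = ?S * (?q - 1) / of_nat N"
      using sum_over_positions[of "\<lambda>i. of_real (hop L ?A i \<sigma>) * ?c i"] by simp
    also have "?S = cis (pi * of_int \<sigma> * real N / real L) * ?F \<sigma> / (2 * \<i> * of_real ?s)"
      using hop_power_sum[OF L AL \<sigma>, of n] n s0 unfolding cA twisted_sums_eq by (simp add: field_simps)
    also have "?q - 1 = 2 * \<i> * of_real (sin (pi * real n * of_int \<sigma> / real L)) * cis (pi * real n * of_int \<sigma> / real L)"
    proof -
      have h: "(2 * pi * real n * of_int \<sigma> / real L - 0) / 2 = pi * real n * of_int \<sigma> / real L"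
        "(2 * pi * real n * of_int \<sigma> / real L + 0) / 2 = pi * real n * of_int \<sigma> / real L" by simp_all
      show ?thesis using cis_diff[of "2 * pi * real n * of_int \<sigma> / real L" 0] unfolding h by simp
    qed
    also have "cis (pi * of_int \<sigma> * real N / real L) * ?F \<sigma> / (2 * \<i> * of_real ?s) *
        (2 * \<i> * of_real (sin (pi * real n * of_int \<sigma> / real L)) * cis (pi * real n * of_int \<sigma> / real L)) / of_nat N =
        of_real (sin (pi * real n * of_int \<sigma> / real L) / ?s) * (cis (pi * of_int \<sigma> * real N / real L) * cis (pi * real n * of_int \<sigma> / real L)) * ?F \<sigma> / of_nat N"
    proof -
      have gen: "c * f / (k * s) * (k * t * q) = t / s * (c * q) * f" if "k \<noteq> 0" "s \<noteq> 0" for c f k s t q :: complex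
        using that by (simp add: field_simps)
      have "2 * \<i> \<noteq> 0" "complex_of_real ?s \<noteq> 0" using s0 by auto
      from gen[OF this] show ?thesis unfolding of_real_divide by (rule arg_cong[where f = "\<lambda>w. w / of_nat N"])
    qed
    also have "sin (pi * real n * of_int \<sigma> / real L) / ?s = sin (pi * real n / real L) / sin (pi / real L)"
      using \<sigma> by auto
    also have "cis (pi * of_int \<sigma> * real N / real L) * cis (pi * real n * of_int \<sigma> / real L) = cis (pi * of_int \<sigma> * real (N + n) / real L)"
      unfolding cis_mult by (rule arg_cong[where f = cis]) (simp add: algebra_simps add_divide_distrib)
    finally show ?thesis .
  qed
  have "(\<Sum>y | y \<in> weyl_walks L N \<and> walk_adj x y. of_real (messep_kernel L N \<psi> x y) *
      (fps_nth (walk_moments L y) n - fps_nth (walk_moments L x) n)) =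
      (\<Sum>\<sigma>\<in>{1, -1}. of_real (sin (pi * real n / real L) / sin (pi / real L)) * cis (pi * of_int \<sigma> * real (N + n) / real L) * ?F \<sigma> / of_nat N) / of_real (messep_rho L N)"
    unfolding kernel_sum(3)[OF L N x NL \<psi>]
    by (rule arg_cong[where f = "\<lambda>w. w / _"], rule sum.cong[OF refl], rule inner) auto
  also have "\<dots> = walk_drift L N (walk_moments L x) n"
  proof -
    have gen: "(R * u * f / c + R * v * g / c) / p = (R / p) * (u * f + v * g) / c" for R u v f g c p :: complex
      by (simp add: add_divide_distrib distrib_left mult.assoc mult.commute[of c])
    have R: "complex_of_real (sin (pi * real n / real L) / sin (pi / real L)) / of_real (messep_rho L N) =
        of_real (sin (pi * real n / real L) / (2 * sin (pi * real N / real L)))"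
      unfolding rho using sin_circle_pos by (simp flip: of_real_divide)
    have s2: "(\<Sum>\<sigma>\<in>{1, -1}. h \<sigma>) = h 1 + h (-1)" for h :: "int \<Rightarrow> complex" by simp
    show ?thesis unfolding walk_drift_def s2 R[symmetric] by (rule gen)
  qed
  finally show ?thesis .
qed

lemma walk_drift_bound:
  assumes n: "n > 0"
  shows "norm (walk_drift L N (walk_moments L x) n) \<le> 2 * pi * real n / (real L * real N)"
proof -
  let ?S = "{y. y \<in> weyl_walks L N \<and> walk_adj x y}"
  have "norm (walk_drift L N (walk_moments L x) n) \<le> (\<Sum>y\<in>?S. messep_kernel L N \<psi> x y * (2 * pi * real n / (real L * real N)))"
    unfolding kernel_drift[OF n, symmetric]
  proof (rule sum_norm_le)
    fix y assume y: "y \<in> ?S"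
    have k0: "messep_kernel L N \<psi> x y \<ge> 0" by (rule kernel_sum(2)[OF L N x NL \<psi>])
    have "norm (of_real (messep_kernel L N \<psi> x y) * (fps_nth (walk_moments L y) n - fps_nth (walk_moments L x) n))
        = messep_kernel L N \<psi> x y * norm (fps_nth (walk_moments L y) n - fps_nth (walk_moments L x) n)"
      using k0 by (simp add: norm_mult)
    also have "\<dots> \<le> messep_kernel L N \<psi> x y * (2 * pi * real n / (real L * real N))"
      by (rule mult_left_mono[OF walk_moments_increment k0]) (use y in auto)
    finally show "norm (of_real (messep_kernel L N \<psi> x y) * (fps_nth (walk_moments L y) n - fps_nth (walk_moments L x) n))
        \<le> messep_kernel L N \<psi> x y * (2 * pi * real n / (real L * real N))" .
  qed
  also have "\<dots> = 2 * pi * real n / (real L * real N)"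
    by (simp only: sum_distrib_right[symmetric] kernel_total mult_1)
  finally show ?thesis .
qed

end

text \<open>A variable whose integral vanishes on every atom of a countable partition is orthogonal to all bounded
functions of the partition.\<close>
lemma integral_function_of_countable_eq_0:
  fixes f :: "'a \<Rightarrow> complex" and H :: "'a \<Rightarrow> 'b :: countable"
  assumes H: "H \<in> measurable M (count_space UNIV)" and f: "integrable M f"
    and 0: "\<And>l. (LINT \<omega>:{\<omega> \<in> space M. H \<omega> = l}|M. f \<omega>) = 0"
    and s: "\<And>\<omega>. \<omega> \<in> space M \<Longrightarrow> norm (s (H \<omega>)) \<le> B"
  shows "(LINT \<omega>|M. s (H \<omega>) * f \<omega>) = 0"
proof -
  let ?A = "\<lambda>i. {\<omega> \<in> space M. H \<omega> \<in> {l. to_nat l = i}}"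
  have sm: "(\<lambda>\<omega>. s (H \<omega>)) \<in> borel_measurable M"
    using measurable_compose[OF H, of s borel] by simp
  have int: "integrable M (\<lambda>\<omega>. s (H \<omega>) * f \<omega>)"
  proof (rule Bochner_Integration.integrable_bound)
    show "integrable M (\<lambda>\<omega>. of_real B * f \<omega>)" using f by simp
    show "AE \<omega> in M. norm (s (H \<omega>) * f \<omega>) \<le> norm (of_real B * f \<omega>)"
    proof (rule AE_I2)
      fix \<omega> assume "\<omega> \<in> space M"
      from s[OF this] have "norm (s (H \<omega>)) \<le> \<bar>B\<bar>" by linarith
      then show "norm (s (H \<omega>) * f \<omega>) \<le> norm (of_real B * f \<omega>)" by (simp add: norm_mult mult_right_mono)
    qed
  qed (use sm f in auto)
  have un: "(\<Union>i. ?A i) = space M" by auto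
  have "(LINT \<omega>|M. s (H \<omega>) * f \<omega>) = (LINT \<omega>:(\<Union>i. ?A i)|M. s (H \<omega>) * f \<omega>)"
    unfolding un set_lebesgue_integral_def by (rule Bochner_Integration.integral_cong) auto
  also have "\<dots> = (\<Sum>i. LINT \<omega>:?A i|M. s (H \<omega>) * f \<omega>)"
  proof (rule lebesgue_integral_countable_add)
    show "?A i \<in> sets M" for i using measurable_sets[OF H, of "{l. to_nat l = i}"] by (simp add: vimage_def Int_def conj_commute)
    show "set_integrable M (\<Union>i. ?A i) (\<lambda>\<omega>. s (H \<omega>) * f \<omega>)"
      unfolding un set_integrable_def by (rule Bochner_Integration.integrable_cong[THEN iffD1, OF refl _ int]) auto
  qed auto
  also have "\<dots> = (\<Sum>i. 0)"
  proof (intro suminf_cong)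
    fix i
    show "(LINT \<omega>:?A i|M. s (H \<omega>) * f \<omega>) = 0"
    proof (cases "\<exists>l :: 'b. to_nat l = i")
      case True
      then obtain l :: 'b where l: "to_nat l = i" by blast
      then have A: "?A i = {\<omega> \<in> space M. H \<omega> = l}" by auto
      have "(LINT \<omega>:?A i|M. s (H \<omega>) * f \<omega>) = (LINT \<omega>|M. s l * (indicator {\<omega> \<in> space M. H \<omega> = l} \<omega> *\<^sub>R f \<omega>))"
        unfolding A set_lebesgue_integral_def
        by (rule Bochner_Integration.integral_cong) (auto simp: indicator_def)
      also have "\<dots> = s l * (LINT \<omega>:{\<omega> \<in> space M. H \<omega> = l}|M. f \<omega>)"
        by (simp only: set_lebesgue_integral_def integral_mult_right_zero)
      finally show ?thesis by (simp add: 0)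
    next
      case False
      then have "?A i = {}" by auto
      then show ?thesis by (simp add: set_lebesgue_integral_def)
    qed
  qed
  finally show ?thesis by simp
qed

context
  fixes M :: "'a measure" and L N :: nat and \<psi> :: "int set \<Rightarrow> real" and X :: "nat \<Rightarrow> 'a \<Rightarrow> int list"
  assumes M: "prob_space M" and L: "L \<ge> 3" and N: "N \<ge> 1" and NL: "N \<le> L - 1"
    and \<psi>: "perron_eigenvector L N \<psi>" and X: "messep M L N \<psi> X"
begin

text \<open>The list of states up to time m takes countably many values, so conditioning on the past
reduces to conditioning on events.\<close>
definition history :: "nat \<Rightarrow> 'a \<Rightarrow> int list list" where
  "history m \<omega> = map (\<lambda>i. X i \<omega>) [0..<Suc m]"

lemma messep_measurable: "X m \<in> measurable M (count_space UNIV)"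
  and messep_weyl: "\<omega> \<in> space M \<Longrightarrow> X m \<omega> \<in> weyl_walks L N"
  by (rule X[unfolded messep_def, THEN conjunct1, THEN spec])
     (erule X[unfolded messep_def, THEN conjunct2, THEN conjunct1, THEN spec, THEN bspec])

lemma messep_function_measurable: "(\<lambda>\<omega>. f (X m \<omega>)) \<in> borel_measurable M"
  using measurable_compose[OF messep_measurable, of f borel] by simp

lemma history_eq_iff: "history m \<omega> = l \<longleftrightarrow> length l = Suc m \<and> (\<forall>i\<le>m. X i \<omega> = l ! i)"
proof -
  have "history m \<omega> = l \<longleftrightarrow> length l = Suc m \<and> (\<forall>i<Suc m. history m \<omega> ! i = l ! i)"
    by (subst list_eq_iff_nth_eq) (auto simp: history_def simp del: upt_Suc)
  moreover have "history m \<omega> ! i = X i \<omega>" if "i < Suc m" for i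
    using that by (simp add: history_def del: upt_Suc)
  ultimately show ?thesis by (auto simp: less_Suc_eq_le)
qed

lemma messep_event: "{\<omega> \<in> space M. X m \<omega> = y} \<in> sets M"
proof -
  have "{\<omega> \<in> space M. X m \<omega> = y} = X m -` {y} \<inter> space M" by auto
  then show ?thesis using measurable_sets[OF messep_measurable, of "{y}" m] by simp
qed

lemma history_event: "{\<omega> \<in> space M. history m \<omega> = l} \<in> sets M"
proof (cases "length l = Suc m")
  case True
  have "{\<omega> \<in> space M. history m \<omega> = l} = (\<Inter>i\<in>{..m}. {\<omega> \<in> space M. X i \<omega> = l ! i})"
    using True by (auto simp: history_eq_iff)
  also have "\<dots> \<in> sets M" by (intro sets.finite_INT messep_event) auto
  finally show ?thesis .
next
  case False
  then have "{\<omega> \<in> space M. history m \<omega> = l} = {}" by (auto simp: history_eq_iff)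
  then show ?thesis by (simp only: sets.empty_sets)
qed

lemma history_measurable: "history m \<in> measurable M (count_space UNIV)"
  unfolding measurable_count_space_eq2_countable
proof (intro conjI ballI)
  fix l
  have "history m -` {l} \<inter> space M = {\<omega> \<in> space M. history m \<omega> = l}" by auto
  then show "history m -` {l} \<inter> space M \<in> sets M" using history_event[of m l] by simp
qed auto

lemma history_next:
  assumes "length l = Suc m"
  shows "measure M {\<omega> \<in> space M. history m \<omega> = l \<and> X (Suc m) \<omega> = y} =
    measure M {\<omega> \<in> space M. history m \<omega> = l} * messep_kernel L N \<psi> (l ! m) y"
proof -
  interpret prob_space M by (rule M)
  let ?h = "\<lambda>i. l ! i"
  have e: "{\<omega> \<in> space M. history m \<omega> = l} = {\<omega> \<in> space M. \<forall>i\<le>m. X i \<omega> = ?h i}"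
    "{\<omega> \<in> space M. history m \<omega> = l \<and> X (Suc m) \<omega> = y} = {\<omega> \<in> space M. X (Suc m) \<omega> = y \<and> (\<forall>i\<le>m. X i \<omega> = ?h i)}"
    using assms by (auto simp: history_eq_iff)
  let ?Q = "{\<omega> \<in> space M. \<forall>i\<le>m. X i \<omega> = ?h i}"
  let ?R = "{\<omega> \<in> space M. X (Suc m) \<omega> = y \<and> (\<forall>i\<le>m. X i \<omega> = ?h i)}"
  have "prob ?R = prob ?Q * messep_kernel L N \<psi> (?h m) y"
  proof (cases "prob ?Q = 0")
    case True
    have "?Q \<in> sets M" using history_event[of m l] unfolding e(1) .
    then have "prob ?R \<le> prob ?Q" by (rule finite_measure_mono[rotated]) blast
    then have "prob ?R = 0" using True measure_nonneg[of M ?R] by linarith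
    then show ?thesis using True by simp
  next
    case False
    from X[unfolded messep_def, THEN conjunct2, THEN conjunct2, rule_format, OF False, of y]
    have "prob ?R / prob ?Q = messep_kernel L N \<psi> (?h m) y" unfolding cond_prob_def .
    from this[unfolded nonzero_divide_eq_eq[OF False]] show ?thesis by (rule trans[OF _ mult.commute])
  qed
  then show ?thesis unfolding e .
qed

lemma messep_step_AE: "AE \<omega> in M. \<forall>m. X (Suc m) \<omega> \<in> weyl_walks L N \<and> walk_adj (X m \<omega>) (X (Suc m) \<omega>)"
proof -
  interpret prob_space M by (rule M)
  have "AE \<omega> in M. \<not> (history m \<omega> = l \<and> X (Suc m) \<omega> = y \<and> \<not> (y \<in> weyl_walks L N \<and> walk_adj (X m \<omega>) y))" for m l y
  proof (cases "length l = Suc m \<and> \<not> (y \<in> weyl_walks L N \<and> walk_adj (l ! m) y)")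
    case True
    let ?E = "{\<omega> \<in> space M. history m \<omega> = l \<and> X (Suc m) \<omega> = y}"
    have "?E = {\<omega> \<in> space M. history m \<omega> = l} \<inter> {\<omega> \<in> space M. X (Suc m) \<omega> = y}" by auto
    then have "?E \<in> sets M" using history_event messep_event by auto
    moreover have "prob ?E = 0" using True history_next[of l m y] by (auto simp: messep_kernel_def)
    ultimately show ?thesis by (intro AE_I[where N = ?E]) (auto simp: emeasure_eq_measure)
  next
    case False
    then show ?thesis by (intro AE_I2) (auto simp: history_eq_iff)
  qed
  then have "AE \<omega> in M. \<forall>m l y. \<not> (history m \<omega> = l \<and> X (Suc m) \<omega> = y \<and> \<not> (y \<in> weyl_walks L N \<and> walk_adj (X m \<omega>) y))"
    unfolding AE_all_countable by blast
  then show ?thesis by eventually_elim blast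
qed

definition noise :: "nat \<Rightarrow> nat \<Rightarrow> 'a \<Rightarrow> complex" where
  "noise n m \<omega> = fps_nth (walk_moments L (X (Suc m) \<omega>)) n - fps_nth (walk_moments L (X m \<omega>)) n
     - walk_drift L N (walk_moments L (X m \<omega>)) n"

lemma noise_measurable: "noise n m \<in> borel_measurable M"
  unfolding noise_def[abs_def]
  using messep_function_measurable[of "\<lambda>x. fps_nth (walk_moments L x) n"]
    messep_function_measurable[of "\<lambda>x. walk_drift L N (walk_moments L x) n"]
  by (intro borel_measurable_diff) auto

lemma noise_bound:
  assumes n: "n > 0"
  shows "AE \<omega> in M. norm (noise n m \<omega>) \<le> 4 * pi * real n / (real L * real N)"
  using messep_step_AE AE_space
proof eventually_elim
  case (elim \<omega>)
  have x: "X m \<omega> \<in> weyl_walks L N" using elim messep_weyl by blast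
  have "norm (noise n m \<omega>) \<le> 2 * pi * real n / (real L * real N) + 2 * pi * real n / (real L * real N)"
    unfolding noise_def
    by (intro order_trans[OF norm_triangle_ineq4] add_mono walk_moments_increment[OF L N NL x \<psi>] walk_drift_bound[OF L N NL x \<psi> n])
       (use elim in auto)
  also have "\<dots> = 4 * pi * real n / (real L * real N)" by simp
  finally show ?case .
qed

lemma noise_integrable: "n > 0 \<Longrightarrow> integrable M (noise n m)"
proof -
  assume n: "n > 0"
  interpret prob_space M by (rule M)
  show ?thesis by (rule integrable_const_bound[OF noise_bound[OF n] noise_measurable])
qed

text \<open>On each event of the past the drift is the conditional mean of the increment, by the Markov property
in the elementary form of the definition of the chain.\<close>
lemma noise_centred:
  assumes n: "n > 0"
  shows "(LINT \<omega>:{\<omega> \<in> space M. history m \<omega> = l}|M. noise n m \<omega>) = 0"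
proof (cases "length l = Suc m \<and> (\<exists>\<omega>\<in>space M. history m \<omega> = l)")
  case False
  then have e: "{\<omega> \<in> space M. history m \<omega> = l} = {}" by (auto simp: history_eq_iff)
  show ?thesis unfolding e by (simp add: set_lebesgue_integral_def)
next
  case True
  interpret prob_space M by (rule M)
  let ?x = "l ! m"
  have x: "?x \<in> weyl_walks L N" using True messep_weyl by (metis history_eq_iff order_refl)
  let ?S = "{y. y \<in> weyl_walks L N \<and> walk_adj ?x y}"
  let ?d = "walk_drift L N (walk_moments L ?x) n"
  let ?f = "\<lambda>y. fps_nth (walk_moments L y) n - fps_nth (walk_moments L ?x) n - ?d"
  let ?E = "\<lambda>y. {\<omega> \<in> space M. history m \<omega> = l \<and> X (Suc m) \<omega> = y}"
  have fin: "finite ?S" by (rule kernel_sum(1)[OF L N x NL \<psi>])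
  have E: "?E y \<in> sets M" for y
  proof -
    have "?E y = {\<omega> \<in> space M. history m \<omega> = l} \<inter> {\<omega> \<in> space M. X (Suc m) \<omega> = y}" by auto
    then show ?thesis using history_event messep_event by auto
  qed
  have "(LINT \<omega>:{\<omega> \<in> space M. history m \<omega> = l}|M. noise n m \<omega>) = (LINT \<omega>|M. (\<Sum>y\<in>?S. indicator (?E y) \<omega> *\<^sub>R ?f y))"
    unfolding set_lebesgue_integral_def
  proof (rule integral_cong_AE)
    show "(\<lambda>\<omega>. indicator {\<omega> \<in> space M. history m \<omega> = l} \<omega> *\<^sub>R noise n m \<omega>) \<in> borel_measurable M"
      using history_event noise_measurable by auto
    show "(\<lambda>\<omega>. \<Sum>y\<in>?S. indicator (?E y) \<omega> *\<^sub>R ?f y) \<in> borel_measurable M"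
      using E by auto
    show "AE \<omega> in M. indicator {\<omega> \<in> space M. history m \<omega> = l} \<omega> *\<^sub>R noise n m \<omega> = (\<Sum>y\<in>?S. indicator (?E y) \<omega> *\<^sub>R ?f y)"
      using messep_step_AE AE_space
    proof eventually_elim
      case (elim \<omega>)
      show ?case
      proof (cases "history m \<omega> = l")
        case hl: True
        then have xm: "X m \<omega> = ?x" by (auto simp: history_eq_iff)
        have "(\<Sum>y\<in>?S. indicator (?E y) \<omega> *\<^sub>R ?f y) = (\<Sum>y\<in>?S. if y = X (Suc m) \<omega> then ?f y else 0)"
          using hl elim by (intro sum.cong) (auto simp: indicator_def)
        also have "\<dots> = ?f (X (Suc m) \<omega>)"
        proof -
          have "X (Suc m) \<omega> \<in> ?S" using elim(1)[rule_format, of m] xm by simp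
          then show ?thesis using fin by simp
        qed
        finally show ?thesis using hl elim by (simp add: noise_def xm)
      next
        case False
        then show ?thesis by simp
      qed
    qed
  qed
  also have "\<dots> = (\<Sum>y\<in>?S. LINT \<omega>|M. indicator (?E y) \<omega> *\<^sub>R ?f y)"
    using E by (intro Bochner_Integration.integral_sum) (auto intro!: integrable_scaleR_left integrable_real_indicator simp: emeasure_eq_measure)
  also have "\<dots> = (\<Sum>y\<in>?S. prob (?E y) *\<^sub>R ?f y)"
    using E by (intro sum.cong refl) (simp add: integrable_real_indicator emeasure_eq_measure)
  also have "\<dots> = (\<Sum>y\<in>?S. prob {\<omega> \<in> space M. history m \<omega> = l} *\<^sub>R (of_real (messep_kernel L N \<psi> ?x y) * ?f y))"
    using True history_next[of l m] by (intro sum.cong refl) (simp add: scaleR_conv_of_real)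
  also have "\<dots> = prob {\<omega> \<in> space M. history m \<omega> = l} *\<^sub>R (\<Sum>y\<in>?S. of_real (messep_kernel L N \<psi> ?x y) * ?f y)"
    by (simp add: scaleR_sum_right)
  also have "(\<Sum>y\<in>?S. of_real (messep_kernel L N \<psi> ?x y) * ?f y) =
      (\<Sum>y\<in>?S. of_real (messep_kernel L N \<psi> ?x y) * (fps_nth (walk_moments L y) n - fps_nth (walk_moments L ?x) n))
      - of_real (\<Sum>y\<in>?S. messep_kernel L N \<psi> ?x y) * ?d"
    by (simp only: right_diff_distrib sum_subtractf sum_distrib_right of_real_sum)
  also have "\<dots> = 0"
    unfolding kernel_drift[OF L N NL x \<psi> n] kernel_total[OF L N NL x \<psi>] by simp
  finally show ?thesis by simp
qed

text \<open>The noise terms are orthogonal in $L^2$, so the second moment of their sum grows linearly in the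
number of steps. After $L^2 t$ steps the bound is of order $1/N$.\<close>
lemma noise_sum_L1:
  assumes n: "n > 0"
  shows "(LINT \<omega>|M. norm (\<Sum>i<m. noise n i \<omega>)) \<le> sqrt (real m) * (4 * pi * real n / (real L * real N))"
proof -
  interpret prob_space M by (rule M)
  let ?C = "4 * pi * real n / (real L * real N)"
  have C: "?C > 0" using n L N by simp
  define S where "S m \<omega> = (\<Sum>i<m. noise n i \<omega>)" for m \<omega>
  have Sm [measurable]: "S m \<in> borel_measurable M" for m
    unfolding S_def[abs_def] using noise_measurable by (intro borel_measurable_sum) auto
  have nm [measurable]: "noise n m \<in> borel_measurable M" for m by (rule noise_measurable)
  have Sb: "AE \<omega> in M. norm (S m \<omega>) \<le> real m * ?C" for m
  proof -
    have "AE \<omega> in M. \<forall>i\<in>{..<m}. norm (noise n i \<omega>) \<le> ?C"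
      using noise_bound[OF n] by (intro AE_finite_allI) auto
    then show ?thesis
    proof eventually_elim
      case (elim \<omega>)
      show ?case unfolding S_def using elim by (intro order_trans[OF norm_sum] order_trans[OF sum_bounded_above[where K = ?C]]) auto
    qed
  qed
  have i2: "integrable M (\<lambda>\<omega>. (norm (S m \<omega>))\<^sup>2)" for m
  proof (rule integrable_const_bound[where B = "(real m * ?C)\<^sup>2"])
    show "AE \<omega> in M. norm ((norm (S m \<omega>))\<^sup>2) \<le> (real m * ?C)\<^sup>2"
      using Sb[of m] by eventually_elim (auto intro!: power_mono)
  qed measurable
  have S_history: "\<exists>s. (\<forall>\<omega>. S m \<omega> = s (history m \<omega>)) \<and> (\<forall>\<omega>\<in>space M. norm (S m \<omega>) \<le> real m * (2 + ?C))" for m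
  proof -
    let ?z = "\<lambda>x. fps_nth (walk_moments L x) n"
    let ?s = "\<lambda>l. \<Sum>i<m. ?z (l ! Suc i) - ?z (l ! i) - walk_drift L N (walk_moments L (l ! i)) n"
    have s: "S m \<omega> = ?s (history m \<omega>)" for \<omega>
      unfolding S_def noise_def history_def by (intro sum.cong refl) (simp del: upt_Suc)
    have b: "norm (S m \<omega>) \<le> real m * (2 + ?C)" if "\<omega> \<in> space M" for \<omega>
    proof -
      have "norm (noise n i \<omega>) \<le> 2 + ?C" for i
      proof -
        have "norm (walk_drift L N (walk_moments L (X i \<omega>)) n) \<le> 2 * pi * real n / (real L * real N)"
          by (rule walk_drift_bound[OF L N NL messep_weyl[OF that] \<psi> n])
        also have "\<dots> \<le> ?C" by (intro divide_right_mono) auto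
        finally have "norm (walk_drift L N (walk_moments L (X i \<omega>)) n) \<le> ?C" .
        moreover have "norm (?z (X (Suc i) \<omega>) - ?z (X i \<omega>)) \<le> 1 + 1"
          by (intro order_trans[OF norm_triangle_ineq4] add_mono walk_moments_norm)
        ultimately show ?thesis unfolding noise_def by (intro order_trans[OF norm_triangle_ineq4]) linarith
      qed
      then show ?thesis unfolding S_def by (intro order_trans[OF norm_sum] order_trans[OF sum_bounded_above[where K = "2 + ?C"]]) auto
    qed
    show ?thesis by (rule exI[of _ ?s], rule conjI, rule allI, rule s, rule ballI, rule b)
  qed
  have step: "(LINT \<omega>|M. (norm (S (Suc m) \<omega>))\<^sup>2) \<le> (LINT \<omega>|M. (norm (S m \<omega>))\<^sup>2) + ?C\<^sup>2" for m
  proof -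
    obtain s where s: "\<And>\<omega>. S m \<omega> = s (history m \<omega>)" and sb: "\<And>\<omega>. \<omega> \<in> space M \<Longrightarrow> norm (S m \<omega>) \<le> real m * (2 + ?C)"
      using S_history[of m] by blast
    have orth: "(LINT \<omega>|M. cnj (s (history m \<omega>)) * noise n m \<omega>) = 0"
      by (rule integral_function_of_countable_eq_0[where s = "\<lambda>l. cnj (s l)" and B = "real m * (2 + ?C)", OF history_measurable noise_integrable[OF n] noise_centred[OF n]])
         (use sb s in simp)
    have ic: "integrable M (\<lambda>\<omega>. cnj (S m \<omega>) * noise n m \<omega>)"
    proof (rule integrable_const_bound[where B = "(real m * ?C) * ?C"])
      show "AE \<omega> in M. norm (cnj (S m \<omega>) * noise n m \<omega>) \<le> (real m * ?C) * ?C"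
        using Sb[of m] noise_bound[OF n, of m]
        by eventually_elim (simp only: norm_mult complex_mod_cnj, intro mult_mono, use C in auto)
      have "(\<lambda>\<omega>. cnj (S m \<omega>)) \<in> borel_measurable M"
        by (rule measurable_compose[OF Sm borel_measurable_continuous_onI]) (intro continuous_intros)
      then show "(\<lambda>\<omega>. cnj (S m \<omega>) * noise n m \<omega>) \<in> borel_measurable M"
        by (intro borel_measurable_times nm)
    qed
    have in2: "integrable M (\<lambda>\<omega>. (norm (noise n m \<omega>))\<^sup>2)"
    proof (rule integrable_const_bound[where B = "?C\<^sup>2"])
      show "AE \<omega> in M. norm ((norm (noise n m \<omega>))\<^sup>2) \<le> ?C\<^sup>2"
        using noise_bound[OF n, of m] by eventually_elim (auto intro!: power_mono)
    qed measurable
    have sq: "(norm (S (Suc m) \<omega>))\<^sup>2 = (norm (S m \<omega>))\<^sup>2 + (norm (noise n m \<omega>))\<^sup>2 + 2 * Re (cnj (S m \<omega>) * noise n m \<omega>)" for \<omega>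
    proof -
      have "(norm (s + d))\<^sup>2 = (norm s)\<^sup>2 + (norm d)\<^sup>2 + 2 * Re (cnj s * d)" for s d :: complex
        unfolding cmod_power2 by (simp add: power2_eq_square algebra_simps)
      then show ?thesis unfolding S_def sum.lessThan_Suc .
    qed
    have "(LINT \<omega>|M. (norm (S (Suc m) \<omega>))\<^sup>2) = (LINT \<omega>|M. (norm (S m \<omega>))\<^sup>2) + (LINT \<omega>|M. (norm (noise n m \<omega>))\<^sup>2) +
        2 * Re (LINT \<omega>|M. cnj (S m \<omega>) * noise n m \<omega>)"
    proof -
      define c where "c \<omega> = Re (cnj (S m \<omega>) * noise n m \<omega>)" for \<omega>
      have c: "integrable M c" "(LINT \<omega>|M. c \<omega>) = Re (LINT \<omega>|M. cnj (S m \<omega>) * noise n m \<omega>)"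
        unfolding c_def by (rule integrable_Re[OF ic], rule integral_Re[OF ic])
      have "(norm (S (Suc m) \<omega>))\<^sup>2 = (norm (S m \<omega>))\<^sup>2 + (norm (noise n m \<omega>))\<^sup>2 + 2 * c \<omega>" for \<omega>
        unfolding c_def by (rule sq)
      then show ?thesis using i2[of m] in2 c by simp
    qed
    also have "(LINT \<omega>|M. cnj (S m \<omega>) * noise n m \<omega>) = 0" using orth by (simp add: s)
    also have "(LINT \<omega>|M. (norm (noise n m \<omega>))\<^sup>2) \<le> (LINT \<omega>|M. ?C\<^sup>2)"
      by (rule integral_mono_AE[OF in2]) (use noise_bound[OF n, of m] in \<open>auto elim!: eventually_mono intro!: power_mono\<close>)
    finally show ?thesis by (simp add: prob_space)
  qed
  have L2: "(LINT \<omega>|M. (norm (S m \<omega>))\<^sup>2) \<le> real m * ?C\<^sup>2" for m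
  proof (induction m)
    case (Suc m)
    then show ?case using step[of m] by (simp add: algebra_simps)
  qed (simp add: S_def)
  show ?thesis
  proof (cases "m = 0")
    case False
    define e where "e = sqrt (real m) * ?C"
    have e: "e > 0" unfolding e_def by (intro mult_pos_pos C) (use False in simp)
    have iS: "integrable M (\<lambda>\<omega>. norm (S m \<omega>))"
      by (rule integrable_const_bound[where B = "real m * ?C"]) (use Sb[of m] in auto)
    have "(LINT \<omega>|M. norm (S m \<omega>)) \<le> (LINT \<omega>|M. e / 2 + (norm (S m \<omega>))\<^sup>2 / (2 * e))"
    proof (rule integral_mono[OF iS])
      show "integrable M (\<lambda>\<omega>. e / 2 + (norm (S m \<omega>))\<^sup>2 / (2 * e))" using i2 by simp
      fix \<omega>
      have "0 \<le> (norm (S m \<omega>) - e)\<^sup>2" by simp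
      then show "norm (S m \<omega>) \<le> e / 2 + (norm (S m \<omega>))\<^sup>2 / (2 * e)"
        using e by (simp add: power2_eq_square field_simps)
    qed
    also have "\<dots> = e / 2 + (LINT \<omega>|M. (norm (S m \<omega>))\<^sup>2) / (2 * e)"
      using i2 by (simp add: prob_space)
    also have "\<dots> \<le> e / 2 + (real m * ?C\<^sup>2) / (2 * e)"
      using L2 e by (intro add_left_mono divide_right_mono) auto
    also have "real m * ?C\<^sup>2 = e\<^sup>2" unfolding e_def power_mult_distrib by simp
    also have "e / 2 + e\<^sup>2 / (2 * e) = e" using e by (simp add: power2_eq_square)
    finally show ?thesis by (simp add: S_def e_def)
  qed simp
qed

end

section \<open>Densities with prescribed moments\<close>

lemma integral_cis_period:
  "(LBINT x:{0..2 * pi}. cis (of_int k * x)) = (if k = 0 then of_real (2 * pi) else 0)"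
proof (cases "k = 0")
  case True
  have "(LBINT x:{0..2 * pi}. (1 :: complex)) = of_real (2 * pi) - of_real 0"
    unfolding set_lebesgue_integral_def
    by (rule integral_FTC_Icc) (auto intro!: has_vector_derivative_of_real derivative_eq_intros continuous_intros)
  then show ?thesis using True by simp
next
  case False
  let ?F = "\<lambda>x. cis (of_int k * x) / (\<i> * of_int k)"
  have "(LBINT x:{0..2 * pi}. cis (of_int k * x)) = ?F (2 * pi) - ?F 0"
    unfolding set_lebesgue_integral_def
  proof (rule integral_FTC_Icc)
    fix x assume "0 \<le> x" "x \<le> 2 * pi"
    let ?c = "\<i> * of_int k"
    have "((\<lambda>z. exp (?c * z)) has_field_derivative exp (?c * of_real x) * ?c) (at (of_real x))"
      by (auto intro!: derivative_eq_intros)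
    from has_vector_derivative_real_field[OF DERIV_cdivide[OF this, of ?c]] False
    show "(?F has_vector_derivative cis (of_int k * x)) (at x within {0..2 * pi})"
      by (simp add: cis_conv_exp mult.assoc)
  qed (auto intro!: continuous_intros)
  also have "?F (2 * pi) = ?F 0"
    using cis_multiple_2pi[of "of_int k"] by (simp add: mult_ac)
  finally show ?thesis using False by simp
qed

lemma set_integrable_period: "continuous_on UNIV f \<Longrightarrow> set_integrable lborel {0..2 * pi} (f :: real \<Rightarrow> complex)"
  by (rule borel_integrable_atLeastAtMost') (rule continuous_on_subset[OF _ subset_UNIV])

lemma set_integral_sum_period:
  fixes F :: "'i \<Rightarrow> real \<Rightarrow> complex"
  assumes "\<And>i. i \<in> I \<Longrightarrow> continuous_on UNIV (F i)"
  shows "(LBINT x:{0..2 * pi}. \<Sum>i\<in>I. F i x) = (\<Sum>i\<in>I. LBINT x:{0..2 * pi}. F i x)"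
  unfolding set_lebesgue_integral_def scaleR_sum_right
  by (rule Bochner_Integration.integral_sum) (rule set_integrable_period[unfolded set_integrable_def, OF assms])

text \<open>The Fourier coefficients of a real measure extended to negative indices.\<close>
definition hermitian :: "(nat \<Rightarrow> complex) \<Rightarrow> int \<Rightarrow> complex" where
  "hermitian m k = (if k \<ge> 0 then m (nat k) else cnj (m (nat (- k))))"

text \<open>Up to the factor $2 \pi$, the mean of Fejer of order K of the measure with moments m. Bounds on all
these means characterise densities with values between 0 and $C/2\pi$, and they are closed
conditions on finitely many moments each.\<close>
definition fejer_mean :: "(nat \<Rightarrow> complex) \<Rightarrow> nat \<Rightarrow> real \<Rightarrow> real" where
  "fejer_mean m K x = Re (\<Sum>j<K. \<Sum>l<K. hermitian m (int j - int l) * cis (- (of_int (int j - int l) * x))) / real K"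

lemma hermitian_uminus: "m 0 = 1 \<Longrightarrow> hermitian m (- k) = cnj (hermitian m k)"
  by (auto simp: hermitian_def)

lemma of_real_fejer_mean:
  assumes "m 0 = 1"
  shows "complex_of_real (fejer_mean m K x) =
    (\<Sum>j<K. \<Sum>l<K. hermitian m (int j - int l) * cis (- (of_int (int j - int l) * x))) / of_nat K"
proof -
  let ?s = "\<Sum>j<K. \<Sum>l<K. hermitian m (int j - int l) * cis (- (of_int (int j - int l) * x))"
  have "cnj ?s = (\<Sum>j<K. \<Sum>l<K. hermitian m (int l - int j) * cis (- (of_int (int l - int j) * x)))"
  proof -
    have "cnj (hermitian m (int j - int l) * cis (- (of_int (int j - int l) * x))) =
        hermitian m (int l - int j) * cis (- (of_int (int l - int j) * x))" for j l
      using hermitian_uminus[of m "int j - int l", OF assms] by (simp add: cis_cnj left_diff_distrib)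
    then show ?thesis by (simp only: cnj_sum)
  qed
  also have "\<dots> = ?s" by (rule sum.swap)
  finally have "?s \<in> \<real>" by (simp add: Reals_cnj_iff)
  then have "complex_of_real (Re ?s) = ?s" by (rule of_real_Re)
  then show ?thesis by (simp add: fejer_mean_def)
qed

lemma continuous_fejer_mean: "continuous_on UNIV (fejer_mean m K)"
  unfolding fejer_mean_def[abs_def] divide_inverse by (intro continuous_intros)

lemma fejer_mean_moment:
  assumes m: "m 0 = 1" and n: "n < K"
  shows "(LBINT x:{0..2 * pi}. cis (real n * x) * complex_of_real (fejer_mean m K x)) = of_real (2 * pi * (real (K - n) / real K)) * m n"
proof -
  let ?h = "\<lambda>j l. hermitian m (int j - int l)"
  have count: "(\<Sum>j<K. \<Sum>l<K. if int n = int j - int l then c else 0) = of_nat (K - n) * c" for c :: complex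
  proof -
    have "(\<Sum>j<K. \<Sum>l<K. if int n = int j - int l then c else 0) = (\<Sum>l<K. \<Sum>j<K. if j = n + l then c else 0)"
      by (subst sum.swap) (intro sum.cong refl, auto)
    also have "\<dots> = (\<Sum>l<K. if n + l < K then c else 0)"
      by (intro sum.cong refl) (simp add: sum.delta')
    also have "\<dots> = (\<Sum>l\<in>{..<K - n}. c)"
      by (rule sum.mono_neutral_cong_right) auto
    finally show ?thesis by simp
  qed
  have "cis (real n * x) * complex_of_real (fejer_mean m K x) =
      (\<Sum>j<K. \<Sum>l<K. (?h j l / of_nat K) * cis (of_int (int n - (int j - int l)) * x))" for x
  proof -
    have "cis (real n * x) * (?h j l * cis (- (of_int (int j - int l) * x)) / of_nat K) =
        (?h j l / of_nat K) * cis (of_int (int n - (int j - int l)) * x)" for j l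
    proof -
      have "cis (real n * x) * cis (- (of_int (int j - int l) * x)) = cis (of_int (int n - (int j - int l)) * x)"
        by (simp add: cis_mult algebra_simps)
      then show ?thesis by (metis mult.left_commute times_divide_eq_left times_divide_eq_right)
    qed
    then show ?thesis by (simp only: of_real_fejer_mean[of m, OF m] sum_divide_distrib sum_distrib_left)
  qed
  then have "(LBINT x:{0..2 * pi}. cis (real n * x) * complex_of_real (fejer_mean m K x)) =
      (LBINT x:{0..2 * pi}. (\<Sum>j<K. \<Sum>l<K. (?h j l / of_nat K) * cis (of_int (int n - (int j - int l)) * x)))"
    by (simp only:)
  also have "\<dots> = (\<Sum>j<K. \<Sum>l<K. LBINT x:{0..2 * pi}. (?h j l / of_nat K) * cis (of_int (int n - (int j - int l)) * x))"
    by (subst set_integral_sum_period, intro continuous_intros, intro sum.cong refl set_integral_sum_period continuous_intros)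
  also have "\<dots> = (\<Sum>j<K. \<Sum>l<K. (?h j l / of_nat K) * (LBINT x:{0..2 * pi}. cis (of_int (int n - (int j - int l)) * x)))"
    by (simp only: set_lebesgue_integral_def mult_scaleR_right[symmetric] integral_mult_right_zero)
  also have "\<dots> = (\<Sum>j<K. \<Sum>l<K. if int n = int j - int l then of_real (2 * pi) * m n / of_nat K else 0)"
    by (intro sum.cong refl) (simp only: integral_cis_period, auto simp: hermitian_def intro!: arg_cong[where f = m])
  also have "\<dots> = of_real (2 * pi * (real (K - n) / real K)) * m n"
    unfolding count by (simp add: field_simps)
  finally show ?thesis .
qed

text \<open>The indicator of an open set is an increasing limit of continuous functions.\<close>
lemma measure_open_le_of_continuous_below:
  fixes M :: "real measure"
  assumes M: "real_distribution M" and U: "open U" "U \<noteq> UNIV" and c: "c \<ge> 0"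
    and bd: "\<And>\<phi> :: real \<Rightarrow> real. continuous_on UNIV \<phi> \<Longrightarrow> (\<And>x. 0 \<le> \<phi> x) \<Longrightarrow> (\<And>x. \<phi> x \<le> indicator U x) \<Longrightarrow>
      (LINT x|M. \<phi> x) \<le> c"
  shows "measure M U \<le> c"
proof -
  interpret real_distribution M by (rule M)
  define \<phi> where "\<phi> k x = min 1 (real k * infdist x (- U))" for k x
  have cont: "continuous_on UNIV (\<phi> k)" for k
    unfolding \<phi>_def[abs_def] by (intro continuous_intros)
  have "- U \<noteq> {}" "closed (- U)" using U by auto
  then have pos: "x \<in> U \<longleftrightarrow> infdist x (- U) > 0" for x
    using in_closed_iff_infdist_zero[of "- U" x] infdist_nonneg[of x "- U"] by (auto simp: less_le)
  have lim: "(\<lambda>k. \<phi> k x) \<longlonglongrightarrow> indicator U x" for x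
  proof (cases "x \<in> U")
    case True
    then have p: "infdist x (- U) > 0" using pos by simp
    then obtain k0 where k0: "1 < real k0 * infdist x (- U)" using reals_Archimedean3 by blast
    have "eventually (\<lambda>k. \<phi> k x = 1) sequentially"
      using eventually_ge_at_top[of k0]
    proof eventually_elim
      case (elim k)
      have "real k0 * infdist x (- U) \<le> real k * infdist x (- U)" using elim p by (intro mult_right_mono) auto
      then show ?case using k0 by (simp add: \<phi>_def)
    qed
    then show ?thesis using True by (simp add: tendsto_eventually)
  next
    case False
    then have "\<not> infdist x (- U) > 0" using pos by blast
    then have "infdist x (- U) = 0" using infdist_nonneg[of x "- U"] by linarith
    then show ?thesis using False by (simp add: \<phi>_def)
  qed
  have meas: "\<phi> k \<in> borel_measurable M" for k
    using borel_measurable_continuous_onI[OF cont[of k]] by simp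
  have "(\<lambda>k. LINT x|M. \<phi> k x) \<longlonglongrightarrow> (LINT x|M. indicator U x)"
  proof (rule integral_dominated_convergence[where w = "\<lambda>_. 1"])
    show "AE x in M. norm (\<phi> k x) \<le> 1" for k
      by (auto simp: \<phi>_def infdist_nonneg)
  qed (use U(1) lim meas in auto)
  moreover have "(LINT x|M. \<phi> k x) \<le> c" for k
    by (rule bd[OF cont]) (use pos infdist_nonneg in \<open>auto simp: \<phi>_def indicator_def not_less intro!: mult_nonneg_nonneg\<close>)
  ultimately have "(LINT x|M. indicator U x) \<le> c"
    by (intro LIMSEQ_le_const2) auto
  then show ?thesis using U by simp
qed

text \<open>The Fejer means, divided by $2 \pi$, are densities of probability measures on a compact interval whose
moments converge to m. By Helly's selection theorem they have a weak limit point. It is bounded by a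
multiple of Lebesgue measure on open sets, hence on all Borel sets by outer regularity, and the
theorem of Radon and Nikodym yields the density.\<close>
theorem density_with_moments:
  fixes m :: "nat \<Rightarrow> complex"
  assumes m: "m 0 = 1" and bd: "\<And>K x. K > 0 \<Longrightarrow> 0 \<le> fejer_mean m K x \<and> fejer_mean m K x \<le> C"
  obtains D where "D \<in> borel_measurable borel" "\<And>x. 0 \<le> D x" "\<And>n. moment D n = m n"
proof -
  have C: "C \<ge> 0" using bd[of 1 0] by simp
  \<comment> \<open>The order is shifted by one because there is no Fejer mean of order 0.\<close>
  define w where "w K x = indicator {0..2 * pi} x * (fejer_mean m (Suc K) x / (2 * pi))" for K x
  define \<nu> where "\<nu> K = density lborel (\<lambda>x. ennreal (w K x))" for K
  have [measurable]: "fejer_mean m K \<in> borel_measurable borel" for K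
    by (rule borel_measurable_continuous_onI[OF continuous_fejer_mean])
  have wm [measurable]: "w K \<in> borel_measurable borel" for K
    unfolding w_def[abs_def] by measurable
  have w0: "0 \<le> w K x" for K x using bd[of "Suc K" x] by (simp add: w_def)
  have wC: "w K x \<le> C / (2 * pi) * indicator {0..2 * pi} x" for K x
    using bd[of "Suc K" x] by (auto simp: w_def indicator_def divide_right_mono)
  have int: "(LINT x|\<nu> K. f x) = (LINT x|lborel. w K x *\<^sub>R f x)" if "f \<in> borel_measurable borel" for K and f :: "real \<Rightarrow> 'b :: {banach, second_countable_topology}"
    unfolding \<nu>_def by (rule integral_density) (use that w0 in auto)
  have mom: "(LINT x|\<nu> K. cis (real n * x)) = of_real (real (Suc K - n) / real (Suc K)) * m n" if "n < Suc K" for K n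
  proof -
    have "(LINT x|\<nu> K. cis (real n * x)) = (LINT x|lborel. w K x *\<^sub>R cis (real n * x))"
      by (rule int) (intro borel_measurable_continuous_onI continuous_intros)
    also have "\<dots> = (LBINT x:{0..2 * pi}. cis (real n * x) * complex_of_real (fejer_mean m (Suc K) x)) / (2 * pi)"
      unfolding set_lebesgue_integral_def integral_divide_zero[symmetric]
      by (rule Bochner_Integration.integral_cong) (auto simp: w_def scaleR_conv_of_real)
    also have "\<dots> = of_real (real (Suc K - n) / real (Suc K)) * m n"
      unfolding fejer_mean_moment[of m, OF m that] by (simp del: of_nat_Suc)
    finally show ?thesis .
  qed
  have wi: "integrable lborel (w K)" for K
  proof -
    have "set_integrable lborel {0..2 * pi} (\<lambda>x. fejer_mean m (Suc K) x / (2 * pi))"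
      by (rule borel_integrable_atLeastAtMost') (intro continuous_intros continuous_on_subset[OF continuous_fejer_mean], auto)
    then show ?thesis unfolding set_integrable_def w_def[abs_def] by simp
  qed
  have mass: "(LINT x|lborel. w K x) = 1" for K
  proof -
    have "complex_of_real (LINT x|lborel. w K x) = (LINT x|\<nu> K. cis (real 0 * x))"
      by (subst int) (simp_all add: scaleR_conv_of_real)
    also have "\<dots> = 1" using mom[of 0 K] m by simp
    finally show ?thesis by simp
  qed
  have em: "emeasure (\<nu> K) A = 1" if "{0..2 * pi} \<subseteq> A" "A \<in> sets borel" for A K
  proof -
    have "emeasure (\<nu> K) A = (\<integral>\<^sup>+x. ennreal (w K x) * indicator A x \<partial>lborel)"
      unfolding \<nu>_def by (rule emeasure_density) (use that in auto)
    also have "\<dots> = (\<integral>\<^sup>+x. ennreal (w K x) \<partial>lborel)"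
      by (rule nn_integral_cong) (use that in \<open>auto simp: w_def indicator_def\<close>)
    also have "\<dots> = ennreal 1"
      using nn_integral_eq_integral[OF wi, of K] w0 mass by simp
    finally show ?thesis by simp
  qed
  have rd: "real_distribution (\<nu> K)" for K
  proof (intro real_distribution.intro real_distribution_axioms.intro prob_spaceI)
    show "emeasure (\<nu> K) (space (\<nu> K)) = 1" using em[of UNIV K] by (simp add: \<nu>_def)
  qed (simp add: \<nu>_def)
  have "tight \<nu>"
    unfolding tight_def
  proof (intro conjI allI impI)
    fix \<epsilon> :: real assume "\<epsilon> > 0"
    have "measure (\<nu> K) {-1<..2 * pi} = 1" for K
    proof -
      have "{0..2 * pi} \<subseteq> {-1<..2 * pi}" by auto
      from em[OF this, of K] show ?thesis by (simp add: measure_def)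
    qed
    moreover have "(-1 :: real) < 2 * pi" using pi_gt_zero by linarith
    ultimately have "(-1 :: real) < 2 * pi \<and> (\<forall>n. 1 - \<epsilon> < measure (\<nu> n) {-1<..2 * pi})"
      using \<open>\<epsilon> > 0\<close> by simp
    then show "\<exists>a b. a < b \<and> (\<forall>n. 1 - \<epsilon> < measure (\<nu> n) {a<..b})" by blast
  qed (rule rd)
  from tight_imp_convergent_subsubsequence[OF this, of id]
  obtain r M where r: "strict_mono r" and M: "real_distribution M" and wc: "weak_conv_m (\<nu> \<circ> r) M"
    by (auto simp: strict_mono_def)
  interpret M: real_distribution M by (rule M)
  have conv: "(\<lambda>k. LINT x|\<nu> (r k). f x) \<longlonglongrightarrow> (LINT x|M. f x)"
    if "continuous_on UNIV f" "\<And>x. norm (f x) \<le> B" for B and f :: "real \<Rightarrow> 'b :: {banach, second_countable_topology}"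
    using weak_conv_imp_integral_bdd_continuous_conv[OF _ M wc, of f B] rd that
    by (auto simp: continuous_on_eq_continuous_at o_def)
  have momM: "(LINT x|M. cis (real n * x)) = m n" for n
  proof -
    have "(\<lambda>k. of_real (real (Suc (r k) - n) / real (Suc (r k))) * m n) \<longlonglongrightarrow> of_real 1 * m n"
    proof (intro tendsto_intros)
      have "(\<lambda>k. 1 - real n / real (Suc k)) \<longlonglongrightarrow> 1 - 0"
        by (intro tendsto_intros LIMSEQ_Suc[OF lim_const_over_n])
      from LIMSEQ_subseq_LIMSEQ[OF this r]
      have l: "(\<lambda>k. 1 - real n / real (Suc (r k))) \<longlonglongrightarrow> 1" by (simp add: o_def)
      show "(\<lambda>k. real (Suc (r k) - n) / real (Suc (r k))) \<longlonglongrightarrow> 1"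
      proof (rule Lim_transform_eventually[OF l])
        show "\<forall>\<^sub>F k in sequentially. 1 - real n / real (Suc (r k)) = real (Suc (r k) - n) / real (Suc (r k))"
          using eventually_ge_at_top[of n]
        proof eventually_elim
          case (elim k)
          then have "n \<le> Suc (r k)" using seq_suble[OF r, of k] by linarith
          then show ?case by (simp add: of_nat_diff diff_divide_distrib del: of_nat_Suc)
        qed
      qed
    qed
    moreover have "(\<lambda>k. LINT x|\<nu> (r k). cis (real n * x)) \<longlonglongrightarrow> (LINT x|M. cis (real n * x))"
    proof (rule conv)
      show "continuous_on UNIV (\<lambda>x. cis (real n * x))" by (intro continuous_intros)
      show "norm (cis (real n * x)) \<le> 1" for x by simp
    qed
    moreover have "\<forall>\<^sub>F k in sequentially. (LINT x|\<nu> (r k). cis (real n * x)) = of_real (real (Suc (r k) - n) / real (Suc (r k))) * m n"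
      using eventually_ge_at_top[of n]
    proof eventually_elim
      case (elim k)
      then have "n < Suc (r k)" using seq_suble[OF r, of k] by linarith
      then show ?case by (rule mom)
    qed
    ultimately have "(\<lambda>k. LINT x|\<nu> (r k). cis (real n * x)) \<longlonglongrightarrow> m n"
      by (simp add: tendsto_cong)
    then show ?thesis using \<open>(\<lambda>k. LINT x|\<nu> (r k). cis (real n * x)) \<longlonglongrightarrow> (LINT x|M. cis (real n * x))\<close>
      by (rule LIMSEQ_unique[symmetric])
  qed
  have openbd: "measure M U \<le> C / (2 * pi) * measure lborel (U \<inter> {0..2 * pi})" if U: "open U" "U \<noteq> UNIV" for U
  proof (rule measure_open_le_of_continuous_below[OF M U])
    show "0 \<le> C / (2 * pi) * measure lborel (U \<inter> {0..2 * pi})" using C by simp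
    fix \<phi> :: "real \<Rightarrow> real"
    assume \<phi>: "continuous_on UNIV \<phi>" "\<And>x. 0 \<le> \<phi> x" "\<And>x. \<phi> x \<le> indicator U x"
    have \<phi>m [measurable]: "\<phi> \<in> borel_measurable borel" by (rule borel_measurable_continuous_onI[OF \<phi>(1)])
    have um [measurable]: "U \<in> sets borel" using U by auto
    have fin: "emeasure lborel (U \<inter> {0..2 * pi}) < \<infinity>"
      by (rule le_less_trans[OF emeasure_mono[of _ "{0..2*pi}"]]) auto
    have "(LINT x|\<nu> K. \<phi> x) \<le> C / (2 * pi) * measure lborel (U \<inter> {0..2 * pi})" for K
    proof -
      have le: "w K x * \<phi> x \<le> C / (2 * pi) * indicator (U \<inter> {0..2 * pi}) x" for x
      proof -
        have "w K x * \<phi> x \<le> (C / (2 * pi) * indicator {0..2 * pi} x) * indicator U x"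
          by (intro mult_mono wC \<phi>) (use C \<phi> in \<open>auto simp: indicator_def\<close>)
        then show ?thesis by (simp add: indicator_inter_arith mult_ac)
      qed
      have "(LINT x|\<nu> K. \<phi> x) = (LINT x|lborel. w K x * \<phi> x)" by (subst int) auto
      also have "\<dots> \<le> (LINT x|lborel. C / (2 * pi) * indicator (U \<inter> {0..2 * pi}) x)"
      proof (rule integral_mono)
        show i2: "integrable lborel (\<lambda>x. C / (2 * pi) * indicator (U \<inter> {0..2 * pi}) x)"
          using fin by (intro integrable_mult_right integrable_real_indicator) auto
        show "integrable lborel (\<lambda>x. w K x * \<phi> x)"
          by (rule Bochner_Integration.integrable_bound[OF i2])
             (use le w0 \<phi>(2) C in \<open>auto simp: abs_mult\<close>)
      qed (rule le)
      finally show ?thesis by (simp add: Int_commute)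
    qed
    moreover have "(\<lambda>k. LINT x|\<nu> (r k). \<phi> x) \<longlonglongrightarrow> (LINT x|M. \<phi> x)"
    proof (rule conv[OF \<phi>(1)])
      show "norm (\<phi> x) \<le> 1" for x using \<phi>(2)[of x] \<phi>(3)[of x] by (cases "x \<in> U") auto
    qed
    ultimately show "(LINT x|M. \<phi> x) \<le> C / (2 * pi) * measure lborel (U \<inter> {0..2 * pi})"
      by (intro LIMSEQ_le_const2) auto
  qed
  have "absolutely_continuous lborel M"
    unfolding absolutely_continuous_def
  proof
    fix A :: "real set" assume "A \<in> null_sets lborel"
    then have A: "A \<in> sets borel" "emeasure lborel A = 0" by auto
    have "measure M A \<le> 0 + e" if "e > 0" for e
    proof -
      define d where "d = min 1 (e / (C / (2 * pi) + 1))"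
      have d: "d > 0" using that C by (auto simp: d_def intro!: divide_pos_pos add_nonneg_pos)
      obtain U where U: "open U" "A \<subseteq> U" "emeasure lborel (U - A) < d"
        using outer_regular_lborel[OF A(1) d] by blast
      have "emeasure lborel U \<le> emeasure lborel (U - A) + emeasure lborel A"
        using emeasure_subadditive[of "U - A" lborel A] U A by (simp add: Un_absorb2)
      then have eU: "emeasure lborel U < ennreal d" using U(3) A(2) by simp
      then have "U \<noteq> UNIV" by auto
      have "measure lborel (U \<inter> {0..2 * pi}) \<le> d"
      proof -
        have "emeasure lborel (U \<inter> {0..2 * pi}) \<le> emeasure lborel U" using U by (intro emeasure_mono) auto
        also have "\<dots> \<le> ennreal d" using eU by simp
        finally show ?thesis using d by (simp add: measure_def enn2real_leI)
      qed
      then have "C / (2 * pi) * measure lborel (U \<inter> {0..2 * pi}) \<le> C / (2 * pi) * d"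
        using C by (intro mult_left_mono) auto
      also have "\<dots> \<le> (C / (2 * pi) + 1) * (e / (C / (2 * pi) + 1))"
        using d C by (intro mult_mono) (auto simp: d_def)
      also have "\<dots> = e" using C by (simp add: add_nonneg_pos[THEN less_imp_neq[THEN not_sym]])
      finally have "measure M U \<le> e" using openbd[OF U(1) \<open>U \<noteq> UNIV\<close>] by simp
      moreover have "measure M A \<le> measure M U" using U A by (intro M.finite_measure_mono) auto
      ultimately show ?thesis by simp
    qed
    then have "measure M A = 0" using field_le_epsilon[of "measure M A" 0] measure_nonneg[of M A] by force
    then show "A \<in> null_sets M" using A by (auto simp: null_sets_def M.emeasure_eq_measure)
  qed
  then obtain D where D: "D \<in> borel_measurable lborel" "AE x in lborel. RN_deriv lborel M x = ennreal (D x)" "\<And>x. 0 \<le> D x"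
    using sigma_finite_measure.real_RN_deriv[OF sigma_finite_lborel M.finite_measure_axioms] by auto
  have Dm [measurable]: "D \<in> borel_measurable borel" using D by simp
  have "density lborel (\<lambda>x. ennreal (D x)) = density lborel (RN_deriv lborel M)"
    by (rule density_cong) (use D in \<open>auto elim: AE_mp\<close>)
  also have "\<dots> = M"
    by (rule sigma_finite_measure.density_RN_deriv[OF sigma_finite_lborel \<open>absolutely_continuous lborel M\<close>]) simp
  finally have MD: "M = density lborel (\<lambda>x. ennreal (D x))" by simp
  have "(0 :: real) \<in> {0..2 * pi}" by auto
  then have "- {0..2 * pi} \<noteq> (UNIV :: real set)" by blast
  then have "measure M (- {0..2 * pi}) \<le> 0"
    using openbd[of "- {0..2 * pi}"] by (simp add: open_Compl Compl_disjoint2)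
  then have "emeasure M (- {0..2 * pi}) = 0"
    by (simp add: M.emeasure_eq_measure measure_le_0_iff)
  then have supp: "AE x in M. x \<in> {0..2 * pi}"
    by (intro AE_I[where N = "- {0..2 * pi}"]) auto
  show ?thesis
  proof (rule that[OF Dm D(3)])
    fix n
    have cm: "(\<lambda>x. cis (real n * x)) \<in> borel_measurable borel" by (intro borel_measurable_continuous_onI continuous_intros)
    have "m n = (LINT x|M. cis (real n * x))" by (simp add: momM)
    also have "\<dots> = (LINT x|M. indicator {0..2 * pi} x *\<^sub>R cis (real n * x))"
      by (rule integral_cong_AE) (use cm supp in \<open>auto elim: AE_mp\<close>)
    also have "\<dots> = (LINT x|lborel. D x *\<^sub>R (indicator {0..2 * pi} x *\<^sub>R cis (real n * x)))"
      by (subst MD, rule integral_density) (use cm D(3) in auto)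
    also have "\<dots> = moment D n"
      unfolding moment_def set_lebesgue_integral_def
      by (rule Bochner_Integration.integral_cong) (auto simp: scaleR_conv_of_real)
    finally show "moment D n = m n" by simp
  qed
qed

section \<open>From the transport equation to the weak form\<close>

lemma integral_cnj_period:
  "(LBINT x:{0..2 * pi}. cnj (f x)) = cnj (LBINT x:{0..2 * pi}. f x)"
proof -
  have "(\<lambda>x. indicator {0..2 * pi} x *\<^sub>R cnj (f x)) = (\<lambda>x. cnj (indicator {0..2 * pi} x *\<^sub>R f x))"
    by (simp add: scaleR_conv_of_real)
  then show ?thesis unfolding set_lebesgue_integral_def by (simp only: Bochner_Integration.integral_cnj)
qed

lemma fourier_coeff_moment:
  "fourier_coeff u (- int n) = moment u n / (2 * pi)"
  "fourier_coeff u (int n) = cnj (moment u n) / (2 * pi)"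
proof -
  show "fourier_coeff u (- int n) = moment u n / (2 * pi)"
    by (simp add: fourier_coeff_def moment_def)
  have "cnj (moment u n) = (LBINT x:{0..2 * pi}. cis (- (of_int (int n) * x)) * complex_of_real (u x))"
    unfolding moment_def integral_cnj_period[symmetric] by (simp add: cis_cnj)
  then show "fourier_coeff u (int n) = cnj (moment u n) / (2 * pi)"
    by (simp add: fourier_coeff_def)
qed

text \<open>The sums over all integers in the definitions of the Hilbert transform and of the Poisson mean are
split into the constant term and two power series.\<close>
lemma infsum_int_two_sided:
  fixes a :: "int \<Rightarrow> complex"
  assumes A: "(\<lambda>n. a (int (Suc n))) sums A" "summable (\<lambda>n. norm (a (int (Suc n))))"
    and B: "(\<lambda>n. a (- int (Suc n))) sums B" "summable (\<lambda>n. norm (a (- int (Suc n))))"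
  shows "infsum a UNIV = a 0 + A + B"
proof -
  let ?p = "\<lambda>n. int (Suc n)" and ?m = "\<lambda>n. - int (Suc n)"
  have p: "(a has_sum A) (range ?p)"
    by (subst has_sum_reindex) (use norm_summable_imp_has_sum[OF A(2,1)] in \<open>auto simp: inj_on_def o_def\<close>)
  have m: "(a has_sum B) (range ?m)"
    by (subst has_sum_reindex) (use norm_summable_imp_has_sum[OF B(2,1)] in \<open>auto simp: inj_on_def o_def\<close>)
  have z: "(a has_sum a 0) {0}" using has_sum_finite[of "{0}" a] by simp
  have "(a has_sum (a 0 + A + B)) (({0} \<union> range ?p) \<union> range ?m)"
    by (intro has_sum_Un_disjoint z p m) auto
  also have "({0} \<union> range ?p) \<union> range ?m = UNIV"
  proof -
    have "k \<in> ({0} \<union> range ?p) \<union> range ?m" for k :: int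
    proof (cases k)
      case (nonneg n) then show ?thesis by (cases n) auto
    qed auto
    then show ?thesis by blast
  qed
  finally show ?thesis by (rule infsumI)
qed

text \<open>
For a probability density u with moment generating function g and $w = g(r e^{-ix})$, the Poisson
mean of u is $(1 + 2\,\mathrm{Re}\,w)/2\pi$ and its Hilbert transform is $-\mathrm{Im}\,w/\pi$: the
negative Fourier coefficients are the moments, the positive ones their conjugates.
\<close>
context
  fixes u :: "real \<Rightarrow> real" and r :: real
  assumes u0: "moment u 0 = 1" and u1: "\<And>n. norm (moment u n) \<le> 1" and r: "0 < r" "r < 1"
begin

lemma moment_gf_sums:
  assumes "norm z < 1"
  shows "(\<lambda>n. moment u (Suc n) * z ^ Suc n) sums moment_gf u z" "summable (\<lambda>n. norm (moment u (Suc n) * z ^ Suc n))"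
proof -
  show s: "summable (\<lambda>n. norm (moment u (Suc n) * z ^ Suc n))"
  proof (rule summable_comparison_test'[of "\<lambda>n. norm z ^ n" 0])
    show "summable (\<lambda>n. norm z ^ n)" using assms by (simp add: summable_geometric)
    fix n
    have "norm (moment u (Suc n)) * norm z ^ Suc n \<le> 1 * norm z ^ n"
      using u1[of "Suc n"] assms by (intro mult_mono power_decreasing) auto
    then show "norm (norm (moment u (Suc n) * z ^ Suc n)) \<le> norm z ^ n" by (simp only: norm_mult norm_power real_norm_def abs_mult abs_norm_cancel power_abs mult_1)
  qed
  show "(\<lambda>n. moment u (Suc n) * z ^ Suc n) sums moment_gf u z"
    unfolding moment_gf_def by (rule summable_sums[OF summable_norm_cancel[OF s]])
qed

lemma poisson_mean_eq:
  "poisson_mean r u x = (1 + 2 * Re (moment_gf u (of_real r * cis (- x)))) / (2 * pi)"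
  and conjugate_poisson_sum: "- \<i> * (\<Sum>\<^sub>\<infinity>n::int. of_int (sgn n) * (complex_of_real (r ^ nat \<bar>n\<bar>) * fourier_coeff u n) * cis (of_int n * x)) =
     of_real (- Im (moment_gf u (of_real r * cis (- x))) / pi)"
proof -
  let ?z = "of_real r * cis (- x)" and ?w = "moment_gf u (of_real r * cis (- x))"
  have z: "norm ?z < 1" using r by (simp add: norm_mult)
  note s = moment_gf_sums[OF z]
  have zp: "?z ^ n = of_real (r ^ n) * cis (- (real n * x))" for n
    by (simp add: power_mult_distrib Complex.DeMoivre)
  have zc: "cnj (?z ^ n) = of_real (r ^ n) * cis (real n * x)" for n
    unfolding zp by (simp add: cis_cnj)
  let ?a = "\<lambda>n::int. complex_of_real (r ^ nat \<bar>n\<bar>) * fourier_coeff u n * cis (of_int n * x)"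
  have nn: "nat \<bar>int (Suc n)\<bar> = Suc n" "nat \<bar>- int (Suc n)\<bar> = Suc n" for n by simp_all
  have ap: "?a (int (Suc n)) = cnj (moment u (Suc n) * ?z ^ Suc n) / (2 * pi)" for n
    unfolding fourier_coeff_moment complex_cnj_mult zc nn by (simp add: mult_ac)
  have am: "?a (- int (Suc n)) = (moment u (Suc n) * ?z ^ Suc n) / (2 * pi)" for n
  proof -
    have "of_int (- int (Suc n)) * x = - (real (Suc n) * x)" by (simp add: algebra_simps)
    then show ?thesis unfolding fourier_coeff_moment zp nn by (simp only: mult_ac times_divide_eq_right times_divide_eq_left)
  qed
  have a0: "?a 0 = 1 / (2 * pi)" using fourier_coeff_moment(1)[of u 0] u0 by simp
  have sm: "summable (\<lambda>n. norm (moment u (Suc n) * ?z ^ Suc n / (2 * pi)))"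
    using summable_divide[OF s(2), of "2 * pi"] by (simp add: norm_divide)
  then have sp: "summable (\<lambda>n. norm (cnj (moment u (Suc n) * ?z ^ Suc n) / (2 * pi)))" by (simp add: norm_divide norm_mult norm_power)
  have cs: "(\<lambda>n. cnj (moment u (Suc n) * ?z ^ Suc n)) sums cnj ?w" using s(1) by (simp only: sums_cnj)
  have P: "infsum ?a UNIV = ?a 0 + cnj ?w / (2 * pi) + ?w / (2 * pi)"
    by (rule infsum_int_two_sided) (simp_all only: ap am sums_divide[OF cs] sums_divide[OF s(1)] sp sm)
  also have "\<dots> = of_real ((1 + 2 * Re ?w) / (2 * pi))"
    unfolding a0 by (simp add: complex_eq_iff field_simps)
  finally have P: "infsum ?a UNIV = of_real ((1 + 2 * Re ?w) / (2 * pi))" .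
  then show p: "poisson_mean r u x = (1 + 2 * Re ?w) / (2 * pi)" unfolding poisson_mean_def by simp
  let ?b = "\<lambda>n::int. of_int (sgn n) * (complex_of_real (r ^ nat \<bar>n\<bar>) * fourier_coeff u n) * cis (of_int n * x)"
  have b: "?b n = of_int (sgn n) * ?a n" for n by (simp add: mult_ac)
  have bp: "?b (int (Suc n)) = cnj (moment u (Suc n) * ?z ^ Suc n) / (2 * pi)" for n
    unfolding b ap by simp
  have bm: "?b (- int (Suc n)) = - ((moment u (Suc n) * ?z ^ Suc n) / (2 * pi))" for n
    unfolding b am by simp
  have "infsum ?b UNIV = ?b 0 + cnj ?w / (2 * pi) + - (?w / (2 * pi))"
    by (rule infsum_int_two_sided) (simp_all only: bp bm norm_minus_cancel sums_divide[OF cs] sums_minus[OF sums_divide[OF s(1)]] sp sm)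
  then have "infsum ?b UNIV = (cnj ?w - ?w) / (2 * pi)" by (simp add: diff_divide_distrib)
  then show "- \<i> * infsum ?b UNIV = of_real (- Im ?w / pi)" by (simp add: complex_eq_iff field_simps)
qed

text \<open>The Hilbert transform is defined through Fourier coefficients, so those of the Poisson mean must be
recovered from its series; uniform convergence for $r < 1$ allows termwise integration.\<close>
lemma fourier_coeff_poisson_mean:
  "fourier_coeff (poisson_mean r u) k = complex_of_real (r ^ nat \<bar>k\<bar>) * fourier_coeff u k"
proof -
  let ?z = "\<lambda>x. of_real r * cis (- x)" and ?m = "\<lambda>n. moment u (Suc n)"
  let ?I = "\<lambda>f. (LBINT x:{0..2 * pi}. f x) :: complex"
  define t where "t n x = cis (- (of_int k * x)) * ((?m n * ?z x ^ Suc n + cnj (?m n * ?z x ^ Suc n)) / (2 * pi))" for n x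
  have zp: "?z x ^ n = of_real (r ^ n) * cis (- (real n * x))" for n x
    by (simp add: power_mult_distrib Complex.DeMoivre)
  have t_eq: "t n x = (?m n * of_real (r ^ Suc n) / (2 * pi)) * cis (of_int (- k - int (Suc n)) * x)
      + (cnj (?m n) * of_real (r ^ Suc n) / (2 * pi)) * cis (of_int (int (Suc n) - k) * x)" for n x
  proof -
    have 1: "cis (- (of_int k * x)) * cis (- (real (Suc n) * x)) = cis (of_int (- k - int (Suc n)) * x)"
      unfolding cis_mult by (rule arg_cong[where f = cis]) (simp add: algebra_simps)
    have 2: "cis (- (of_int k * x)) * cis (real (Suc n) * x) = cis (of_int (int (Suc n) - k) * x)"
      unfolding cis_mult by (rule arg_cong[where f = cis]) (simp add: algebra_simps)
    have gen: "c * ((m * (R * e) + m' * (R * e')) / p) = (m * R / p) * (c * e) + (m' * R / p) * (c * e')" for c m R e m' e' p :: complex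
      by (simp add: add_divide_distrib distrib_left mult_ac)
    show ?thesis unfolding t_def zp complex_cnj_mult complex_cnj_complex_of_real cis_cnj minus_minus 1[symmetric] 2[symmetric] by (rule gen)
  qed
  have ct: "continuous_on UNIV (t n)" for n unfolding t_eq[abs_def] by (intro continuous_intros)
  have It: "?I (t n) = (if k = - int (Suc n) then ?m n * of_real (r ^ Suc n) else 0) + (if k = int (Suc n) then cnj (?m n) * of_real (r ^ Suc n) else 0)" for n
  proof -
    have i: "set_integrable lborel {0..2 * pi} (\<lambda>x. c * cis (of_int j * x))" for c :: complex and j
      by (rule set_integrable_period) (intro continuous_intros)
    have m: "?I (\<lambda>x. c * cis (of_int j * x)) = c * (if j = 0 then of_real (2 * pi) else 0)" for c :: complex and j
      unfolding integral_cis_period[symmetric] by (simp only: set_lebesgue_integral_def mult_scaleR_right[symmetric] integral_mult_right_zero)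
    have "?I (t n) = (?m n * of_real (r ^ Suc n) / (2 * pi)) * (if - k - int (Suc n) = 0 then of_real (2 * pi) else 0)
        + (cnj (?m n) * of_real (r ^ Suc n) / (2 * pi)) * (if int (Suc n) - k = 0 then of_real (2 * pi) else 0)"
      unfolding t_eq set_integral_add(2)[OF i i] m ..
    then show ?thesis by (auto simp del: of_nat_Suc)
  qed
  have tb: "norm (t n x) \<le> r ^ n" for n x
  proof -
    have "norm (?m n * ?z x ^ Suc n) \<le> 1 * r ^ n"
      unfolding norm_mult norm_power using u1[of "Suc n"] r by (intro mult_mono) (auto intro!: mult_left_le_one_le simp: power_le_one)
    then have "norm (?m n * ?z x ^ Suc n + cnj (?m n * ?z x ^ Suc n)) \<le> r ^ n + r ^ n"
      by (intro order_trans[OF norm_triangle_ineq] add_mono) (simp_all only: complex_mod_cnj mult_1)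
    then have "norm (t n x) \<le> (r ^ n + r ^ n) / (2 * pi)"
      unfolding t_def norm_mult norm_cis mult_1 norm_divide by (intro frac_le) (use r in auto)
    also have "\<dots> \<le> r ^ n" using r pi_ge_two by (simp add: field_simps)
    finally show ?thesis .
  qed
  have geo: "summable (\<lambda>n. r ^ n)" using r by (intro summable_geometric) auto
  have P: "cis (- (of_int k * x)) * complex_of_real (poisson_mean r u x) = cis (- (of_int k * x)) / (2 * pi) + (\<Sum>n. t n x)" for x
  proof -
    have z: "norm (?z x) < 1" using r by (simp add: norm_mult)
    have "(\<lambda>n. ?m n * ?z x ^ Suc n + cnj (?m n * ?z x ^ Suc n)) sums (moment_gf u (?z x) + cnj (moment_gf u (?z x)))"
      using moment_gf_sums(1)[OF z] by (intro sums_add) (simp_all only: sums_cnj)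
    from sums_mult[OF sums_divide[OF this, of "2 * pi"], of "cis (- (of_int k * x))"]
    have "(\<Sum>n. t n x) = cis (- (of_int k * x)) * ((moment_gf u (?z x) + cnj (moment_gf u (?z x))) / (2 * pi))"
      unfolding t_def by (rule sums_unique[symmetric])
    moreover have "moment_gf u (?z x) + cnj (moment_gf u (?z x)) = of_real (2 * Re (moment_gf u (?z x)))" by (simp add: complex_eq_iff)
    ultimately show ?thesis unfolding poisson_mean_eq by (simp add: add_divide_distrib distrib_left)
  qed
  let ?M = "restrict_space lborel {0..2 * pi}"
  have S: "?I (\<lambda>x. \<Sum>n. t n x) = (\<Sum>n. ?I (t n)) \<and> set_integrable lborel {0..2 * pi} (\<lambda>x. \<Sum>n. t n x)"
  proof -
    let ?f = "\<lambda>n x. indicator {0..2 * pi} x *\<^sub>R t n x"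
    have f: "integrable lborel (?f n)" for n using set_integrable_period[OF ct] by (simp add: set_integrable_def)
    have nf: "norm (?f n x) \<le> indicator {0..2 * pi} x *\<^sub>R r ^ n" for n x using tb by (simp add: indicator_def)
    have s1: "AE x in lborel. summable (\<lambda>n. norm (?f n x))"
      by (intro AE_I2 summable_comparison_test'[OF geo, of 0]) (use tb r in \<open>auto simp: indicator_def\<close>)
    have s2: "summable (\<lambda>n. LINT x|lborel. norm (?f n x))"
    proof (rule summable_comparison_test'[of "\<lambda>n. 2 * pi * r ^ n" 0])
      show "summable (\<lambda>n. 2 * pi * r ^ n)" by (intro summable_mult geo)
      fix n
      have "(LINT x|lborel. norm (?f n x)) \<le> (LINT x|lborel. indicator {0..2 * pi} x *\<^sub>R r ^ n)"
        by (rule integral_mono[OF integrable_norm[OF f] _ nf], rule integrable_scaleR_left, rule integrable_real_indicator) auto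
      also have "\<dots> = 2 * pi * r ^ n" by simp
      finally show "norm (LINT x|lborel. norm (?f n x)) \<le> 2 * pi * r ^ n" by (simp add: integral_nonneg_AE)
    qed
    have e: "(\<lambda>x. indicator {0..2 * pi} x *\<^sub>R (\<Sum>n. t n x)) = (\<lambda>x. \<Sum>n. ?f n x)"
      by (auto simp: indicator_def fun_eq_iff)
    show ?thesis unfolding set_lebesgue_integral_def set_integrable_def e
      using integral_suminf[OF f s1 s2] integrable_suminf[OF f s1 s2] by blast
  qed
  have i0: "set_integrable lborel {0..2 * pi} (\<lambda>x. cis (- (of_int k * x)) / (2 * pi))"
    unfolding divide_inverse by (rule set_integrable_period) (intro continuous_intros)
  have I0: "?I (\<lambda>x. cis (- (of_int k * x)) / (2 * pi)) = (if k = 0 then 1 else 0)"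
  proof -
    have "?I (\<lambda>x. cis (- (of_int k * x)) / (2 * pi)) = ?I (\<lambda>x. cis (of_int (- k) * x)) / (2 * pi)"
      unfolding set_lebesgue_integral_def integral_divide_zero[symmetric] by (simp add: scaleR_conv_of_real)
    then show ?thesis unfolding integral_cis_period by simp
  qed
  have "2 * pi * fourier_coeff (poisson_mean r u) k = (if k = 0 then 1 else 0) + (\<Sum>n. ?I (t n))"
    unfolding fourier_coeff_def P set_integral_add(2)[OF i0 conjunct2[OF S]] I0 conjunct1[OF S] by simp
  also have "\<dots> = 2 * pi * (complex_of_real (r ^ nat \<bar>k\<bar>) * fourier_coeff u k)"
  proof -
    consider "k = 0" | n where "k = int (Suc n)" | n where "k = - int (Suc n)"
    proof -
      have "k = 0 \<or> (\<exists>n. k = int (Suc n)) \<or> (\<exists>n. k = - int (Suc n))"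
      proof (cases k)
        case (nonneg n) then show ?thesis by (cases n) auto
      qed auto
      then show thesis using that by blast
    qed
    then show ?thesis
    proof cases
      case 1
      then show ?thesis unfolding It using fourier_coeff_moment(1)[of u 0] u0 by (simp del: of_nat_Suc)
    next
      case (2 n)
      have "(\<Sum>n. ?I (t n)) = (\<Sum>j. if j = n then cnj (?m n) * of_real (r ^ Suc n) else 0)"
        unfolding It 2 by (intro suminf_cong) auto
      also have "\<dots> = cnj (?m n) * of_real (r ^ Suc n)"
        using suminf_finite[of "{n}" "\<lambda>j. if j = n then cnj (?m n) * of_real (r ^ Suc n) else 0"] by simp
      finally show ?thesis unfolding 2 fourier_coeff_moment by (simp del: of_nat_Suc add: mult_ac)
    next
      case (3 n)
      have "(\<Sum>n. ?I (t n)) = (\<Sum>j. if j = n then ?m n * of_real (r ^ Suc n) else 0)"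
        unfolding It 3 by (intro suminf_cong) auto
      also have "\<dots> = ?m n * of_real (r ^ Suc n)"
        using suminf_finite[of "{n}" "\<lambda>j. if j = n then ?m n * of_real (r ^ Suc n) else 0"] by simp
      finally show ?thesis unfolding 3 fourier_coeff_moment by (simp del: of_nat_Suc add: mult_ac)
    qed
  qed
  finally show ?thesis by simp
qed

lemma hilbert_transform_poisson_mean:
  "hilbert_transform (poisson_mean r u) x = - Im (moment_gf u (of_real r * cis (- x))) / pi"
  unfolding hilbert_transform_def fourier_coeff_poisson_mean using conjugate_poisson_sum[of x] by simp

text \<open>From $\mathrm{Im} \cos(x + iy) = - \sin x \sinh y$.\<close>
lemma flux_poisson_mean:
  "flux \<alpha> (poisson_mean r u) x = Im (cos (of_real (pi * \<alpha>) * (1 + 2 * moment_gf u (of_real r * cis (- x)))))"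
proof -
  let ?w = "moment_gf u (of_real r * cis (- x))"
  have Im_cos: "Im (cos z) = - (sin (Re z) * sinh (Im z))" for z :: complex
    by (simp add: Im_cos sinh_field_def field_simps)
  have "flux \<alpha> (poisson_mean r u) x = sin (pi * \<alpha> * (1 + 2 * Re ?w)) * sinh (- (2 * pi * \<alpha> * Im ?w))"
    unfolding flux_def poisson_mean_eq hilbert_transform_poisson_mean
    by (rule arg_cong2[where f = "\<lambda>x y. sin x * sinh y"]) (simp_all add: power2_eq_square field_simps)
  then show ?thesis unfolding Im_cos by (simp add: algebra_simps)
qed

end

text \<open>The flux of the Poisson mean is the imaginary part of $\cos(\pi\alpha(1 + 2g))$ on the circle of
radius r, and differentiating this cosine along the circle produces the transport term of the
equation for g. The weak form is the real part of that equation.\<close>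
theorem weak_solution_of_transport:
  assumes \<alpha>: "0 < \<alpha>" "\<alpha> < 1"
    and f0: "\<And>t. t \<ge> 0 \<Longrightarrow> moment (f t) 0 = 1" and f1: "\<And>t n. t \<ge> 0 \<Longrightarrow> norm (moment (f t) n) \<le> 1"
    and sol: "analytic_transport_solution \<alpha> g\<^sub>0 (\<lambda>t. moment_gf (f t))"
  shows "weak_solution \<alpha> f"
  unfolding weak_solution_def
proof (intro ballI allI impI)
  fix r t x :: real assume r: "r \<in> {0<..<1}" and t: "t \<ge> 0"
  then have r: "0 < r" "r < 1" by auto
  let ?z = "\<lambda>x. of_real r * cis (- x) :: complex" and ?G = "\<lambda>t. moment_gf (f t)"
  have z: "?z x \<in> ball 0 1" using r by (simp add: norm_mult)
  obtain g\<^sub>t g\<^sub>z where gt: "((\<lambda>s. ?G s (?z x)) has_vector_derivative g\<^sub>t) (at t within {0..})"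
    and gz: "(?G t has_field_derivative g\<^sub>z) (at (?z x))"
    and pde: "g\<^sub>t + ?z x * velocity \<alpha> (?G t (?z x)) * g\<^sub>z = 0"
    using sol t z unfolding analytic_transport_solution_def by blast
  let ?s = "sin (of_real (pi * \<alpha>) * (1 + 2 * ?G t (?z x)))"
  define D where "D = 2 * pi * \<alpha> * Re (?s * (?z x * g\<^sub>z))"
  have sa: "sin (pi * \<alpha>) > 0" using \<alpha> by (intro sin_gt_zero) auto
  have dz: "(?z has_vector_derivative - \<i> * ?z x) (at x)"
  proof -
    have "((\<lambda>w. of_real r * exp (- \<i> * w)) has_field_derivative of_real r * (exp (- \<i> * of_real x) * - \<i>)) (at (of_real x))"
      by (auto intro!: derivative_eq_intros)
    from has_vector_derivative_real_field[OF this]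
    show ?thesis by (simp add: cis_conv_exp mult_ac)
  qed
  have "((\<lambda>w. cos (of_real (pi * \<alpha>) * (1 + 2 * ?G t w))) has_field_derivative - ?s * (of_real (pi * \<alpha>) * (2 * g\<^sub>z))) (at (?z x))"
    by (auto intro!: derivative_eq_intros gz)
  from field_vector_diff_chain_at[OF dz this]
  have "((\<lambda>x. cos (of_real (pi * \<alpha>) * (1 + 2 * ?G t (?z x)))) has_vector_derivative
      (- \<i> * ?z x) * (- ?s * (of_real (pi * \<alpha>) * (2 * g\<^sub>z)))) (at x)"
    by (simp add: o_def)
  from bounded_linear.has_vector_derivative[OF bounded_linear_Im this]
  have "((\<lambda>x. Im (cos (of_real (pi * \<alpha>) * (1 + 2 * ?G t (?z x))))) has_real_derivative
      Im ((- \<i> * ?z x) * (- ?s * (of_real (pi * \<alpha>) * (2 * g\<^sub>z))))) (at x)"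
    by (simp add: has_real_derivative_iff_has_vector_derivative)
  also have "(- \<i> * ?z x) * (- ?s * (of_real (pi * \<alpha>) * (2 * g\<^sub>z))) = \<i> * (of_real (2 * pi * \<alpha>) * (?s * (?z x * g\<^sub>z)))"
    by (simp add: mult_ac)
  also have "Im \<dots> = D"
  proof -
    have "Im (\<i> * (of_real c * W)) = c * Re W" for c W by simp
    then show ?thesis unfolding D_def .
  qed
  finally have flux: "(flux \<alpha> (poisson_mean r (f t)) has_real_derivative D) (at x)"
    unfolding flux_poisson_mean[OF f0[OF t] f1[OF t] r, abs_def] .
  have "g\<^sub>t = - (of_real (2 * pi\<^sup>2 / sin (pi * \<alpha>)) * (?s * (?z x * g\<^sub>z)))"
    using pde unfolding velocity_def by (simp add: eq_neg_iff_add_eq_0 mult_ac)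
  moreover have "Re (- (of_real c * W)) = - c * Re W" for c W by simp
  ultimately have Re_gt: "Re g\<^sub>t = - (2 * pi\<^sup>2 / sin (pi * \<alpha>)) * Re (?s * (?z x * g\<^sub>z))"
    by (simp only:)
  have "((\<lambda>s. Re (?G s (?z x))) has_real_derivative Re g\<^sub>t) (at t within {0..})"
    using bounded_linear.has_vector_derivative[OF bounded_linear_Re gt] by (simp add: has_real_derivative_iff_has_vector_derivative)
  then have "((\<lambda>s. (1 + 2 * Re (?G s (?z x))) / (2 * pi)) has_real_derivative (0 + 2 * Re g\<^sub>t) / (2 * pi)) (at t within {0..})"
    by (intro DERIV_cdivide DERIV_add DERIV_const DERIV_cmult)
  also have "(0 + 2 * Re g\<^sub>t) / (2 * pi) = - (1 / (\<alpha> * sin (pi * \<alpha>)) * D)"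
    unfolding Re_gt D_def using \<alpha> sa by (simp add: power2_eq_square field_simps)
  finally have time: "((\<lambda>s. poisson_mean r (f s) x) has_real_derivative - (1 / (\<alpha> * sin (pi * \<alpha>)) * D)) (at t within {0..})"
    by (rule has_field_derivative_transform_within[where d = 1]) (use t poisson_mean_eq[OF f0 f1 r] in auto)
  from flux time show "\<exists>D. (flux \<alpha> (poisson_mean r (f t)) has_real_derivative D) (at x) \<and>
      ((\<lambda>s. poisson_mean r (f s) x) has_real_derivative - (1 / (\<alpha> * sin (pi * \<alpha>)) * D)) (at t within {0..})" by blast
qed

section \<open>Random measures on the circle and their moments\<close>

lemma periodic_int_multiple:
  fixes \<phi> :: "real \<Rightarrow> 'b"
  assumes "\<And>x. \<phi> (x + 2 * pi) = \<phi> x"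
  shows "\<phi> (x + 2 * pi * of_int k) = \<phi> x"
proof -
  have n: "\<phi> (y + 2 * pi * real n) = \<phi> y" for n y
    by (induction n) (use assms[of "y + 2 * pi * real _"] in \<open>simp_all add: algebra_simps\<close>)
  show ?thesis
  proof (cases k)
    case (nonneg m) then show ?thesis using n by simp
  next
    case (neg m)
    have "x + 2 * pi * of_int k + 2 * pi * real (Suc m) = x" unfolding neg by (simp add: algebra_simps)
    then show ?thesis using n[of "x + 2 * pi * of_int k" "Suc m"] by (simp only:)
  qed
qed

lemma periodic_cis_cong:
  fixes \<phi> :: "real \<Rightarrow> 'b"
  assumes \<phi>: "\<And>x. \<phi> (x + 2 * pi) = \<phi> x" and "cis a = cis b"
  shows "\<phi> a = \<phi> b"
proof -
  have "sin a = sin b \<and> cos a = cos b" using assms(2) by (metis cis.sel)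
  then obtain k :: int where "a = b + 2 * pi * of_int k" unfolding sin_cos_eq_iff by auto
  then show ?thesis using periodic_int_multiple[of \<phi>, OF \<phi>] by simp
qed

text \<open>Real trigonometric polynomials. The inductive form reduces linear statements on integrals to a single
exponential.\<close>
inductive trig_poly :: "(real \<Rightarrow> real) \<Rightarrow> bool" where
  monomial: "trig_poly (\<lambda>x. Re (c * cis (real n * x)))"
| add: "trig_poly p \<Longrightarrow> trig_poly q \<Longrightarrow> trig_poly (\<lambda>x. p x + q x)"

lemma trig_poly_monomial_int: "trig_poly (\<lambda>x. Re (c * cis (of_int k * x)))"
proof (cases k)
  case (nonneg n) then show ?thesis using trig_poly.monomial[of c n] by simp
next
  case (neg n)
  have "Re (c * cis (of_int k * x)) = Re (cnj c * cis (real (Suc n) * x))" for x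
  proof -
    have "Re (c * cis (of_int k * x)) = Re (cnj (c * cis (of_int k * x)))" by simp
    also have "cnj (c * cis (of_int k * x)) = cnj c * cis (real (Suc n) * x)"
      unfolding complex_cnj_mult cis_cnj neg by (simp add: algebra_simps)
    finally show ?thesis .
  qed
  then show ?thesis using trig_poly.monomial[of "cnj c" "Suc n"] by (simp only:)
qed

lemma trig_poly_mult:
  assumes "trig_poly p" "trig_poly q"
  shows "trig_poly (\<lambda>x. p x * q x)"
  using assms(1)
proof induction
  case (monomial c n)
  show ?case using assms(2)
  proof induction
    case (monomial d m)
    have Re: "Re u * Re v = Re (u * v / 2) + Re (u * cnj v / 2)" for u v by (simp add: field_simps)
    have 1: "c * cis (real n * x) * (d * cis (real m * x)) / 2 = (c * d / 2) * cis (of_int (int n + int m) * x)" for x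
    proof -
      have "cis (of_int (int n + int m) * x) = cis (real n * x) * cis (real m * x)"
        unfolding cis_mult by (rule arg_cong[where f = cis]) (simp add: algebra_simps)
      then show ?thesis by (simp only: mult_ac times_divide_eq_right times_divide_eq_left)
    qed
    have 2: "c * cis (real n * x) * cnj (d * cis (real m * x)) / 2 = (c * cnj d / 2) * cis (of_int (int n - int m) * x)" for x
    proof -
      have "cis (of_int (int n - int m) * x) = cis (real n * x) * cis (- (real m * x))"
        unfolding cis_mult by (rule arg_cong[where f = cis]) (simp add: algebra_simps)
      then show ?thesis by (simp only: complex_cnj_mult cis_cnj mult_ac times_divide_eq_right times_divide_eq_left)
    qed
    show ?case unfolding Re 1 2 by (intro trig_poly.add trig_poly_monomial_int)
  next
    case (add p q) then show ?case unfolding distrib_left by (intro trig_poly.add)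
  qed
next
  case (add p q) then show ?case unfolding distrib_right by (intro trig_poly.add)
qed

lemma real_polynomial_on_circle:
  assumes "real_polynomial_function p"
  shows "trig_poly (\<lambda>x. p (cis x))"
  using assms
proof induction
  case (linear f)
  interpret bounded_linear f by (rule linear)
  have lin: "f w = Re (Complex (f 1) (- f \<i>) * w)" for w
  proof -
    have "w = Re w *\<^sub>R 1 + Im w *\<^sub>R \<i>" by (simp add: complex_eq_iff)
    then have "f w = f (Re w *\<^sub>R 1 + Im w *\<^sub>R \<i>)" by simp
    also have "\<dots> = Re w * f 1 + Im w * f \<i>" unfolding add scaleR by simp
    finally show ?thesis by (simp add: mult.commute)
  qed
  have eq: "(\<lambda>x. f (cis x)) = (\<lambda>x. Re (Complex (f 1) (- f \<i>) * cis (real 1 * x)))" unfolding of_nat_1 mult_1 by (rule ext, rule lin)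
  show ?case unfolding eq by (rule trig_poly.monomial)
next
  case (const c)
  then show ?case using trig_poly.monomial[of "of_real c" 0] by simp
qed (intro trig_poly.add trig_poly_mult; assumption)+

text \<open>A continuous periodic function is a continuous function on the unit circle, where the theorem of Stone
and Weierstrass applies; polynomials in the real and imaginary part of $e^{ix}$ are trigonometric
polynomials.\<close>
lemma trig_approximation:
  assumes c: "continuous_on UNIV \<phi>" and per: "\<And>x. \<phi> (x + 2 * pi) = \<phi> x" and e: "e > 0"
  obtains p where "trig_poly p" "\<And>x. \<bar>\<phi> x - p x\<bar> < e"
proof -
  have cphi: "isCont \<phi> x" for x using c by (simp add: continuous_on_eq_continuous_at)
  have 1: "continuous_on (sphere 0 1 - \<real>\<^sub>\<le>\<^sub>0) (\<lambda>w. \<phi> (Arg w))"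
    by (intro continuous_at_imp_continuous_on ballI isCont_o2[OF continuous_at_Arg] cphi) auto
  have eq: "\<phi> (Arg w) = \<phi> (Arg (- w) + pi)" if "w \<in> sphere 0 1" for w
  proof (rule periodic_cis_cong[of \<phi>, OF per])
    have "w \<noteq> 0" "norm w = 1" using that by auto
    then show "cis (Arg w) = cis (Arg (- w) + pi)"
      by (simp add: cis_mult[symmetric] cis_Arg sgn_div_norm)
  qed
  have cont: "continuous_on (sphere 0 1) (\<lambda>w. \<phi> (Arg w))"
    unfolding continuous_on_eq_continuous_within
  proof
    fix w :: complex assume w: "w \<in> sphere 0 1"
    show "continuous (at w within sphere 0 1) (\<lambda>w. \<phi> (Arg w))"
    proof (cases "w \<in> \<real>\<^sub>\<le>\<^sub>0")
      case False
      show ?thesis by (rule continuous_at_imp_continuous_at_within[OF isCont_o2[OF continuous_at_Arg[OF False] cphi]])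
    next
      case True
      have nn: "- w \<notin> \<real>\<^sub>\<le>\<^sub>0"
      proof
        assume "- w \<in> \<real>\<^sub>\<le>\<^sub>0"
        then have "w = 0" using True by (simp add: complex_nonpos_Reals_iff complex_eq_iff)
        then show False using w by simp
      qed
      have a: "isCont (\<lambda>w. Arg (- w)) w"
        by (rule isCont_o2[where f = uminus and g = Arg, OF _ continuous_at_Arg[OF nn]]) (rule continuous_minus[OF continuous_ident])
      have "isCont (\<lambda>w. Arg (- w) + pi) w" by (rule continuous_add[OF a continuous_const])
      then have "isCont (\<lambda>w. \<phi> (Arg (- w) + pi)) w" by (rule isCont_o2[OF _ cphi])
      then have "continuous (at w within sphere 0 1) (\<lambda>w. \<phi> (Arg (- w) + pi))" by (rule continuous_at_imp_continuous_at_within)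
      then show ?thesis
        unfolding continuous_within eq[OF w] by (rule Lim_transform_eventually) (auto simp: eventually_at_filter eq)
    qed
  qed
  obtain g where g: "real_polynomial_function g" "\<And>w. w \<in> sphere 0 1 \<Longrightarrow> \<bar>\<phi> (Arg w) - g w\<bar> < e"
    using Stone_Weierstrass_real_polynomial_function[OF compact_sphere cont e] by blast
  show thesis
  proof (rule that[OF real_polynomial_on_circle[OF g(1)]])
    fix x
    have "\<phi> (Arg (cis x)) = \<phi> x" by (rule periodic_cis_cong[of \<phi>, OF per]) (simp add: cis_Arg sgn_div_norm)
    then show "\<bar>\<phi> x - g (cis x)\<bar> < e" using g(2)[of "cis x"] by simp
  qed
qed

lemma trig_poly_continuous: "trig_poly p \<Longrightarrow> continuous_on UNIV p"
  by (induction rule: trig_poly.induct) (intro continuous_intros; assumption)+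

lemma trig_poly_bounded: "trig_poly p \<Longrightarrow> \<exists>B. \<forall>x. \<bar>p x\<bar> \<le> B"
proof (induction rule: trig_poly.induct)
  case (monomial c n)
  have "\<bar>Re (c * cis (real n * x))\<bar> \<le> norm c" for x
    using abs_Re_le_cmod[of "c * cis (real n * x)"] by (simp add: norm_mult)
  then show ?case by blast
next
  case (add p q)
  then obtain A B where "\<forall>x. \<bar>p x\<bar> \<le> A" "\<forall>x. \<bar>q x\<bar> \<le> B" by blast
  then have "\<bar>p x + q x\<bar> \<le> A + B" for x by (meson abs_triangle_ineq add_mono order_trans)
  then show ?case by blast
qed

lemma trig_poly_integrable:
  assumes "prob_space \<mu>" "sets \<mu> = sets borel" "trig_poly p"
  shows "integrable \<mu> p"
proof -
  interpret prob_space \<mu> by (rule assms)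
  obtain B where "\<forall>x. \<bar>p x\<bar> \<le> B" using trig_poly_bounded[OF assms(3)] by blast
  moreover have "p \<in> borel_measurable \<mu>"
    using borel_measurable_continuous_onI[OF trig_poly_continuous[OF assms(3)]] measurable_cong_sets[OF assms(2) refl] by blast
  ultimately show ?thesis by (intro integrable_const_bound[of _ B]) auto
qed

lemma cis_integrable:
  assumes "prob_space \<mu>" "sets \<mu> = sets borel"
  shows "integrable \<mu> (\<lambda>x. cis (c * x))"
proof -
  interpret prob_space \<mu> by (rule assms)
  have "(\<lambda>x. cis (c * x)) \<in> borel_measurable borel" by (intro borel_measurable_continuous_onI continuous_intros)
  then have "(\<lambda>x. cis (c * x)) \<in> borel_measurable \<mu>" using measurable_cong_sets[OF assms(2) refl] by blast
  then show ?thesis by (intro integrable_const_bound[of _ 1]) auto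
qed

lemma integral_uniform_approx:
  assumes \<mu>: "prob_space \<mu>" "sets \<mu> = sets borel" and c: "continuous_on UNIV \<phi>" and p: "trig_poly p"
    and e: "\<And>x. \<bar>\<phi> x - p x\<bar> < e"
  shows "integrable \<mu> \<phi>" "\<bar>(LINT x|\<mu>. \<phi> x) - (LINT x|\<mu>. p x)\<bar> \<le> e"
proof -
  interpret prob_space \<mu> by (rule \<mu>)
  note ip = trig_poly_integrable[OF \<mu> p]
  have m: "\<phi> \<in> borel_measurable \<mu>" using borel_measurable_continuous_onI[OF c] measurable_cong_sets[OF \<mu>(2) refl] by blast
  have "integrable \<mu> (\<lambda>x. \<phi> x - p x)"
    by (rule integrable_const_bound[of _ e]) (use e m ip in \<open>auto intro!: AE_I2 less_imp_le\<close>)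
  from Bochner_Integration.integrable_add[OF this ip] show i: "integrable \<mu> \<phi>" by simp
  have "\<bar>(LINT x|\<mu>. \<phi> x) - (LINT x|\<mu>. p x)\<bar> = norm (LINT x|\<mu>. \<phi> x - p x)" using i ip by simp
  also have "\<dots> \<le> (LINT x|\<mu>. e)"
    by (rule order_trans[OF integral_norm_bound integral_mono]) (use i ip e in \<open>auto intro: less_imp_le\<close>)
  finally show "\<bar>(LINT x|\<mu>. \<phi> x) - (LINT x|\<mu>. p x)\<bar> \<le> e" by (simp add: prob_space)
qed

context
  fixes D :: "real \<Rightarrow> real"
  assumes D: "D \<in> borel_measurable borel" "\<And>x. 0 \<le> D x"
begin

lemma circle_measure_density:
  "circle_measure D = density lborel (\<lambda>x. ennreal (indicator {0..<2 * pi} x * D x))"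
  unfolding circle_measure_def by (intro arg_cong[where f = "density lborel"] ext) (auto simp: indicator_def)

lemma sets_circle_measure: "sets (circle_measure D) = sets borel" "space (circle_measure D) = UNIV"
  unfolding circle_measure_def by auto

lemma moment_eq_integral: "moment D n = (LINT x|circle_measure D. cis (real n * x))"
proof -
  have c: "(\<lambda>x. cis (real n * x)) \<in> borel_measurable borel" by (intro borel_measurable_continuous_onI continuous_intros)
  have "(LINT x|circle_measure D. cis (real n * x)) = (LINT x|lborel. (indicator {0..<2 * pi} x * D x) *\<^sub>R cis (real n * x))"
    unfolding circle_measure_density by (rule integral_density) (use D c in \<open>auto intro!: AE_I2\<close>)
  also have "\<dots> = (LINT x|lborel. indicator {0..2 * pi} x *\<^sub>R (cis (real n * x) * complex_of_real (D x)))"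
  proof (rule integral_cong_AE)
    show "AE x in lborel. (indicator {0..<2 * pi} x * D x) *\<^sub>R cis (real n * x) = indicator {0..2 * pi} x *\<^sub>R (cis (real n * x) * complex_of_real (D x))"
      using AE_lborel_singleton[of "2 * pi"]
      by eventually_elim (auto simp: indicator_def scaleR_conv_of_real)
  qed (use D c in measurable)
  finally show ?thesis unfolding moment_def set_lebesgue_integral_def ..
qed

lemma prob_space_circle_measure:
  assumes "moment D 0 = 1"
  shows "prob_space (circle_measure D)"
proof (rule prob_spaceI)
  let ?\<mu> = "circle_measure D"
  have "complex_of_real (measure ?\<mu> (space ?\<mu>)) = 1" using assms unfolding moment_eq_integral by (simp add: scaleR_conv_of_real)
  then have "enn2real (emeasure ?\<mu> (space ?\<mu>)) = 1" by (simp add: measure_def)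
  then show "emeasure ?\<mu> (space ?\<mu>) = 1" by (cases "emeasure ?\<mu> (space ?\<mu>)") (auto simp: top_ennreal.rep_eq)
qed

text \<open>The measure of a half-line is a limit of integrals of continuous periodic functions: for $0 < x < 2\pi$,
$\cos(x - b/2) - \cos(b/2)$ is positive exactly if $x < b$. The measure has no atoms, so the boundary
points 0 and b do not matter.\<close>
lemma circle_measure_atMost:
  assumes "moment D 0 = 1"
  obtains \<phi> :: "nat \<Rightarrow> real \<Rightarrow> real" where "\<And>k. continuous_on UNIV (\<phi> k)" "\<And>k x. \<phi> k (x + 2 * pi) = \<phi> k x"
    "(\<lambda>k. LINT x|circle_measure D. \<phi> k x) \<longlonglongrightarrow> measure (circle_measure D) {..a}"
    "\<phi> = (\<lambda>k x. min 1 (real k * max 0 (cos (x - max 0 (min (2 * pi) a) / 2) - cos (max 0 (min (2 * pi) a) / 2))))"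
proof -
  interpret prob_space "circle_measure D" by (rule prob_space_circle_measure[OF assms])
  define b where "b = max 0 (min (2 * pi) a)"
  define \<phi> where "\<phi> k x = min 1 (real k * max 0 (cos (x - b / 2) - cos (b / 2)))" for k x
  have c: "continuous_on UNIV (\<phi> k)" for k unfolding \<phi>_def[abs_def] by (intro continuous_intros)
  have per: "\<phi> k (x + 2 * pi) = \<phi> k x" for k x
  proof -
    have "cos (x + 2 * pi - b / 2) = cos (x - b / 2)" using cos_periodic[of "x - b / 2"] by (simp add: algebra_simps)
    then show ?thesis unfolding \<phi>_def by simp
  qed
  have lim: "(\<lambda>k. \<phi> k x) \<longlonglongrightarrow> indicator {..a} x" if x: "0 < x" "x < 2 * pi" "x \<noteq> a" for x
  proof -
    have h: "cos (x - b / 2) - cos (b / 2) = 2 * sin (x / 2) * sin ((b - x) / 2)"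
    proof -
      have "(x - b / 2 + b / 2) / 2 = x / 2" "(b / 2 - (x - b / 2)) / 2 = (b - x) / 2" by (simp_all add: field_simps)
      then show ?thesis unfolding cos_diff_cos by (simp only:)
    qed
    have s: "sin (x / 2) > 0" using x by (intro sin_gt_zero) auto
    show ?thesis
    proof (cases "x < a")
      case True
      then have "sin ((b - x) / 2) > 0" using x by (intro sin_gt_zero) (auto simp: b_def)
      then have h0: "cos (x - b / 2) - cos (b / 2) > 0" unfolding h using s by simp
      obtain k0 where k0: "1 / (cos (x - b / 2) - cos (b / 2)) < real k0" using reals_Archimedean2 by blast
      have "\<phi> k x = 1" if "k \<ge> k0" for k
      proof -
        have "1 / (cos (x - b / 2) - cos (b / 2)) < real k" using k0 that by simp
        then have "1 < real k * (cos (x - b / 2) - cos (b / 2))" using h0 by (simp add: divide_less_eq)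
        then show ?thesis unfolding \<phi>_def using h0 by simp
      qed
      then have "\<forall>\<^sub>F k in sequentially. \<phi> k x = indicator {..a} x" using True by (auto simp: eventually_sequentially)
      then show ?thesis by (rule tendsto_eventually)
    next
      case False
      then have "b \<le> x" using x by (auto simp: b_def)
      then have "sin ((x - b) / 2) \<ge> 0" using x by (intro sin_ge_zero) (auto simp: b_def)
      moreover have "sin ((b - x) / 2) = - sin ((x - b) / 2)" unfolding sin_minus[symmetric] by (rule arg_cong[where f = sin]) (simp add: field_simps)
      ultimately have "cos (x - b / 2) - cos (b / 2) \<le> 0" unfolding h using s by (simp add: mult_nonneg_nonneg)
      then have "\<phi> k x = 0" for k unfolding \<phi>_def by simp
      then show ?thesis using False x by simp
    qed
  qed
  have "(\<lambda>k. LINT x|circle_measure D. \<phi> k x) \<longlonglongrightarrow> (LINT x|circle_measure D. indicator {..a} x)"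
  proof (rule integral_dominated_convergence[where w = "\<lambda>_. 1"])
    show "AE x in circle_measure D. (\<lambda>k. \<phi> k x) \<longlonglongrightarrow> indicator {..a} x"
      unfolding circle_measure_density
    proof (subst AE_density)
      show "AE x in lborel. 0 < ennreal (indicator {0..<2 * pi} x * D x) \<longrightarrow> (\<lambda>k. \<phi> k x) \<longlonglongrightarrow> indicator {..a} x"
        using AE_lborel_singleton[of 0] AE_lborel_singleton[of a]
      proof eventually_elim
        case (elim x)
        show ?case
        proof
          assume "0 < ennreal (indicator {0..<2 * pi} x * D x)"
          then have "x \<in> {0..<2 * pi}" by (rule contrapos_pp) (simp only: indicator_simps mult_zero_left ennreal_0 less_irrefl not_False_eq_True)
          then show "(\<lambda>k. \<phi> k x) \<longlonglongrightarrow> indicator {..a} x" by (intro lim) (use elim in auto)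
        qed
      qed
    qed (use D in measurable)
    have "\<bar>\<phi> k x\<bar> \<le> 1" for k x unfolding \<phi>_def by simp
    then show "AE x in circle_measure D. norm (\<phi> k x) \<le> 1" for k by simp
    show "\<phi> k \<in> borel_measurable (circle_measure D)" for k
      using borel_measurable_continuous_onI[OF c] measurable_cong_sets[OF sets_circle_measure(1) refl] by blast
    show "(\<lambda>x. indicator {..a} x :: real) \<in> borel_measurable (circle_measure D)"
      unfolding measurable_cong_sets[OF sets_circle_measure(1) refl] by measurable
  qed simp
  also have "(LINT x|circle_measure D. indicator {..a} x) = measure (circle_measure D) {..a}"
    using sets_circle_measure by simp
  finally show thesis using that[OF c per] by (simp add: \<phi>_def[abs_def] b_def)
qed

end

lemma moment_norm_le:
  assumes "D \<in> borel_measurable borel" "\<And>x. 0 \<le> D x" "moment D 0 = 1"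
  shows "norm (moment D n) \<le> 1"
proof -
  interpret prob_space "circle_measure D" by (rule prob_space_circle_measure[OF assms])
  have "norm (LINT x|circle_measure D. cis (real n * x)) \<le> (LINT x|circle_measure D. norm (cis (real n * x)))"
    by (rule integral_norm_bound)
  then show ?thesis unfolding moment_eq_integral[OF assms(1,2)] using prob_space by simp
qed

text \<open>Measurability of a random measure can be tested on its moments: these determine the integrals of
continuous periodic functions measurably, hence the measures of half-lines, which generate the Borel
sets.\<close>
lemma random_measure_of_moments:
  assumes f: "\<And>\<omega>. \<omega> \<in> space M \<Longrightarrow> f \<omega> \<in> borel_measurable borel" "\<And>\<omega> x. \<omega> \<in> space M \<Longrightarrow> 0 \<le> f \<omega> x"
    and 1: "\<And>\<omega>. \<omega> \<in> space M \<Longrightarrow> moment (f \<omega>) 0 = 1"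
    and m: "\<And>n. (\<lambda>\<omega>. moment (f \<omega>) n) \<in> borel_measurable M"
  shows "random_density M f"
proof -
  let ?\<mu> = "\<lambda>\<omega>. circle_measure (f \<omega>)"
  have P: "prob_space (?\<mu> \<omega>)" "sets (?\<mu> \<omega>) = sets borel" if "\<omega> \<in> space M" for \<omega>
    by (rule prob_space_circle_measure[OF f(1)[OF that] f(2)[OF that] 1[OF that]]) (simp add: circle_measure_def)
  have tp: "(\<lambda>\<omega>. LINT x|?\<mu> \<omega>. p x) \<in> borel_measurable M" if "trig_poly p" for p
    using that
  proof induction
    case (monomial c n)
    have "(LINT x|?\<mu> \<omega>. Re (c * cis (real n * x))) = Re (c * moment (f \<omega>) n)" if "\<omega> \<in> space M" for \<omega>
    proof -
      have i: "integrable (?\<mu> \<omega>) (\<lambda>x. cis (real n * x))" by (rule cis_integrable[OF P, OF that that])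
      have "(LINT x|?\<mu> \<omega>. Re (c * cis (real n * x))) = Re (LINT x|?\<mu> \<omega>. c * cis (real n * x))"
        by (rule integral_bounded_linear[OF bounded_linear_Re]) (intro integrable_mult_right i)
      then show ?thesis unfolding moment_eq_integral[OF f, OF that that] by simp
    qed
    moreover have "(\<lambda>\<omega>. Re (c * moment (f \<omega>) n)) \<in> borel_measurable M" using m by measurable
    ultimately show ?case by (simp cong: measurable_cong)
  next
    case (add p q)
    have "(LINT x|?\<mu> \<omega>. p x + q x) = (LINT x|?\<mu> \<omega>. p x) + (LINT x|?\<mu> \<omega>. q x)" if "\<omega> \<in> space M" for \<omega>
      using trig_poly_integrable[OF P, OF that that] add.hyps by (intro Bochner_Integration.integral_add)
    then show ?case using add.IH by (simp cong: measurable_cong)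
  qed
  have cont: "(\<lambda>\<omega>. LINT x|?\<mu> \<omega>. \<phi> x) \<in> borel_measurable M"
    if \<phi>: "continuous_on UNIV \<phi>" "\<And>x. \<phi> (x + 2 * pi) = \<phi> x" for \<phi> :: "real \<Rightarrow> real"
  proof -
    have "\<exists>p. trig_poly p \<and> (\<forall>x. \<bar>\<phi> x - p x\<bar> < inverse (real (Suc k)))" for k
      by (rule trig_approximation[OF \<phi>, of "inverse (real (Suc k))"]) (auto simp del: of_nat_Suc)
    then obtain p where p: "\<And>k. trig_poly (p k)" "\<And>k x. \<bar>\<phi> x - p k x\<bar> < inverse (real (Suc k))" by metis
    show ?thesis
    proof (rule borel_measurable_LIMSEQ_real[of M "\<lambda>k \<omega>. LINT x|?\<mu> \<omega>. p k x"])
      fix \<omega> assume \<omega>: "\<omega> \<in> space M"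
      show "(\<lambda>k. LINT x|?\<mu> \<omega>. p k x) \<longlonglongrightarrow> (LINT x|?\<mu> \<omega>. \<phi> x)"
        unfolding LIM_zero_iff[symmetric, of _ "LINT x|?\<mu> \<omega>. \<phi> x"]
        by (rule Lim_null_comparison[OF always_eventually LIMSEQ_inverse_real_of_nat])
          (use integral_uniform_approx(2)[OF P[OF \<omega>] \<phi>(1) p] in \<open>simp add: abs_minus_commute\<close>)
    qed (rule tp[OF p(1)])
  qed
  have "?\<mu> \<in> measurable M (prob_algebra borel)"
  proof (rule measurable_prob_algebra_generated[where G = "range atMost" and \<Omega> = UNIV])
    show "sets borel = sigma_sets UNIV (range (atMost :: real \<Rightarrow> _))"
      unfolding borel_eq_atMost by (simp add: sets_measure_of_conv)
    show "Int_stable (range (atMost :: real \<Rightarrow> _))" by (auto simp: Int_stable_def)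
    fix A :: "real set" assume "A \<in> range atMost"
    then obtain a where A: "A = {..a}" by blast
    let ?\<phi> = "\<lambda>k x. min 1 (real k * max 0 (cos (x - max 0 (min (2 * pi) a) / 2) - cos (max 0 (min (2 * pi) a) / 2)))"
    have e: "continuous_on UNIV (?\<phi> k)" "?\<phi> k (x + 2 * pi) = ?\<phi> k x"
        "(\<lambda>k. LINT x|?\<mu> \<omega>. ?\<phi> k x) \<longlonglongrightarrow> measure (?\<mu> \<omega>) {..a}" if "\<omega> \<in> space M" for \<omega> k x
      by (rule circle_measure_atMost[OF f 1, OF that that that, of a]; simp only:)+
    have "(\<lambda>\<omega>. measure (?\<mu> \<omega>) {..a}) \<in> borel_measurable M"
    proof (cases "space M = {}")
      case True then show ?thesis by (simp add: measurable_def)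
    next
      case False
      then obtain \<omega>0 where "\<omega>0 \<in> space M" by blast
      from cont[OF e(1,2)[OF this]] e(3) show ?thesis by (rule borel_measurable_LIMSEQ_real[rotated])
    qed
    moreover have "emeasure (?\<mu> \<omega>) A = ennreal (measure (?\<mu> \<omega>) {..a})" if "\<omega> \<in> space M" for \<omega>
      unfolding A using finite_measure.emeasure_eq_measure[OF prob_space.finite_measure[OF P(1)[OF that]]] .
    ultimately show "(\<lambda>\<omega>. emeasure (?\<mu> \<omega>) A) \<in> borel_measurable M" by (simp cong: measurable_cong)
  qed (use P in auto)
  then show ?thesis unfolding random_density_def using f by blast
qed

lemma random_density_props:
  assumes "random_density M f" "\<omega> \<in> space M"
  shows "f \<omega> \<in> borel_measurable borel" "\<And>x. 0 \<le> f \<omega> x" "moment (f \<omega>) 0 = 1"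
proof -
  show b: "f \<omega> \<in> borel_measurable borel" "\<And>x. 0 \<le> f \<omega> x" using assms unfolding random_density_def by blast+
  have "circle_measure (f \<omega>) \<in> space (prob_algebra borel)"
    using assms unfolding random_density_def by (blast dest: measurable_space)
  then interpret prob_space "circle_measure (f \<omega>)" by (simp add: space_prob_algebra)
  show "moment (f \<omega>) 0 = 1" unfolding moment_eq_integral[OF b] using prob_space by simp
qed

lemma random_density_moment_measurable:
  assumes "random_density M f"
  shows "(\<lambda>\<omega>. moment (f \<omega>) n) \<in> borel_measurable M"
proof -
  have c: "(\<lambda>x. cis (real n * x)) \<in> borel_measurable borel" by (intro borel_measurable_continuous_onI continuous_intros)
  have "(\<lambda>\<omega>. circle_measure (f \<omega>)) \<in> measurable M (subprob_algebra borel)"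
    using assms unfolding random_density_def by (blast intro: measurable_prob_algebraD)
  from measurable_compose[OF this integral_measurable_subprob_algebra[OF c]]
  have "(\<lambda>\<omega>. LINT x|circle_measure (f \<omega>). cis (real n * x)) \<in> borel_measurable M" .
  moreover have "moment (f \<omega>) n = (LINT x|circle_measure (f \<omega>). cis (real n * x))" if "\<omega> \<in> space M" for \<omega>
    using moment_eq_integral random_density_props(1,2)[OF assms that] by blast
  ultimately show ?thesis by (simp cong: measurable_cong)
qed

definition interpolated_moment :: "nat \<Rightarrow> nat \<Rightarrow> (nat \<Rightarrow> 'a \<Rightarrow> int list) \<Rightarrow> real \<Rightarrow> 'a \<Rightarrow> nat \<Rightarrow> complex" where
  "interpolated_moment L N X t \<omega> n =
     (\<Sum>k<N. cis (real n * (2 * pi * interpolate X ((real L)\<^sup>2 * t) \<omega> k / real L))) / of_nat N"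

lemma prob_space_empirical_measure:
  "N \<ge> 1 \<Longrightarrow> prob_space (empirical_measure L N X t \<omega>)" "sets (empirical_measure L N X t \<omega>) = sets borel"
proof -
  assume N: "N \<ge> 1"
  interpret prob_space "uniform_count_measure {..<N}" by (rule prob_space_uniform_count_measure) (use N in \<open>auto simp: lessThan_empty_iff\<close>)
  show "prob_space (empirical_measure L N X t \<omega>)" unfolding empirical_measure_def
    by (rule prob_space_distr) (simp add: measurable_def space_uniform_count_measure sets_uniform_count_measure)
qed (simp add: empirical_measure_def)

lemma empirical_integral:
  fixes \<phi> :: "real \<Rightarrow> real"
  assumes N: "N \<ge> 1" and \<phi>: "continuous_on UNIV \<phi>" "\<And>x. \<phi> (x + 2 * pi) = \<phi> x"
  shows "(LINT x|empirical_measure L N X t \<omega>. \<phi> x) =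
    (\<Sum>k<N. \<phi> (2 * pi * interpolate X ((real L)\<^sup>2 * t) \<omega> k / real L)) / real N"
proof -
  have r: "\<phi> (x rmod (2 * pi)) = \<phi> x" for x
    using periodic_int_multiple[of \<phi> "x rmod (2 * pi)" "\<lfloor>x / (2 * pi)\<rfloor>", OF \<phi>(2)] by (simp add: rmod_def)
  have m: "(\<lambda>k. (2 * pi * interpolate X ((real L)\<^sup>2 * t) \<omega> k / real L) rmod (2 * pi)) \<in> measurable (uniform_count_measure {..<N}) borel"
    by (simp add: measurable_def space_uniform_count_measure sets_uniform_count_measure)
  show ?thesis unfolding empirical_measure_def integral_distr[OF m borel_measurable_continuous_onI[OF \<phi>(1)]]
    by (simp add: r integral_uniform_count_measure)
qed

lemma empirical_integral_monomial:
  assumes N: "N \<ge> 1"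
  shows "(LINT x|empirical_measure L N X t \<omega>. Re (c * cis (real n * x))) = Re (c * interpolated_moment L N X t \<omega> n)"
proof -
  have e: "Re (c * cis (real n * (x + 2 * pi))) = Re (c * cis (real n * x))" for x
  proof -
    have "cis (real n * (x + 2 * pi)) = cis (real n * x) * cis (2 * pi * real n)" unfolding cis_mult by (simp add: algebra_simps)
    then show ?thesis by simp
  qed
  have "(LINT x|empirical_measure L N X t \<omega>. Re (c * cis (real n * x))) =
    (\<Sum>k<N. Re (c * cis (real n * (2 * pi * interpolate X ((real L)\<^sup>2 * t) \<omega> k / real L)))) / real N"
    by (rule empirical_integral[OF N]) (intro continuous_intros e)+
  also have "\<dots> = Re ((\<Sum>k<N. c * cis (real n * (2 * pi * interpolate X ((real L)\<^sup>2 * t) \<omega> k / real L))) / of_nat N)"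
    unfolding Re_divide_of_nat Re_sum ..
  finally show ?thesis unfolding interpolated_moment_def by (simp only: sum_distrib_left times_divide_eq_right)
qed

text \<open>Interpolation between two states moves one particle by less than one site.\<close>
lemma interpolated_moment_close:
  assumes L: "L \<ge> 1" and N: "N \<ge> 1" and len: "length (X j \<omega>) = N" and adj: "walk_adj (X j \<omega>) (X (Suc j) \<omega>)"
    and j: "j = nat \<lfloor>(real L)\<^sup>2 * t\<rfloor>" and n: "n > 0"
  shows "norm (interpolated_moment L N X t \<omega> n - fps_nth (walk_moments L (X j \<omega>)) n) \<le> 2 * pi * real n / (real L * real N)"
proof -
  let ?x = "X j \<omega>" and ?y = "X (Suc j) \<omega>"
  let ?u = "\<lambda>k. real n * (2 * pi * interpolate X ((real L)\<^sup>2 * t) \<omega> k / real L)" and ?v = "\<lambda>k. 2 * pi * real n * of_int (?x ! k) / real L"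
  obtain i where i: "i < N" "?y = ?x[i := ?x ! i + 1] \<or> ?y = ?x[i := ?x ! i - 1]" using adj len unfolding walk_adj_def by auto
  have d: "norm (cis (?u k) - cis (?v k)) \<le> (if k = i then 2 * pi * real n / real L else 0)" if k: "k < N" for k
  proof -
    let ?f = "frac ((real L)\<^sup>2 * t)"
    have ip: "interpolate X ((real L)\<^sup>2 * t) \<omega> k = of_int (?x ! k) + ?f * (of_int (?y ! k) - of_int (?x ! k))"
      unfolding interpolate_def Let_def j[symmetric] by (simp add: algebra_simps)
    have "\<bar>?u k - ?v k\<bar> = 2 * pi * real n / real L * \<bar>?f * (of_int (?y ! k) - of_int (?x ! k))\<bar>"
    proof -
      have "?u k - ?v k = 2 * pi * real n / real L * (?f * (of_int (?y ! k) - of_int (?x ! k)))"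
        unfolding ip by (simp add: algebra_simps add_divide_distrib diff_divide_distrib)
      then have "\<bar>?u k - ?v k\<bar> = \<bar>2 * pi * real n / real L * (?f * (of_int (?y ! k) - of_int (?x ! k)))\<bar>" by (simp only:)
      also have "\<dots> = 2 * pi * real n / real L * \<bar>?f * (of_int (?y ! k) - of_int (?x ! k))\<bar>"
        by (subst abs_mult[of "2 * pi * real n / real L"], subst abs_of_nonneg[of "2 * pi * real n / real L"]) simp_all
      finally show ?thesis .
    qed
    also have "\<dots> \<le> 2 * pi * real n / real L * (if k = i then 1 else 0)"
    proof (rule mult_left_mono)
      show "\<bar>?f * (of_int (?y ! k) - of_int (?x ! k))\<bar> \<le> (if k = i then 1 else 0)"
        using i k len frac_ge_0[of "(real L)\<^sup>2 * t"] frac_lt_1[of "(real L)\<^sup>2 * t"] by (auto simp: nth_list_update abs_mult)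
    qed simp
    finally show ?thesis using norm_cis_diff_le[of "?u k" "?v k"] by (auto split: if_splits)
  qed
  have "norm (\<Sum>k<N. cis (?u k) - cis (?v k)) \<le> (\<Sum>k<N. if k = i then 2 * pi * real n / real L else 0)"
    by (rule sum_norm_le) (use d in auto)
  also have "\<dots> = 2 * pi * real n / real L" using i by simp
  finally have "norm (\<Sum>k<N. cis (?u k) - cis (?v k)) / real N \<le> 2 * pi * real n / real L / real N" by (intro divide_right_mono) auto
  moreover have "interpolated_moment L N X t \<omega> n - fps_nth (walk_moments L ?x) n = (\<Sum>k<N. cis (?u k) - cis (?v k)) / of_nat N"
    using n unfolding interpolated_moment_def walk_moments_def by (simp add: len sum_subtractf diff_divide_distrib)
  ultimately show ?thesis by (simp add: norm_divide)
qed

lemma interpolated_moment_norm: "norm (interpolated_moment L N X t \<omega> n) \<le> 1"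
proof -
  have "norm (\<Sum>k<N. cis (real n * (2 * pi * interpolate X ((real L)\<^sup>2 * t) \<omega> k / real L))) \<le> (\<Sum>k<N. 1)"
    by (rule sum_norm_le) simp
  then show ?thesis unfolding interpolated_moment_def by (cases "N = 0") (auto simp: norm_divide)
qed

section \<open>The limit of the drift and bounds that pass to the limit\<close>

lemma norm_nth_le_pnorm_1: "i \<le> n \<Longrightarrow> norm (fps_nth f i) \<le> pnorm 1 n f"
  using norm_nth_le_pnorm[of 1 i n f] by simp

context transport_equation
begin

lemma rate_nth:
  "fps_nth g 0 = 0 \<Longrightarrow> fps_nth (rate g) n =
     of_nat n * (a * fps_nth (fexp (fps_const \<beta> * g)) n + b * fps_nth (fexp (fps_const (- \<beta>) * g)) n)"
  by (simp add: rate_eq_euler potential_def)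

definition rate_lipschitz_const :: "nat \<Rightarrow> real \<Rightarrow> real" where
  "rate_lipschitz_const n B = real n * (norm a + norm b) * (exp (3 * (norm \<beta> * (real (Suc n) * B))) * norm \<beta>)"

lemma rate_lipschitz_const_nonneg: "0 \<le> rate_lipschitz_const n B"
  by (simp add: rate_lipschitz_const_def)

text \<open>On bounded sets the vector field is Lipschitz in the coefficients up to n, which is what the Gronwall
argument requires.\<close>
lemma rate_lipschitz:
  assumes 0: "fps_nth g 0 = 0" "fps_nth h 0 = 0"
    and B: "\<And>k. k \<le> n \<Longrightarrow> norm (fps_nth g k) \<le> B" "\<And>k. k \<le> n \<Longrightarrow> norm (fps_nth h k) \<le> B" and k: "k \<le> n"
  shows "norm (fps_nth (rate g) k - fps_nth (rate h) k) \<le> rate_lipschitz_const n B * pnorm 1 n (g - h)"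
proof -
  let ?d = "exp (3 * (norm \<beta> * (real (Suc n) * B))) * (norm \<beta> * pnorm 1 n (g - h))"
  have d: "norm (fps_nth (fexp (fps_const c * g)) k - fps_nth (fexp (fps_const c * h)) k) \<le> ?d" if c: "norm c = norm \<beta>" for c
  proof -
    have pg: "pnorm 1 n (fps_const c * g) \<le> norm \<beta> * (real (Suc n) * B)"
      unfolding pnorm_const_mult c by (intro mult_left_mono pnorm_1_le B) auto
    have ph: "pnorm 1 n (fps_const c * h) \<le> norm \<beta> * (real (Suc n) * B)"
      unfolding pnorm_const_mult c by (intro mult_left_mono pnorm_1_le B) auto
    have "norm (fps_nth (fexp (fps_const c * g) - fexp (fps_const c * h)) k) \<le> pnorm 1 n (fexp (fps_const c * g) - fexp (fps_const c * h))"
      by (rule norm_nth_le_pnorm_1[OF k])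
    also have "\<dots> \<le> exp (3 * (norm \<beta> * (real (Suc n) * B))) * pnorm 1 n (fps_const c * g - fps_const c * h)"
      by (rule pnorm_fexp_diff[OF _ _ _ pg ph]) (use 0 in auto)
    also have "fps_const c * g - fps_const c * h = fps_const c * (g - h)" by (simp add: algebra_simps)
    finally show ?thesis unfolding pnorm_const_mult c by simp
  qed
  have "norm (fps_nth (rate g) k - fps_nth (rate h) k) = real k *
      norm (a * (fps_nth (fexp (fps_const \<beta> * g)) k - fps_nth (fexp (fps_const \<beta> * h)) k) +
            b * (fps_nth (fexp (fps_const (- \<beta>) * g)) k - fps_nth (fexp (fps_const (- \<beta>) * h)) k))"
    unfolding rate_nth[OF 0(1)] rate_nth[OF 0(2)]
    by (subst norm_of_nat[symmetric, where 'a = complex], subst norm_mult[symmetric]) (simp only: algebra_simps)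
  also have "\<dots> \<le> real n * (norm a * ?d + norm b * ?d)"
    using k by (intro mult_mono order_trans[OF norm_triangle_ineq] add_mono) (auto simp only: norm_mult norm_minus_cancel norm_ge_zero of_nat_0_le_iff of_nat_le_iff intro!: mult_left_mono d)
  also have "\<dots> = rate_lipschitz_const n B * pnorm 1 n (g - h)"
    unfolding rate_lipschitz_const_def by (simp add: algebra_simps)
  finally show ?thesis .
qed

definition rate_bound :: "nat \<Rightarrow> real \<Rightarrow> real" where
  "rate_bound n B = rate_lipschitz_const n B * (real (Suc n) * B)"

lemma norm_rate_le:
  assumes 0: "fps_nth g 0 = 0" and B: "B \<ge> 0" "\<And>k. k \<le> n \<Longrightarrow> norm (fps_nth g k) \<le> B" and k: "k \<le> n"
  shows "norm (fps_nth (rate g) k) \<le> rate_bound n B"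
proof -
  have "norm (fps_nth (rate g) k - fps_nth (rate 0) k) \<le> rate_lipschitz_const n B * pnorm 1 n (g - 0)"
    by (rule rate_lipschitz) (use 0 B k in auto)
  also have "\<dots> \<le> rate_bound n B" unfolding rate_bound_def
    by (rule mult_left_mono[OF _ rate_lipschitz_const_nonneg]) (use pnorm_1_le[of n g B] B in simp)
  finally have "norm (fps_nth (rate g) k - fps_nth (rate 0) k) \<le> rate_bound n B" .
  moreover have "rate 0 = 0" by (rule fps_ext) (simp add: rate_def euler_def)
  ultimately show ?thesis by simp
qed

text \<open>A solution moves with bounded speed, and one step of the Euler scheme has an error that is quadratic
in the step size.\<close>
lemma flow_increment:
  assumes flow: "transport_flow g" and st: "0 \<le> s" "s \<le> t" "t \<le> T" and B: "B \<ge> 0"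
    and bd: "\<And>s k. s \<in> {0..T} \<Longrightarrow> k \<le> n \<Longrightarrow> norm (fps_nth (g s) k) \<le> B" and k: "k \<le> n"
  shows "norm (fps_nth (g t) k - fps_nth (g s) k) \<le> 3 * rate_bound n B * (t - s)"
    and "norm (fps_nth (g t) k - fps_nth (g s) k - of_real (t - s) * fps_nth (rate (g s)) k)
      \<le> (rate_lipschitz_const n B * (real (Suc n) * (3 * rate_bound n B))) * (t - s)\<^sup>2"
proof -
  have R0: "0 \<le> rate_bound n B" unfolding rate_bound_def using B rate_lipschitz_const_nonneg by auto
  have g0: "fps_nth (g u) 0 = 0" if "u \<ge> 0" for u by (rule transport_flow_nth_0[OF flow that])
  have lin: "norm (fps_nth (g t) k - fps_nth (g s) k - of_real (t - s) * fps_nth (rate (g s)) k) \<le> (t - s) * C"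
    if st: "0 \<le> s" "s \<le> t" "t \<le> T" and k: "k \<le> n" and C: "\<And>u. u \<in> {s..t} \<Longrightarrow> norm (fps_nth (rate (g u)) k - fps_nth (rate (g s)) k) \<le> C" for s t k C
  proof -
    have "norm (fps_nth (g t) k - fps_nth (g s) k - (t - s) *\<^sub>R fps_nth (rate (g s)) k) \<le> norm (t - s) * C"
    proof (rule vector_differentiable_bound_linearization[where S = "{s..t}" and f' = "\<lambda>u. fps_nth (rate (g u)) k"])
      fix u assume u: "u \<in> {s..t}"
      then have "((\<lambda>s. fps_nth (g s) k) has_vector_derivative fps_nth (rate (g u)) k) (at u within {0..})"
        using flow st unfolding transport_flow_def by auto
      then show "((\<lambda>s. fps_nth (g s) k) has_vector_derivative fps_nth (rate (g u)) k) (at u within {s..t})"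
        by (rule has_vector_derivative_within_subset) (use st in auto)
      show "norm (fps_nth (rate (g u)) k - fps_nth (rate (g s)) k) \<le> C" by (rule C[OF u])
    qed (use st in \<open>auto simp: closed_segment_eq_real_ivl\<close>)
    then show ?thesis using st by (simp add: scaleR_conv_of_real)
  qed
  have rb: "norm (fps_nth (rate (g u)) k) \<le> rate_bound n B" if "u \<in> {0..T}" "k \<le> n" for u k
    by (rule norm_rate_le) (use that g0 B bd in auto)
  have inc1: "norm (fps_nth (g t) k - fps_nth (g s) k) \<le> 3 * rate_bound n B * (t - s)"
    if st: "0 \<le> s" "s \<le> t" "t \<le> T" and k: "k \<le> n" for s t k
  proof -
    have "norm (fps_nth (g t) k - fps_nth (g s) k - of_real (t - s) * fps_nth (rate (g s)) k) \<le> (t - s) * (rate_bound n B + rate_bound n B)"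
    proof (rule lin[OF st k])
      fix u assume "u \<in> {s..t}"
      then show "norm (fps_nth (rate (g u)) k - fps_nth (rate (g s)) k) \<le> rate_bound n B + rate_bound n B"
        by (intro order_trans[OF norm_triangle_ineq4] add_mono rb k) (use st in auto)
    qed
    moreover have "norm (of_real (t - s) * fps_nth (rate (g s)) k) \<le> (t - s) * rate_bound n B"
      unfolding norm_mult norm_of_real using st rb[of s k] k by (intro mult_mono) auto
    ultimately have "norm (fps_nth (g t) k - fps_nth (g s) k) \<le> (t - s) * (rate_bound n B + rate_bound n B) + (t - s) * rate_bound n B"
      using norm_triangle_ineq2[of "fps_nth (g t) k - fps_nth (g s) k" "of_real (t - s) * fps_nth (rate (g s)) k"] by linarith
    then show ?thesis by (simp add: algebra_simps)
  qed
  show "norm (fps_nth (g t) k - fps_nth (g s) k) \<le> 3 * rate_bound n B * (t - s)" by (rule inc1[OF st k])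
  have "norm (fps_nth (g t) k - fps_nth (g s) k - of_real (t - s) * fps_nth (rate (g s)) k) \<le>
     (t - s) * (rate_lipschitz_const n B * (real (Suc n) * (3 * rate_bound n B * (t - s))))"
  proof (rule lin[OF st k])
    fix u assume u: "u \<in> {s..t}"
    have "norm (fps_nth (rate (g u)) k - fps_nth (rate (g s)) k) \<le> rate_lipschitz_const n B * pnorm 1 n (g u - g s)"
      by (rule rate_lipschitz) (use u st g0 bd k in auto)
    also have "\<dots> \<le> rate_lipschitz_const n B * (real (Suc n) * (3 * rate_bound n B * (t - s)))"
    proof (rule mult_left_mono[OF _ rate_lipschitz_const_nonneg], rule pnorm_1_le)
      fix j assume j: "j \<le> n"
      have "norm (fps_nth (g u) j - fps_nth (g s) j) \<le> 3 * rate_bound n B * (u - s)"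
        by (rule inc1) (use u st j in auto)
      also have "\<dots> \<le> 3 * rate_bound n B * (t - s)" using u R0 by (intro mult_left_mono) auto
      finally show "norm (fps_nth (g u - g s) j) \<le> 3 * rate_bound n B * (t - s)" by simp
    qed
    finally show "norm (fps_nth (rate (g u)) k - fps_nth (rate (g s)) k) \<le> rate_lipschitz_const n B * (real (Suc n) * (3 * rate_bound n B * (t - s)))" .
  qed
  then show "norm (fps_nth (g t) k - fps_nth (g s) k - of_real (t - s) * fps_nth (rate (g s)) k)
      \<le> (rate_lipschitz_const n B * (real (Suc n) * (3 * rate_bound n B))) * (t - s)\<^sup>2"
    by (simp add: power2_eq_square mult_ac)
qed

end

text \<open>The parameters of the transport equation for which the speed is $-\mathcal V_\alpha$. Up to a factor n
they are the limits of $L^2$ times the factors in front of the exponentials in the drift of the n-th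
moment; the phase belongs to jumps in direction \<open>\<sigma>\<close>.\<close>
definition amplitude :: "real \<Rightarrow> int \<Rightarrow> complex" where
  "amplitude \<alpha> \<sigma> = of_real (pi / (2 * \<alpha> * sin (pi * \<alpha>))) * cis (pi * of_int \<sigma> * \<alpha>)"

abbreviation "messep_phase \<alpha> \<equiv> \<i> * complex_of_real (2 * pi * \<alpha>)"
abbreviation "messep_rate \<alpha> \<equiv> transport_equation.rate (amplitude \<alpha> 1) (amplitude \<alpha> (- 1)) (messep_phase \<alpha>)"
abbreviation "messep_flow \<alpha> \<equiv> transport_equation.flow (amplitude \<alpha> 1) (amplitude \<alpha> (- 1)) (messep_phase \<alpha>)"

lemma velocity_eq_speed:
  assumes "0 < \<alpha>" "\<alpha> < 1"
  shows "velocity \<alpha> w = - transport_equation.speed_fun (amplitude \<alpha> 1) (amplitude \<alpha> (- 1)) (messep_phase \<alpha>) w"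
proof -
  have s: "sin (pi * \<alpha>) > 0" using assms by (intro sin_gt_zero) auto
  let ?u = "complex_of_real (pi * \<alpha>) * (1 + 2 * w)"
  have e1: "cis (pi * \<alpha>) * exp (messep_phase \<alpha> * w) = exp (\<i> * ?u)"
    unfolding cis_conv_exp exp_add[symmetric] by (rule arg_cong[where f = exp]) (simp add: algebra_simps)
  have e2: "cis (- (pi * \<alpha>)) * exp (- (messep_phase \<alpha>) * w) = exp (- (\<i> * ?u))"
    unfolding cis_conv_exp exp_add[symmetric] by (rule arg_cong[where f = exp]) (simp add: algebra_simps)
  let ?c = "complex_of_real (pi / (2 * \<alpha> * sin (pi * \<alpha>)))"
  have "transport_equation.speed_fun (amplitude \<alpha> 1) (amplitude \<alpha> (- 1)) (messep_phase \<alpha>) w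
    = messep_phase \<alpha> * ?c * (cis (pi * \<alpha>) * exp (messep_phase \<alpha> * w)) - messep_phase \<alpha> * ?c * (cis (- (pi * \<alpha>)) * exp (- (messep_phase \<alpha>) * w))"
    unfolding transport_equation.speed_fun_def amplitude_def by (simp add: mult_ac)
  also have "\<dots> = messep_phase \<alpha> * ?c * (exp (\<i> * ?u) - exp (- (\<i> * ?u)))"
    unfolding e1 e2 by (simp only: right_diff_distrib)
  also have "exp (\<i> * ?u) - exp (- (\<i> * ?u)) = 2 * \<i> * sin ?u" unfolding sin_exp_eq by simp
  also have "messep_phase \<alpha> * ?c * (2 * \<i> * sin ?u) = - velocity \<alpha> w"
    unfolding velocity_def using assms s by (simp add: power2_eq_square field_simps)
  finally show ?thesis by simp
qed

lemma sin_scaled_tendsto: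
  assumes L: "filterlim L at_top sequentially"
  shows "(\<lambda>j. real (L j) * sin (c / real (L j))) \<longlonglongrightarrow> c"
proof (cases "c = 0")
  case False
  have L': "filterlim (\<lambda>j. real (L j)) at_top sequentially"
    by (rule filterlim_compose[OF filterlim_real_sequentially L])
  have ev: "\<forall>\<^sub>F j in sequentially. L j \<ge> 1" using L by (simp add: filterlim_at_top)
  have y: "filterlim (\<lambda>j. c / real (L j)) (at 0) sequentially"
    by (rule filterlim_atI) (use ev False in \<open>auto intro!: tendsto_divide_0[OF tendsto_const filterlim_at_top_imp_at_infinity[OF L']] elim: eventually_mono\<close>)
  have "((\<lambda>h. (sin (0 + h) - sin 0) / h) \<longlongrightarrow> cos (0::real)) (at 0)" using DERIV_sin[of 0] unfolding DERIV_def .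
  from tendsto_mult[OF filterlim_compose[OF this y] tendsto_const[of c]]
  have "(\<lambda>j. (sin (c / real (L j)) / (c / real (L j))) * c) \<longlonglongrightarrow> c" by simp
  moreover have "\<forall>\<^sub>F j in sequentially. (sin (c / real (L j)) / (c / real (L j))) * c = real (L j) * sin (c / real (L j))"
    using ev by eventually_elim (use False in \<open>simp add: field_simps\<close>)
  ultimately show ?thesis by (rule Lim_transform_eventually)
qed simp

context
  fixes \<alpha> :: real and L N :: "nat \<Rightarrow> nat"
  assumes \<alpha>: "0 < \<alpha>" "\<alpha> < 1" and NL: "\<And>j. 1 \<le> N j \<and> N j \<le> L j - 1"
    and L: "filterlim L at_top sequentially" and density: "(\<lambda>j. real (N j) / real (L j)) \<longlonglongrightarrow> \<alpha>"
begin

text \<open>The coefficient of $z_n$ in the logarithm of the finite drift: for large L the factor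
$1 - e^{-2\pi i \sigma n/L}$ is nearly $2\pi i \sigma n/L$, and $N/L$ tends to $\alpha$.\<close>
lemma drift_multiplier_tendsto:
  assumes n: "n > 0"
  shows "(\<lambda>j. (1 - cis (- (2 * pi * of_int \<sigma> * real n / real (L j)))) * of_nat (N j) / of_nat n) \<longlonglongrightarrow> of_int \<sigma> * messep_phase \<alpha>"
proof (cases "\<sigma> = 0")
  case False
  have Lp: "L j > 0" for j using NL[of j] by (cases "L j") auto
  have L': "filterlim (\<lambda>j. real (L j)) at_top sequentially"
    by (rule filterlim_compose[OF filterlim_real_sequentially L])
  define w where "w j = \<i> * of_real (- (2 * pi * of_int \<sigma> * real n / real (L j)))" for j
  have "(\<lambda>j. 2 * pi * of_int \<sigma> * real n / real (L j)) \<longlonglongrightarrow> 0"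
    by (rule tendsto_divide_0[OF tendsto_const filterlim_at_top_imp_at_infinity[OF L']])
  from tendsto_mult[OF tendsto_const[of \<i>] tendsto_of_real[OF tendsto_minus[OF this]]]
  have "w \<longlonglongrightarrow> 0" unfolding w_def by simp
  then have "filterlim w (at 0) sequentially"
    by (rule filterlim_atI) (use False n Lp in \<open>auto simp: w_def intro!: always_eventually\<close>)
  from filterlim_compose[OF lim_exp_minus_1 this]
  have "(\<lambda>j. (exp (w j) - 1) / w j) \<longlonglongrightarrow> 1" .
  from tendsto_mult[OF this tendsto_mult[OF tendsto_const[of "of_int \<sigma> * (\<i> * of_real (2 * pi))"] tendsto_of_real[OF density]]]
  have "(\<lambda>j. (exp (w j) - 1) / w j * (of_int \<sigma> * (\<i> * of_real (2 * pi)) * of_real (real (N j) / real (L j)))) \<longlonglongrightarrow> of_int \<sigma> * messep_phase \<alpha>"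
    by (simp add: mult_ac)
  moreover have "(exp (w j) - 1) / w j * (of_int \<sigma> * (\<i> * of_real (2 * pi)) * of_real (real (N j) / real (L j)))
    = (1 - cis (- (2 * pi * of_int \<sigma> * real n / real (L j)))) * of_nat (N j) / of_nat n" for j
    unfolding cis_conv_exp w_def[symmetric] using Lp[of j] False n by (simp add: w_def field_simps)
  ultimately show ?thesis by (simp only:)
qed simp

lemma drift_amplitude_tendsto:
  "(\<lambda>j. of_real ((real (L j))\<^sup>2 * sin (pi * real n / real (L j)) / (2 * sin (pi * real (N j) / real (L j)) * real (N j)))
      * cis (pi * of_int \<sigma> * real (N j + n) / real (L j))) \<longlonglongrightarrow> of_nat n * amplitude \<alpha> \<sigma>"
proof -
  have Lp: "L j > 0" for j using NL[of j] by (cases "L j") auto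
  have Np: "N j > 0" for j using NL[of j] by auto
  have L': "filterlim (\<lambda>j. real (L j)) at_top sequentially"
    by (rule filterlim_compose[OF filterlim_real_sequentially L])
  have s: "sin (pi * \<alpha>) > 0" using \<alpha> by (intro sin_gt_zero) auto
  have "(\<lambda>j. (real (L j) * sin (pi * real n / real (L j))) / (2 * sin (pi * (real (N j) / real (L j))) * (real (N j) / real (L j))))
     \<longlonglongrightarrow> (pi * real n) / (2 * sin (pi * \<alpha>) * \<alpha>)"
    by (intro tendsto_divide sin_scaled_tendsto L tendsto_mult tendsto_const tendsto_sin density) (use \<alpha> s in auto)
  moreover have "(real (L j) * sin (pi * real n / real (L j))) / (2 * sin (pi * (real (N j) / real (L j))) * (real (N j) / real (L j)))
     = (real (L j))\<^sup>2 * sin (pi * real n / real (L j)) / (2 * sin (pi * real (N j) / real (L j)) * real (N j))" for j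
    using Lp[of j] by (simp add: power2_eq_square)
  ultimately have c: "(\<lambda>j. (real (L j))\<^sup>2 * sin (pi * real n / real (L j)) / (2 * sin (pi * real (N j) / real (L j)) * real (N j)))
     \<longlonglongrightarrow> (pi * real n) / (2 * sin (pi * \<alpha>) * \<alpha>)" by (simp only:)
  have "(\<lambda>j. real n / real (L j)) \<longlonglongrightarrow> 0"
    by (rule tendsto_divide_0[OF tendsto_const filterlim_at_top_imp_at_infinity[OF L']])
  from tendsto_mult[OF tendsto_const[of "pi * of_int \<sigma>"] tendsto_add[OF density this]]
  have "(\<lambda>j. pi * of_int \<sigma> * real (N j + n) / real (L j)) \<longlonglongrightarrow> pi * of_int \<sigma> * \<alpha>"
    by (simp add: add_divide_distrib[symmetric])
  then have "(\<lambda>j. cis (pi * of_int \<sigma> * real (N j + n) / real (L j))) \<longlonglongrightarrow> cis (pi * of_int \<sigma> * \<alpha>)"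
    unfolding cis_conv_exp by (intro tendsto_intros)
  from tendsto_mult[OF tendsto_of_real[OF c] this] show ?thesis unfolding amplitude_def by (simp add: mult_ac)
qed

text \<open>The limit is uniform over all series with coefficients bounded by 1, since the exponential is Lipschitz
on bounded sets and only finitely many multipliers enter.\<close>
theorem walk_drift_limit:
  assumes \<epsilon>: "\<epsilon> > 0"
  shows "\<forall>\<^sub>F j in sequentially. \<forall>z. fps_nth z 0 = 0 \<longrightarrow> (\<forall>k. norm (fps_nth z k) \<le> 1) \<longrightarrow>
    norm (of_real ((real (L j))\<^sup>2) * walk_drift (L j) (N j) z n - fps_nth (messep_rate \<alpha> z) n) \<le> \<epsilon>"
proof -
  let ?\<beta> = "messep_phase \<alpha>"
  define c where "c \<sigma> k j = (1 - cis (- (2 * pi * of_int \<sigma> * real k / real (L j)))) * of_nat (N j) / of_nat k" for \<sigma> k j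
  \<comment> \<open>The distance of the multipliers from their limits; it bounds the distance of the logarithms of the two exponentials in the drift.\<close>
  define \<eta> where "\<eta> \<sigma> j = (\<Sum>k\<in>{1..n}. norm (c \<sigma> k j - of_int \<sigma> * ?\<beta>))" for \<sigma> j
  define p where "p \<sigma> j = of_real ((real (L j))\<^sup>2 * sin (pi * real n / real (L j)) / (2 * sin (pi * real (N j) / real (L j)) * real (N j)))
      * cis (pi * of_int \<sigma> * real (N j + n) / real (L j))" for \<sigma> j
  define P where "P = norm ?\<beta> * (real (Suc n) * 1) + 1"
  define d where "d \<sigma> j = norm (p \<sigma> j) * (exp (3 * P) * \<eta> \<sigma> j) + norm (p \<sigma> j - of_nat n * amplitude \<alpha> \<sigma>) * exp P" for \<sigma> j
  have \<eta>: "\<eta> \<sigma> \<longlonglongrightarrow> 0" for \<sigma>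
  proof -
    have "\<eta> \<sigma> \<longlonglongrightarrow> (\<Sum>k\<in>{1..n}. norm (of_int \<sigma> * ?\<beta> - of_int \<sigma> * ?\<beta>))"
      unfolding \<eta>_def c_def by (intro tendsto_sum tendsto_norm tendsto_diff tendsto_const drift_multiplier_tendsto) auto
    then show ?thesis by simp
  qed
  have p: "p \<sigma> \<longlonglongrightarrow> of_nat n * amplitude \<alpha> \<sigma>" for \<sigma> unfolding p_def by (rule drift_amplitude_tendsto)
  have d: "d \<sigma> \<longlonglongrightarrow> 0" for \<sigma>
  proof -
    have "d \<sigma> \<longlonglongrightarrow> norm (of_nat n * amplitude \<alpha> \<sigma>) * (exp (3 * P) * 0) + norm (of_nat n * amplitude \<alpha> \<sigma> - of_nat n * amplitude \<alpha> \<sigma>) * exp P"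
      unfolding d_def by (intro tendsto_intros p \<eta>)
    then show ?thesis by simp
  qed
  have key: "norm (p \<sigma> j * fps_nth (fexp (twist (L j) (N j) \<sigma> z)) n - of_nat n * amplitude \<alpha> \<sigma> * fps_nth (fexp (fps_const (of_int \<sigma> * ?\<beta>) * z)) n) \<le> d \<sigma> j"
    if \<sigma>: "norm (of_int \<sigma> :: complex) = 1" and e: "\<eta> \<sigma> j \<le> 1" and z: "fps_nth z 0 = 0" "\<And>k. norm (fps_nth z k) \<le> 1" for \<sigma> j z
  proof -
    let ?f = "twist (L j) (N j) \<sigma> z" and ?h = "fps_const (of_int \<sigma> * ?\<beta>) * z"
    have f0: "fps_nth ?f 0 = 0" "fps_nth ?h 0 = 0" using z by (simp_all add: twist_def)
    have fk: "fps_nth ?f k = c \<sigma> k j * fps_nth z k" for k unfolding twist_def c_def by simp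
    have "pnorm 1 n (?f - ?h) = (\<Sum>k\<in>{1..n}. norm (fps_nth (?f - ?h) k))"
      unfolding pnorm_def by (rule sum.mono_neutral_cong_right) (use f0 in \<open>auto simp: Suc_le_eq\<close>)
    also have "\<dots> \<le> \<eta> \<sigma> j" unfolding \<eta>_def
    proof (rule sum_mono)
      fix k assume "k \<in> {1..n}"
      have "norm (fps_nth (?f - ?h) k) = norm (c \<sigma> k j - of_int \<sigma> * ?\<beta>) * norm (fps_nth z k)"
        unfolding norm_mult[symmetric] by (simp add: fk algebra_simps)
      also have "\<dots> \<le> norm (c \<sigma> k j - of_int \<sigma> * ?\<beta>) * 1" by (intro mult_left_mono z) auto
      finally show "norm (fps_nth (?f - ?h) k) \<le> norm (c \<sigma> k j - of_int \<sigma> * ?\<beta>)" by simp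
    qed
    finally have fh: "pnorm 1 n (?f - ?h) \<le> \<eta> \<sigma> j" .
    have "pnorm 1 n ?h \<le> norm ?\<beta> * (real (Suc n) * 1)"
      unfolding pnorm_const_mult norm_mult[of "of_int \<sigma>"] \<sigma> mult_1 by (intro mult_left_mono transport_equation.pnorm_1_le z) auto
    then have h: "pnorm 1 n ?h \<le> P" and f: "pnorm 1 n ?f \<le> P"
      using pnorm_add[of 1 n ?h "?f - ?h"] fh e unfolding P_def by auto
    have FH: "norm (fps_nth (fexp ?f) n - fps_nth (fexp ?h) n) \<le> exp (3 * P) * \<eta> \<sigma> j"
    proof -
      have "norm (fps_nth (fexp ?f - fexp ?h) n) \<le> exp (3 * P) * pnorm 1 n (?f - ?h)"
        by (rule order_trans[OF norm_nth_le_pnorm_1[OF order_refl] pnorm_fexp_diff[OF _ f0 f h]]) simp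
      also have "\<dots> \<le> exp (3 * P) * \<eta> \<sigma> j" by (intro mult_left_mono fh) auto
      finally show ?thesis by simp
    qed
    have H: "norm (fps_nth (fexp ?h) n) \<le> exp P"
      using norm_nth_le_pnorm_1[of n n "fexp ?h"] pnorm_fexp[of 1 ?h n] h f0 by (auto intro: order_trans)
    have "p \<sigma> j * fps_nth (fexp ?f) n - of_nat n * amplitude \<alpha> \<sigma> * fps_nth (fexp ?h) n =
      p \<sigma> j * (fps_nth (fexp ?f) n - fps_nth (fexp ?h) n) + (p \<sigma> j - of_nat n * amplitude \<alpha> \<sigma>) * fps_nth (fexp ?h) n"
      by (simp add: algebra_simps)
    also have "norm \<dots> \<le> d \<sigma> j" unfolding d_def
      by (rule order_trans[OF norm_triangle_ineq], unfold norm_mult[of "p \<sigma> j"] norm_mult[of "p \<sigma> j - of_nat n * amplitude \<alpha> \<sigma>"])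
        (intro add_mono mult_left_mono FH H norm_ge_zero)
    finally show ?thesis .
  qed
  have ev: "\<forall>\<^sub>F j in sequentially. \<eta> \<sigma> j < 1" "\<forall>\<^sub>F j in sequentially. d \<sigma> j < \<epsilon> / 2" for \<sigma>
    using order_tendstoD(2)[OF \<eta>, of 1] order_tendstoD(2)[OF d, of "\<epsilon> / 2"] \<epsilon> by auto
  show ?thesis
    using ev(1)[of 1] ev(1)[of "-1"] ev(2)[of 1] ev(2)[of "-1"]
  proof eventually_elim
    case (elim j)
    show ?case
    proof (intro allI impI)
      fix z :: "complex fps" assume z: "fps_nth z 0 = 0" "\<forall>k. norm (fps_nth z k) \<le> 1"
      let ?F = "\<lambda>\<sigma>. fps_nth (fexp (twist (L j) (N j) \<sigma> z)) n"
      have "of_real ((real (L j))\<^sup>2) * walk_drift (L j) (N j) z n = p 1 j * ?F 1 + p (- 1) j * ?F (- 1)"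
        unfolding walk_drift_def p_def by (simp add: field_simps, simp add: add_divide_distrib mult_ac)
      moreover have "fps_nth (messep_rate \<alpha> z) n =
        of_nat n * amplitude \<alpha> 1 * fps_nth (fexp (fps_const (of_int 1 * ?\<beta>) * z)) n
        + of_nat n * amplitude \<alpha> (- 1) * fps_nth (fexp (fps_const (of_int (- 1) * ?\<beta>) * z)) n"
        unfolding transport_equation.rate_nth[OF z(1)] by (simp add: algebra_simps)
      ultimately have "norm (of_real ((real (L j))\<^sup>2) * walk_drift (L j) (N j) z n - fps_nth (messep_rate \<alpha> z) n) \<le> d 1 j + d (- 1) j"
        by (simp only: add_diff_add) (rule norm_triangle_mono[OF key key], use elim z in auto)
      then show "norm (of_real ((real (L j))\<^sup>2) * walk_drift (L j) (N j) z n - fps_nth (messep_rate \<alpha> z) n) \<le> \<epsilon>"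
        using elim by linarith
    qed
  qed
qed

end

text \<open>Restores the moment of order 0, which is 1 for a probability measure.\<close>
definition with_mass :: "complex fps \<Rightarrow> nat \<Rightarrow> complex" where
  "with_mass g n = (if n = 0 then 1 else fps_nth g n)"

lemma fejer_mean_diff:
  "\<bar>fejer_mean m K x - fejer_mean m' K x\<bar> \<le>
    (\<Sum>j<K. \<Sum>l<K. norm (m (nat \<bar>int j - int l\<bar>) - m' (nat \<bar>int j - int l\<bar>))) / real K"
proof -
  have h: "norm (hermitian m k - hermitian m' k) = norm (m (nat \<bar>k\<bar>) - m' (nat \<bar>k\<bar>))" for k
    unfolding hermitian_def by (auto simp: complex_cnj_diff[symmetric] simp del: complex_cnj_diff)
  let ?c = "\<lambda>j l. cis (- (of_int (int j - int l) * x))"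
  have "fejer_mean m K x - fejer_mean m' K x =
    Re (\<Sum>j<K. \<Sum>l<K. (hermitian m (int j - int l) - hermitian m' (int j - int l)) * ?c j l) / real K"
    unfolding fejer_mean_def by (simp only: diff_divide_distrib[symmetric] minus_complex.simps(1)[symmetric] sum_subtractf[symmetric] left_diff_distrib)
  also have "\<bar>\<dots>\<bar> \<le> norm (\<Sum>j<K. \<Sum>l<K. (hermitian m (int j - int l) - hermitian m' (int j - int l)) * ?c j l) / real K"
    unfolding abs_divide abs_of_nat by (rule divide_right_mono[OF abs_Re_le_cmod]) simp
  also have "\<dots> \<le> (\<Sum>j<K. \<Sum>l<K. norm (m (nat \<bar>int j - int l\<bar>) - m' (nat \<bar>int j - int l\<bar>))) / real K"
    by (intro divide_right_mono sum_norm_le) (auto simp: norm_mult h)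
  finally show ?thesis .
qed

lemma sum_roots_of_unity:
  assumes L: "L > 0" and p: "\<bar>p\<bar> < int L"
  shows "(\<Sum>r<L. cis (2 * pi * of_int p * real r / real L)) = (if p = 0 then of_nat L else 0)"
proof (cases "p = 0")
  case False
  let ?w = "cis (2 * pi * of_int p / real L)"
  have w1: "?w \<noteq> 1"
  proof
    assume "?w = 1"
    then have "sin (2 * pi * of_int p / real L) = sin 0 \<and> cos (2 * pi * of_int p / real L) = cos 0" by (metis cis.sel cis_zero)
    then obtain k :: int where "2 * pi * of_int p / real L = 0 + 2 * pi * of_int k" unfolding sin_cos_eq_iff by auto
    then have "of_int p = (of_int (k * int L) :: real)" using L by (simp add: field_simps)
    then have "p = k * int L" by (simp only: of_int_eq_iff)
    then have "int L dvd \<bar>p\<bar>" by simp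
    then have "int L \<le> \<bar>p\<bar>" using False zdvd_imp_le[of "int L" "\<bar>p\<bar>"] by simp
    then show False using p by simp
  qed
  have wL: "?w ^ L = 1"
  proof -
    have "?w ^ L = cis (2 * pi * of_int p)" unfolding Complex.DeMoivre using L by simp
    then show ?thesis by (simp add: cis_multiple_2pi)
  qed
  have "(\<Sum>r<L. cis (2 * pi * of_int p * real r / real L)) = (\<Sum>r<L. ?w ^ r)"
    by (intro sum.cong refl) (simp add: Complex.DeMoivre mult_ac)
  also have "\<dots> = 0" using w1 wL by (simp add: geometric_sum)
  finally show ?thesis using False by simp
qed simp

lemma cis_mod: "cis (2 * pi * real n * of_int (i mod int L) / real L) = cis (2 * pi * real n * of_int i / real L)"
proof (cases "L = 0")
  case False
  have "(of_int i :: real) = of_int (i mod int L) + real L * of_int (i div int L)"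
    by (metis mod_mult_div_eq of_int_add of_int_mult of_int_of_nat_eq)
  then have "2 * pi * real n * of_int i / real L = 2 * pi * real n * of_int (i mod int L) / real L + 2 * pi * (of_int (int n * (i div int L)))"
    using False by (simp add: field_simps)
  moreover have "cis (2 * pi * (of_int (int n * (i div int L)))) = 1" by (rule cis_multiple_2pi) simp
  ultimately show ?thesis by (simp only: cis_mult[symmetric] mult_1_right)
qed simp

lemma sum_swap3: "(\<Sum>j\<in>A. \<Sum>l\<in>B. \<Sum>k\<in>C. h j l k) = (\<Sum>k\<in>C. \<Sum>j\<in>A. \<Sum>l\<in>B. h j l k)"
proof -
  have "(\<Sum>j\<in>A. \<Sum>l\<in>B. \<Sum>k\<in>C. h j l k) = (\<Sum>j\<in>A. \<Sum>k\<in>C. \<Sum>l\<in>B. h j l k)"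
    by (rule sum.cong[OF refl], rule sum.swap)
  also have "\<dots> = (\<Sum>k\<in>C. \<Sum>j\<in>A. \<Sum>l\<in>B. h j l k)" by (rule sum.swap)
  finally show ?thesis .
qed

text \<open>The Fejer mean is an average over the particles of the Fejer kernel
$\frac1K |\sum_{j<K} e^{ij\theta}|^2$, hence nonnegative. The particles occupy distinct sites, so the sum
over particles is at most the sum over all L sites, and this sum equals L at every point as long as
$K \le L$. This is how the exclusion rule enters: it makes the limit a bounded density.\<close>
theorem fejer_mean_walk_bounds:
  assumes L: "L \<ge> 3" and N: "N \<ge> 1" and x: "x \<in> weyl_walks L N" and K: "0 < K" "K \<le> L"
  shows "0 \<le> fejer_mean (with_mass (walk_moments L x)) K y" "fejer_mean (with_mass (walk_moments L x)) K y \<le> real L / real N"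
proof -
  note len = walk_length[OF L N x]
  define S where "S i = (\<Sum>j<K. cis (2 * pi * real j * of_int i / real L) * cis (- (real j * y)))" for i :: int
  let ?e = "\<lambda>(p::int) (i::int). cis (2 * pi * of_int p * of_int i / real L)"
  have S2: "complex_of_real ((norm (S i))\<^sup>2) = (\<Sum>j<K. \<Sum>l<K. ?e (int j - int l) i * cis (- (of_int (int j - int l) * y)))" for i
  proof -
    have "complex_of_real ((norm (S i))\<^sup>2) = S i * cnj (S i)" by (rule complex_norm_square)
    also have "\<dots> = (\<Sum>j<K. \<Sum>l<K. (cis (2 * pi * real j * of_int i / real L) * cis (- (real j * y))) *
        (cis (- (2 * pi * real l * of_int i / real L)) * cis (real l * y)))"
      unfolding S_def cnj_sum complex_cnj_mult cis_cnj minus_minus by (rule sum_product)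
    also have "\<dots> = (\<Sum>j<K. \<Sum>l<K. ?e (int j - int l) i * cis (- (of_int (int j - int l) * y)))"
      unfolding cis_mult by (intro sum.cong refl arg_cong[where f = cis]) (simp add: algebra_simps diff_divide_distrib)
    finally show ?thesis .
  qed
  have herm: "hermitian (with_mass (walk_moments L x)) p = (\<Sum>k<N. ?e p (x ! k)) / of_nat N" for p
  proof (cases p rule: int_cases3)
    case zero then show ?thesis using N by (simp add: hermitian_def with_mass_def)
  next
    case (pos n) then show ?thesis by (simp add: hermitian_def with_mass_def walk_moments_def len)
  next
    case (neg n)
    then show ?thesis by (simp add: hermitian_def with_mass_def walk_moments_def len cis_cnj)
  qed
  have "complex_of_real (fejer_mean (with_mass (walk_moments L x)) K y) =
    (\<Sum>j<K. \<Sum>l<K. (\<Sum>k<N. ?e (int j - int l) (x ! k)) / of_nat N * cis (- (of_int (int j - int l) * y))) / of_nat K"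
    unfolding herm[symmetric] by (rule of_real_fejer_mean) (simp add: with_mass_def)
  also have "(\<Sum>j<K. \<Sum>l<K. (\<Sum>k<N. ?e (int j - int l) (x ! k)) / of_nat N * cis (- (of_int (int j - int l) * y)))
    = (\<Sum>j<K. \<Sum>l<K. \<Sum>k<N. ?e (int j - int l) (x ! k) * cis (- (of_int (int j - int l) * y))) / of_nat N"
    by (simp only: sum_divide_distrib sum_distrib_right times_divide_eq_left)
  also have "(\<Sum>j<K. \<Sum>l<K. \<Sum>k<N. ?e (int j - int l) (x ! k) * cis (- (of_int (int j - int l) * y)))
    = (\<Sum>k<N. complex_of_real ((norm (S (x ! k)))\<^sup>2))"
    unfolding S2 by (rule sum_swap3)
  also have "\<dots> / of_nat N / of_nat K = of_real ((\<Sum>k<N. (norm (S (x ! k)))\<^sup>2) / real N / real K)" by simp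
  finally have F: "fejer_mean (with_mass (walk_moments L x)) K y = (\<Sum>k<N. (norm (S (x ! k)))\<^sup>2) / real N / real K"
    by (simp only: of_real_eq_iff)
  show "0 \<le> fejer_mean (with_mass (walk_moments L x)) K y" unfolding F by (intro divide_nonneg_nonneg sum_nonneg) auto
  have Smod: "S (i mod int L) = S i" for i unfolding S_def cis_mod ..
  have "(\<Sum>k<N. (norm (S (x ! k)))\<^sup>2) = (\<Sum>k<N. (norm (S (x ! k mod int L)))\<^sup>2)" unfolding Smod ..
  also have "\<dots> = (\<Sum>i\<in>(\<lambda>k. x ! k mod int L) ` {..<N}. (norm (S i))\<^sup>2)"
    by (subst sum.reindex[OF walk_residues_inj[OF L N x]]) simp
  also have "\<dots> \<le> (\<Sum>i\<in>int ` {..<L}. (norm (S i))\<^sup>2)"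
  proof (rule sum_mono2)
    have "x ! k mod int L = int (nat (x ! k mod int L)) \<and> nat (x ! k mod int L) < L" for k
      using L by (simp add: nat_less_iff)
    then show "(\<lambda>k. x ! k mod int L) ` {..<N} \<subseteq> int ` {..<L}" by blast
  qed auto
  also have "\<dots> = (\<Sum>r<L. (norm (S (int r)))\<^sup>2)" by (subst sum.reindex) auto
  also have "(\<Sum>r<L. (norm (S (int r)))\<^sup>2) = real L * real K"
  proof -
    have "complex_of_real (\<Sum>r<L. (norm (S (int r)))\<^sup>2) = (\<Sum>r<L. \<Sum>j<K. \<Sum>l<K. ?e (int j - int l) (int r) * cis (- (of_int (int j - int l) * y)))"
      unfolding of_real_sum S2 ..
    also have "\<dots> = (\<Sum>j<K. \<Sum>l<K. (\<Sum>r<L. ?e (int j - int l) (int r)) * cis (- (of_int (int j - int l) * y)))"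
      unfolding sum_distrib_right by (rule sum_swap3[symmetric])
    also have "\<dots> = (\<Sum>j<K. \<Sum>l<K. if j = l then of_nat L else 0)"
    proof (intro sum.cong refl)
      fix j l assume "j \<in> {..<K}" "l \<in> {..<K}"
      then have "\<bar>int j - int l\<bar> < int L" using K by auto
      then have "(\<Sum>r<L. ?e (int j - int l) (int r)) = (if int j - int l = 0 then of_nat L else 0)"
        using sum_roots_of_unity[of L "int j - int l"] L by simp
      then show "(\<Sum>r<L. ?e (int j - int l) (int r)) * cis (- (of_int (int j - int l) * y)) = (if j = l then of_nat L else 0)" by simp
    qed
    also have "\<dots> = of_real (real L * real K)" by simp
    finally show ?thesis by (simp only: of_real_eq_iff)
  qed
  finally have "(\<Sum>k<N. (norm (S (x ! k)))\<^sup>2) \<le> real L * real K" .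
  from divide_right_mono[OF this, of "real N * real K"]
  show "fejer_mean (with_mass (walk_moments L x)) K y \<le> real L / real N"
    unfolding F using K N by simp
qed

section \<open>Comparison of the chain with the transport equation\<close>

lemma discrete_gronwall:
  fixes u :: "nat \<Rightarrow> real"
  assumes c: "c \<ge> 0" and u: "\<And>i. i \<le> m \<Longrightarrow> u i \<le> A + c * (\<Sum>l<i. u l)"
  shows "i \<le> m \<Longrightarrow> u i \<le> A * (1 + c) ^ i"
proof (induction i rule: less_induct)
  case (less i)
  have geo: "A + c * (\<Sum>l<k. A * (1 + c) ^ l) = A * (1 + c) ^ k" for k
    by (induction k) (simp_all add: algebra_simps)
  have "u i \<le> A + c * (\<Sum>l<i. u l)" by (rule u) (use less in auto)
  also have "\<dots> \<le> A + c * (\<Sum>l<i. A * (1 + c) ^ l)"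
    using less c by (intro add_left_mono mult_left_mono sum_mono) auto
  finally show ?case unfolding geo .
qed

lemma power_le_exp: "c \<ge> 0 \<Longrightarrow> real i * c \<le> s \<Longrightarrow> (1 + c) ^ i \<le> exp (s :: real)"
proof -
  assume c: "c \<ge> 0" "real i * c \<le> s"
  have "(1 + c) ^ i \<le> exp c ^ i" using c by (intro power_mono) auto
  also have "\<dots> = exp (real i * c)" by (rule exp_of_nat_mult[symmetric])
  also have "\<dots> \<le> exp s" using c by simp
  finally show ?thesis .
qed

context transport_equation
begin

context
  fixes M :: "'a measure" and L N :: nat and \<psi> :: "int set \<Rightarrow> real" and X :: "nat \<Rightarrow> 'a \<Rightarrow> int list"
    and f :: "'a \<Rightarrow> complex fps" and B T \<epsilon> :: real and n :: nat
  assumes M: "prob_space M" and L: "L \<ge> 3" and N: "N \<ge> 1" and NL: "N \<le> L - 1"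
    and \<psi>: "perron_eigenvector L N \<psi>" and X: "messep M L N \<psi> X"
    and f: "\<And>k. (\<lambda>w. fps_nth (f w) k) \<in> borel_measurable M"
    and f0: "\<And>w. w \<in> space M \<Longrightarrow> fps_nth (f w) 0 = 0"
    and f1: "\<And>w k. w \<in> space M \<Longrightarrow> norm (fps_nth (f w) k) \<le> 1"
    and B: "B \<ge> 1" and T: "T \<ge> 0"
    and bd: "\<And>w s k. w \<in> space M \<Longrightarrow> s \<in> {0..T} \<Longrightarrow> k \<le> n \<Longrightarrow> norm (fps_nth (flow (f w) s) k) \<le> B"
    and \<epsilon>: "\<epsilon> \<ge> 0"
    and drift: "\<And>k z. k \<in> {1..n} \<Longrightarrow> fps_nth z 0 = 0 \<Longrightarrow> (\<And>k. norm (fps_nth z k) \<le> 1) \<Longrightarrow>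
      norm (of_real ((real L)\<^sup>2) * walk_drift L N z k - fps_nth (rate z) k) \<le> \<epsilon>"
begin

text \<open>Telescoping over the steps, the difference between the moments of the chain and the solution at the
corresponding times is the sum of its initial value, the differences between drift and vector field at
the moments of the chain, the differences of the vector field at the two states, the Euler errors, and
the noise.\<close>
lemma walk_flow_distance_step:
  fixes i :: nat
  assumes w: "w \<in> space M" and i: "real i \<le> (real L)\<^sup>2 * T"
  defines "D \<equiv> \<lambda>l. pnorm 1 n (walk_moments L (X l w) - flow (f w) (real l / (real L)\<^sup>2))"
  shows "D i \<le> D 0 + real n * real i * (\<epsilon> / (real L)\<^sup>2 + rate_lipschitz_const n B * (real (Suc n) * (3 * rate_bound n B)) / (real L)^4)
     + (\<Sum>k\<in>{1..n}. norm (\<Sum>l<i. noise L N X k l w)) + real n * rate_lipschitz_const n B / (real L)\<^sup>2 * (\<Sum>l<i. D l)"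
proof -
  let ?L2 = "(real L)\<^sup>2" and ?C = "rate_lipschitz_const n B * (real (Suc n) * (3 * rate_bound n B))"
  let ?Z = "\<lambda>l. walk_moments L (X l w)" and ?m = "\<lambda>l. flow (f w) (real l / ?L2)"
  have L2: "?L2 > 0" using L by simp
  have fl: "transport_flow (flow (f w))" by (rule transport_flow_flow[OF f0[OF w]])
  have m0: "fps_nth (?m l) 0 = 0" for l by (rule transport_flow_nth_0[OF fl]) simp
  have Z0: "fps_nth (?Z l) 0 = 0" for l by (simp add: walk_moments_def)
  have Dsum: "D l = (\<Sum>k\<in>{1..n}. norm (fps_nth (?Z l) k - fps_nth (?m l) k))" for l
    unfolding D_def pnorm_def by (rule sum.mono_neutral_cong_right) (auto simp: Suc_le_eq m0 Z0)
  have time: "real l / ?L2 \<le> T" if "l \<le> i" for l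
    using that i L2 by (simp add: divide_le_eq mult.commute)
  define q where "q k l = of_real (1 / ?L2) * (of_real ?L2 * walk_drift L N (?Z l) k - fps_nth (rate (?Z l)) k)
      + of_real (1 / ?L2) * (fps_nth (rate (?Z l)) k - fps_nth (rate (?m l)) k)
      - (fps_nth (?m (Suc l)) k - fps_nth (?m l) k - of_real (1 / ?L2) * fps_nth (rate (?m l)) k)" for k l
  have qb: "norm (q k l) \<le> \<epsilon> / ?L2 + rate_lipschitz_const n B / ?L2 * D l + ?C / (real L)^4" if k: "k \<in> {1..n}" and l: "l < i" for k l
  proof -
    have 1: "norm (of_real (1 / ?L2) * (of_real ?L2 * walk_drift L N (?Z l) k - fps_nth (rate (?Z l)) k)) \<le> 1 / ?L2 * \<epsilon>"
      unfolding norm_mult norm_of_real using L2 by (intro mult_mono drift[OF k] Z0 walk_moments_norm) auto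
    have "norm (fps_nth (rate (?Z l)) k - fps_nth (rate (?m l)) k) \<le> rate_lipschitz_const n B * D l"
      unfolding D_def
    proof (rule rate_lipschitz[OF Z0 m0])
      fix k' assume k': "k' \<le> n"
      show "norm (fps_nth (?Z l) k') \<le> B" using walk_moments_norm[of L "X l w" k'] B by linarith
      show "norm (fps_nth (?m l) k') \<le> B" by (rule bd[OF w _ k']) (use time[of l] l in auto)
    qed (use k in auto)
    then have 2: "norm (of_real (1 / ?L2) * (fps_nth (rate (?Z l)) k - fps_nth (rate (?m l)) k)) \<le> 1 / ?L2 * (rate_lipschitz_const n B * D l)"
      unfolding norm_mult norm_of_real using L2 by (intro mult_mono) auto
    have st: "real (Suc l) / ?L2 - real l / ?L2 = 1 / ?L2" unfolding diff_divide_distrib[symmetric] by simp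
    have "norm (fps_nth (?m (Suc l)) k - fps_nth (?m l) k - of_real (real (Suc l) / ?L2 - real l / ?L2) * fps_nth (rate (?m l)) k)
      \<le> ?C * (real (Suc l) / ?L2 - real l / ?L2)\<^sup>2"
    proof (rule flow_increment(2)[where g = "flow (f w)" and T = T, OF fl])
      show "real l / ?L2 \<le> real (Suc l) / ?L2" by (intro divide_right_mono) auto
      show "real (Suc l) / ?L2 \<le> T" by (rule time) (use l in simp)
    qed (use B k bd[OF w] in auto)
    then have 3: "norm (fps_nth (?m (Suc l)) k - fps_nth (?m l) k - of_real (1 / ?L2) * fps_nth (rate (?m l)) k) \<le> ?C / (real L)^4"
      unfolding st by (simp add: power_divide)
    have "norm (q k l) \<le> 1 / ?L2 * \<epsilon> + 1 / ?L2 * (rate_lipschitz_const n B * D l) + ?C / (real L)^4"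
      unfolding q_def by (rule order_trans[OF norm_triangle_ineq4 add_mono[OF order_trans[OF norm_triangle_ineq add_mono[OF 1 2]] 3]])
    then show ?thesis by simp
  qed
  have ek: "norm (fps_nth (?Z i) k - fps_nth (?m i) k) \<le> norm (fps_nth (?Z 0) k - fps_nth (?m 0) k)
      + (\<Sum>l<i. \<epsilon> / ?L2 + rate_lipschitz_const n B / ?L2 * D l + ?C / (real L)^4) + norm (\<Sum>l<i. noise L N X k l w)" if k: "k \<in> {1..n}" for k
  proof -
    have step: "fps_nth (?Z (Suc l)) k - fps_nth (?m (Suc l)) k = fps_nth (?Z l) k - fps_nth (?m l) k + (q k l + noise L N X k l w)" for l
    proof -
      have "of_real (1 / ?L2) * (of_real ?L2 * walk_drift L N (?Z l) k) = walk_drift L N (?Z l) k"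
        using L2 unfolding mult.assoc[symmetric] of_real_mult[symmetric] by simp
      then have "q k l = walk_drift L N (?Z l) k - (fps_nth (?m (Suc l)) k - fps_nth (?m l) k)"
        unfolding q_def right_diff_distrib by simp
      then show ?thesis unfolding noise_def[OF M L N NL \<psi> X] by simp
    qed
    have sum: "fps_nth (?Z i') k - fps_nth (?m i') k = fps_nth (?Z 0) k - fps_nth (?m 0) k + ((\<Sum>l<i'. q k l) + (\<Sum>l<i'. noise L N X k l w))" for i'
    proof (induction i')
      case (Suc i')
      show ?case unfolding step Suc sum.lessThan_Suc by (simp only: add_ac)
    qed simp
    have "norm (fps_nth (?Z i) k - fps_nth (?m i) k) = norm (fps_nth (?Z 0) k - fps_nth (?m 0) k + (\<Sum>l<i. q k l) + (\<Sum>l<i. noise L N X k l w))"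
      by (subst sum[of i]) (simp only: add.assoc)
    also have "\<dots> \<le> norm (fps_nth (?Z 0) k - fps_nth (?m 0) k) + (\<Sum>l<i. \<epsilon> / ?L2 + rate_lipschitz_const n B / ?L2 * D l + ?C / (real L)^4) + norm (\<Sum>l<i. noise L N X k l w)"
      by (intro order_trans[OF norm_triangle_ineq] add_mono order_refl sum_norm_le qb k) auto
    finally show ?thesis .
  qed
  have "D i \<le> (\<Sum>k\<in>{1..n}. norm (fps_nth (?Z 0) k - fps_nth (?m 0) k)
      + (\<Sum>l<i. \<epsilon> / ?L2 + rate_lipschitz_const n B / ?L2 * D l + ?C / (real L)^4) + norm (\<Sum>l<i. noise L N X k l w))"
    unfolding Dsum[of i] by (rule sum_mono[OF ek])
  also have "\<dots> = D 0 + real n * (\<Sum>l<i. \<epsilon> / ?L2 + rate_lipschitz_const n B / ?L2 * D l + ?C / (real L)^4) + (\<Sum>k\<in>{1..n}. norm (\<Sum>l<i. noise L N X k l w))"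
  proof -
    have "(\<Sum>k\<in>{1..n}. u k + s + v k) = sum u {1..n} + real n * s + sum v {1..n}" for u v :: "nat \<Rightarrow> real" and s
      by (simp add: sum.distrib)
    then show ?thesis unfolding Dsum[of 0] .
  qed
  also have "(\<Sum>l<i. \<epsilon> / ?L2 + rate_lipschitz_const n B / ?L2 * D l + ?C / (real L)^4)
     = real i * (\<epsilon> / ?L2 + ?C / (real L)^4) + rate_lipschitz_const n B / ?L2 * (\<Sum>l<i. D l)"
    unfolding sum.distrib sum_distrib_left[symmetric] by (simp add: distrib_left)
  finally show ?thesis by (simp add: distrib_left mult.assoc)
qed

lemma flow_coeff_measurable: "t \<ge> 0 \<Longrightarrow> (\<lambda>w. fps_nth (flow (f w) t) k) \<in> borel_measurable M"
  by (rule flow_taylor_measurable[OF f f0 f1])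

lemma walk_flow_distance_integrable:
  assumes "real l \<le> (real L)\<^sup>2 * T"
  shows "integrable M (\<lambda>w. pnorm 1 n (walk_moments L (X l w) - flow (f w) (real l / (real L)\<^sup>2)))"
proof -
  interpret prob_space M by (rule M)
  have L2: "(real L)\<^sup>2 > 0" using L by simp
  have "integrable M (\<lambda>w. norm (fps_nth (walk_moments L (X l w)) k - fps_nth (flow (f w) (real l / (real L)\<^sup>2)) k))" if k: "k \<le> n" for k
  proof (rule integrable_norm, rule integrable_const_bound[of _ "1 + B"])
    show "(\<lambda>w. fps_nth (walk_moments L (X l w)) k - fps_nth (flow (f w) (real l / (real L)\<^sup>2)) k) \<in> borel_measurable M"
      by (intro borel_measurable_diff flow_coeff_measurable messep_function_measurable[OF M L N NL \<psi> X, of "\<lambda>x. fps_nth (walk_moments L x) k"]) auto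
    show "AE w in M. norm (fps_nth (walk_moments L (X l w)) k - fps_nth (flow (f w) (real l / (real L)\<^sup>2)) k) \<le> 1 + B"
    proof (rule AE_I2)
      fix w assume "w \<in> space M"
      then have "norm (fps_nth (flow (f w) (real l / (real L)\<^sup>2)) k) \<le> B"
        by (rule bd[OF _ _ k]) (use assms L2 in \<open>auto simp: divide_le_eq mult.commute\<close>)
      then show "norm (fps_nth (walk_moments L (X l w)) k - fps_nth (flow (f w) (real l / (real L)\<^sup>2)) k) \<le> 1 + B"
        by (rule order_trans[OF norm_triangle_ineq4 add_mono[OF walk_moments_norm]])
    qed
  qed
  then show ?thesis unfolding pnorm_def by (intro Bochner_Integration.integrable_sum) simp
qed

text \<open>Expectations of the preceding estimate and Gronwall's inequality. The noise contributes
$\sqrt{L^2 T} \cdot O(1/(L N)) = O(1/N)$, the Euler errors $L^2 T \cdot O(L^{-4})$.\<close>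
theorem walk_flow_distance:
  assumes i: "real i \<le> (real L)\<^sup>2 * T"
  shows "(LINT w|M. pnorm 1 n (walk_moments L (X i w) - flow (f w) (real i / (real L)\<^sup>2))) \<le>
    ((LINT w|M. pnorm 1 n (walk_moments L (X 0 w) - f w))
      + real n * T * (\<epsilon> + rate_lipschitz_const n B * (real (Suc n) * (3 * rate_bound n B)) / (real L)\<^sup>2)
      + real n * (sqrt T * (4 * pi * real n / real N))) * exp (real n * rate_lipschitz_const n B * T)"
proof -
  interpret prob_space M by (rule M)
  let ?L2 = "(real L)\<^sup>2" and ?C = "rate_lipschitz_const n B * (real (Suc n) * (3 * rate_bound n B))"
  let ?K = "rate_lipschitz_const n B"
  define D where "D l w = pnorm 1 n (walk_moments L (X l w) - flow (f w) (real l / ?L2))" for l w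
  define A where "A = expectation (D 0) + real n * T * (\<epsilon> + ?C / ?L2) + real n * (sqrt T * (4 * pi * real n / real N))"
  have L2: "?L2 > 0" using L by simp
  have R0: "0 \<le> rate_bound n B" unfolding rate_bound_def using B rate_lipschitz_const_nonneg by auto
  have C0: "0 \<le> ?C" using R0 rate_lipschitz_const_nonneg by auto
  have iD: "integrable M (D l)" if "real l \<le> ?L2 * T" for l unfolding D_def by (rule walk_flow_distance_integrable[OF that])
  have iN: "integrable M (\<lambda>w. norm (\<Sum>l<j. noise L N X k l w))" if "k \<in> {1..n}" for k j
    by (intro integrable_norm Bochner_Integration.integrable_sum noise_integrable[OF M L N NL \<psi> X]) (use that in auto)
  have ineq: "expectation (D j) \<le> A + real n * ?K / ?L2 * (\<Sum>l<j. expectation (D l))" if j: "j \<le> i" for j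
  proof -
    have jT: "real j \<le> ?L2 * T" using j i by (meson of_nat_le_iff order_trans)
    have lT: "real l \<le> ?L2 * T" if "l < j" for l using that jT by simp
    have 0: "0 \<le> ?L2 * T" using T by simp
    have "expectation (D j) \<le> (LINT w|M. D 0 w + real n * real j * (\<epsilon> / ?L2 + ?C / (real L)^4)
       + (\<Sum>k\<in>{1..n}. norm (\<Sum>l<j. noise L N X k l w)) + real n * ?K / ?L2 * (\<Sum>l<j. D l w))"
    proof (rule integral_mono)
      show "integrable M (D j)" by (rule iD[OF jT])
      show "integrable M (\<lambda>w. D 0 w + real n * real j * (\<epsilon> / ?L2 + ?C / (real L)^4)
       + (\<Sum>k\<in>{1..n}. norm (\<Sum>l<j. noise L N X k l w)) + real n * ?K / ?L2 * (\<Sum>l<j. D l w))"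
        by (intro Bochner_Integration.integrable_add Bochner_Integration.integrable_sum integrable_mult_right iN iD integrable_const) (use lT 0 in auto)
      show "D j w \<le> D 0 w + real n * real j * (\<epsilon> / ?L2 + ?C / (real L)^4)
       + (\<Sum>k\<in>{1..n}. norm (\<Sum>l<j. noise L N X k l w)) + real n * ?K / ?L2 * (\<Sum>l<j. D l w)" if "w \<in> space M" for w
        unfolding D_def by (rule walk_flow_distance_step[OF that jT])
    qed
    also have "\<dots> = expectation (D 0) + real n * real j * (\<epsilon> / ?L2 + ?C / (real L)^4)
       + (\<Sum>k\<in>{1..n}. expectation (\<lambda>w. norm (\<Sum>l<j. noise L N X k l w))) + real n * ?K / ?L2 * (\<Sum>l<j. expectation (D l))"
    proof -
      have s1: "integrable M (\<lambda>w. \<Sum>k\<in>{1..n}. norm (\<Sum>l<j. noise L N X k l w))" by (intro Bochner_Integration.integrable_sum iN)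
      have s2: "integrable M (\<lambda>w. \<Sum>l<j. D l w)" by (intro Bochner_Integration.integrable_sum iD lT) auto
      have s3: "integrable M (\<lambda>w. real n * ?K / ?L2 * (\<Sum>l<j. D l w))" by (intro integrable_mult_right s2)
      have s4: "integrable M (D 0)" by (rule iD) (use 0 in simp)
      note s5 = Bochner_Integration.integrable_add[OF s4 integrable_const[of "real n * real j * (\<epsilon> / ?L2 + ?C / (real L)^4)"]]
      have e1: "expectation (\<lambda>w. \<Sum>k\<in>{1..n}. norm (\<Sum>l<j. noise L N X k l w)) = (\<Sum>k\<in>{1..n}. expectation (\<lambda>w. norm (\<Sum>l<j. noise L N X k l w)))"
        by (rule Bochner_Integration.integral_sum) (rule iN)
      have e2: "expectation (\<lambda>w. \<Sum>l<j. D l w) = (\<Sum>l<j. expectation (D l))"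
        by (rule Bochner_Integration.integral_sum) (rule iD[OF lT], simp)
      have e3: "expectation (\<lambda>w. c) = c" for c :: real using prob_space by simp
      show ?thesis
        unfolding Bochner_Integration.integral_add[OF Bochner_Integration.integrable_add[OF s5 s1] s3]
          Bochner_Integration.integral_add[OF s5 s1] Bochner_Integration.integral_add[OF s4 integrable_const] e1 e3 integral_mult_right_zero e2 ..
    qed
    also have "\<dots> \<le> A + real n * ?K / ?L2 * (\<Sum>l<j. expectation (D l))"
    proof -
      have "real n * real j * (\<epsilon> / ?L2 + ?C / (real L)^4) \<le> real n * (?L2 * T) * (\<epsilon> / ?L2 + ?C / (real L)^4)"
        using jT \<epsilon> C0 by (intro mult_right_mono mult_left_mono) auto
      also have "\<dots> = real n * T * (?L2 * (\<epsilon> / ?L2 + ?C / (real L)^4))" by (simp only: mult_ac)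
      also have "?L2 * (\<epsilon> / ?L2 + ?C / (real L)^4) = \<epsilon> + ?C / ?L2"
      proof -
        have "(real L)^4 = ?L2 * ?L2" by (simp add: power2_eq_square power4_eq_xxxx)
        moreover have "x * (\<epsilon> / x + c / (x * x)) = \<epsilon> + c / x" if "x > 0" for x c :: real
          using that by (simp add: field_simps)
        ultimately show ?thesis using L2 by (simp only:)
      qed
      finally have 1: "real n * real j * (\<epsilon> / ?L2 + ?C / (real L)^4) \<le> real n * T * (\<epsilon> + ?C / ?L2)" .
      have "expectation (\<lambda>w. norm (\<Sum>l<j. noise L N X k l w)) \<le> sqrt T * (4 * pi * real n / real N)" if k: "k \<in> {1..n}" for k
      proof -
        have "expectation (\<lambda>w. norm (\<Sum>l<j. noise L N X k l w)) \<le> sqrt (real j) * (4 * pi * real k / (real L * real N))"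
          by (rule noise_sum_L1[OF M L N NL \<psi> X]) (use k in auto)
        also have "\<dots> \<le> (real L * sqrt T) * (4 * pi * real n / (real L * real N))"
        proof (intro mult_mono divide_right_mono)
          have "sqrt (real j) \<le> sqrt (?L2 * T)" using jT by simp
          then show "sqrt (real j) \<le> real L * sqrt T" by (simp add: real_sqrt_mult)
        qed (use k T in auto)
        also have "\<dots> = sqrt T * (4 * pi * real n / real N)" using L by simp
        finally show ?thesis .
      qed
      then have 2: "(\<Sum>k\<in>{1..n}. expectation (\<lambda>w. norm (\<Sum>l<j. noise L N X k l w))) \<le> real n * (sqrt T * (4 * pi * real n / real N))"
        using sum_bounded_above[of "{1..n}" _ "sqrt T * (4 * pi * real n / real N)"] by simp
      show ?thesis unfolding A_def using 1 2 by linarith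
    qed
    finally show ?thesis .
  qed
  have K0: "0 \<le> real n * ?K / ?L2" using rate_lipschitz_const_nonneg L2 by auto
  have A0: "A \<ge> 0"
    unfolding A_def D_def using T \<epsilon> C0 L2 R0 rate_lipschitz_const_nonneg by (intro add_nonneg_nonneg mult_nonneg_nonneg Bochner_Integration.integral_nonneg pnorm_nonneg divide_nonneg_nonneg) auto
  have "expectation (D i) \<le> A * (1 + real n * ?K / ?L2) ^ i"
    by (rule discrete_gronwall[of _ i "\<lambda>i. expectation (D i)", OF K0 ineq order_refl])
  also have "\<dots> \<le> A * exp (real n * ?K * T)"
  proof (intro mult_left_mono[OF _ A0] power_le_exp K0)
    have "real i * (real n * ?K / ?L2) \<le> (?L2 * T) * (real n * ?K / ?L2)" by (rule mult_right_mono[OF i K0])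
    also have "\<dots> = real n * ?K * T" using L by simp
    finally show "real i * (real n * ?K / ?L2) \<le> real n * ?K * T" .
  qed
  finally show ?thesis unfolding A_def D_def by (simp only: of_nat_0 div_0 flow_0)
qed

end

end

lemma L1_tendsto_of_probability:
  fixes Y :: "nat \<Rightarrow> 'a \<Rightarrow> real"
  assumes M: "prob_space M" and Y: "\<And>j. Y j \<in> borel_measurable M" and B: "\<And>j w. w \<in> space M \<Longrightarrow> \<bar>Y j w\<bar> \<le> B"
    and p: "\<And>\<epsilon>. \<epsilon> > 0 \<Longrightarrow> (\<lambda>j. measure M {w \<in> space M. \<bar>Y j w\<bar> > \<epsilon>}) \<longlonglongrightarrow> 0"
  shows "(\<lambda>j. LINT w|M. \<bar>Y j w\<bar>) \<longlonglongrightarrow> 0"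
proof -
  interpret prob_space M by (rule M)
  have B0: "B \<ge> 0" using B[of _ 0] not_empty by fastforce
  have le: "(LINT w|M. \<bar>Y j w\<bar>) \<le> \<epsilon> + B * measure M {w \<in> space M. \<bar>Y j w\<bar> > \<epsilon>}" if "\<epsilon> > 0" for \<epsilon> j
  proof -
    let ?S = "{w \<in> space M. \<bar>Y j w\<bar> > \<epsilon>}"
    have S: "?S \<in> sets M" using Y[of j] by measurable
    have i: "integrable M (\<lambda>w. \<bar>Y j w\<bar>)" by (rule integrable_const_bound[of _ B]) (use B Y[of j] in auto)
    have iS: "integrable M (indicator ?S :: 'a \<Rightarrow> real)" by (rule integrable_real_indicator[OF S]) (simp add: less_top[symmetric])
    have i2: "integrable M (\<lambda>w. \<epsilon> + B * indicator ?S w)"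
      by (intro Bochner_Integration.integrable_add integrable_const integrable_mult_right iS)
    have "(LINT w|M. \<bar>Y j w\<bar>) \<le> (LINT w|M. \<epsilon> + B * indicator ?S w)"
    proof (rule integral_mono[OF i i2])
      fix w assume "w \<in> space M"
      then show "\<bar>Y j w\<bar> \<le> \<epsilon> + B * indicator ?S w"
        using B[of w j] B0 that by (auto simp: indicator_def)
    qed
    also have "\<dots> = \<epsilon> + B * measure M ?S"
      unfolding Bochner_Integration.integral_add[OF integrable_const integrable_mult_right[OF iS]] integral_mult_right_zero
      using S by (simp add: prob_space)
    finally show ?thesis .
  qed
  show ?thesis
  proof (rule LIMSEQ_I)
    fix r :: real assume r: "r > 0"
    have "(\<lambda>j. r / 2 + B * measure M {w \<in> space M. \<bar>Y j w\<bar> > r / 2}) \<longlonglongrightarrow> r / 2 + B * 0"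
      by (intro tendsto_intros p) (use r in auto)
    then have "\<forall>\<^sub>F j in sequentially. r / 2 + B * measure M {w \<in> space M. \<bar>Y j w\<bar> > r / 2} < r"
      by (rule order_tendstoD(2)) (use r in auto)
    then obtain j0 where j0: "\<And>j. j \<ge> j0 \<Longrightarrow> r / 2 + B * measure M {w \<in> space M. \<bar>Y j w\<bar> > r / 2} < r"
      unfolding eventually_sequentially by blast
    have "norm ((LINT w|M. \<bar>Y j w\<bar>) - 0) < r" if "j \<ge> j0" for j
      using le[of "r / 2" j] j0[OF that] r Bochner_Integration.integral_nonneg[of M "\<lambda>w. \<bar>Y j w\<bar>"] by simp
    then show "\<exists>no. \<forall>n\<ge>no. norm ((LINT w|M. \<bar>Y n w\<bar>) - 0) < r" by blast
  qed
qed

text \<open>Upper bounds pass to limits in $L^1$, because the expectation of the positive part of $Y - h_0$ is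
bounded by the distance to the approximations.\<close>
lemma AE_le_of_L1_limit:
  fixes Y :: "'a \<Rightarrow> real"
  assumes M: "prob_space M" and Y: "integrable M Y" and Yj: "\<forall>\<^sub>F j in sequentially. integrable M (Yj j) \<and> (\<forall>w\<in>space M. Yj j w \<le> h j)"
    and lim: "(\<lambda>j. LINT w|M. \<bar>Y w - Yj j w\<bar>) \<longlonglongrightarrow> 0" and h: "h \<longlonglongrightarrow> h0"
  shows "AE w in M. Y w \<le> h0"
proof -
  interpret prob_space M by (rule M)
  let ?P = "\<lambda>w. max 0 (Y w - h0)"
  have iP: "integrable M ?P" using Y by simp
  have le: "\<forall>\<^sub>F j in sequentially. expectation ?P \<le> (LINT w|M. \<bar>Y w - Yj j w\<bar>) + \<bar>h j - h0\<bar>"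
    using Yj
  proof eventually_elim
    case (elim j)
    have i: "integrable M (\<lambda>w. \<bar>Y w - Yj j w\<bar>)" using Y elim by simp
    have "expectation ?P \<le> (LINT w|M. \<bar>Y w - Yj j w\<bar> + \<bar>h j - h0\<bar>)"
    proof (rule integral_mono[OF iP])
      show "integrable M (\<lambda>w. \<bar>Y w - Yj j w\<bar> + \<bar>h j - h0\<bar>)" using i by simp
      fix w assume "w \<in> space M"
      then have "Yj j w \<le> h j" using elim by blast
      then show "?P w \<le> \<bar>Y w - Yj j w\<bar> + \<bar>h j - h0\<bar>" by linarith
    qed
    also have "\<dots> = (LINT w|M. \<bar>Y w - Yj j w\<bar>) + \<bar>h j - h0\<bar>" using i by (simp add: prob_space)
    finally show ?case .
  qed
  have "(\<lambda>j. (LINT w|M. \<bar>Y w - Yj j w\<bar>) + \<bar>h j - h0\<bar>) \<longlonglongrightarrow> 0 + \<bar>h0 - h0\<bar>"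
    by (intro tendsto_intros lim h)
  then have "expectation ?P \<le> 0 + \<bar>h0 - h0\<bar>"
    using le by (rule tendsto_lowerbound) simp
  moreover have "0 \<le> expectation ?P" by (rule Bochner_Integration.integral_nonneg) simp
  ultimately have "expectation ?P = 0" by simp
  then have "AE w in M. ?P w = 0" using integral_nonneg_eq_0_iff_AE[OF iP] by simp
  then show ?thesis by eventually_elim auto
qed

lemma continuous_bounds_from_rationals:
  fixes f :: "real \<Rightarrow> real"
  assumes f: "continuous_on {a..} f" and q: "\<And>q. q \<in> \<rat> \<Longrightarrow> q > a \<Longrightarrow> l \<le> f q \<and> f q \<le> u" and t: "t \<ge> a"
  shows "l \<le> f t \<and> f t \<le> u"
proof -
  have "\<exists>q\<in>\<rat>. t < q \<and> q < t + inverse (real (Suc k))" for k by (rule Rats_dense_in_real) simp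
  then obtain q where q': "\<And>k. q k \<in> \<rat>" "\<And>k. t < q k" "\<And>k. q k < t + inverse (real (Suc k))" by metis
  have "(\<lambda>k. t + inverse (real (Suc k))) \<longlonglongrightarrow> t + 0" by (intro tendsto_intros LIMSEQ_inverse_real_of_nat)
  then have u: "(\<lambda>k. t + inverse (real (Suc k))) \<longlonglongrightarrow> t" by (simp only: add_0_right)
  have qt: "t \<le> q k" "q k \<le> t + inverse (real (Suc k))" for k by (rule less_imp_le, rule q')+
  have "q \<longlonglongrightarrow> t"
    by (rule tendsto_sandwich[OF always_eventually always_eventually tendsto_const u]) (use qt in blast)+
  then have lim: "(\<lambda>k. f (q k)) \<longlonglongrightarrow> f t"
  proof (rule continuous_on_tendsto_compose[OF f])
    show "t \<in> {a..}" using t by simp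
    show "\<forall>\<^sub>F k in sequentially. q k \<in> {a..}" using qt(1) t by (intro always_eventually) (auto intro: order_trans)
  qed
  have "q k > a" for k using q'(2)[of k] t by linarith
  then have "l \<le> f (q k)" "f (q k) \<le> u" for k using q[OF q'(1)] by auto
  then show ?thesis using LIMSEQ_le_const[OF lim] LIMSEQ_le_const2[OF lim] by blast
qed

section \<open>The hydrodynamic limit\<close>

definition moment_fps :: "(real \<Rightarrow> real) \<Rightarrow> complex fps" where
  "moment_fps f = Abs_fps (\<lambda>n. if n = 0 then 0 else moment f n)"

lemma moment_fps_nth_0 [simp]: "fps_nth (moment_fps f) 0 = 0"
  by (simp add: moment_fps_def)

text \<open>The identity holds at points where the series diverges as well: the two sequences of partial sums
differ by a shift, so they have the same limits.\<close>
lemma moment_gf_eq_eval_fps: "moment_gf f = eval_fps (moment_fps f)"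
proof
  fix z
  have "(\<lambda>n. moment f (Suc n) * z ^ Suc n) sums s \<longleftrightarrow> (\<lambda>n. fps_nth (moment_fps f) n * z ^ n) sums s" for s
    using sums_Suc_iff[of "\<lambda>n. fps_nth (moment_fps f) n * z ^ n" s] by (simp add: moment_fps_def)
  then show "moment_gf f z = eval_fps (moment_fps f) z"
    unfolding moment_gf_def eval_fps_def suminf_def by presburger
qed

lemma (in transport_equation) transport_flow_cong:
  assumes g: "transport_flow g" and eq: "\<And>t. t \<ge> 0 \<Longrightarrow> g' t = g t"
  shows "transport_flow g'"
  unfolding transport_flow_def
proof (intro allI impI conjI)
  fix t :: real and n assume t: "t \<ge> 0"
  show "fps_nth (g' t) 0 = 0" unfolding eq[OF t] by (rule transport_flow_nth_0[OF g t])
  have "((\<lambda>s. fps_nth (g s) n) has_vector_derivative fps_nth (rate (g t)) n) (at t within {0..})"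
    using g t unfolding transport_flow_def by blast
  then show "((\<lambda>s. fps_nth (g' s) n) has_vector_derivative fps_nth (rate (g' t)) n) (at t within {0..})"
    unfolding eq[OF t] by (rule has_vector_derivative_transform[rotated 2]) (use t eq in auto)
qed

definition limit_flow :: "real \<Rightarrow> (real \<Rightarrow> real) \<Rightarrow> real \<Rightarrow> complex fps" where
  "limit_flow \<alpha> f = messep_flow \<alpha> (moment_fps f)"

lemma limit_flow_0 [simp]: "limit_flow \<alpha> f 0 = moment_fps f"
  unfolding limit_flow_def by (rule transport_equation.flow_0)

lemma limit_flow_is_flow:
  "transport_equation.transport_flow (amplitude \<alpha> 1) (amplitude \<alpha> (- 1)) (messep_phase \<alpha>) (limit_flow \<alpha> f)"
  unfolding limit_flow_def by (rule transport_equation.transport_flow_flow) simp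

lemma limit_flow_continuous: "continuous_on {0..} (\<lambda>t. fps_nth (limit_flow \<alpha> f t) n)"
  unfolding continuous_on_eq_continuous_within
proof
  fix t :: real assume "t \<in> {0..}"
  then have "((\<lambda>s. fps_nth (limit_flow \<alpha> f s) n) has_vector_derivative fps_nth (messep_rate \<alpha> (limit_flow \<alpha> f t)) n) (at t within {0..})"
    using limit_flow_is_flow[of \<alpha> f] unfolding transport_equation.transport_flow_def by blast
  then show "continuous (at t within {0..}) (\<lambda>t. fps_nth (limit_flow \<alpha> f t) n)" by (rule has_vector_derivative_continuous)
qed

lemma fejer_mean_limit_flow_continuous:
  "continuous_on {0..} (\<lambda>t. fejer_mean (with_mass (limit_flow \<alpha> f t)) K y)"
proof -
  have m: "continuous_on {0..} (\<lambda>t. with_mass (limit_flow \<alpha> f t) n)" for n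
    unfolding with_mass_def using limit_flow_continuous by (cases "n = 0") auto
  have "continuous_on {0..} (\<lambda>t. hermitian (with_mass (limit_flow \<alpha> f t)) k)" for k
    unfolding hermitian_def using m[of "nat k"] continuous_on_cnj[OF m[of "nat (- k)"]] by (cases "k \<ge> 0") auto
  then show ?thesis unfolding fejer_mean_def divide_inverse by (intro continuous_intros)
qed

lemma fejer_mean_integrable:
  assumes m: "\<And>n. integrable M (\<lambda>w. m w n)"
  shows "integrable M (\<lambda>w. fejer_mean (m w) K y)"
proof -
  have "integrable M (\<lambda>w. hermitian (m w) k)" for k
    unfolding hermitian_def using m[of "nat k"] integrable_cnj[OF m[of "nat (- k)"]] by (cases "k \<ge> 0") auto
  then show ?thesis
    unfolding fejer_mean_def divide_inverse
    by (intro integrable_mult_left integrable_Re Bochner_Integration.integrable_sum)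
qed

lemma density_tendsto:
  assumes \<alpha>: "0 < \<alpha>" and N: "\<And>j. 1 \<le> N j" and asymp: "(\<lambda>j. real (N j)) \<sim>[sequentially] (\<lambda>j. \<alpha> * real (L j))"
  shows "(\<lambda>j. real (N j) / real (L j)) \<longlonglongrightarrow> \<alpha>"
proof -
  have "(\<lambda>j. if real (N j) = 0 \<and> \<alpha> * real (L j) = 0 then 1 else real (N j) / (\<alpha> * real (L j))) \<longlonglongrightarrow> 1"
    using asymp unfolding asymp_equiv_def .
  moreover have "N j \<noteq> 0" for j using N[of j] by simp
  ultimately have "(\<lambda>j. real (N j) / (\<alpha> * real (L j))) \<longlonglongrightarrow> 1" by simp
  from tendsto_mult[OF tendsto_const[of \<alpha>] this] show ?thesis using \<alpha> by simp
qed

lemma moment_integrable: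
  assumes M: "prob_space M" and f: "random_density M f"
  shows "integrable M (\<lambda>w. moment (f w) n)"
proof -
  interpret prob_space M by (rule M)
  show ?thesis
    by (rule integrable_const_bound[of _ 1, OF AE_I2 random_density_moment_measurable[OF f]])
      (rule moment_norm_le[OF random_density_props(1)[OF f] random_density_props(2)[OF f] random_density_props(3)[OF f]])
qed

text \<open>Uniform approximation by trigonometric polynomials reduces convergence against a continuous function to
convergence of finitely many moments; Markov's inequality turns convergence in $L^1$ into convergence in
probability.\<close>
theorem converges_in_probability_of_moments:
  assumes M: "prob_space M" and N: "\<And>j. 1 \<le> N j" and f: "random_density M f"
    and int: "\<And>j n. integrable M (\<lambda>w. interpolated_moment (L j) (N j) (X j) t w n)"
    and lim: "\<And>n. (\<lambda>j. LINT w|M. norm (interpolated_moment (L j) (N j) (X j) t w n - moment (f w) n)) \<longlonglongrightarrow> 0"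
  shows "converges_in_probability M (\<lambda>j w. empirical_measure (L j) (N j) (X j) t w) (\<lambda>w. circle_measure (f w))"
proof -
  interpret prob_space M by (rule M)
  let ?\<mu> = "\<lambda>j w. empirical_measure (L j) (N j) (X j) t w" and ?\<nu> = "\<lambda>w. circle_measure (f w)"
  define err where "err j p w = (LINT x|?\<mu> j w. p x) - (LINT x|?\<nu> w. p x)" for j and p :: "real \<Rightarrow> real" and w
  have P: "prob_space (?\<mu> j w)" "sets (?\<mu> j w) = sets borel" for j w
    by (rule prob_space_empirical_measure(1)[OF N], simp add: empirical_measure_def)
  have Q: "prob_space (?\<nu> w)" "sets (?\<nu> w) = sets borel" if "w \<in> space M" for w
    by (rule prob_space_circle_measure[OF random_density_props(1)[OF f that] random_density_props(2)[OF f that] random_density_props(3)[OF f that]])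
      (simp add: circle_measure_def)
  have trig: "(\<forall>j. integrable M (err j p)) \<and> (\<lambda>j. LINT w|M. \<bar>err j p w\<bar>) \<longlonglongrightarrow> 0" if "trig_poly p" for p
    using that
  proof induction
    case (monomial c n)
    let ?W = "\<lambda>j w. interpolated_moment (L j) (N j) (X j) t w n - moment (f w) n"
    have eq: "err j (\<lambda>x. Re (c * cis (real n * x))) w = Re (c * ?W j w)" if w: "w \<in> space M" for j w
    proof -
      have i: "integrable (?\<nu> w) (\<lambda>x. cis (real n * x))" by (rule cis_integrable[OF Q[OF w]])
      have "(LINT x|?\<nu> w. Re (c * cis (real n * x))) = Re (LINT x|?\<nu> w. c * cis (real n * x))"
        by (rule integral_bounded_linear[OF bounded_linear_Re]) (intro integrable_mult_right i)
      also have "\<dots> = Re (c * moment (f w) n)"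
        unfolding moment_eq_integral[OF random_density_props(1)[OF f w] random_density_props(2)[OF f w]] by simp
      finally show ?thesis unfolding err_def empirical_integral_monomial[OF N] by (simp add: algebra_simps)
    qed
    have iW: "integrable M (?W j)" for j by (intro Bochner_Integration.integrable_diff int moment_integrable[OF M f])
    have iR: "integrable M (\<lambda>w. Re (c * ?W j w))" for j by (intro integrable_Re integrable_mult_right iW)
    have iI: "integrable M (err j (\<lambda>x. Re (c * cis (real n * x))))" for j
      by (rule Bochner_Integration.integrable_cong[THEN iffD2, OF refl _ iR[of j]]) (rule eq)
    have "(\<lambda>j. LINT w|M. \<bar>err j (\<lambda>x. Re (c * cis (real n * x))) w\<bar>) \<longlonglongrightarrow> 0"
    proof (rule Lim_null_comparison[OF always_eventually])
      show "(\<lambda>j. norm c * (LINT w|M. norm (?W j w))) \<longlonglongrightarrow> 0" by (rule tendsto_mult_right_zero[OF lim])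
      show "\<forall>j. norm (LINT w|M. \<bar>err j (\<lambda>x. Re (c * cis (real n * x))) w\<bar>) \<le> norm c * (LINT w|M. norm (?W j w))"
      proof
        fix j
        have "(LINT w|M. \<bar>err j (\<lambda>x. Re (c * cis (real n * x))) w\<bar>) \<le> (LINT w|M. norm c * norm (?W j w))"
        proof (rule integral_mono[OF integrable_abs[OF iI] integrable_mult_right[OF integrable_norm[OF iW]]])
          show "\<bar>err j (\<lambda>x. Re (c * cis (real n * x))) w\<bar> \<le> norm c * norm (?W j w)" if "w \<in> space M" for w
            unfolding eq[OF that] norm_mult[symmetric] by (rule abs_Re_le_cmod)
        qed
        then show "norm (LINT w|M. \<bar>err j (\<lambda>x. Re (c * cis (real n * x))) w\<bar>) \<le> norm c * (LINT w|M. norm (?W j w))"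
          by (simp add: Bochner_Integration.integral_nonneg)
      qed
    qed
    then show ?case using iI by blast
  next
    case (add p q)
    have eq: "err j (\<lambda>x. p x + q x) w = err j p w + err j q w" if "w \<in> space M" for j w
      unfolding err_def
        Bochner_Integration.integral_add[OF trig_poly_integrable[OF P add.hyps(1)] trig_poly_integrable[OF P add.hyps(2)]]
        Bochner_Integration.integral_add[OF trig_poly_integrable[OF Q[OF that] add.hyps(1)] trig_poly_integrable[OF Q[OF that] add.hyps(2)]]
      by simp
    have ip: "integrable M (err j p)" "integrable M (err j q)" for j using add.IH by blast+
    have iI: "integrable M (err j (\<lambda>x. p x + q x))" for j
      by (rule Bochner_Integration.integrable_cong[THEN iffD2, OF refl _ Bochner_Integration.integrable_add[OF ip]]) (rule eq)
    have "(\<lambda>j. LINT w|M. \<bar>err j (\<lambda>x. p x + q x) w\<bar>) \<longlonglongrightarrow> 0"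
    proof (rule Lim_null_comparison[OF always_eventually])
      show "(\<lambda>j. (LINT w|M. \<bar>err j p w\<bar>) + (LINT w|M. \<bar>err j q w\<bar>)) \<longlonglongrightarrow> 0"
        using add.IH by (intro tendsto_add_zero) blast+
      show "\<forall>j. norm (LINT w|M. \<bar>err j (\<lambda>x. p x + q x) w\<bar>) \<le> (LINT w|M. \<bar>err j p w\<bar>) + (LINT w|M. \<bar>err j q w\<bar>)"
      proof
        fix j
        have "(LINT w|M. \<bar>err j (\<lambda>x. p x + q x) w\<bar>) \<le> (LINT w|M. \<bar>err j p w\<bar> + \<bar>err j q w\<bar>)"
          by (rule integral_mono[OF integrable_abs[OF iI] Bochner_Integration.integrable_add[OF integrable_abs[OF ip(1)] integrable_abs[OF ip(2)]]])
            (simp add: eq)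
        also have "\<dots> = (LINT w|M. \<bar>err j p w\<bar>) + (LINT w|M. \<bar>err j q w\<bar>)"
          by (rule Bochner_Integration.integral_add[OF integrable_abs[OF ip(1)] integrable_abs[OF ip(2)]])
        finally show "norm (LINT w|M. \<bar>err j (\<lambda>x. p x + q x) w\<bar>) \<le> (LINT w|M. \<bar>err j p w\<bar>) + (LINT w|M. \<bar>err j q w\<bar>)"
          by (simp add: Bochner_Integration.integral_nonneg)
      qed
    qed
    then show ?case using iI by blast
  qed
  show ?thesis
    unfolding converges_in_probability_def
  proof (intro allI impI)
    fix \<phi> :: "real \<Rightarrow> real" and \<epsilon> :: real
    assume \<phi>: "continuous_on UNIV \<phi> \<and> (\<forall>x. \<phi> (x + 2 * pi) = \<phi> x)" and \<epsilon>: "\<epsilon> > 0"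
    obtain p where p: "trig_poly p" "\<And>x. \<bar>\<phi> x - p x\<bar> < \<epsilon> / 3"
      using trig_approximation[of \<phi> "\<epsilon> / 3"] \<phi> \<epsilon> by auto
    have i: "integrable M (err j p)" for j using trig[OF p(1)] by blast
    have bound: "\<P>(w in M. \<bar>(LINT x|?\<mu> j w. \<phi> x) - (LINT x|?\<nu> w. \<phi> x)\<bar> > \<epsilon>) \<le> (LINT w|M. \<bar>err j p w\<bar>) / (\<epsilon> / 3)" for j
    proof -
      have "\<P>(w in M. \<bar>(LINT x|?\<mu> j w. \<phi> x) - (LINT x|?\<nu> w. \<phi> x)\<bar> > \<epsilon>) \<le> measure M {w \<in> space M. \<epsilon> / 3 \<le> \<bar>err j p w\<bar>}"
      proof (rule finite_measure_mono)
        show "{w \<in> space M. \<epsilon> / 3 \<le> \<bar>err j p w\<bar>} \<in> sets M" using borel_measurable_integrable[OF i[of j]] by measurable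
        show "{w \<in> space M. \<bar>(LINT x|?\<mu> j w. \<phi> x) - (LINT x|?\<nu> w. \<phi> x)\<bar> > \<epsilon>} \<subseteq> {w \<in> space M. \<epsilon> / 3 \<le> \<bar>err j p w\<bar>}"
        proof clarify
          fix w assume w: "w \<in> space M" and gt: "\<bar>(LINT x|?\<mu> j w. \<phi> x) - (LINT x|?\<nu> w. \<phi> x)\<bar> > \<epsilon>"
          have "\<bar>(LINT x|?\<mu> j w. \<phi> x) - (LINT x|?\<mu> j w. p x)\<bar> \<le> \<epsilon> / 3"
            by (rule integral_uniform_approx(2)[OF P conjunct1[OF \<phi>] p])
          moreover have "\<bar>(LINT x|?\<nu> w. \<phi> x) - (LINT x|?\<nu> w. p x)\<bar> \<le> \<epsilon> / 3"
            by (rule integral_uniform_approx(2)[OF Q[OF w] conjunct1[OF \<phi>] p])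
          ultimately show "\<epsilon> / 3 \<le> \<bar>err j p w\<bar>" unfolding err_def using gt by linarith
        qed
      qed
      also have "\<dots> \<le> (LINT w|M. \<bar>err j p w\<bar>) / (\<epsilon> / 3)"
        by (rule integral_Markov_inequality_measure[where A = "{}"]) (use i[of j] \<epsilon> in auto)
      finally show ?thesis .
    qed
    have "(\<lambda>j. (LINT w|M. \<bar>err j p w\<bar>) / (\<epsilon> / 3)) \<longlonglongrightarrow> 0"
      using tendsto_divide[OF conjunct2[OF trig[OF p(1)]] tendsto_const[of "\<epsilon> / 3"]] \<epsilon> by simp
    then show "(\<lambda>j. \<P>(w in M. \<bar>(LINT x|?\<mu> j w. \<phi> x) - (LINT x|?\<nu> w. \<phi> x)\<bar> > \<epsilon>)) \<longlonglongrightarrow> 0"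
      by (rule Lim_null_comparison[OF always_eventually, rotated]) (use bound in \<open>simp add: measure_nonneg\<close>)
  qed
qed

lemma moment_uniform_density: "moment (\<lambda>_. 1 / (2 * pi)) n = (if n = 0 then 1 else 0)"
proof -
  have "moment (\<lambda>_. 1 / (2 * pi)) n = (LBINT x:{0..2 * pi}. cis (of_int (int n) * x)) * complex_of_real (1 / (2 * pi))"
    unfolding moment_def set_lebesgue_integral_def mult_scaleR_left[symmetric] integral_mult_left_zero by simp
  then show ?thesis unfolding integral_cis_period by simp
qed

context
  fixes M :: "'a measure" and \<alpha> :: real and L N :: "nat \<Rightarrow> nat" and \<psi> :: "nat \<Rightarrow> int set \<Rightarrow> real"
    and X :: "nat \<Rightarrow> nat \<Rightarrow> 'a \<Rightarrow> int list" and f0 :: "'a \<Rightarrow> real \<Rightarrow> real"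
  assumes M: "prob_space M" and \<alpha>: "0 < \<alpha>" "\<alpha> < 1" and NL: "\<And>j. 1 \<le> N j \<and> N j \<le> L j - 1"
    and L: "filterlim L at_top sequentially" and N: "filterlim N at_top sequentially"
    and density: "(\<lambda>j. real (N j) / real (L j)) \<longlonglongrightarrow> \<alpha>"
    and \<psi>: "\<And>j. perron_eigenvector (L j) (N j) (\<psi> j)" and X: "\<And>j. messep M (L j) (N j) (\<psi> j) (X j)"
    and f0: "random_density M f0"
    and init: "converges_in_probability M (\<lambda>j w. empirical_measure (L j) (N j) (X j) 0 w) (\<lambda>w. circle_measure (f0 w))"
begin

interpretation prob_space M by (rule M)

lemma chain_measurable: "(\<lambda>w. h (X j i w)) \<in> borel_measurable M"
proof -
  have "X j i \<in> measurable M (count_space UNIV)" by (rule X[unfolded messep_def, THEN conjunct1, THEN spec])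
  then show ?thesis by (rule measurable_compose) simp
qed

lemma chain_weyl: "w \<in> space M \<Longrightarrow> X j i w \<in> weyl_walks (L j) (N j)"
  by (erule X[unfolded messep_def, THEN conjunct2, THEN conjunct1, THEN spec, THEN bspec])

lemma chain_length: "w \<in> space M \<Longrightarrow> length (X j i w) = N j"
  using chain_weyl unfolding weyl_walks_def by blast

lemma eventually_L: "\<forall>\<^sub>F j in sequentially. L j \<ge> 3"
  using L by (simp add: filterlim_at_top)

lemma inverse_L_tendsto: "(\<lambda>j. c / (real (L j))\<^sup>2) \<longlonglongrightarrow> 0" "(\<lambda>j. c / real (N j)) \<longlonglongrightarrow> 0"
proof -
  have L': "filterlim (\<lambda>j. real (L j)) at_top sequentially" and N': "filterlim (\<lambda>j. real (N j)) at_top sequentially"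
    by (rule filterlim_compose[OF filterlim_real_sequentially L], rule filterlim_compose[OF filterlim_real_sequentially N])
  have "(\<lambda>j. c / real (L j) * (1 / real (L j))) \<longlonglongrightarrow> 0 * 0"
    by (intro tendsto_mult tendsto_divide_0[OF tendsto_const filterlim_at_top_imp_at_infinity[OF L']])
  then show "(\<lambda>j. c / (real (L j))\<^sup>2) \<longlonglongrightarrow> 0" by (simp add: power2_eq_square)
  show "(\<lambda>j. c / real (N j)) \<longlonglongrightarrow> 0"
    by (rule tendsto_divide_0[OF tendsto_const filterlim_at_top_imp_at_infinity[OF N']])
qed

lemma initial_moments:
  shows "(\<lambda>w. fps_nth (moment_fps (f0 w)) n) \<in> borel_measurable M"
    and "w \<in> space M \<Longrightarrow> norm (fps_nth (moment_fps (f0 w)) n) \<le> 1"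
proof -
  show "(\<lambda>w. fps_nth (moment_fps (f0 w)) n) \<in> borel_measurable M"
    unfolding moment_fps_def using random_density_moment_measurable[OF f0, of n] by (cases "n = 0") auto
  assume w: "w \<in> space M"
  show "norm (fps_nth (moment_fps (f0 w)) n) \<le> 1"
    unfolding moment_fps_def
    using moment_norm_le[OF random_density_props(1)[OF f0 w] random_density_props(2)[OF f0 w] random_density_props(3)[OF f0 w], of n] by simp
qed

lemma limit_flow_integrable:
  assumes t: "t \<ge> 0"
  shows "integrable M (\<lambda>w. fps_nth (limit_flow \<alpha> (f0 w) t) n)"
proof -
  obtain B where B: "\<forall>g. transport_equation.transport_flow (amplitude \<alpha> 1) (amplitude \<alpha> (- 1)) (messep_phase \<alpha>) g \<longrightarrow>
      (\<forall>k. norm (fps_nth (g 0) k) \<le> 1) \<longrightarrow> (\<forall>t\<in>{0..t}. \<forall>k\<le>n. norm (fps_nth (g t) k) \<le> B)"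
    using transport_equation.transport_flow_bounded[OF t, where n = n] by blast
  have bd: "norm (fps_nth (limit_flow \<alpha> (f0 w) t) n) \<le> B" if "w \<in> space M" for w
    using B[rule_format, OF limit_flow_is_flow[of \<alpha> "f0 w"], of t n] initial_moments(2)[OF that] t by simp
  have "(\<lambda>w. fps_nth (limit_flow \<alpha> (f0 w) t) n) \<in> borel_measurable M"
    unfolding limit_flow_def
    by (rule transport_equation.flow_taylor_measurable[OF initial_moments(1) _ initial_moments(2) t]) simp
  then show ?thesis by (intro integrable_const_bound[of _ B] AE_I2 bd)
qed

lemma walk_moments_integrable: "integrable M (\<lambda>w. fps_nth (walk_moments (L j) (X j i w)) n)"
  by (rule integrable_const_bound[of _ 1])
    (use walk_moments_norm chain_measurable[of "\<lambda>x. fps_nth (walk_moments (L j) x) n" j i] in auto)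

lemma interpolated_moment_0:
  assumes "w \<in> space M" "n > 0"
  shows "interpolated_moment (L j) (N j) (X j) 0 w n = fps_nth (walk_moments (L j) (X j 0 w)) n"
  unfolding interpolated_moment_def walk_moments_def using assms chain_length[OF assms(1), of j 0]
  by (simp add: interpolate_def mult_ac)

text \<open>At time 0 there is no interpolation, so the hypothesis on the empirical measures concerns the moments of
the initial states; for bounded variables convergence in probability implies convergence in $L^1$.\<close>
lemma initial_moments_converge:
  "(\<lambda>j. LINT w|M. norm (fps_nth (walk_moments (L j) (X j 0 w)) n - fps_nth (moment_fps (f0 w)) n)) \<longlonglongrightarrow> 0"
proof (cases "n = 0")
  case True
  then show ?thesis by (simp add: walk_moments_def)
next
  case False
  then have n: "n > 0" by simp
  let ?W = "\<lambda>j w. fps_nth (walk_moments (L j) (X j 0 w)) n - fps_nth (moment_fps (f0 w)) n"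
  have iW: "integrable M (?W j)" for j
    by (intro Bochner_Integration.integrable_diff walk_moments_integrable limit_flow_integrable[of 0, simplified])
  have W: "?W j \<in> borel_measurable M" for j by (rule borel_measurable_integrable[OF iW])
  have part: "(\<lambda>j. LINT w|M. \<bar>Re (c * ?W j w)\<bar>) \<longlonglongrightarrow> 0" for c
  proof (rule L1_tendsto_of_probability[OF M, where B = "norm c * 2"])
    show "(\<lambda>w. Re (c * ?W j w)) \<in> borel_measurable M" for j using W[of j] by measurable
    show "\<bar>Re (c * ?W j w)\<bar> \<le> norm c * 2" if "w \<in> space M" for j w
    proof -
      have "norm (?W j w) \<le> 1 + 1"
        by (intro order_trans[OF norm_triangle_ineq4] add_mono walk_moments_norm initial_moments(2) that)
      then have "norm c * norm (?W j w) \<le> norm c * 2" by (intro mult_left_mono) auto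
      then show ?thesis using abs_Re_le_cmod[of "c * ?W j w"] by (simp only: norm_mult)
    qed
    fix \<epsilon> :: real assume \<epsilon>: "\<epsilon> > 0"
    let ?\<phi> = "\<lambda>x. Re (c * cis (real n * x))"
    have c: "continuous_on UNIV ?\<phi>" by (intro continuous_intros)
    have per: "?\<phi> (x + 2 * pi) = ?\<phi> x" for x
    proof -
      have "cis (real n * (x + 2 * pi)) = cis (real n * x) * cis (2 * pi * real n)" unfolding cis_mult by (simp add: algebra_simps)
      then show ?thesis by simp
    qed
    have "(\<lambda>j. \<P>(w in M. \<bar>(LINT x|empirical_measure (L j) (N j) (X j) 0 w. ?\<phi> x) - (LINT x|circle_measure (f0 w). ?\<phi> x)\<bar> > \<epsilon>)) \<longlonglongrightarrow> 0"
      using init[unfolded converges_in_probability_def, THEN spec, of ?\<phi>] c per \<epsilon> by blast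
    moreover have "(LINT x|empirical_measure (L j) (N j) (X j) 0 w. ?\<phi> x) - (LINT x|circle_measure (f0 w). ?\<phi> x) = Re (c * ?W j w)" if w: "w \<in> space M" for j w
    proof -
      have e: "(LINT x|empirical_measure (L j) (N j) (X j) 0 w. ?\<phi> x) = Re (c * fps_nth (walk_moments (L j) (X j 0 w)) n)"
        using empirical_integral_monomial[of "N j" "L j" "X j" 0 w c n] NL[of j] interpolated_moment_0[OF w n] by simp
      note p = random_density_props[OF f0 w]
      have i: "integrable (circle_measure (f0 w)) (\<lambda>x. cis (real n * x))"
        by (rule cis_integrable[OF prob_space_circle_measure[OF p]]) (simp add: circle_measure_def)
      have "(LINT x|circle_measure (f0 w). ?\<phi> x) = Re (LINT x|circle_measure (f0 w). c * cis (real n * x))"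
        by (rule integral_bounded_linear[OF bounded_linear_Re]) (intro integrable_mult_right i)
      also have "\<dots> = Re (c * moment (f0 w) n)" unfolding moment_eq_integral[OF p(1,2)] by simp
      finally show ?thesis unfolding e using n by (simp add: moment_fps_def algebra_simps)
    qed
    ultimately show "(\<lambda>j. measure M {w \<in> space M. \<bar>Re (c * ?W j w)\<bar> > \<epsilon>}) \<longlonglongrightarrow> 0"
      by (simp cong: conj_cong)
  qed
  show ?thesis
  proof (rule Lim_null_comparison[OF always_eventually])
    show "(\<lambda>j. (LINT w|M. \<bar>Re (1 * ?W j w)\<bar>) + (LINT w|M. \<bar>Re (- \<i> * ?W j w)\<bar>)) \<longlonglongrightarrow> 0"
      by (rule tendsto_add_zero[OF part part])
    show "\<forall>j. norm (LINT w|M. norm (?W j w)) \<le> (LINT w|M. \<bar>Re (1 * ?W j w)\<bar>) + (LINT w|M. \<bar>Re (- \<i> * ?W j w)\<bar>)"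
    proof
      fix j
      have i: "integrable M (\<lambda>w. \<bar>Re (c * ?W j w)\<bar>)" for c by (intro integrable_abs integrable_Re integrable_mult_right iW)
      have "(LINT w|M. norm (?W j w)) \<le> (LINT w|M. \<bar>Re (1 * ?W j w)\<bar> + \<bar>Re (- \<i> * ?W j w)\<bar>)"
      proof (rule integral_mono[OF integrable_norm[OF iW] Bochner_Integration.integrable_add[OF i i]])
        show "norm (?W j w) \<le> \<bar>Re (1 * ?W j w)\<bar> + \<bar>Re (- \<i> * ?W j w)\<bar>" for w
          using cmod_le[of "?W j w"] by simp
      qed
      also have "\<dots> = (LINT w|M. \<bar>Re (1 * ?W j w)\<bar>) + (LINT w|M. \<bar>Re (- \<i> * ?W j w)\<bar>)"
        by (rule Bochner_Integration.integral_add[OF i i])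
      finally show "norm (LINT w|M. norm (?W j w)) \<le> (LINT w|M. \<bar>Re (1 * ?W j w)\<bar>) + (LINT w|M. \<bar>Re (- \<i> * ?W j w)\<bar>)"
        by (simp add: Bochner_Integration.integral_nonneg)
    qed
  qed
qed

theorem walk_moments_converge:
  assumes t: "t \<ge> 0"
  shows "(\<lambda>j. LINT w|M. norm (fps_nth (walk_moments (L j) (X j (nat \<lfloor>(real (L j))\<^sup>2 * t\<rfloor>) w)) n - fps_nth (limit_flow \<alpha> (f0 w) t) n)) \<longlonglongrightarrow> 0"
proof (cases "n = 0")
  case True
  have "fps_nth (limit_flow \<alpha> f t) 0 = 0" for f by (rule transport_equation.transport_flow_nth_0[OF limit_flow_is_flow t])
  then show ?thesis using True by (simp add: walk_moments_def)
next
  case False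
  interpret transport_equation "amplitude \<alpha> 1" "amplitude \<alpha> (- 1)" "messep_phase \<alpha>" .
  obtain B0 where B0: "\<forall>g. transport_flow g \<longrightarrow> (\<forall>k. norm (fps_nth (g 0) k) \<le> 1) \<longrightarrow> (\<forall>t\<in>{0..t}. \<forall>k\<le>n. norm (fps_nth (g t) k) \<le> B0)"
    using transport_flow_bounded[OF t, of n] by blast
  define B where "B = max 1 B0"
  have B: "B \<ge> 1" unfolding B_def by simp
  have bd: "norm (fps_nth (limit_flow \<alpha> (f0 w) s) k) \<le> B" if w: "w \<in> space M" and s: "s \<in> {0..t}" and k: "k \<le> n" for w s k
  proof -
    have "norm (fps_nth (limit_flow \<alpha> (f0 w) s) k) \<le> B0"
      by (rule B0[THEN spec, THEN mp, THEN mp, THEN bspec, THEN spec, THEN mp, OF limit_flow_is_flow _ s k])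
        (simp add: initial_moments(2)[OF w])
    then show ?thesis unfolding B_def by simp
  qed
  let ?K = "rate_lipschitz_const n B" and ?C = "rate_lipschitz_const n B * (real (Suc n) * (3 * rate_bound n B))" and ?R = "3 * rate_bound n B"
  let ?E = "exp (real n * ?K * t)"
  let ?i = "\<lambda>j. nat \<lfloor>(real (L j))\<^sup>2 * t\<rfloor>"
  let ?u = "\<lambda>j. LINT w|M. pnorm 1 n (walk_moments (L j) (X j 0 w) - moment_fps (f0 w))"
  let ?Y = "\<lambda>j w. norm (fps_nth (walk_moments (L j) (X j (?i j) w)) n - fps_nth (limit_flow \<alpha> (f0 w) t) n)"
  have R0: "0 \<le> ?R" unfolding rate_bound_def using B rate_lipschitz_const_nonneg by auto
  have u: "?u \<longlonglongrightarrow> 0"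
  proof -
    have "integrable M (\<lambda>w. norm (fps_nth (walk_moments (L j) (X j 0 w)) k - fps_nth (moment_fps (f0 w)) k))" for j k
      by (intro integrable_norm Bochner_Integration.integrable_diff walk_moments_integrable limit_flow_integrable[of 0, simplified])
    then have "?u j = (\<Sum>k\<le>n. LINT w|M. norm (fps_nth (walk_moments (L j) (X j 0 w)) k - fps_nth (moment_fps (f0 w)) k))" for j
      unfolding pnorm_def by simp
    moreover have "(\<lambda>j. \<Sum>k\<le>n. LINT w|M. norm (fps_nth (walk_moments (L j) (X j 0 w)) k - fps_nth (moment_fps (f0 w)) k)) \<longlonglongrightarrow> (\<Sum>k\<le>n. 0)"
      by (intro tendsto_sum initial_moments_converge)
    ultimately show ?thesis by simp
  qed
  have main: "\<forall>\<^sub>F j in sequentially. (LINT w|M. ?Y j w) \<le>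
      (?u j + real n * t * (\<epsilon> + ?C / (real (L j))\<^sup>2) + real n * (sqrt t * (4 * pi * real n / real (N j)))) * ?E + ?R / (real (L j))\<^sup>2" if \<epsilon>: "\<epsilon> > 0" for \<epsilon>
  proof -
    have "\<forall>\<^sub>F j in sequentially. \<forall>k\<in>{1..n}. \<forall>z. fps_nth z 0 = 0 \<longrightarrow> (\<forall>k. norm (fps_nth z k) \<le> 1) \<longrightarrow>
      norm (of_real ((real (L j))\<^sup>2) * walk_drift (L j) (N j) z k - fps_nth (rate z) k) \<le> \<epsilon>"
      using walk_drift_limit[OF \<alpha> NL L density \<epsilon>] by (intro eventually_ball_finite) auto
    then show ?thesis using eventually_L
    proof eventually_elim
      case (elim j)
      have Lp: "(real (L j))\<^sup>2 > 0" using elim by simp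
      have i1: "real (?i j) \<le> (real (L j))\<^sup>2 * t" using t by simp
      have i2: "(real (L j))\<^sup>2 * t \<le> real (?i j) + 1" using t by linarith
      let ?s = "real (?i j) / (real (L j))\<^sup>2"
      have s: "?s \<ge> 0" "?s \<le> t" "t - ?s \<le> 1 / (real (L j))\<^sup>2"
      proof -
        have gen: "y / x \<le> t" "t - y / x \<le> 1 / x" if "x > 0" "y \<le> x * t" "x * t \<le> y + 1" for x y :: real
        proof -
          show "y / x \<le> t" using that by (simp add: field_simps)
          have "t \<le> (y + 1) / x" using that by (simp add: pos_le_divide_eq mult.commute)
          then show "t - y / x \<le> 1 / x" by (simp add: add_divide_distrib)
        qed
        show "?s \<ge> 0" "?s \<le> t" "t - ?s \<le> 1 / (real (L j))\<^sup>2"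
          using gen[OF Lp i1 i2] by simp_all
      qed
      let ?D = "\<lambda>w. pnorm 1 n (walk_moments (L j) (X j (?i j) w) - limit_flow \<alpha> (f0 w) ?s)"
      have D: "(LINT w|M. ?D w) \<le> (?u j + real n * t * (\<epsilon> + ?C / (real (L j))\<^sup>2) + real n * (sqrt t * (4 * pi * real n / real (N j)))) * ?E"
        unfolding limit_flow_def
      proof (rule walk_flow_distance[OF M _ _ _ \<psi> X initial_moments(1) _ initial_moments(2) B t _ _ _ i1])
        show "norm (fps_nth (flow (moment_fps (f0 w)) s) k) \<le> B" if "w \<in> space M" "s \<in> {0..t}" "k \<le> n" for w s k
          using bd[OF that] unfolding limit_flow_def .
        show "norm (of_real ((real (L j))\<^sup>2) * walk_drift (L j) (N j) z k - fps_nth (rate z) k) \<le> \<epsilon>"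
          if "k \<in> {1..n}" "fps_nth z 0 = 0" "\<And>k. norm (fps_nth z k) \<le> 1" for k z
          using elim(1) that by blast
      qed (use elim NL[of j] \<epsilon> in auto)
      have iD: "integrable M ?D"
        unfolding pnorm_def fps_sub_nth by (intro Bochner_Integration.integrable_sum integrable_mult_left integrable_norm Bochner_Integration.integrable_diff walk_moments_integrable limit_flow_integrable s)
      have "(LINT w|M. ?Y j w) \<le> (LINT w|M. ?D w + ?R / (real (L j))\<^sup>2)"
      proof (rule integral_mono)
        show "integrable M (?Y j)"
          by (intro integrable_norm Bochner_Integration.integrable_diff walk_moments_integrable limit_flow_integrable t)
        show "integrable M (\<lambda>w. ?D w + ?R / (real (L j))\<^sup>2)" by (intro Bochner_Integration.integrable_add iD integrable_const)
        fix w assume w: "w \<in> space M"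
        have "norm (fps_nth (walk_moments (L j) (X j (?i j) w) - limit_flow \<alpha> (f0 w) ?s) n) \<le> ?D w"
          by (rule norm_nth_le_pnorm_1) simp
        moreover have "norm (fps_nth (limit_flow \<alpha> (f0 w) t) n - fps_nth (limit_flow \<alpha> (f0 w) ?s) n) \<le> ?R / (real (L j))\<^sup>2"
        proof -
          have "norm (fps_nth (limit_flow \<alpha> (f0 w) t) n - fps_nth (limit_flow \<alpha> (f0 w) ?s) n) \<le> ?R * (t - ?s)"
            by (rule flow_increment(1)[OF limit_flow_is_flow s(1,2) order_refl _ bd[OF w] order_refl]) (use B in auto)
          also have "\<dots> \<le> ?R * (1 / (real (L j))\<^sup>2)" by (rule mult_left_mono[OF s(3) R0])
          finally show ?thesis by simp
        qed
        ultimately show "?Y j w \<le> ?D w + ?R / (real (L j))\<^sup>2"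
          using norm_triangle_ineq4[of "fps_nth (walk_moments (L j) (X j (?i j) w)) n - fps_nth (limit_flow \<alpha> (f0 w) ?s) n"
              "fps_nth (limit_flow \<alpha> (f0 w) t) n - fps_nth (limit_flow \<alpha> (f0 w) ?s) n"] by simp
      qed
      also have "\<dots> = (LINT w|M. ?D w) + ?R / (real (L j))\<^sup>2"
        using Bochner_Integration.integral_add[OF iD integrable_const[of "?R / (real (L j))\<^sup>2"]] by (simp add: prob_space)
      finally show ?case using D by linarith
    qed
  qed
  show ?thesis
  proof (rule tendstoI)
    fix r :: real assume r: "r > 0"
    \<comment> \<open>With this choice the term of the bound that does not vanish as L grows is at most half of r.\<close>
    define \<epsilon> where "\<epsilon> = r / (2 * ?E * (real n * t + 1))"
    have nt: "real n * t + 1 > 0" using t by (simp add: add_nonneg_pos)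
    have \<epsilon>: "\<epsilon> > 0" unfolding \<epsilon>_def using r nt by simp
    have nte: "real n * t * \<epsilon> * ?E \<le> r / 2"
    proof -
      have "real n * t * \<epsilon> * ?E = (r / 2) * (real n * t / (real n * t + 1))" 
      proof -
        have "c * (r / (2 * E * (c + 1))) * E = (r / 2) * (c / (c + 1))" if "E > 0" "c + 1 > 0" for c E :: real
        proof -
          have "c * (r / (2 * E * (c + 1))) * E = (E * (c * r)) / (E * (2 * (c + 1)))"
            by (simp only: mult_ac times_divide_eq_right times_divide_eq_left)
          also have "\<dots> = (c * r) / (2 * (c + 1))" using that by (intro mult_divide_mult_cancel_left) simp
          finally show ?thesis by (simp add: mult_ac)
        qed
        from this[OF _ nt, of ?E] show ?thesis unfolding \<epsilon>_def by simp
      qed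
      also have "\<dots> \<le> (r / 2) * 1" using r nt t by (intro mult_left_mono) auto
      finally show ?thesis by simp
    qed
    let ?b = "\<lambda>j. (?u j + real n * t * (\<epsilon> + ?C / (real (L j))\<^sup>2) + real n * (sqrt t * (4 * pi * real n / real (N j)))) * ?E + ?R / (real (L j))\<^sup>2"
    have "?b \<longlonglongrightarrow> (0 + real n * t * (\<epsilon> + 0) + real n * (sqrt t * 0)) * ?E + 0"
      by (intro tendsto_add tendsto_mult tendsto_const u inverse_L_tendsto)
    moreover have "(0 + real n * t * (\<epsilon> + 0) + real n * (sqrt t * 0)) * ?E + 0 < r" using nte r by simp
    ultimately have "\<forall>\<^sub>F j in sequentially. ?b j < r" by (rule order_tendstoD(2))
    then show "\<forall>\<^sub>F j in sequentially. dist (LINT w|M. ?Y j w) 0 < r"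
      using main[OF \<epsilon>]
    proof eventually_elim
      case (elim j)
      have "(LINT w|M. ?Y j w) \<ge> 0" by (rule Bochner_Integration.integral_nonneg) simp
      then show ?case unfolding dist_real_def using elim by linarith
    qed
  qed
qed

text \<open>The Fejer means of the chain at time t lie between 0 and $L/N$, and converge in $L^1$ to those of the
solution, while $L/N$ tends to $1/\alpha$.\<close>
lemma flow_fejer_bounds:
  assumes t: "t \<ge> 0" and K: "K > 0"
  shows "AE w in M. 0 \<le> fejer_mean (with_mass (limit_flow \<alpha> (f0 w) t)) K y \<and> fejer_mean (with_mass (limit_flow \<alpha> (f0 w) t)) K y \<le> 1 / \<alpha>"
proof -
  let ?i = "\<lambda>j. nat \<lfloor>(real (L j))\<^sup>2 * t\<rfloor>"
  let ?m = "\<lambda>w. with_mass (limit_flow \<alpha> (f0 w) t)" and ?z = "\<lambda>j w. with_mass (walk_moments (L j) (X j (?i j) w))"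
  let ?Y = "\<lambda>w. fejer_mean (?m w) K y" and ?Yj = "\<lambda>j w. fejer_mean (?z j w) K y"
  have im: "integrable M (\<lambda>w. ?m w n)" for n
    unfolding with_mass_def using limit_flow_integrable[OF t, of n] by (cases "n = 0") simp_all
  have iz: "integrable M (\<lambda>w. ?z j w n)" for n j
    unfolding with_mass_def using walk_moments_integrable[of j "?i j" n] by (cases "n = 0") simp_all
  have iY: "integrable M ?Y" by (rule fejer_mean_integrable[OF im])
  have iYj: "integrable M (?Yj j)" for j by (rule fejer_mean_integrable[OF iz])
  have lim1: "(\<lambda>j. LINT w|M. norm (?m w n - ?z j w n)) \<longlonglongrightarrow> 0" for n
    unfolding with_mass_def using walk_moments_converge[OF t, of n] by (cases "n = 0") (simp_all add: norm_minus_commute)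
  have lim: "(\<lambda>j. LINT w|M. \<bar>?Y w - ?Yj j w\<bar>) \<longlonglongrightarrow> 0"
  proof (rule Lim_null_comparison[OF always_eventually])
    let ?p = "\<lambda>k l. nat \<bar>int k - int l\<bar>"
    have "(\<lambda>j. (\<Sum>k<K. \<Sum>l<K. LINT w|M. norm (?m w (?p k l) - ?z j w (?p k l))) / real K) \<longlonglongrightarrow> (\<Sum>k<K. \<Sum>l<K. 0) / real K"
      by (intro tendsto_divide tendsto_sum lim1 tendsto_const) (use K in auto)
    then show "(\<lambda>j. (\<Sum>k<K. \<Sum>l<K. LINT w|M. norm (?m w (?p k l) - ?z j w (?p k l))) / real K) \<longlonglongrightarrow> 0" by simp
    show "\<forall>j. norm (LINT w|M. \<bar>?Y w - ?Yj j w\<bar>) \<le> (\<Sum>k<K. \<Sum>l<K. LINT w|M. norm (?m w (?p k l) - ?z j w (?p k l))) / real K"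
    proof
      fix j
      have i: "integrable M (\<lambda>w. norm (?m w n - ?z j w n))" for n by (intro integrable_norm Bochner_Integration.integrable_diff im iz)
      have i2: "integrable M (\<lambda>w. (\<Sum>k<K. \<Sum>l<K. norm (?m w (?p k l) - ?z j w (?p k l))) / real K)"
        by (intro integrable_divide Bochner_Integration.integrable_sum i)
      have "(LINT w|M. \<bar>?Y w - ?Yj j w\<bar>) \<le> (LINT w|M. (\<Sum>k<K. \<Sum>l<K. norm (?m w (?p k l) - ?z j w (?p k l))) / real K)"
        by (rule integral_mono[OF integrable_abs[OF Bochner_Integration.integrable_diff[OF iY iYj]] i2]) (rule fejer_mean_diff)
      also have "\<dots> = (\<Sum>k<K. \<Sum>l<K. LINT w|M. norm (?m w (?p k l) - ?z j w (?p k l))) / real K"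
        unfolding integral_divide_zero
        by (subst Bochner_Integration.integral_sum, intro Bochner_Integration.integrable_sum i, subst Bochner_Integration.integral_sum, rule i, rule refl)
      finally show "norm (LINT w|M. \<bar>?Y w - ?Yj j w\<bar>) \<le> (\<Sum>k<K. \<Sum>l<K. LINT w|M. norm (?m w (?p k l) - ?z j w (?p k l))) / real K"
        by (simp add: Bochner_Integration.integral_nonneg)
    qed
  qed
  have ev: "\<forall>\<^sub>F j in sequentially. \<forall>w\<in>space M. 0 \<le> ?Yj j w \<and> ?Yj j w \<le> real (L j) / real (N j)"
  proof -
    have "\<forall>\<^sub>F j in sequentially. L j \<ge> K" using L by (simp add: filterlim_at_top)
    then show ?thesis using eventually_L
    proof eventually_elim
      case (elim j)
      show ?case using fejer_mean_walk_bounds[OF elim(2) _ chain_weyl K elim(1)] NL[of j] by blast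
    qed
  qed
  have h: "(\<lambda>j. real (L j) / real (N j)) \<longlonglongrightarrow> 1 / \<alpha>"
    using tendsto_divide[OF tendsto_const[of 1] density] \<alpha> by simp
  have upper: "AE w in M. ?Y w \<le> 1 / \<alpha>"
    by (rule AE_le_of_L1_limit[OF M iY _ lim h]) (use ev iYj in \<open>auto elim!: eventually_mono\<close>)
  have lim': "(\<lambda>j. LINT w|M. \<bar>- ?Y w - - ?Yj j w\<bar>) \<longlonglongrightarrow> 0"
  proof -
    have e: "\<bar>- u - - v\<bar> = \<bar>u - v\<bar>" for u v :: real by simp
    show ?thesis unfolding e by (rule lim)
  qed
  have iYn: "integrable M (\<lambda>w. - ?Y w)" "integrable M (\<lambda>w. - ?Yj j w)" for j
    by (intro Bochner_Integration.integrable_minus iY iYj)+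
  have lower: "AE w in M. - ?Y w \<le> 0"
    by (rule AE_le_of_L1_limit[OF M iYn(1) _ lim' tendsto_const]) (use ev iYn(2) in \<open>auto elim!: eventually_mono\<close>)
  from upper lower show ?thesis by eventually_elim simp
qed

text \<open>The exceptional null set may depend on t, K and the point; countably many of these suffice, by
continuity in t and in the point.\<close>
lemma flow_fejer_bounds_all:
  "AE w in M. \<forall>t\<ge>0. \<forall>K>0. \<forall>y. 0 \<le> fejer_mean (with_mass (limit_flow \<alpha> (f0 w) t)) K y \<and> fejer_mean (with_mass (limit_flow \<alpha> (f0 w) t)) K y \<le> 1 / \<alpha>"
proof -
  let ?F = "\<lambda>w t K y. fejer_mean (with_mass (limit_flow \<alpha> (f0 w) t)) K y"
  have "AE w in M. \<forall>K. \<forall>q. \<forall>y. K > 0 \<and> (of_rat q :: real) \<ge> 0 \<longrightarrow> 0 \<le> ?F w (of_rat q) K (of_rat y) \<and> ?F w (of_rat q) K (of_rat y) \<le> 1 / \<alpha>"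
    unfolding AE_all_countable
  proof (intro allI)
    fix K :: nat and q y :: rat
    show "AE w in M. K > 0 \<and> (of_rat q :: real) \<ge> 0 \<longrightarrow> 0 \<le> ?F w (of_rat q) K (of_rat y) \<and> ?F w (of_rat q) K (of_rat y) \<le> 1 / \<alpha>"
    proof (cases "K > 0 \<and> (of_rat q :: real) \<ge> 0")
      case True
      then show ?thesis using flow_fejer_bounds[of "of_rat q" K "of_rat y"] by simp
    next
      case False then show ?thesis by (intro AE_I2) blast
    qed
  qed
  then show ?thesis
  proof eventually_elim
    case (elim w)
    have 1: "0 \<le> ?F w q K y \<and> ?F w q K y \<le> 1 / \<alpha>" if q: "q \<in> \<rat>" "q > 0" and K: "K > 0" for q K y
    proof (rule continuous_bounds_from_rationals[of y "\<lambda>y. ?F w q K y"])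
      show "continuous_on {y..} (\<lambda>y. ?F w q K y)" by (rule continuous_on_subset[OF continuous_fejer_mean]) simp
      fix x :: real assume "x \<in> \<rat>"
      then obtain x' q' where "x = of_rat x'" "q = of_rat q'" using q by (auto elim!: Rats_cases)
      then show "0 \<le> ?F w q K x \<and> ?F w q K x \<le> 1 / \<alpha>" using elim[rule_format, of K q' x'] q K by simp
    qed simp
    show ?case
    proof (intro allI impI)
      fix t :: real and K :: nat and y assume "t \<ge> 0" "K > 0"
      then show "0 \<le> ?F w t K y \<and> ?F w t K y \<le> 1 / \<alpha>"
        by (intro continuous_bounds_from_rationals[OF fejer_mean_limit_flow_continuous 1])
    qed
  qed
qed

lemma interpolated_moment_integrable: "integrable M (\<lambda>w. interpolated_moment (L j) (N j) (X j) t w n)"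
proof (rule integrable_const_bound[of _ 1])
  show "AE w in M. norm (interpolated_moment (L j) (N j) (X j) t w n) \<le> 1" using interpolated_moment_norm by (intro AE_I2)
  have c: "(\<lambda>w. cis (h w)) \<in> borel_measurable M" if "h \<in> borel_measurable M" for h
    by (rule measurable_compose[OF that borel_measurable_continuous_onI]) (intro continuous_intros)
  have "(\<lambda>w. interpolate (X j) s w k) \<in> borel_measurable M" for s k
    unfolding interpolate_def Let_def
    by (intro borel_measurable_add borel_measurable_times borel_measurable_const chain_measurable[of "\<lambda>x. real_of_int (x ! k)"])
  then show "(\<lambda>w. interpolated_moment (L j) (N j) (X j) t w n) \<in> borel_measurable M"
    unfolding interpolated_moment_def
    by (intro borel_measurable_divide borel_measurable_sum c borel_measurable_times borel_measurable_const)
qed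

lemma empirical_moments_converge:
  assumes t: "t \<ge> 0"
  shows "(\<lambda>j. LINT w|M. norm (interpolated_moment (L j) (N j) (X j) t w n - with_mass (limit_flow \<alpha> (f0 w) t) n)) \<longlonglongrightarrow> 0"
proof (cases "n = 0")
  case True
  have "interpolated_moment (L j) (N j) (X j) t w 0 = 1" for j w
  proof -
    have "N j \<noteq> 0" using NL[of j] by auto
    then show ?thesis by (simp add: interpolated_moment_def)
  qed
  then show ?thesis using True by (simp add: with_mass_def)
next
  case False
  then have n: "n > 0" by simp
  let ?i = "\<lambda>j. nat \<lfloor>(real (L j))\<^sup>2 * t\<rfloor>"
  let ?I = "\<lambda>j w. interpolated_moment (L j) (N j) (X j) t w n" and ?Z = "\<lambda>j w. fps_nth (walk_moments (L j) (X j (?i j) w)) n"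
    and ?m = "\<lambda>w. fps_nth (limit_flow \<alpha> (f0 w) t) n"
  have "(\<lambda>j. LINT w|M. norm (?I j w - ?m w)) \<longlonglongrightarrow> 0"
  proof (rule Lim_null_comparison)
    show "(\<lambda>j. 2 * pi * real n / real (N j) + (LINT w|M. norm (?Z j w - ?m w))) \<longlonglongrightarrow> 0"
      by (rule tendsto_add_zero[OF inverse_L_tendsto(2) walk_moments_converge[OF t]])
    show "\<forall>\<^sub>F j in sequentially. norm (LINT w|M. norm (?I j w - ?m w)) \<le> 2 * pi * real n / real (N j) + (LINT w|M. norm (?Z j w - ?m w))"
      using eventually_L
    proof eventually_elim
      case (elim j)
      have N1: "1 \<le> N j" "N j \<le> L j - 1" using NL[of j] by auto
      have i1: "integrable M (\<lambda>w. norm (?I j w - ?m w))"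
        by (intro integrable_norm Bochner_Integration.integrable_diff interpolated_moment_integrable limit_flow_integrable[OF t])
      have i2: "integrable M (\<lambda>w. norm (?Z j w - ?m w))"
        by (intro integrable_norm Bochner_Integration.integrable_diff walk_moments_integrable limit_flow_integrable[OF t])
      have "AE w in M. norm (?I j w - ?m w) \<le> 2 * pi * real n / real (N j) + norm (?Z j w - ?m w)"
        using messep_step_AE[OF M elim N1 \<psi> X] AE_space
      proof eventually_elim
        case (elim w)
        have "norm (?I j w - ?Z j w) \<le> 2 * pi * real n / (real (L j) * real (N j))"
          by (rule interpolated_moment_close[where X = "X j" and j = "?i j"]) (use elim(1) chain_length[OF elim(2)] N1 n \<open>3 \<le> L j\<close> in auto)
        also have "\<dots> \<le> 2 * pi * real n / real (N j)"
          using \<open>3 \<le> L j\<close> N1 by (intro divide_left_mono) auto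
        finally show ?case using norm_triangle_ineq[of "?I j w - ?Z j w" "?Z j w - ?m w"] by simp
      qed
      then have "(LINT w|M. norm (?I j w - ?m w)) \<le> (LINT w|M. 2 * pi * real n / real (N j) + norm (?Z j w - ?m w))"
        by (rule integral_mono_AE[OF i1 Bochner_Integration.integrable_add[OF integrable_const i2]])
      also have "\<dots> = 2 * pi * real n / real (N j) + (LINT w|M. norm (?Z j w - ?m w))"
        unfolding Bochner_Integration.integral_add[OF integrable_const i2] by (simp add: prob_space)
      finally show ?case by (simp add: Bochner_Integration.integral_nonneg)
    qed
  qed
  then show ?thesis using n by (simp add: with_mass_def)
qed

theorem hydrodynamic_limit:
  "\<exists>f :: real \<Rightarrow> 'a \<Rightarrow> real \<Rightarrow> real.
     f 0 = f0 \<and>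
     (\<forall>t\<ge>0. random_density M (f t) \<and>
        converges_in_probability M (\<lambda>j w. empirical_measure (L j) (N j) (X j) t w) (\<lambda>w. circle_measure (f t w))) \<and>
     (AE w in M. weak_solution \<alpha> (\<lambda>t. f t w) \<and>
        analytic_transport_solution \<alpha> (moment_gf (f0 w)) (\<lambda>t. moment_gf (f t w)) \<and>
        (\<forall>h. analytic_transport_solution \<alpha> (moment_gf (f0 w)) h \<longrightarrow>
           (\<forall>t\<ge>0. \<forall>z\<in>ball 0 1. h t z = moment_gf (f t w) z)))"
proof -
  let ?m = "\<lambda>t w. with_mass (limit_flow \<alpha> (f0 w) t)"
  let ?Q = "\<lambda>t w D. D \<in> borel_measurable borel \<and> (\<forall>x. 0 \<le> D x) \<and> (\<forall>n. moment D n = ?m t w n)"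
  obtain Z where Z: "{w \<in> space M. \<not> (\<forall>t\<ge>0. \<forall>K>0. \<forall>y. 0 \<le> fejer_mean (?m t w) K y \<and> fejer_mean (?m t w) K y \<le> 1 / \<alpha>)} \<subseteq> Z"
      "emeasure M Z = 0" "Z \<in> sets M"
    using AE_E[OF flow_fejer_bounds_all] by blast
  \<comment> \<open>The set of full measure is shrunk to a measurable one, so that the density can be chosen by cases.\<close>
  define G where "G = space M - Z"
  have G: "G \<in> sets M" unfolding G_def using Z by blast
  have AE_G: "AE w in M. w \<in> G"
    by (rule AE_I[OF _ Z(2,3)]) (auto simp: G_def)
  have ex: "\<exists>D. ?Q t w D" if w: "w \<in> G" and t: "t \<ge> 0" for t w
  proof -
    have bd: "0 \<le> fejer_mean (?m t w) K y \<and> fejer_mean (?m t w) K y \<le> 1 / \<alpha>" if "K > 0" for K y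
      using Z(1) w t that unfolding G_def by blast
    have m1: "?m t w 0 = 1" by (simp add: with_mass_def)
    show ?thesis
    proof (rule density_with_moments[OF m1 bd])
      fix D assume "D \<in> borel_measurable borel" "\<And>x. 0 \<le> D x" "\<And>n. moment D n = ?m t w n"
      then show "\<exists>D. ?Q t w D" by blast
    qed
  qed
  \<comment> \<open>At time 0 the given density has to be kept. Outside of G, or for negative times, any density will do; the uniform one keeps the family measurable.\<close>
  define f where "f t w = (if t = 0 then f0 w else if t \<ge> 0 \<and> w \<in> G then SOME D. ?Q t w D else (\<lambda>_. 1 / (2 * pi)))" for t w
  have m0: "moment (f0 w) n = ?m 0 w n" if "w \<in> space M" for w n
    using random_density_props(3)[OF f0 that] by (simp add: with_mass_def moment_fps_def)
  have fG: "?Q t w (f t w)" if "w \<in> G" "t > 0" for t w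
    using someI_ex[OF ex[OF that(1), of t]] that unfolding f_def by simp
  have fN: "f t w = (\<lambda>_. 1 / (2 * pi))" if "w \<notin> G" "t > 0" for t w using that by (simp add: f_def)
  have mG: "moment (f t w) n = ?m t w n" if "w \<in> G" "t \<ge> 0" for t w n
  proof (cases "t = 0")
    case True
    moreover have "w \<in> space M" using that unfolding G_def by blast
    ultimately show ?thesis using m0[of w n] by (simp add: f_def)
  next
    case False then show ?thesis using fG[OF that(1), of t] that by auto
  qed
  have rd: "random_density M (f t)" if t: "t \<ge> 0" for t
  proof (cases "t = 0")
    case True
    then have "f t = f0" by (simp add: f_def fun_eq_iff)
    then show ?thesis using f0 by simp
  next
    case False
    then have t: "t > 0" using t by simp
    have u: "?Q t w (f t w) \<or> f t w = (\<lambda>_. 1 / (2 * pi))" for w using fG fN t by blast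
    show ?thesis
    proof (rule random_measure_of_moments)
      fix w
      show "f t w \<in> borel_measurable borel" using u[of w] by auto
      show "0 \<le> f t w x" for x using u[of w] by auto
      show "moment (f t w) 0 = 1" using u[of w] by (auto simp: with_mass_def moment_uniform_density)
    next
      fix n
      have "(\<lambda>w. ?m t w n) \<in> borel_measurable M"
        unfolding with_mass_def using borel_measurable_integrable[OF limit_flow_integrable[OF that, of n]] by (cases "n = 0") auto
      then have "(\<lambda>w. if w \<in> G then ?m t w n else (if n = 0 then 1 else 0)) \<in> borel_measurable M"
        by (rule measurable_If_set) (use G in auto)
      also have "(\<lambda>w. if w \<in> G then ?m t w n else (if n = 0 then 1 else 0)) = (\<lambda>w. moment (f t w) n)"
      proof
        show "(if w \<in> G then ?m t w n else (if n = 0 then 1 else 0)) = moment (f t w) n" for w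
          by (cases "w \<in> G") (simp_all add: mG[OF _ that] fN[OF _ t] moment_uniform_density)
      qed
      finally show "(\<lambda>w. moment (f t w) n) \<in> borel_measurable M" .
    qed
  qed
  have conv: "converges_in_probability M (\<lambda>j w. empirical_measure (L j) (N j) (X j) t w) (\<lambda>w. circle_measure (f t w))" if t: "t \<ge> 0" for t
  proof (rule converges_in_probability_of_moments[OF M _ rd[OF t] interpolated_moment_integrable])
    show "1 \<le> N j" for j using NL[of j] by blast
    fix n
    have "(LINT w|M. norm (interpolated_moment (L j) (N j) (X j) t w n - moment (f t w) n)) =
      (LINT w|M. norm (interpolated_moment (L j) (N j) (X j) t w n - ?m t w n))" for j
    proof (rule integral_cong_AE)
      show "(\<lambda>w. norm (interpolated_moment (L j) (N j) (X j) t w n - moment (f t w) n)) \<in> borel_measurable M"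
        by (rule borel_measurable_integrable, intro integrable_norm Bochner_Integration.integrable_diff interpolated_moment_integrable moment_integrable[OF M rd[OF t]])
      have im: "integrable M (\<lambda>w. ?m t w n)"
        unfolding with_mass_def using limit_flow_integrable[OF t, of n] by (cases "n = 0") simp_all
      show "(\<lambda>w. norm (interpolated_moment (L j) (N j) (X j) t w n - ?m t w n)) \<in> borel_measurable M"
        by (rule borel_measurable_integrable, intro integrable_norm Bochner_Integration.integrable_diff interpolated_moment_integrable im)
      show "AE w in M. norm (interpolated_moment (L j) (N j) (X j) t w n - moment (f t w) n) = norm (interpolated_moment (L j) (N j) (X j) t w n - ?m t w n)"
        using AE_G by eventually_elim (simp add: mG[OF _ t])
    qed
    then show "(\<lambda>j. LINT w|M. norm (interpolated_moment (L j) (N j) (X j) t w n - moment (f t w) n)) \<longlonglongrightarrow> 0"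
      using empirical_moments_converge[OF t, of n] by simp
  qed
  have pde: "weak_solution \<alpha> (\<lambda>t. f t w) \<and>
        analytic_transport_solution \<alpha> (moment_gf (f0 w)) (\<lambda>t. moment_gf (f t w)) \<and>
        (\<forall>h. analytic_transport_solution \<alpha> (moment_gf (f0 w)) h \<longrightarrow>
           (\<forall>t\<ge>0. \<forall>z\<in>ball 0 1. h t z = moment_gf (f t w) z))" if w: "w \<in> G" for w
  proof -
    interpret transport_equation "amplitude \<alpha> 1" "amplitude \<alpha> (- 1)" "messep_phase \<alpha>" .
    \<comment> \<open>The series is defined from the densities for all real t, so that it agrees with the generating functions also at negative times.\<close>
    let ?g = "\<lambda>t. moment_fps (f t w)"
    have wM: "w \<in> space M" using w unfolding G_def by blast
    have m1: "moment (f t w) 0 = 1" "norm (moment (f t w) n) \<le> 1" if "t \<ge> 0" for t n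
      using random_density_props(3)[OF rd[OF that] wM]
        moment_norm_le[OF random_density_props(1)[OF rd[OF that] wM] random_density_props(2)[OF rd[OF that] wM] random_density_props(3)[OF rd[OF that] wM]]
      by blast+
    have g: "?g t = limit_flow \<alpha> (f0 w) t" if "t \<ge> 0" for t
    proof (rule fps_ext)
      fix n
      have "fps_nth (limit_flow \<alpha> (f0 w) t) 0 = 0" by (rule transport_flow_nth_0[OF limit_flow_is_flow that])
      then show "fps_nth (?g t) n = fps_nth (limit_flow \<alpha> (f0 w) t) n"
        using mG[OF w that, of n] by (auto simp: moment_fps_def with_mass_def)
    qed
    have flow: "transport_flow ?g" by (rule transport_flow_cong[OF limit_flow_is_flow g])
    have bounded: "norm (fps_nth (?g t) n) \<le> 1" if "t \<ge> 0" for t n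
      using m1(2)[OF that, of n] by (simp add: moment_fps_def)
    note vel = velocity_eq_speed[OF \<alpha>]
    have f00: "f 0 w = f0 w" by (simp add: f_def)
    have sol: "analytic_transport_solution \<alpha> (moment_gf (f0 w)) (\<lambda>t. moment_gf (f t w))"
      using analytic_transport_solution_flow[OF flow bounded vel] unfolding moment_gf_eq_eval_fps f00 .
    have uni: "h t z = moment_gf (f t w) z" if h: "analytic_transport_solution \<alpha> (moment_gf (f0 w)) h" and "t \<ge> 0" "z \<in> ball 0 1" for h t z
      unfolding moment_gf_eq_eval_fps
      by (rule analytic_transport_solution_unique[OF flow bounded vel h _ that(2,3)]) (simp_all only: moment_gf_eq_eval_fps f00)
    have weak: "weak_solution \<alpha> (\<lambda>t. f t w)"
      by (rule weak_solution_of_transport[OF \<alpha> m1 sol])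
    from weak sol uni show ?thesis by blast
  qed
  have "f 0 = f0" by (simp add: f_def fun_eq_iff)
  moreover have "AE w in M. weak_solution \<alpha> (\<lambda>t. f t w) \<and>
        analytic_transport_solution \<alpha> (moment_gf (f0 w)) (\<lambda>t. moment_gf (f t w)) \<and>
        (\<forall>h. analytic_transport_solution \<alpha> (moment_gf (f0 w)) h \<longrightarrow>
           (\<forall>t\<ge>0. \<forall>z\<in>ball 0 1. h t z = moment_gf (f t w) z))"
    using AE_G by (rule AE_mp) (intro AE_I2 impI pde)
  ultimately show ?thesis using rd conv by blast
qed

end

theorem theorem4p1:
  fixes M :: "'a measure"
    and \<alpha> :: real
    and L N :: "nat \<Rightarrow> nat"
    and \<psi> :: "nat \<Rightarrow> int set \<Rightarrow> real"
    and X :: "nat \<Rightarrow> nat \<Rightarrow> 'a \<Rightarrow> int list"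
    and f\<^sub>0 :: "'a \<Rightarrow> real \<Rightarrow> real"
  assumes "prob_space M"
    and "0 < \<alpha>" and "\<alpha> < 1"
    and "\<forall>j. 1 \<le> N j \<and> N j \<le> L j - 1"
    and "filterlim L at_top sequentially"
    and "filterlim N at_top sequentially"
    and "(\<lambda>j. real (N j)) \<sim>[sequentially] (\<lambda>j. \<alpha> * real (L j))"
    and "\<forall>j. perron_eigenvector (L j) (N j) (\<psi> j)"
    and "\<forall>j. messep M (L j) (N j) (\<psi> j) (X j)"
    and "random_density M f\<^sub>0"
    and "converges_in_probability M (\<lambda>j \<omega>. empirical_measure (L j) (N j) (X j) 0 \<omega>)
           (\<lambda>\<omega>. circle_measure (f\<^sub>0 \<omega>))"
  shows "\<exists>f :: real \<Rightarrow> 'a \<Rightarrow> real \<Rightarrow> real.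
     f 0 = f\<^sub>0 \<and>
     (\<forall>t\<ge>0. random_density M (f t) \<and>
        converges_in_probability M (\<lambda>j \<omega>. empirical_measure (L j) (N j) (X j) t \<omega>)
          (\<lambda>\<omega>. circle_measure (f t \<omega>))) \<and>
     (AE \<omega> in M.
        weak_solution \<alpha> (\<lambda>t. f t \<omega>) \<and>
        analytic_transport_solution \<alpha> (moment_gf (f\<^sub>0 \<omega>)) (\<lambda>t. moment_gf (f t \<omega>)) \<and>
        (\<forall>h. analytic_transport_solution \<alpha> (moment_gf (f\<^sub>0 \<omega>)) h \<longrightarrow>
           (\<forall>t\<ge>0. \<forall>z\<in>ball 0 1. h t z = moment_gf (f t \<omega>) z)))"
proof (rule hydrodynamic_limit[OF assms(1-3) _ assms(5,6) _ _ _ assms(10,11)])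
  show "1 \<le> N j \<and> N j \<le> L j - 1" for j using assms(4) by blast
  then show "(\<lambda>j. real (N j) / real (L j)) \<longlonglongrightarrow> \<alpha>" by (intro density_tendsto[OF assms(2) _ assms(7)]) blast
  show "perron_eigenvector (L j) (N j) (\<psi> j)" for j by (rule assms(8)[THEN spec])
  show "messep M (L j) (N j) (\<psi> j) (X j)" for j by (rule assms(9)[THEN spec])
qed

end
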